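(* Let $n\geq 1$ and let $X=(X_1,\ldots,X_n)$ be an isotropic unconditional log-concave random vector in $\mathbb{R}^n$ such that the random variables $|X_1|,\ldots,|X_n|$ are negatively associated. Then for all $a=(a_1,\ldots,a_n)\in\mathbb{R}^n$ and $p\geq 3$, $$-\sqrt{3}\,p\,\|a\|_{\infty}\leq \Big\|\sum_{i=1}^n a_iX_i\Big\|_p-\gamma_p\|a\|_2\leq p\,\|a\|_{\infty}.$$ In particular, these inequalities hold for all $a\in\mathbb{R}^n$ and $p\geq 3$ if $X$ is uniformly distributed on an Orlicz ball in $\mathbb{R}^n$ rescaled so that $X$ is isotropic.
   Context: For a random variable $Y$ and $p>0$, $\|Y\|_p=(\mathbb{E}|Y|^p)^{1/p}$. $\gamma_p=\|G\|_p$ where $G$ is a standard Gaussian $\mathcal{N}(0,1)$ random variable. For $a\in\mathbb{R}^n$, $\|a\|_2=(\sum_i a_i^2)^{1/2}$ and $\|a\|_\infty=\max_i|a_i|$. A random vector $X$ in $\mathbb{R}^n$ is log-concave if it has a density of the form $e^{-h}$ with $h\colon\mathbb{R}^n\to(-\infty,\infty]$ convex. $X$ is unconditional if $(\eta_1X_1,\ldots,\eta_nX_n)$ has the same distribution as $X$ for every choice of signs $\eta_i\in\{-1,1\}$. $X$ is isotropic if its covariance matrix is the identity. Random variables $Y_1,\ldots,Y_n$ are negatively associated if for any disjoint sets $I_1,I_2\subset\{1,\ldots,n\}$ and any bounded functions $f_j\colon\mathbb{R}^{I_j}\to\mathbb{R}$, $j=1,2$, that are nondecreasing in each coordinate, $\mathrm{Cov}\big(f_1((Y_i)_{i\in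 I_1}),f_2((Y_i)_{i\in I_2})\big)\leq 0$. An Orlicz ball in $\mathbb{R}^n$ is a set of the form $\{x\in\mathbb{R}^n\colon \sum_{i=1}^n f(|x_i|)\leq 1\}$, where $f\colon[0,\infty)\to[0,\infty]$ is a Young function: $f$ is convex, $f(0)=0$, $f(x)\neq 0$ for some $x$, and $f(x)<\infty$ for some $x>0$. *)

theory Defs
  imports "HOL-Probability.Probability"
begin

text \<open>The Bochner integral is 0 for non-integrable integrands, so \<^term>\<open>Lp_norm\<close> only has its usual
  meaning together with \<^term>\<open>finite_moment\<close>, which says that the norm is finite.\<close>

definition finite_moment :: "'a measure \<Rightarrow> real \<Rightarrow> ('a \<Rightarrow> real) \<Rightarrow> bool" where
  "finite_moment M p Y \<longleftrightarrow> integrable M (\<lambda>\<omega>. \<bar>Y \<omega>\<bar> powr p)"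

definition Lp_norm :: "'a measure \<Rightarrow> real \<Rightarrow> ('a \<Rightarrow> real) \<Rightarrow> real" where
  "Lp_norm M p Y = (LINT \<omega>|M. \<bar>Y \<omega>\<bar> powr p) powr (1 / p)"

definition gauss_norm :: "real \<Rightarrow> real" where
  "gauss_norm p = Lp_norm (density lborel std_normal_density) p (\<lambda>x. x)"

definition covariance :: "'a measure \<Rightarrow> ('a \<Rightarrow> real) \<Rightarrow> ('a \<Rightarrow> real) \<Rightarrow> real" where
  "covariance M U V =
     (LINT \<omega>|M. (U \<omega> - (LINT \<omega>|M. U \<omega>)) * (V \<omega> - (LINT \<omega>|M. V \<omega>)))"

definition covariance_matrix :: "'a measure \<Rightarrow> ('a \<Rightarrow> real ^ 'n) \<Rightarrow> real ^ 'n ^ 'n" where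
  "covariance_matrix M X = (\<chi> i j. covariance M (\<lambda>\<omega>. X \<omega> $ i) (\<lambda>\<omega>. X \<omega> $ j))"

text \<open>For measurable \<open>X\<close> on a probability space, finiteness of the second moments is implied: a
  diagonal entry equal to 1 means that the corresponding square is integrable.\<close>

definition isotropic :: "'a measure \<Rightarrow> ('a \<Rightarrow> real ^ 'n) \<Rightarrow> bool" where
  "isotropic M X \<longleftrightarrow> covariance_matrix M X = mat 1"

definition unconditional :: "'a measure \<Rightarrow> ('a \<Rightarrow> real ^ 'n) \<Rightarrow> bool" where
  "unconditional M X \<longleftrightarrow>
     (\<forall>\<eta> :: 'n \<Rightarrow> real. (\<forall>i. \<eta> i \<in> {-1, 1}) \<longrightarrow>
        distr M borel (\<lambda>\<omega>. \<chi> i. \<eta> i * X \<omega> $ i) = distr M borel X)"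

text \<open>Only used for functions that avoid \<open>-\<infinity>\<close>; since \<open>0 * \<infinity> = 0\<close> in \<^typ>\<open>ereal\<close>, the degenerate
  cases \<open>u = 0\<close> and \<open>v = 0\<close> are harmless.\<close>

definition ereal_convex_on :: "'a::real_vector set \<Rightarrow> ('a \<Rightarrow> ereal) \<Rightarrow> bool" where
  "ereal_convex_on S h \<longleftrightarrow> convex S \<and>
     (\<forall>x\<in>S. \<forall>y\<in>S. \<forall>u\<ge>0. \<forall>v\<ge>0. u + v = 1 \<longrightarrow>
        h (u *\<^sub>R x + v *\<^sub>R y) \<le> ereal u * h x + ereal v * h y)"

text \<open>The value \<open>e\<^sup>-\<^sup>t\<close> for \<open>t\<close> in \<open>(-\<infinity>, \<infinity>]\<close>.\<close>

definition exp_minus :: "ereal \<Rightarrow> ennreal" where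
  "exp_minus t = (if t = \<infinity> then 0 else ennreal (exp (- real_of_ereal t)))"

text \<open>\<^const>\<open>distributed\<close> asks for a Borel density. This is no restriction: replacing a convex \<open>h\<close> by
  its lower semicontinuous hull changes it only on a null set.\<close>

definition log_concave_vector :: "'a measure \<Rightarrow> ('a \<Rightarrow> 'b::euclidean_space) \<Rightarrow> bool" where
  "log_concave_vector M X \<longleftrightarrow>
     (\<exists>h. (\<forall>x. h x \<noteq> -\<infinity>) \<and> ereal_convex_on UNIV h \<and>
          distributed M lborel X (\<lambda>x. exp_minus (h x)))"

text \<open>\<open>\<real>\<^sup>I\<close> is the space of the product measure \<open>PiM I (\<lambda>_. borel)\<close>, i.e. functions on \<open>I\<close>
  extended by \<^const>\<open>undefined\<close>. The test functions are assumed Borel, since a bounded coordinatewise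
  nondecreasing function need not be, and the covariance has to make sense.\<close>

definition monotone_test_function :: "'i set \<Rightarrow> (('i \<Rightarrow> real) \<Rightarrow> real) \<Rightarrow> bool" where
  "monotone_test_function I f \<longleftrightarrow>
     f \<in> borel_measurable (PiM I (\<lambda>_. borel)) \<and>
     bounded (f ` (I \<rightarrow>\<^sub>E UNIV)) \<and>
     (\<forall>x \<in> I \<rightarrow>\<^sub>E UNIV. \<forall>i\<in>I. mono (\<lambda>t. f (x(i := t))))"

definition negatively_associated :: "'a measure \<Rightarrow> ('i::finite \<Rightarrow> 'a \<Rightarrow> real) \<Rightarrow> bool" where
  "negatively_associated M Y \<longleftrightarrow>
     (\<forall>I\<^sub>1 I\<^sub>2 f\<^sub>1 f\<^sub>2. I\<^sub>1 \<inter> I\<^sub>2 = {} \<and> monotone_test_function I\<^sub>1 f\<^sub>1 \<and> monotone_test_function I\<^sub>2 f\<^sub>2 \<longrightarrow>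
        covariance M (\<lambda>\<omega>. f\<^sub>1 (\<lambda>i\<in>I\<^sub>1. Y i \<omega>)) (\<lambda>\<omega>. f\<^sub>2 (\<lambda>i\<in>I\<^sub>2. Y i \<omega>)) \<le> 0)"

text \<open>Only the values on \<open>[0, \<infinity>)\<close> matter.\<close>

definition young_function :: "(real \<Rightarrow> ereal) \<Rightarrow> bool" where
  "young_function f \<longleftrightarrow>
     (\<forall>x\<ge>0. 0 \<le> f x) \<and> ereal_convex_on {0..} f \<and> f 0 = 0 \<and>
     (\<exists>x\<ge>0. f x \<noteq> 0) \<and> (\<exists>x>0. f x < \<infinity>)"

definition orlicz_ball :: "(real \<Rightarrow> ereal) \<Rightarrow> (real ^ 'n) set" where
  "orlicz_ball f = {x. (\<Sum>i\<in>UNIV. f \<bar>x $ i\<bar>) \<le> 1}"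

definition uniformly_distributed :: "'a measure \<Rightarrow> ('a \<Rightarrow> 'b::euclidean_space) \<Rightarrow> 'b set \<Rightarrow> bool" where
  "uniformly_distributed M X A \<longleftrightarrow> distr M lborel X = uniform_measure lborel A"

end

theory Submission
  imports Defs
begin

text \<open>Lower bound. Given \<open>\<bar>X\<bar>\<close>, the sum is a Rademacher sum with coefficients \<open>b\<^sub>i = \<bar>a\<^sub>i X\<^sub>i\<bar>\<close>, and
  \<open>E \<bar>\<Sum> b\<^sub>i \<epsilon>\<^sub>i\<bar>\<^sup>p \<ge> \<gamma>\<^sub>p\<^sup>p (\<Sum> b\<^sub>i\<^sup>2 - sqrt p (\<Sum> b\<^sub>i\<^sup>4)\<^sup>1\<^sup>/\<^sup>2)\<^sup>p\<^sup>/\<^sup>2\<close>. This is a Lindeberg argument for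
  \<open>p \<in> [3, 5]\<close> and follows for larger \<open>p\<close> from a recursion that lowers \<open>p\<close> by 2, like the one for
  Gaussian moments. Log-concavity gives \<open>E X\<^sub>i\<^sup>4 \<le> 6\<close>, and Jensen's inequality removes the conditioning.

  Upper bound. Negative dependence and the comparison of the log-concave tails of \<open>\<bar>X\<^sub>i\<bar>\<close> with an
  exponential tail allow one to replace the \<open>X\<^sub>i\<close> one by one by independent two-sided exponential
  variables of variance 1. These are Gaussian mixtures \<open>sqrt V\<^sub>i * G\<^sub>i\<close> with \<open>V\<^sub>i\<close> exponential, so the
  moment becomes \<open>\<gamma>\<^sub>p\<^sup>p E (\<Sum> a\<^sub>i\<^sup>2 V\<^sub>i)\<^sup>p\<^sup>/\<^sup>2\<close>, which an exponential moment controls.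

  On an Orlicz ball, fixing one coordinate leaves the uniform law on \<open>{z. \<Sum> G (z\<^sub>j) \<le> s}\<close> with \<open>s\<close>
  decreasing in that coordinate. This law is stochastically increasing in \<open>s\<close>, which yields the
  negative dependence needed for the upper bound.\<close>

section \<open>The Prekopa-Leindler inequality\<close>

text \<open>Write \<gamma>_p for the Gaussian norm; \<open>gauss_moment_le\<close> is the bound
  \<gamma>_p \<le> sqrt (p / 2). The lower bound loses sqrt (6 p) |a|_inf before the factor
  \<gamma>_p is applied, and sqrt (6 p) * sqrt (p / 2) = sqrt 3 * p; the 6 is the fourth moment of
  the two-sided exponential law of variance 1. In the upper bound the exponential moment replaces
  |a|_2^2 by |a|_2^2 + (p / 2) |a|_inf^2.

  The restriction p \<ge> 3 makes |x|^(p - 2) convex. Then the derivative of the symmetrized p-th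
  power is convex in the sum of the remaining terms, so that it may serve as a test function for
  negative dependence.

  Coordinates have to be exchanged while the others are still dependent. The dependence enters in
  one form only: a tail event of |X_j| against a convex function of a signed sum of other
  coordinates. Averaging over the signs makes such a function nondecreasing in the absolute values.
  Hence the property follows from negative association, and it is in this form that it is proved for
  Orlicz balls.\<close>

lemma mono_cofinal_sequence:
  fixes A :: "real set"
  assumes "A \<noteq> {}"
  obtains f :: "nat \<Rightarrow> real" where "mono f" "range f \<subseteq> A" "\<And>x. x \<in> A \<Longrightarrow> \<exists>n. x \<le> f n"
proof -
  have "\<exists>g::nat \<Rightarrow> real. range g \<subseteq> A \<and> (\<forall>x\<in>A. \<exists>n. x \<le> g n)"
  proof (cases "\<exists>m\<in>A. \<forall>x\<in>A. x \<le> m")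
    case True
    then obtain m where "m \<in> A" "\<forall>x\<in>A. x \<le> m" by blast
    then show ?thesis by (intro exI[of _ "\<lambda>_. m"]) auto
  next
    case False
    \<comment> \<open>Without a maximum every x in A lies strictly below some y in A, and a point of
      the dense set close enough to y still exceeds x.\<close>
    obtain D :: "real set" where D: "countable D" "D \<subseteq> A" "A \<subseteq> closure D"
      using separable by blast
    have "D \<noteq> {}" using D assms by auto
    moreover have "\<exists>d\<in>D. x \<le> d" if "x \<in> A" for x
    proof -
      obtain y where y: "y \<in> A" "x < y" using False \<open>x \<in> A\<close> by (meson not_le)
      then have "y \<in> closure D" using D by auto
      then obtain d where "d \<in> D" "dist d y < y - x"
        using y closure_approachable[of y D] by (meson diff_gt_0_iff_gt)
      then show ?thesis by (intro bexI[of _ d]) (auto simp: dist_real_def)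
    qed
    ultimately show ?thesis using D
      by (intro exI[of _ "from_nat_into D"])
        (metis from_nat_into from_nat_into_surj image_subset_iff subset_iff)
  qed
  then obtain g :: "nat \<Rightarrow> real" where g: "range g \<subseteq> A" "\<And>x. x \<in> A \<Longrightarrow> \<exists>n. x \<le> g n"
    by blast
  define f where "f n = Max (g ` {..n})" for n
  have "mono f" unfolding f_def by (intro monoI Max_mono) auto
  moreover have "f n \<in> A" for n
  proof -
    have "f n \<in> g ` {..n}" unfolding f_def by (intro Max_in) auto
    then show ?thesis using g by auto
  qed
  moreover have "\<exists>n. x \<le> f n" if "x \<in> A" for x
  proof -
    obtain n where "x \<le> g n" using g(2) \<open>x \<in> A\<close> by blast
    also have "g n \<le> f n" unfolding f_def by (intro Max_ge) auto
    finally show ?thesis by blast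
  qed
  ultimately show ?thesis using that by blast
qed

text \<open>Countably many initial segments cut off at points of A exhaust A, even when A has no
  largest point. This takes the place of the usual approximation by compact sets in the
  Brunn-Minkowski inequality.\<close>

lemma emeasure_le_of_initial_segments:
  fixes A :: "real set"
  assumes [measurable]: "A \<in> sets borel" and "\<And>a. a \<in> A \<Longrightarrow> emeasure lborel (A \<inter> {..a}) \<le> c"
  shows "emeasure lborel A \<le> c"
proof (cases "A = {}")
  case False
  then obtain f :: "nat \<Rightarrow> real" where f: "mono f" "range f \<subseteq> A" "\<And>x. x \<in> A \<Longrightarrow> \<exists>n. x \<le> f n"
    using mono_cofinal_sequence by blast
  have "A = (\<Union>n. A \<inter> {..f n})" using f(3) by auto
  also have "emeasure lborel \<dots> = (SUP n. emeasure lborel (A \<inter> {..f n}))"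
    using f(1) by (intro SUP_emeasure_incseq[symmetric]) (auto simp: incseq_def mono_def intro: order_trans)
  also have "\<dots> \<le> c" using assms(2) f(2) by (intro SUP_least) auto
  finally show ?thesis .
qed auto

lemma emeasure_le_of_final_segments:
  fixes A :: "real set"
  assumes [measurable]: "A \<in> sets borel" and *: "\<And>a. a \<in> A \<Longrightarrow> emeasure lborel (A \<inter> {a..}) \<le> c"
  shows "emeasure lborel A \<le> c"
proof -
  have ref: "emeasure lborel (uminus -` S) = emeasure lborel S" if [measurable]: "S \<in> sets borel" for S :: "real set"
    using lborel_distr_uminus emeasure_distr[of uminus "lborel :: real measure" borel S] by (simp add: that)
  have "emeasure lborel (uminus -` A) \<le> c"
  proof (rule emeasure_le_of_initial_segments)
    show "uminus -` A \<in> sets borel" using measurable_sets_borel[of uminus borel A] by simp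
    fix a assume "a \<in> uminus -` A"
    then have "emeasure lborel (A \<inter> {-a..}) \<le> c" using * by simp
    moreover have "uminus -` A \<inter> {..a} = uminus -` (A \<inter> {-a..})" by auto
    moreover have "emeasure lborel (uminus -` (A \<inter> {-a..})) = emeasure lborel (A \<inter> {-a..})"
      by (rule ref) auto
    ultimately show "emeasure lborel (uminus -` A \<inter> {..a}) \<le> c" by (simp only:)
  qed
  then show ?thesis by (simp add: ref)
qed

section \<open>The Brunn-Minkowski inequality on the line\<close>

lemma emeasure_lborel_half_shift:
  fixes S :: "real set"
  assumes [measurable]: "S \<in> sets borel"
  shows "2 * emeasure lborel ((\<lambda>x. 2 * x - b) -` S) = emeasure lborel S"
proof -
  have "emeasure lborel S = (\<integral>\<^sup>+x. indicator S x \<partial>lborel)" by simp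
  also have "\<dots> = ennreal \<bar>2\<bar> * (\<integral>\<^sup>+x. indicator S (- b + 2 * x) \<partial>lborel)"
    by (intro nn_integral_real_affine) auto
  also have "(\<integral>\<^sup>+x. indicator S (- b + 2 * x) \<partial>lborel)
      = (\<integral>\<^sup>+x. indicator ((\<lambda>x. 2 * x - b) -` S) x \<partial>lborel)"
    by (intro nn_integral_cong) (auto split: split_indicator simp: algebra_simps)
  also have "\<dots> = emeasure lborel ((\<lambda>x. 2 * x - b) -` S)"
    by (rule nn_integral_indicator) (use measurable_sets_borel[of "\<lambda>x. 2 * x - b" borel S] in simp)
  finally show ?thesis by simp
qed

text \<open>With \<open>a \<in> A\<close> and \<open>b \<in> B\<close>, the sets \<open>(A \<inter> {..a} + b) / 2\<close> and \<open>(a + B \<inter> {b..}) / 2\<close> lie in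
  \<open>C\<close> and overlap in one point only.\<close>

lemma brunn_minkowski_midpoint:
  fixes A B C :: "real set"
  assumes [measurable]: "A \<in> sets borel" "B \<in> sets borel" "C \<in> sets borel"
    and ne: "A \<noteq> {}" "B \<noteq> {}"
    and C: "\<And>a b. a \<in> A \<Longrightarrow> b \<in> B \<Longrightarrow> (a + b) / 2 \<in> C"
  shows "emeasure lborel A + emeasure lborel B \<le> 2 * emeasure lborel C"
proof -
  have key: "emeasure lborel (A \<inter> {..a}) + emeasure lborel (B \<inter> {b..}) \<le> 2 * emeasure lborel C"
    if ab: "a \<in> A" "b \<in> B" for a b
  proof -
    define P where "P = (\<lambda>x. 2 * x - b) -` (A \<inter> {..a})"
    define Q where "Q = (\<lambda>x. 2 * x - a) -` (B \<inter> {b..})"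
    have [measurable]: "P \<in> sets borel" "Q \<in> sets borel"
      unfolding P_def Q_def
      using measurable_sets_borel[of "\<lambda>x. 2 * x - b" borel "A \<inter> {..a}"]
        measurable_sets_borel[of "\<lambda>x. 2 * x - a" borel "B \<inter> {b..}"]
      by (simp_all del: vimage_Int)
    have sub: "P \<subseteq> C" "Q \<subseteq> C"
    proof safe
      fix x assume "x \<in> P"
      then show "x \<in> C" using C[of "2 * x - b" b] ab by (auto simp: P_def)
    next
      fix x assume "x \<in> Q"
      then show "x \<in> C" using C[of a "2 * x - a"] ab by (auto simp: Q_def)
    qed
    have PQ: "P \<inter> Q \<subseteq> {(a + b) / 2}" by (auto simp: P_def Q_def)
    have "emeasure lborel (P \<inter> Q) = 0"
      by (rule emeasure_eq_0[OF _ _ PQ]) auto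
    then have "emeasure lborel P + emeasure lborel Q = emeasure lborel (P \<union> Q)"
      using emeasure_Un_Int[of P lborel Q] by simp
    also have "\<dots> \<le> emeasure lborel C" using sub by (intro emeasure_mono) auto
    finally have "2 * (emeasure lborel P + emeasure lborel Q) \<le> 2 * emeasure lborel C"
      by (rule mult_left_mono) simp
    moreover have "2 * emeasure lborel P = emeasure lborel (A \<inter> {..a})"
      "2 * emeasure lborel Q = emeasure lborel (B \<inter> {b..})"
      unfolding P_def Q_def
      using emeasure_lborel_half_shift[of "A \<inter> {..a}" b] emeasure_lborel_half_shift[of "B \<inter> {b..}" a]
      by (simp_all del: vimage_Int)
    ultimately show ?thesis by (simp add: distrib_left)
  qed
  show ?thesis
  proof -
    \<comment> \<open>The limits in b and in a are taken one after the other. Moving the other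
      summand to the right-hand side gives a bound that does not depend on the segment, as the
      segment lemmas require.\<close>
    have swap: "y \<le> c - x \<Longrightarrow> x \<le> c \<Longrightarrow> x + y \<le> c" for x y c :: ennreal
      using add_left_mono[of y "c - x" x] by (simp only: add_diff_inverse_ennreal)
    have swap': "x + y \<le> c \<Longrightarrow> y \<le> c - x \<and> x \<le> c" for x y c :: ennreal
      using ennreal_le_minus_iff[of y c x] order_trans[of x "x + y" c] by (auto simp: add.commute)
    have B: "emeasure lborel (A \<inter> {..a}) + emeasure lborel B \<le> 2 * emeasure lborel C" if a: "a \<in> A" for a
    proof (rule swap)
      show "emeasure lborel B \<le> 2 * emeasure lborel C - emeasure lborel (A \<inter> {..a})"
      proof (rule emeasure_le_of_final_segments)
        fix b assume "b \<in> B"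
        then show "emeasure lborel (B \<inter> {b..}) \<le> 2 * emeasure lborel C - emeasure lborel (A \<inter> {..a})"
          using swap'[OF key[OF a]] by blast
      qed fact
      obtain b where "b \<in> B" using ne by blast
      then show "emeasure lborel (A \<inter> {..a}) \<le> 2 * emeasure lborel C"
        using swap'[OF key[OF a]] by blast
    qed
    then have B': "emeasure lborel B + emeasure lborel (A \<inter> {..a}) \<le> 2 * emeasure lborel C" if "a \<in> A" for a
      using that by (simp add: add.commute)
    have "emeasure lborel B + emeasure lborel A \<le> 2 * emeasure lborel C"
    proof (rule swap)
      show "emeasure lborel A \<le> 2 * emeasure lborel C - emeasure lborel B"
      proof (rule emeasure_le_of_initial_segments)
        fix a assume "a \<in> A"
        then show "emeasure lborel (A \<inter> {..a}) \<le> 2 * emeasure lborel C - emeasure lborel B"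
          using swap'[OF B'] by blast
      qed fact
      obtain a where "a \<in> A" using ne by blast
      then show "emeasure lborel B \<le> 2 * emeasure lborel C"
        using swap'[OF B'] by blast
    qed
    then show ?thesis by (simp add: add.commute)
  qed
qed

section \<open>Layer cake formula and the Prekopa-Leindler inequality on the line\<close>

lemma emeasure_lborel_lessThan_ennreal: "emeasure lborel {t. 0 \<le> t \<and> ennreal t < c} = c"
proof (cases c)
  case (real r)
  then have "{t. 0 \<le> t \<and> ennreal t < c} = {0..<r}" by (auto simp: ennreal_less_iff)
  then show ?thesis using real by simp
next
  case top
  then have "{t. 0 \<le> t \<and> ennreal t < c} = {0..}" by auto
  moreover have "emeasure lborel {0::real..} = \<infinity>"
  proof -
    have "of_nat n \<le> emeasure lborel {0::real..}" for n :: nat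
      using emeasure_mono[of "{0..real n}" "{0..}" lborel] by (simp add: ennreal_of_nat_eq_real_of_nat)
    then show ?thesis by (simp add: ennreal_SUP_of_nat_eq_top flip: top_unique SUP_le_iff) (metis SUP_least ennreal_SUP_of_nat_eq_top)
  qed
  ultimately show ?thesis using top by simp
qed

lemma (in sigma_finite_measure) nn_integral_layer_cake:
  assumes [measurable]: "\<phi> \<in> borel_measurable M"
  shows "(\<integral>\<^sup>+x. \<phi> x \<partial>M) = (\<integral>\<^sup>+t. indicator {0..} t * emeasure M {x\<in>space M. ennreal t < \<phi> x} \<partial>lborel)"
proof -
  interpret pair_sigma_finite M "lborel :: real measure" ..
  have "(\<integral>\<^sup>+x. \<phi> x \<partial>M)
      = (\<integral>\<^sup>+x. (\<integral>\<^sup>+t. indicator {t. 0 \<le> t \<and> ennreal t < \<phi> x} t \<partial>lborel) \<partial>M)"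
  proof (rule nn_integral_cong)
    fix x
    have "{t. 0 \<le> t \<and> ennreal t < \<phi> x} \<in> sets lborel" by measurable
    then show "\<phi> x = (\<integral>\<^sup>+t. indicator {t. 0 \<le> t \<and> ennreal t < \<phi> x} t \<partial>lborel)"
      by (simp only: nn_integral_indicator emeasure_lborel_lessThan_ennreal)
  qed
  also have "\<dots> = (\<integral>\<^sup>+x. (\<integral>\<^sup>+t. indicator {0..} t * indicator {y. ennreal t < \<phi> y} x \<partial>lborel) \<partial>M)"
    by (intro nn_integral_cong) (auto split: split_indicator)
  also have "\<dots> = (\<integral>\<^sup>+t. (\<integral>\<^sup>+x. indicator {0..} t * indicator {y. ennreal t < \<phi> y} x \<partial>M) \<partial>lborel)"
    by (rule Fubini'[symmetric]) measurable
  also have "\<dots> = (\<integral>\<^sup>+t. indicator {0..} t * emeasure M {x\<in>space M. ennreal t < \<phi> x} \<partial>lborel)"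
  proof (rule nn_integral_cong)
    fix t :: real
    have "(\<integral>\<^sup>+x. indicator {0..} t * indicator {y. ennreal t < \<phi> y} x \<partial>M)
        = (\<integral>\<^sup>+x. indicator {0..} t * indicator {x\<in>space M. ennreal t < \<phi> x} x \<partial>M)"
      by (intro nn_integral_cong) (auto split: split_indicator)
    also have "\<dots> = indicator {0..} t * emeasure M {x\<in>space M. ennreal t < \<phi> x}"
      by (rule nn_integral_cmult_indicator) measurable
    finally show "(\<integral>\<^sup>+x. indicator {0..} t * indicator {y. ennreal t < \<phi> y} x \<partial>M) = \<dots>" .
  qed
  finally show ?thesis .
qed

text \<open>The AM-GM inequality. Brunn-Minkowski bounds the sum of the two integrals, and this
  yields the product form.\<close>

lemma ennreal_mult_le_square:
  fixes a b c :: ennreal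
  assumes "a + b \<le> 2 * c"
  shows "a * b \<le> c\<^sup>2"
proof (cases "c = \<infinity>")
  case False
  then have "a + b \<noteq> \<infinity>" using assms by (auto simp: top_unique ennreal_mult_eq_top_iff)
  then obtain x y z where xyz: "a = ennreal x" "b = ennreal y" "c = ennreal z" "x \<ge> 0" "y \<ge> 0" "z \<ge> 0"
    using False by (cases a; cases b; cases c) auto
  then have le: "x + y \<le> 2 * z"
    using assms ennreal_le_iff[of "2 * z" "x + y"] by (simp add: ennreal_mult ennreal_plus)
  have "4 * (x * y) \<le> (x + y)\<^sup>2" using sum_squares_bound[of x y] by (simp add: power2_sum)
  also have "\<dots> \<le> (2 * z)\<^sup>2" using le xyz by (intro power_mono) auto
  finally have "x * y \<le> z\<^sup>2" by (simp add: power_mult_distrib)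
  then show ?thesis using xyz by (simp add: ennreal_mult[symmetric] ennreal_power)
qed simp

text \<open>Since both suprema are 1, the superlevel sets of f and g at every t < 1 are nonempty,
  which Brunn-Minkowski needs; at t \<ge> 1 they are empty. Midpoints of these sets lie in the
  superlevel set of h, because f a * g b > t^2 there. Integrating over t gives the claim.\<close>

lemma prekopa_leindler_normalized:
  fixes f g h :: "real \<Rightarrow> ennreal"
  assumes [measurable]: "f \<in> borel_measurable borel" "g \<in> borel_measurable borel" "h \<in> borel_measurable borel"
    and h: "\<And>x y. f x * g y \<le> (h ((x + y) / 2))\<^sup>2"
    and f: "\<And>x. f x \<le> 1" "\<And>t. t < 1 \<Longrightarrow> \<exists>x. t < f x"
    and g: "\<And>x. g x \<le> 1" "\<And>t. t < 1 \<Longrightarrow> \<exists>x. t < g x"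
  shows "(\<integral>\<^sup>+x. f x \<partial>lborel) * (\<integral>\<^sup>+x. g x \<partial>lborel) \<le> (\<integral>\<^sup>+x. h x \<partial>lborel)\<^sup>2"
proof (rule ennreal_mult_le_square)
  let ?L = "\<lambda>\<phi> t. emeasure lborel {x::real. ennreal t < \<phi> x}"
  have cake: "(\<integral>\<^sup>+x. \<phi> x \<partial>lborel) = (\<integral>\<^sup>+t. indicator {0..} t * ?L \<phi> t \<partial>lborel)"
    if "\<phi> \<in> borel_measurable borel" for \<phi> :: "real \<Rightarrow> ennreal"
    using lborel.nn_integral_layer_cake[of \<phi>] that by simp
  have [measurable]: "(\<lambda>t. ?L \<phi> t) \<in> borel_measurable borel"
    if [measurable]: "\<phi> \<in> borel_measurable borel" for \<phi> :: "real \<Rightarrow> ennreal"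
  proof -
    have "(\<lambda>t. emeasure lborel {x \<in> space lborel. ennreal t < \<phi> x}) \<in> borel_measurable borel"
      by measurable
    then show ?thesis by simp
  qed
  have "(\<integral>\<^sup>+x. f x \<partial>lborel) + (\<integral>\<^sup>+x. g x \<partial>lborel)
      = (\<integral>\<^sup>+t. indicator {0..} t * ?L f t + indicator {0..} t * ?L g t \<partial>lborel)"
    by (subst nn_integral_add) (measurable, simp only: cake[OF assms(1)] cake[OF assms(2)])
  also have "\<dots> \<le> (\<integral>\<^sup>+t. 2 * (indicator {0..} t * ?L h t) \<partial>lborel)"
  proof (rule nn_integral_mono)
    fix t :: real
    show "indicator {0..} t * ?L f t + indicator {0..} t * ?L g t \<le> 2 * (indicator {0..} t * ?L h t)"
    proof (cases "0 \<le> t")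
      case t0: True
      show ?thesis
      proof (cases "t < 1")
        case True
        have t1: "ennreal t < 1" using True t0 by (simp add: ennreal_less_one_iff)
        have "?L f t + ?L g t \<le> 2 * ?L h t"
        proof (rule brunn_minkowski_midpoint)
          show "{x. ennreal t < f x} \<noteq> {}" "{x. ennreal t < g x} \<noteq> {}"
            using f(2)[OF t1] g(2)[OF t1] by auto
          fix a b assume "a \<in> {x. ennreal t < f x}" "b \<in> {x. ennreal t < g x}"
          moreover obtain u v where "f a = ennreal u" "g b = ennreal v" "0 \<le> u" "0 \<le> v"
            using f(1)[of a] g(1)[of b] by (cases "f a"; cases "g b") (auto simp: top_unique)
          ultimately have "ennreal t * ennreal t < f a * g b"
            using t0 by (auto simp: ennreal_mult[symmetric] ennreal_less_iff intro!: mult_strict_mono')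
          also have "\<dots> \<le> (h ((a + b) / 2))\<^sup>2" by (rule h)
          finally have "(ennreal t)\<^sup>2 < (h ((a + b) / 2))\<^sup>2" by (simp add: power2_eq_square)
          then show "(a + b) / 2 \<in> {x. ennreal t < h x}"
            by (metis mem_Collect_eq not_less power_mono zero_le)
        qed measurable
        then show ?thesis using t0 by simp
      next
        case False
        then have "1 \<le> ennreal t" by (simp add: ennreal_ge_1)
        then have "{x. ennreal t < f x} = {}" "{x. ennreal t < g x} = {}"
          using order_trans[OF f(1)] order_trans[OF g(1)] by (auto simp: not_less simp del: ennreal_ge_1)
        then show ?thesis by simp
      qed
    qed simp
  qed
  also have "\<dots> = 2 * (\<integral>\<^sup>+x. h x \<partial>lborel)"
    by (subst nn_integral_cmult) (measurable, simp only: cake[OF assms(3)])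
  finally show "(\<integral>\<^sup>+x. f x \<partial>lborel) + (\<integral>\<^sup>+x. g x \<partial>lborel) \<le> 2 * (\<integral>\<^sup>+x. h x \<partial>lborel)" .
qed

lemma prekopa_leindler_bounded:
  fixes f g h :: "real \<Rightarrow> ennreal"
  assumes [measurable]: "f \<in> borel_measurable borel" "g \<in> borel_measurable borel" "h \<in> borel_measurable borel"
    and h: "\<And>x y. f x * g y \<le> (h ((x + y) / 2))\<^sup>2"
    and fin: "(SUP x. f x) < \<infinity>" "(SUP x. g x) < \<infinity>"
  shows "(\<integral>\<^sup>+x. f x \<partial>lborel) * (\<integral>\<^sup>+x. g x \<partial>lborel) \<le> (\<integral>\<^sup>+x. h x \<partial>lborel)\<^sup>2"
proof (cases "(SUP x. f x) = 0 \<or> (SUP x. g x) = 0")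
  case True
  then have "(\<forall>x. f x = 0) \<or> (\<forall>x. g x = 0)" by (metis UNIV_I SUP_upper le_zero_eq)
  then show ?thesis by auto
next
  case False
  obtain \<alpha> where \<alpha>: "(SUP x. f x) = ennreal \<alpha>" "\<alpha> > 0"
    using fin False by (cases "SUP x. f x") (auto simp: less_le)
  obtain \<beta> where \<beta>: "(SUP x. g x) = ennreal \<beta>" "\<beta> > 0"
    using fin False by (cases "SUP x. g x") (auto simp: less_le)
  \<comment> \<open>The midpoint hypothesis is homogeneous: if f is divided by \<alpha> and g by
    \<beta>, then h has to be divided by their geometric mean.\<close>
  define c where "c = sqrt (\<alpha> * \<beta>)"
  have c: "c > 0" "ennreal (1 / \<alpha>) * ennreal (1 / \<beta>) = (ennreal (1 / c))\<^sup>2"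
    using \<alpha> \<beta> by (simp_all add: c_def ennreal_mult[symmetric] ennreal_power power_divide)
  have norm: "(\<forall>x. ennreal (1 / a) * \<phi> x \<le> 1) \<and> (\<forall>t<1. \<exists>x. t < ennreal (1 / a) * \<phi> x)"
    if a: "(SUP x. \<phi> x) = ennreal a" "a > 0" for a and \<phi> :: "real \<Rightarrow> ennreal"
  proof -
    have "(SUP x. ennreal (1 / a) * \<phi> x) = ennreal (1 / a) * ennreal a"
      using a by (simp add: SUP_mult_left_ennreal[symmetric])
    also have "\<dots> = 1" using a by (simp add: ennreal_mult[symmetric])
    finally have "(SUP x. ennreal (1 / a) * \<phi> x) = 1" .
    then show ?thesis by (metis SUP_upper UNIV_I less_SUP_iff)
  qed
  have "(\<integral>\<^sup>+x. ennreal (1 / \<alpha>) * f x \<partial>lborel) * (\<integral>\<^sup>+x. ennreal (1 / \<beta>) * g x \<partial>lborel)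
      \<le> (\<integral>\<^sup>+x. ennreal (1 / c) * h x \<partial>lborel)\<^sup>2"
  proof (rule prekopa_leindler_normalized)
    fix x y
    have "ennreal (1 / \<alpha>) * f x * (ennreal (1 / \<beta>) * g y) = (ennreal (1 / c))\<^sup>2 * (f x * g y)"
      by (simp add: c(2)[symmetric] ac_simps)
    also have "\<dots> \<le> (ennreal (1 / c))\<^sup>2 * (h ((x + y) / 2))\<^sup>2" by (intro mult_left_mono h) simp
    finally show "ennreal (1 / \<alpha>) * f x * (ennreal (1 / \<beta>) * g y) \<le> (ennreal (1 / c) * h ((x + y) / 2))\<^sup>2"
      by (simp add: power_mult_distrib)
  qed (use norm[OF \<alpha>] norm[OF \<beta>] in auto)
  moreover have "(\<integral>\<^sup>+x. ennreal (1 / \<alpha>) * f x \<partial>lborel) * (\<integral>\<^sup>+x. ennreal (1 / \<beta>) * g x \<partial>lborel)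
      = (ennreal (1 / c))\<^sup>2 * ((\<integral>\<^sup>+x. f x \<partial>lborel) * (\<integral>\<^sup>+x. g x \<partial>lborel))"
    unfolding c(2)[symmetric]
    by (subst (1 2) nn_integral_cmult, measurable, simp only: mult_ac)
  ultimately have "(ennreal (1 / c))\<^sup>2 * ((\<integral>\<^sup>+x. f x \<partial>lborel) * (\<integral>\<^sup>+x. g x \<partial>lborel))
      \<le> (ennreal (1 / c))\<^sup>2 * (\<integral>\<^sup>+x. h x \<partial>lborel)\<^sup>2"
    by (simp add: nn_integral_cmult power_mult_distrib)
  then have "(ennreal c)\<^sup>2 * ((ennreal (1 / c))\<^sup>2 * ((\<integral>\<^sup>+x. f x \<partial>lborel) * (\<integral>\<^sup>+x. g x \<partial>lborel)))
      \<le> (ennreal c)\<^sup>2 * ((ennreal (1 / c))\<^sup>2 * (\<integral>\<^sup>+x. h x \<partial>lborel)\<^sup>2)"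
    by (rule mult_left_mono) simp
  moreover have "(ennreal c)\<^sup>2 * (ennreal (1 / c))\<^sup>2 = 1"
    using c(1) by (simp add: ennreal_mult[symmetric] ennreal_power power_divide)
  ultimately show ?thesis by (simp add: mult.assoc[symmetric])
qed

text \<open>Truncating f and g only lowers the left-hand side of the hypothesis; monotone
  convergence in the two truncation levels separately removes the boundedness.\<close>

lemma prekopa_leindler_real:
  fixes f g h :: "real \<Rightarrow> ennreal"
  assumes [measurable]: "f \<in> borel_measurable borel" "g \<in> borel_measurable borel" "h \<in> borel_measurable borel"
    and h: "\<And>x y. f x * g y \<le> (h ((x + y) / 2))\<^sup>2"
  shows "(\<integral>\<^sup>+x. f x \<partial>lborel) * (\<integral>\<^sup>+x. g x \<partial>lborel) \<le> (\<integral>\<^sup>+x. h x \<partial>lborel)\<^sup>2"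
proof -
  have trunc: "(\<integral>\<^sup>+x. \<phi> x \<partial>lborel) = (SUP n::nat. \<integral>\<^sup>+x. min (\<phi> x) (of_nat n) \<partial>lborel)"
    if [measurable]: "\<phi> \<in> borel_measurable borel" for \<phi> :: "real \<Rightarrow> ennreal"
  proof -
    have "(SUP n::nat. min (\<phi> x) (of_nat n)) = \<phi> x" for x
      by (simp add: inf_min[symmetric] inf_SUP[symmetric] ennreal_SUP_of_nat_eq_top)
    then have "(\<integral>\<^sup>+x. \<phi> x \<partial>lborel) = (\<integral>\<^sup>+x. (SUP n::nat. min (\<phi> x) (of_nat n)) \<partial>lborel)" by simp
    also have "\<dots> = (SUP n::nat. \<integral>\<^sup>+x. min (\<phi> x) (of_nat n) \<partial>lborel)"
      by (intro nn_integral_monotone_convergence_SUP)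
        (auto simp: incseq_def le_fun_def min_le_iff_disj)
    finally show ?thesis .
  qed
  have "(\<integral>\<^sup>+x. min (f x) (of_nat m) \<partial>lborel) * (\<integral>\<^sup>+x. min (g x) (of_nat n) \<partial>lborel)
      \<le> (\<integral>\<^sup>+x. h x \<partial>lborel)\<^sup>2" for m n :: nat
  proof (rule prekopa_leindler_bounded)
    fix x y
    have "min (f x) (of_nat m) * min (g y) (of_nat n) \<le> f x * g y" by (intro mult_mono) auto
    also note h
    finally show "min (f x) (of_nat m) * min (g y) (of_nat n) \<le> (h ((x + y) / 2))\<^sup>2" .
  next
    have "(SUP x. min (\<phi> x) (of_nat n)) \<le> of_nat n" for \<phi> :: "real \<Rightarrow> ennreal" and n
      by (intro SUP_least) auto
    then show "(SUP x. min (f x) (of_nat m)) < \<infinity>" "(SUP x. min (g x) (of_nat n)) < \<infinity>"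
      using of_nat_less_top by (auto intro: le_less_trans)
  qed measurable
  then show ?thesis
    unfolding trunc[OF assms(1)] trunc[OF assms(2)]
    by (simp add: SUP_mult_left_ennreal SUP_mult_right_ennreal SUP_le_iff)
qed

text \<open>Induction on the coordinates: by the induction hypothesis the integrals over the remaining
  coordinates satisfy the hypothesis of the one-dimensional case.\<close>

theorem prekopa_leindler_midpoint:
  fixes f g h :: "('i \<Rightarrow> real) \<Rightarrow> ennreal"
  assumes "finite I"
    and "f \<in> borel_measurable (PiM I (\<lambda>_. lborel))" "g \<in> borel_measurable (PiM I (\<lambda>_. lborel))"
      "h \<in> borel_measurable (PiM I (\<lambda>_. lborel))"
    and "\<And>x y. x \<in> space (PiM I (\<lambda>_. lborel)) \<Longrightarrow> y \<in> space (PiM I (\<lambda>_. lborel)) \<Longrightarrow>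
      f x * g y \<le> (h (\<lambda>i\<in>I. (x i + y i) / 2))\<^sup>2"
  shows "(\<integral>\<^sup>+x. f x \<partial>PiM I (\<lambda>_. lborel)) * (\<integral>\<^sup>+x. g x \<partial>PiM I (\<lambda>_. lborel))
     \<le> (\<integral>\<^sup>+x. h x \<partial>PiM I (\<lambda>_. lborel))\<^sup>2"
  using assms
proof (induction I arbitrary: f g h rule: finite_induct)
  case empty
  interpret product_sigma_finite "\<lambda>_::'i. lborel :: real measure" ..
  show ?case using empty.prems(4)[of "\<lambda>_. undefined" "\<lambda>_. undefined"]
    by (simp add: nn_integral_empty space_PiM restrict_def)
next
  case (insert i I)
  interpret product_sigma_finite "\<lambda>_::'i. lborel :: real measure" ..
  note [measurable] = insert.prems(1-3)
  have I: "finite I" "i \<notin> I" by fact+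
  have upd: "(\<lambda>x. \<phi> (x(i := s))) \<in> borel_measurable (PiM I (\<lambda>_. lborel))"
    if [measurable]: "\<phi> \<in> borel_measurable (PiM (insert i I) (\<lambda>_. lborel))"
    for \<phi> :: "('i \<Rightarrow> real) \<Rightarrow> ennreal" and s
    by (rule measurable_compose[OF _ that], rule measurable_fun_upd[where J = I]) auto
  have int: "(\<lambda>s. \<integral>\<^sup>+x. \<phi> (x(i := s)) \<partial>PiM I (\<lambda>_. lborel)) \<in> borel_measurable borel"
    if [measurable]: "\<phi> \<in> borel_measurable (PiM (insert i I) (\<lambda>_. lborel))"
    for \<phi> :: "('i \<Rightarrow> real) \<Rightarrow> ennreal"
  proof -
    interpret P: sigma_finite_measure "PiM I (\<lambda>_. lborel :: real measure)"
      by (rule sigma_finite) fact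
    have "(\<lambda>(s, x). \<phi> (x(i := s))) \<in> borel_measurable (lborel \<Otimes>\<^sub>M PiM I (\<lambda>_. lborel))"
      by measurable
    then have "(\<lambda>s. \<integral>\<^sup>+x. \<phi> (x(i := s)) \<partial>PiM I (\<lambda>_. lborel)) \<in> borel_measurable lborel"
      by (rule P.borel_measurable_nn_integral)
    then show ?thesis by simp
  qed
  have *: "(\<integral>\<^sup>+x. \<phi> x \<partial>PiM (insert i I) (\<lambda>_. lborel))
      = (\<integral>\<^sup>+s. (\<integral>\<^sup>+x. \<phi> (x(i := s)) \<partial>PiM I (\<lambda>_. lborel)) \<partial>lborel)"
    if "\<phi> \<in> borel_measurable (PiM (insert i I) (\<lambda>_. lborel))" for \<phi> :: "('i \<Rightarrow> real) \<Rightarrow> ennreal"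
    using that I by (rule product_nn_integral_insert_rev[rotated 2])
  show ?case
    unfolding *[OF insert.prems(1)] *[OF insert.prems(2)] *[OF insert.prems(3)]
  proof (rule prekopa_leindler_real)
    fix s t :: real
    show "(\<integral>\<^sup>+x. f (x(i := s)) \<partial>PiM I (\<lambda>_. lborel)) * (\<integral>\<^sup>+x. g (x(i := t)) \<partial>PiM I (\<lambda>_. lborel))
       \<le> (\<integral>\<^sup>+x. h (x(i := (s + t) / 2)) \<partial>PiM I (\<lambda>_. lborel))\<^sup>2"
    proof (rule insert.IH)
      fix x y :: "'i \<Rightarrow> real"
      assume "x \<in> space (PiM I (\<lambda>_. lborel))" "y \<in> space (PiM I (\<lambda>_. lborel))"
      then have "x(i := s) \<in> space (PiM (insert i I) (\<lambda>_. lborel))"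
        "y(i := t) \<in> space (PiM (insert i I) (\<lambda>_. lborel))"
        by (auto simp: space_PiM PiE_fun_upd)
      from insert.prems(4)[OF this]
      have "f (x(i := s)) * g (y(i := t))
          \<le> (h (\<lambda>j\<in>insert i I. ((x(i := s)) j + (y(i := t)) j) / 2))\<^sup>2" .
      also have "(\<lambda>j\<in>insert i I. ((x(i := s)) j + (y(i := t)) j) / 2)
          = (\<lambda>j\<in>I. (x j + y j) / 2)(i := (s + t) / 2)"
        using I by (auto simp: fun_eq_iff)
      finally show "f (x(i := s)) * g (y(i := t))
          \<le> (h ((\<lambda>j\<in>I. (x j + y j) / 2)(i := (s + t) / 2)))\<^sup>2" .
    qed (intro upd insert.prems)+
  qed (intro int insert.prems)+
qed

section \<open>Midpoint log-concavity and the comparison of ratios\<close>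

lemma midpoint_log_concave_imp_log_concave:
  fixes \<phi> :: "real \<Rightarrow> real"
  assumes mono: "mono_on {0..1} \<phi>" and nonneg: "\<And>t. 0 \<le> \<phi> t"
    and mid: "\<And>s t. s \<in> {0..1} \<Longrightarrow> t \<in> {0..1} \<Longrightarrow> \<phi> s * \<phi> t \<le> (\<phi> ((s + t) / 2))\<^sup>2"
    and \<theta>: "\<theta> \<in> {0..1}"
  shows "\<phi> 0 powr (1 - \<theta>) * \<phi> 1 powr \<theta> \<le> \<phi> \<theta>"
proof (cases "\<phi> 0 = 0 \<or> \<phi> 1 = 0")
  case True
  then show ?thesis using nonneg by auto
next
  case False
  then have pos: "\<phi> 0 > 0" "\<phi> 1 > 0" using nonneg by (auto simp: less_le)
  define L where "L t = \<phi> 0 powr (1 - t) * \<phi> 1 powr t" for t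
  have L0: "L t > 0" for t using pos by (simp add: L_def)
  define E where "E t = (1 - t) * ln (\<phi> 0) + t * ln (\<phi> 1)" for t
  have LE: "L t = exp (E t)" for t
    using pos by (simp add: L_def E_def powr_def exp_add)
  have Lmid: "L s * L t = (L ((s + t) / 2))\<^sup>2" for s t
  proof -
    have "E s + E t = 2 * E ((s + t) / 2)" by (simp add: E_def field_simps)
    then show ?thesis by (simp add: LE exp_add[symmetric] exp_double[symmetric])
  qed
  have dyadic: "L (real k / 2 ^ n) \<le> \<phi> (real k / 2 ^ n)" if "k \<le> 2 ^ n" for k n :: nat
    using that
  proof (induction n arbitrary: k)
    case 0
    then have "k = 0 \<or> k = 1" by auto
    then show ?case using pos by (auto simp: L_def)
  next
    case (Suc n)
    show ?case
    proof (cases "even k")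
      case True
      then obtain j where "k = 2 * j" by blast
      then show ?thesis using Suc.IH[of j] Suc.prems by simp
    next
      case False
      then obtain j where k: "k = 2 * j + 1" using oddE by blast
      let ?s = "real j / 2 ^ n" and ?t = "real (Suc j) / 2 ^ n"
      have j: "Suc j \<le> 2 ^ n" using Suc.prems k by simp
      have st: "?s \<in> {0..1}" "?t \<in> {0..1}"
        using j by (auto simp: divide_le_eq) (metis Suc_leD of_nat_Suc of_nat_le_iff of_nat_numeral of_nat_power)+
      have m: "(?s + ?t) / 2 = real k / 2 ^ Suc n" by (simp add: k field_simps)
      have "(L ((?s + ?t) / 2))\<^sup>2 = L ?s * L ?t" by (rule Lmid[symmetric])
      also have "\<dots> \<le> \<phi> ?s * \<phi> ?t"
        using j nonneg L0 by (intro mult_mono Suc.IH) (auto intro: less_imp_le)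
      also have "\<dots> \<le> (\<phi> ((?s + ?t) / 2))\<^sup>2" by (rule mid[OF st])
      finally show ?thesis unfolding m by (rule power2_le_imp_le) (rule nonneg)
    qed
  qed
  \<comment> \<open>The dyadic approximation is taken from below, where monotonicity gives \<phi>
    (?u n) \<le> \<phi> \<theta>. This replaces continuity of \<phi>, which is not assumed.\<close>
  let ?u = "\<lambda>n::nat. real (nat \<lfloor>\<theta> * 2 ^ n\<rfloor>) / 2 ^ n"
  have u: "?u n \<le> \<theta>" "\<theta> - 1 / 2 ^ n \<le> ?u n" for n
  proof -
    have f: "real (nat \<lfloor>\<theta> * 2 ^ n\<rfloor>) = of_int \<lfloor>\<theta> * 2 ^ n\<rfloor>" using \<theta> by simp
    show "?u n \<le> \<theta>" unfolding f by (simp add: divide_le_eq)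
    have "\<theta> * 2 ^ n - 1 \<le> of_int \<lfloor>\<theta> * 2 ^ n\<rfloor>" by linarith
    then have "(\<theta> * 2 ^ n - 1) / 2 ^ n \<le> of_int \<lfloor>\<theta> * 2 ^ n\<rfloor> / 2 ^ n"
      by (intro divide_right_mono) auto
    then show "\<theta> - 1 / 2 ^ n \<le> ?u n" unfolding f by (simp add: diff_divide_distrib)
  qed
  have "?u \<longlonglongrightarrow> \<theta>"
  proof (rule tendsto_sandwich)
    have "(\<lambda>n::nat. \<theta> - (1 / 2) ^ n) \<longlonglongrightarrow> \<theta> - 0"
      by (intro tendsto_diff tendsto_const LIMSEQ_realpow_zero) auto
    then show "(\<lambda>n::nat. \<theta> - 1 / 2 ^ n) \<longlonglongrightarrow> \<theta>" by (simp add: power_one_over)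
    show "(\<lambda>n::nat. \<theta>) \<longlonglongrightarrow> \<theta>" by simp
  qed (use u in auto)
  then have "(\<lambda>n. L (?u n)) \<longlonglongrightarrow> L \<theta>"
    unfolding L_def using pos by (intro tendsto_intros) auto
  moreover have "L (?u n) \<le> \<phi> \<theta>" for n
  proof -
    have "?u n \<le> 1" by (rule order_trans[OF u(1)]) (use \<theta> in simp)
    have "\<theta> * 2 ^ n \<le> 2 ^ n" using \<theta> by (simp add: mult_left_le_one_le)
    then have "\<lfloor>\<theta> * 2 ^ n\<rfloor> \<le> 2 ^ n"
      by (metis floor_mono floor_of_int of_int_numeral of_int_power)
    then have k: "nat \<lfloor>\<theta> * 2 ^ n\<rfloor> \<le> 2 ^ n" by (simp add: nat_le_iff)
    have "L (?u n) \<le> \<phi> (?u n)" by (rule dyadic[OF k])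
    also have "\<dots> \<le> \<phi> \<theta>"
      using u(1)[of n] \<theta> \<open>?u n \<le> 1\<close> by (intro mono_onD[OF mono]) auto
    finally show ?thesis .
  qed
  ultimately have "L \<theta> \<le> \<phi> \<theta>" by (intro LIMSEQ_le_const2) auto
  then show ?thesis by (simp add: L_def)
qed

text \<open>The points u and v divide the segment from p to q in complementary ratios. Log-concavity
  at \<theta> and at 1 - \<theta> is multiplied, and the exponents of f p and of f q each add up to
  1. Where f is positive this says that f (x + d) / f x does not increase with x for d \<ge> 0; the
  product form also covers zeros of f.\<close>

lemma midpoint_log_concave_four_points:
  fixes f :: "real \<Rightarrow> real"
  assumes mono: "mono_on {a..} f" and nonneg: "\<And>t. 0 \<le> f t"
    and mid: "\<And>s t. a \<le> s \<Longrightarrow> a \<le> t \<Longrightarrow> f s * f t \<le> (f ((s + t) / 2))\<^sup>2"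
    and ord: "a \<le> p" "p \<le> u" "p \<le> v" "u + v = p + q"
  shows "f p * f q \<le> f u * f v"
proof (cases "p = q")
  case True
  then have "u = p" "v = p" using ord by auto
  then show ?thesis using True by simp
next
  case False
  then have pq: "p < q" using ord by linarith
  define \<phi> where "\<phi> t = f (p + t * (q - p))" for t
  have "mono_on {0..1} \<phi>"
  proof (rule mono_onI)
    fix r s :: real assume rs: "r \<in> {0..1}" "s \<in> {0..1}" "r \<le> s"
    then have "r * (q - p) \<le> s * (q - p)" "0 \<le> r * (q - p)" using pq by (auto intro: mult_right_mono)
    then show "\<phi> r \<le> \<phi> s" unfolding \<phi>_def using ord by (intro mono_onD[OF mono]) auto
  qed
  moreover have "\<phi> s * \<phi> t \<le> (\<phi> ((s + t) / 2))\<^sup>2" if "s \<in> {0..1}" "t \<in> {0..1}" for s t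
  proof -
    have "0 \<le> s * (q - p)" "0 \<le> t * (q - p)" using that pq by auto
    then have "\<phi> s * \<phi> t \<le> (f ((p + s * (q - p) + (p + t * (q - p))) / 2))\<^sup>2"
      unfolding \<phi>_def using ord by (intro mid) auto
    also have "(p + s * (q - p) + (p + t * (q - p))) / 2 = p + (s + t) / 2 * (q - p)"
      by (simp add: field_simps)
    finally show ?thesis by (simp add: \<phi>_def)
  qed
  moreover have "0 \<le> \<phi> t" for t by (simp add: \<phi>_def nonneg)
  ultimately have *: "\<phi> 0 powr (1 - \<theta>) * \<phi> 1 powr \<theta> \<le> \<phi> \<theta>" if "\<theta> \<in> {0..1}" for \<theta>
    using that by (intro midpoint_log_concave_imp_log_concave)
  define \<theta> where "\<theta> = (u - p) / (q - p)"
  have \<theta>: "\<theta> \<in> {0..1}" "1 - \<theta> \<in> {0..1}" using ord pq by (auto simp: \<theta>_def field_simps)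
  have uv: "u = p + \<theta> * (q - p)" "v = p + (1 - \<theta>) * (q - p)"
  proof -
    have "\<theta> * (q - p) = u - p" using pq by (simp add: \<theta>_def)
    then show "u = p + \<theta> * (q - p)" "v = p + (1 - \<theta>) * (q - p)"
      using ord by (simp_all add: left_diff_distrib)
  qed
  have "f p * f q = (f p powr (1 - \<theta>) * f p powr \<theta>) * (f q powr \<theta> * f q powr (1 - \<theta>))"
    using nonneg[of p] nonneg[of q] by (simp add: powr_add[symmetric])
  also have "\<dots> = (\<phi> 0 powr (1 - \<theta>) * \<phi> 1 powr \<theta>) * (\<phi> 0 powr (1 - (1 - \<theta>)) * \<phi> 1 powr (1 - \<theta>))"
    by (simp add: \<phi>_def)
  also have "\<dots> \<le> \<phi> \<theta> * \<phi> (1 - \<theta>)"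
    by (intro mult_mono *[OF \<theta>(1)] *[OF \<theta>(2)]) (auto simp: \<phi>_def nonneg)
  also have "\<dots> = f u * f v" unfolding \<phi>_def uv ..
  finally show ?thesis .
qed

text \<open>Each full integral is split into its parts over S and over the complement. The products
  of two parts over S agree on both sides, and the mixed products are compared pointwise. For
  positive finite integrals it says that the share of S is no larger under a than under b.\<close>

lemma nn_integral_cross_le:
  fixes a b :: "'a \<Rightarrow> ennreal"
  assumes [measurable]: "a \<in> borel_measurable M" "b \<in> borel_measurable M" "S \<in> sets M"
    and cross: "\<And>w y. w \<in> S \<Longrightarrow> y \<notin> S \<Longrightarrow> a w * b y \<le> b w * a y"
  shows "(\<integral>\<^sup>+w\<in>S. a w \<partial>M) * (\<integral>\<^sup>+y. b y \<partial>M) \<le> (\<integral>\<^sup>+w\<in>S. b w \<partial>M) * (\<integral>\<^sup>+y. a y \<partial>M)"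
proof -
  have split: "(\<integral>\<^sup>+y. c y \<partial>M) = (\<integral>\<^sup>+y\<in>S. c y \<partial>M) + (\<integral>\<^sup>+y\<in>space M - S. c y \<partial>M)"
    if [measurable]: "c \<in> borel_measurable M" for c :: "'a \<Rightarrow> ennreal"
    by (subst nn_integral_add[symmetric]) (auto intro!: nn_integral_cong split: split_indicator)
  have prod: "(\<integral>\<^sup>+w\<in>S. c w \<partial>M) * (\<integral>\<^sup>+y\<in>space M - S. d y \<partial>M)
      = (\<integral>\<^sup>+w. (\<integral>\<^sup>+y. c w * indicator S w * (d y * indicator (space M - S) y) \<partial>M) \<partial>M)"
    if [measurable]: "c \<in> borel_measurable M" "d \<in> borel_measurable M" for c d :: "'a \<Rightarrow> ennreal"
    by (simp add: nn_integral_cmult nn_integral_multc)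
  have "(\<integral>\<^sup>+w\<in>S. a w \<partial>M) * (\<integral>\<^sup>+y\<in>space M - S. b y \<partial>M)
      \<le> (\<integral>\<^sup>+w\<in>S. b w \<partial>M) * (\<integral>\<^sup>+y\<in>space M - S. a y \<partial>M)"
    unfolding prod[OF assms(1,2)] prod[OF assms(2,1)]
    using cross by (intro nn_integral_mono) (auto split: split_indicator)
  then show ?thesis
    unfolding split[OF assms(1)] split[OF assms(2)] distrib_left
    by (intro add_mono) (simp_all add: mult.commute)
qed

lemma ennreal_divide_le_divideI:
  fixes a b c d :: ennreal
  assumes "a * d \<le> c * b" "b \<noteq> 0" "b < \<infinity>" "d \<noteq> 0" "d < \<infinity>"
  shows "a / b \<le> c / d"
proof -
  have "a / b = (a * d) / (b * d)"
    using assms by (simp add: ennreal_mult_divide_eq divide_mult_eq)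
  also have "\<dots> \<le> (c * b) / (b * d)" by (rule divide_right_mono_ennreal) fact
  also have "\<dots> = c / d" using assms
    by (simp add: mult.commute[of b d] divide_mult_eq)
  finally show ?thesis .
qed

lemma ennreal_divide_le_divideD:
  fixes a b c d :: ennreal
  assumes "a / b \<le> c / d" "b \<noteq> 0" "b < \<infinity>" "d \<noteq> 0" "d < \<infinity>"
  shows "a * d \<le> c * b"
proof -
  have eq: "a / b * b = a" "c / d * d = c"
    using assms by (simp_all add: ennreal_divide_times)
  have "a * d = a / b * (b * d)" by (simp only: eq(1) mult.assoc[symmetric])
  also have "\<dots> \<le> c / d * (b * d)" by (rule mult_right_mono) (use assms in auto)
  also have "\<dots> = c / d * d * b" by (simp only: mult_ac)
  also have "\<dots> = c * b" by (simp only: eq)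
  finally show ?thesis .
qed

section \<open>Negative dependence in Orlicz balls\<close>

text \<open>A Young function reduced to a real-valued one: \<open>D\<close> stands for the points
  around which it is finite, so that the value infinity is expressed by leaving \<open>D\<close>.
  Since \<open>D\<close> is open, the convex function \<open>G\<close> is continuous on it, and the
  coupling of coordinate laws relies on that.\<close>

locale orlicz_profile =
  fixes D :: "real set" and G :: "real \<Rightarrow> real"
  assumes open_D: "open D" and zero_D: "0 \<in> D"
    and abs_D: "\<And>y. \<bar>y\<bar> \<in> D \<longleftrightarrow> y \<in> D"
    and G_convex: "convex_on D G"
    and G_abs: "\<And>y. G \<bar>y\<bar> = G y" and G_nonneg: "\<And>y. 0 \<le> G y" and G_0: "G 0 = 0"
    and G_measurable [measurable]: "G \<in> borel_measurable borel"
    and bounded_sublevel: "\<And>c. bounded {y\<in>D. G y \<le> c}"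
begin

lemma D_measurable [measurable]: "D \<in> sets borel" using open_D by simp

lemma convex_D: "convex D" using G_convex by (simp add: convex_on_def)

lemma D_down: "x \<in> D" if "y \<in> D" "\<bar>x\<bar> \<le> \<bar>y\<bar>"
proof -
  have "\<bar>x\<bar> \<in> D"
    using convex_D zero_D that abs_D[of y]
    by (metis abs_ge_zero atLeastAtMost_iff closed_segment_eq_real_ivl convex_contains_segment subsetD)
  then show ?thesis using abs_D by simp
qed

lemma G_mono: "G x \<le> G y" if y: "y \<in> D" "\<bar>x\<bar> \<le> \<bar>y\<bar>"
proof (cases "y = 0")
  case False
  define t where "t = \<bar>x\<bar> / \<bar>y\<bar>"
  have t: "0 \<le> t" "t \<le> 1" "\<bar>x\<bar> = t * \<bar>y\<bar>" using that False by (auto simp: t_def)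
  have "G ((1 - t) *\<^sub>R 0 + t *\<^sub>R \<bar>y\<bar>) \<le> (1 - t) * G 0 + t * G \<bar>y\<bar>"
    using t zero_D y abs_D by (intro convex_onD[OF G_convex]) auto
  then have "G \<bar>x\<bar> \<le> t * G y" by (simp add: t G_0 G_abs)
  also have "\<dots> \<le> G y" using t G_nonneg[of y] by (simp add: mult_left_le_one_le)
  finally show ?thesis by (simp add: G_abs)
qed (use that in simp)

section \<open>Volumes and slices of Orlicz sets\<close>

definition orlicz_set :: "'i set \<Rightarrow> real \<Rightarrow> ('i \<Rightarrow> real) set" where
  "orlicz_set J s = {z \<in> space (PiM J (\<lambda>_. lborel)). (\<forall>j\<in>J. z j \<in> D) \<and> (\<Sum>j\<in>J. G (z j)) \<le> s}"

definition vol :: "'i set \<Rightarrow> real \<Rightarrow> ennreal" where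
  "vol J s = emeasure (PiM J (\<lambda>_. lborel)) (orlicz_set J s)"

text \<open>An unnormalized expectation: \<open>mass J \<psi> s / vol J s\<close> is the mean of
  \<psi> at the absolute values of the coordinates of a uniform point. Inequalities between such
  means are stated multiplied out, so that they remain meaningful on null sets.\<close>

definition mass :: "'i set \<Rightarrow> (('i \<Rightarrow> real) \<Rightarrow> ennreal) \<Rightarrow> real \<Rightarrow> ennreal" where
  "mass J \<psi> s = (\<integral>\<^sup>+z\<in>orlicz_set J s. \<psi> (\<lambda>j\<in>J. \<bar>z j\<bar>) \<partial>PiM J (\<lambda>_. lborel))"

lemma orlicz_set_measurable [measurable]:
  assumes "finite J" shows "orlicz_set J s \<in> sets (PiM J (\<lambda>_. lborel))"
proof -
  have [measurable]: "countable J" using assms by (rule countable_finite)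
  have "{z \<in> space (PiM J (\<lambda>_. lborel)). (\<forall>j\<in>J. z j \<in> D)} \<in> sets (PiM J (\<lambda>_. lborel))"
    using assms by (intro sets.sets_Collect_finite_All) measurable
  moreover have "{z \<in> space (PiM J (\<lambda>_. lborel)). (\<Sum>j\<in>J. G (z j)) \<le> s} \<in> sets (PiM J (\<lambda>_. lborel))"
    by measurable
  ultimately have "{z \<in> space (PiM J (\<lambda>_. lborel)). (\<forall>j\<in>J. z j \<in> D)}
     \<inter> {z \<in> space (PiM J (\<lambda>_. lborel)). (\<Sum>j\<in>J. G (z j)) \<le> s} \<in> sets (PiM J (\<lambda>_. lborel))"
    by (rule sets.Int)
  then show ?thesis by (simp add: orlicz_set_def Collect_conj_eq[symmetric] Int_def conj_ac cong: conj_cong)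
qed

lemma vol_mono: "finite J \<Longrightarrow> s \<le> t \<Longrightarrow> vol J s \<le> vol J t"
  unfolding vol_def by (intro emeasure_mono) (auto simp: orlicz_set_def)

lemma vol_finite: assumes "finite J" shows "vol J s < \<infinity>"
proof -
  interpret product_sigma_finite "\<lambda>_. lborel :: real measure" ..
  obtain R where R: "\<And>y. y \<in> D \<Longrightarrow> G y \<le> s \<Longrightarrow> \<bar>y\<bar> \<le> R"
    using bounded_sublevel[of s] by (auto simp: bounded_iff)
  have "orlicz_set J s \<subseteq> PiE J (\<lambda>_. {-R..R})"
  proof
    fix z assume z: "z \<in> orlicz_set J s"
    have "\<bar>z j\<bar> \<le> R" if "j \<in> J" for j
    proof (rule R)
      have "G (z j) \<le> (\<Sum>j\<in>J. G (z j))"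
        using assms that G_nonneg by (intro member_le_sum) auto
      then show "G (z j) \<le> s" using z by (simp add: orlicz_set_def)
    qed (use z that in \<open>simp add: orlicz_set_def\<close>)
    then show "z \<in> PiE J (\<lambda>_. {-R..R})"
      using z by (auto simp: orlicz_set_def space_PiM PiE_iff abs_le_iff minus_le_iff)
  qed
  then have "vol J s \<le> emeasure (PiM J (\<lambda>_. lborel)) (PiE J (\<lambda>_. {-R..R}))"
    unfolding vol_def using assms by (intro emeasure_mono sets_PiM_I_finite) auto
  also have "\<dots> = (\<Prod>j\<in>J. emeasure lborel {-R..R})" using assms by (subst emeasure_PiM) auto
  also have "\<dots> < \<infinity>" by (simp add: emeasure_lborel_Icc_eq ennreal_power)
  finally show ?thesis .
qed

text \<open>Prekopa-Leindler for three indicators: by convexity of \<open>D\<close> and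
  \<open>G\<close>, the midpoint of a point of level s and a point of level t has level (s + t) /
  2.\<close>

lemma vol_midpoint:
  assumes J: "finite J"
  shows "vol J s * vol J t \<le> (vol J ((s + t) / 2))\<^sup>2"
proof -
  note [measurable] = orlicz_set_measurable[OF J]
  have eq: "vol J r = (\<integral>\<^sup>+z. indicator (orlicz_set J r) z \<partial>PiM J (\<lambda>_. lborel))" for r
    using J by (simp add: vol_def)
  show ?thesis unfolding eq
  proof (rule prekopa_leindler_midpoint[OF J])
    fix x y :: "'a \<Rightarrow> real"
    assume xy: "x \<in> space (PiM J (\<lambda>_. lborel))" "y \<in> space (PiM J (\<lambda>_. lborel))"
    let ?m = "\<lambda>i\<in>J. (x i + y i) / 2"
    have "?m \<in> orlicz_set J ((s + t) / 2)" if x: "x \<in> orlicz_set J s" and y: "y \<in> orlicz_set J t"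
    proof -
      have D: "(x j + y j) / 2 \<in> D" if "j \<in> J" for j
        using convexD[OF convex_D, of "x j" "y j" "1/2" "1/2"] x y that
        by (simp add: orlicz_set_def field_simps)
      have G: "G ((x j + y j) / 2) \<le> (G (x j) + G (y j)) / 2" if "j \<in> J" for j
        using convex_onD[OF G_convex, of "1/2" "x j" "y j"] x y that
        by (simp add: orlicz_set_def field_simps)
      have "(\<Sum>j\<in>J. G ((x j + y j) / 2)) \<le> (\<Sum>j\<in>J. (G (x j) + G (y j)) / 2)"
        by (intro sum_mono G)
      also have "\<dots> = ((\<Sum>j\<in>J. G (x j)) + (\<Sum>j\<in>J. G (y j))) / 2"
        by (simp add: sum.distrib sum_divide_distrib[symmetric])
      also have "\<dots> \<le> (s + t) / 2" using x y by (simp add: orlicz_set_def)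
      finally show ?thesis using D by (simp add: orlicz_set_def space_PiM)
    qed
    then show "indicator (orlicz_set J s) x * indicator (orlicz_set J t) y
        \<le> (indicator (orlicz_set J ((s + t) / 2)) ?m :: ennreal)\<^sup>2"
      by (auto split: split_indicator)
  qed measurable
qed

lemma vol_four_points:
  assumes J: "finite J" and ord: "p \<le> u" "p \<le> v" "u + v = p + q"
  shows "vol J p * vol J q \<le> vol J u * vol J v"
proof -
  define f where "f t = enn2real (vol J t)" for t
  have f: "vol J t = ennreal (f t)" "0 \<le> f t" for t
    using vol_finite[OF J, of t] by (auto simp: f_def)
  have "f p * f q \<le> f u * f v"
  proof (rule midpoint_log_concave_four_points[of p f])
    show "mono_on {p..} f"
      unfolding f_def using vol_finite[OF J]
      by (intro mono_onI enn2real_mono vol_mono J) (simp_all add: infinity_ennreal_def)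
    fix s t show "f s * f t \<le> (f ((s + t) / 2))\<^sup>2"
      using vol_midpoint[OF J, of s t] f by (simp add: f(1) ennreal_mult[symmetric] ennreal_power)
  qed (use ord f in auto)
  then show ?thesis using f by (simp add: f(1) ennreal_mult[symmetric])
qed

lemma mass_one: "finite J \<Longrightarrow> mass J (\<lambda>_. 1) s = vol J s"
  by (simp add: mass_def vol_def)

lemma indicator_orlicz_set_insert:
  assumes J: "finite J" "i \<notin> J" and x: "x \<in> space (PiM J (\<lambda>_. lborel))"
  shows "(indicator (orlicz_set (insert i J) s) (x(i := y)) :: ennreal)
     = indicator D y * indicator (orlicz_set J (s - G y)) x"
proof -
  have "(\<Sum>j\<in>J. G ((x(i := y)) j)) = (\<Sum>j\<in>J. G (x j))"
    using J by (intro sum.cong) auto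
  moreover have "x(i := y) \<in> space (PiM (insert i J) (\<lambda>_. lborel))"
    using x by (auto simp: space_PiM PiE_fun_upd)
  moreover have "(\<forall>j\<in>J. (x(i := y)) j \<in> D) \<longleftrightarrow> (\<forall>j\<in>J. x j \<in> D)"
    using J by auto
  ultimately show ?thesis
    using J x by (auto simp: orlicz_set_def indicator_def simp del: fun_upd_apply) (auto simp: algebra_simps)
qed

text \<open>Fixing the coordinate i at y uses up \<open>G y\<close> of the level and leaves a set of
  the same kind in one dimension less. This self-similarity is what the induction on the coordinates
  lives on.\<close>

lemma mass_insert:
  fixes \<psi> :: "('i \<Rightarrow> real) \<Rightarrow> ennreal"
  assumes J: "finite J" "i \<notin> J"
    and [measurable]: "\<psi> \<in> borel_measurable (PiM (insert i J) (\<lambda>_. lborel))"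
  shows "mass (insert i J) \<psi> s = (\<integral>\<^sup>+y\<in>D. mass J (\<lambda>z. \<psi> (z(i := \<bar>y\<bar>))) (s - G y) \<partial>lborel)"
proof -
  interpret product_sigma_finite "\<lambda>_::'i. lborel :: real measure" ..
  note [measurable] = orlicz_set_measurable[OF finite.insertI[OF J(1)]] orlicz_set_measurable[OF J(1)]
  have "mass (insert i J) \<psi> s
      = (\<integral>\<^sup>+y. (\<integral>\<^sup>+x. \<psi> (\<lambda>j\<in>insert i J. \<bar>(x(i := y)) j\<bar>)
            * indicator (orlicz_set (insert i J) s) (x(i := y)) \<partial>PiM J (\<lambda>_. lborel)) \<partial>lborel)"
    unfolding mass_def
    by (rule product_nn_integral_insert_rev[OF J, of
        "\<lambda>z. \<psi> (\<lambda>j\<in>insert i J. \<bar>z j\<bar>) * indicator (orlicz_set (insert i J) s) z"]) measurable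
  also have "\<dots> = (\<integral>\<^sup>+y. (\<integral>\<^sup>+x. indicator D y * (\<psi> ((\<lambda>j\<in>J. \<bar>x j\<bar>)(i := \<bar>y\<bar>))
            * indicator (orlicz_set J (s - G y)) x) \<partial>PiM J (\<lambda>_. lborel)) \<partial>lborel)"
  proof (intro nn_integral_cong)
    fix y :: real and x :: "'i \<Rightarrow> real" assume x: "x \<in> space (PiM J (\<lambda>_. lborel))"
    have "(\<lambda>j\<in>insert i J. \<bar>(x(i := y)) j\<bar>) = (\<lambda>j\<in>J. \<bar>x j\<bar>)(i := \<bar>y\<bar>)"
      using J by (auto simp: fun_eq_iff)
    then show "\<psi> (\<lambda>j\<in>insert i J. \<bar>(x(i := y)) j\<bar>) * indicator (orlicz_set (insert i J) s) (x(i := y))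
        = indicator D y * (\<psi> ((\<lambda>j\<in>J. \<bar>x j\<bar>)(i := \<bar>y\<bar>)) * indicator (orlicz_set J (s - G y)) x)"
      by (simp only: indicator_orlicz_set_insert[OF J x] mult_ac)
  qed
  also have "\<dots> = (\<integral>\<^sup>+y\<in>D. mass J (\<lambda>z. \<psi> (z(i := \<bar>y\<bar>))) (s - G y) \<partial>lborel)"
    unfolding mass_def
    by (intro nn_integral_cong) (auto split: split_indicator)
  finally show ?thesis .
qed

lemma measurable_mass:
  fixes \<psi> :: "('i \<Rightarrow> real) \<Rightarrow> ennreal"
  assumes J: "finite J" "i \<notin> J"
    and [measurable]: "\<psi> \<in> borel_measurable (PiM (insert i J) (\<lambda>_. lborel))"
  shows "(\<lambda>y. mass J (\<lambda>z. \<psi> (z(i := \<bar>y\<bar>))) (s - G y)) \<in> borel_measurable borel"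
proof -
  interpret product_sigma_finite "\<lambda>_::'i. lborel :: real measure" ..
  interpret P: sigma_finite_measure "PiM J (\<lambda>_. lborel :: real measure)"
    by (rule sigma_finite) fact
  let ?h = "\<lambda>y x. \<psi> ((\<lambda>j\<in>J. \<bar>x j\<bar>)(i := \<bar>y\<bar>))
            * (indicator {z. \<forall>j\<in>J. z j \<in> D} x * indicator {r. r \<le> s} (G y + (\<Sum>j\<in>J. G (x j))))"
  have [measurable]: "{z \<in> space (PiM J (\<lambda>_. lborel)). (\<forall>j\<in>J. z j \<in> D)} \<in> sets (PiM J (\<lambda>_. lborel))"
    using J by (intro sets.sets_Collect_finite_All) measurable
  have [measurable]: "(\<lambda>x. indicator {z. \<forall>j\<in>J. z j \<in> D} x :: ennreal) \<in> borel_measurable (PiM J (\<lambda>_. lborel))"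
    by (subst measurable_cong[where g = "indicator {z \<in> space (PiM J (\<lambda>_. lborel)). (\<forall>j\<in>J. z j \<in> D)}"])
      (auto split: split_indicator)
  have [measurable]: "(\<lambda>p. (\<lambda>j\<in>J. \<bar>snd p j\<bar>)(i := \<bar>fst p\<bar>))
      \<in> measurable (lborel \<Otimes>\<^sub>M PiM J (\<lambda>_. lborel)) (PiM (insert i J) (\<lambda>_. lborel :: real measure))"
    by (rule measurable_fun_upd[where J = J]) measurable
  have "(\<lambda>p. ?h (fst p) (snd p)) \<in> borel_measurable (lborel \<Otimes>\<^sub>M PiM J (\<lambda>_. lborel))"
    by measurable
  then have "(\<lambda>y. \<integral>\<^sup>+x. ?h y x \<partial>PiM J (\<lambda>_. lborel)) \<in> borel_measurable lborel"
    by (intro P.borel_measurable_nn_integral) (simp add: split_beta')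
  moreover have "(\<integral>\<^sup>+x. ?h y x \<partial>PiM J (\<lambda>_. lborel)) = mass J (\<lambda>z. \<psi> (z(i := \<bar>y\<bar>))) (s - G y)" for y
    unfolding mass_def
    by (intro nn_integral_cong) (auto simp: orlicz_set_def algebra_simps split: split_indicator)
  ultimately show ?thesis by simp
qed

lemma vol_insert:
  assumes J: "finite J" "i \<notin> J"
  shows "vol (insert i J) s = (\<integral>\<^sup>+y\<in>D. vol J (s - G y) \<partial>lborel)"
  using mass_insert[OF J, of "\<lambda>_. 1" s] by (simp add: mass_one J)

lemma measurable_vol:
  fixes J :: "'i set"
  assumes J: "finite J" "i \<notin> J"
  shows "(\<lambda>y. vol J (s - G y)) \<in> borel_measurable borel"
  using measurable_mass[OF J, of "\<lambda>_. 1" s] by (simp add: mass_one J)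

text \<open>The length of a sublevel set of a convex function is a concave function of the level.\<close>

lemma sublevel_increment:
  assumes "0 \<le> c" "0 \<le> \<delta>"
  shows "emeasure lborel {y\<in>D. c + \<delta> < G y \<and> G y \<le> r + \<delta>} \<le> emeasure lborel {y\<in>D. c < G y \<and> G y \<le> r}"
proof (cases "c \<le> r")
  case False
  then have "{y\<in>D. c + \<delta> < G y \<and> G y \<le> r + \<delta>} = {}" by auto
  then show ?thesis by (simp only: emeasure_empty zero_le)
next
  case True
  define S where "S t = {y\<in>D. G y \<le> t}" for t
  have [measurable]: "S t \<in> sets borel" for t unfolding S_def by measurable
  have fin: "emeasure lborel (S t) < \<infinity>" for t
    using bounded_sublevel[of t] emeasure_bounded_finite unfolding S_def by blast
  define l where "l t = measure lborel (S t)" for t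
  have l: "emeasure lborel (S t) = ennreal (l t)" "0 \<le> l t" for t
    using fin[of t] by (simp_all add: l_def emeasure_eq_ennreal_measure)
  have l_mono: "l s \<le> l t" if "s \<le> t" for s t
  proof -
    have "emeasure lborel (S s) \<le> emeasure lborel (S t)"
      using that by (intro emeasure_mono) (auto simp: S_def)
    then show ?thesis using l by simp
  qed
  have mid: "l s + l t \<le> 2 * l ((s + t) / 2)" if "0 \<le> s" "0 \<le> t" for s t
  proof -
    have "emeasure lborel (S s) + emeasure lborel (S t) \<le> 2 * emeasure lborel (S ((s + t) / 2))"
    proof (rule brunn_minkowski_midpoint)
      show "S s \<noteq> {}" "S t \<noteq> {}" using that zero_D G_0 by (auto simp: S_def)
      fix a b assume "a \<in> S s" "b \<in> S t"
      then show "(a + b) / 2 \<in> S ((s + t) / 2)"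
        using convexD[OF convex_D, of a b "1/2" "1/2"] convex_onD[OF G_convex, of "1/2" a b]
        by (simp add: S_def field_simps)
    qed measurable
    then have "ennreal (l s + l t) \<le> ennreal (2 * l ((s + t) / 2))"
      using l by (simp add: ennreal_mult)
    then show ?thesis using l(2)[of "(s + t) / 2"] by (subst (asm) ennreal_le_iff) auto
  qed
  \<comment> \<open>The exponential turns midpoint concavity of the length \<open>l\<close> into
    midpoint log-concavity, so the four-point inequality for products yields the one for
    sums.\<close>
  have "exp (l c) * exp (l (r + \<delta>)) \<le> exp (l r) * exp (l (c + \<delta>))"
  proof (rule midpoint_log_concave_four_points[of 0 "\<lambda>t. exp (l t)"])
    show "mono_on {0..} (\<lambda>t. exp (l t))" using l_mono by (auto intro!: mono_onI)
    fix s t :: real assume "0 \<le> s" "0 \<le> t"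
    then show "exp (l s) * exp (l t) \<le> (exp (l ((s + t) / 2)))\<^sup>2"
      using mid[of s t] by (simp add: exp_add[symmetric] exp_double[symmetric])
  qed (use assms True in auto)
  then have inc: "l (r + \<delta>) - l (c + \<delta>) \<le> l r - l c" by (simp add: exp_add[symmetric])
  have diff: "emeasure lborel {y\<in>D. a < G y \<and> G y \<le> b} = ennreal (l b - l a)" if "a \<le> b" for a b
  proof -
    have "{y\<in>D. a < G y \<and> G y \<le> b} = S b - S a" by (auto simp: S_def)
    also have "emeasure lborel \<dots> = emeasure lborel (S b) - emeasure lborel (S a)"
      using that fin[of a] by (intro emeasure_Diff) (auto simp: S_def)
    finally show ?thesis using l by (simp add: ennreal_minus)
  qed
  show ?thesis using diff[of "c + \<delta>" "r + \<delta>"] diff[of c r] inc True by (simp add: ennreal_leI)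
qed

lemma orlicz_set_empty_of_neg: "s < 0 \<Longrightarrow> orlicz_set J s = {}"
  using sum_nonneg[of J "\<lambda>j. G (z j)" for z] G_nonneg by (auto simp: orlicz_set_def not_le intro: less_le_trans)

lemma mass_null:
  assumes "finite J" "vol J s = 0"
  shows "mass J \<psi> s = 0"
proof -
  have "orlicz_set J s \<in> null_sets (PiM J (\<lambda>_. lborel))"
    using assms orlicz_set_measurable[of J s] by (auto simp: vol_def null_sets_def)
  then have "AE z in PiM J (\<lambda>_. lborel). z \<notin> orlicz_set J s" by (rule AE_not_in)
  then have "mass J \<psi> s = (\<integral>\<^sup>+z. 0 \<partial>PiM J (\<lambda>_. lborel :: real measure))"
    unfolding mass_def by (intro nn_integral_cong_AE) (auto elim: eventually_mono)
  then show ?thesis by simp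
qed

text \<open>The law of \<open>\<bar>z i\<bar>\<close> for \<open>z\<close> uniform on \<open>orlicz_set (insert i J) s\<close>.\<close>

definition coord_dist :: "'i set \<Rightarrow> 'i \<Rightarrow> real \<Rightarrow> real measure" where
  "coord_dist J i s = distr (density lborel
     (\<lambda>y. indicator D y * vol J (s - G y) / vol (insert i J) s)) borel abs"

context
  fixes J :: "'i set" and i :: 'i
  assumes J: "finite J" "i \<notin> J"
begin

lemma nn_integral_coord_dist:
  assumes [measurable]: "h \<in> borel_measurable borel"
  shows "(\<integral>\<^sup>+y. h y \<partial>coord_dist J i s)
     = (\<integral>\<^sup>+y. indicator D y * vol J (s - G y) * h \<bar>y\<bar> \<partial>lborel) / vol (insert i J) s"
proof -
  note [measurable] = measurable_vol[OF J, of s]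
  have "(\<integral>\<^sup>+y. h y \<partial>coord_dist J i s)
     = (\<integral>\<^sup>+y. indicator D y * vol J (s - G y) / vol (insert i J) s * h \<bar>y\<bar> \<partial>lborel)"
    unfolding coord_dist_def by (simp add: nn_integral_distr nn_integral_density)
  also have "\<dots> = (\<integral>\<^sup>+y. indicator D y * vol J (s - G y) * h \<bar>y\<bar> / vol (insert i J) s \<partial>lborel)"
    by (intro nn_integral_cong) (simp add: divide_ennreal_def mult_ac)
  finally show ?thesis by (simp add: nn_integral_divide)
qed

lemma emeasure_coord_dist:
  assumes [measurable]: "A \<in> sets borel"
  shows "emeasure (coord_dist J i s) A
     = (\<integral>\<^sup>+y. indicator D y * vol J (s - G y) * indicator A \<bar>y\<bar> \<partial>lborel) / vol (insert i J) s"
  using nn_integral_coord_dist[of "indicator A" s] by (simp add: coord_dist_def)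

lemma real_distribution_coord_dist:
  assumes "vol (insert i J) s \<noteq> 0"
  shows "real_distribution (coord_dist J i s)"
proof -
  have "emeasure (coord_dist J i s) UNIV = vol (insert i J) s / vol (insert i J) s"
    by (simp add: emeasure_coord_dist vol_insert[OF J] mult.commute)
  also have "\<dots> = 1" using assms vol_finite[of "insert i J" s] J by (simp add: ennreal_divide_self)
  finally have "prob_space (coord_dist J i s)"
    by (intro prob_spaceI) (simp add: coord_dist_def)
  then show ?thesis
    by (simp add: real_distribution_def real_distribution_axioms_def coord_dist_def)
qed

text \<open>The likelihood ratio \<open>vol J (t - G y) / vol J (s - G y)\<close> is nondecreasing in \<open>\<bar>y\<bar>\<close> because
  \<open>vol J\<close> is log-concave.\<close>

lemma coord_dist_tail_mono:
  assumes st: "s \<le> t" and nz: "vol (insert i J) s \<noteq> 0"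
  shows "emeasure (coord_dist J i s) {x<..} \<le> emeasure (coord_dist J i t) {x<..}"
proof -
  have J': "finite (insert i J)" using J by simp
  let ?a = "\<lambda>s y. indicator D y * vol J (s - G y)"
  have [measurable]: "?a s \<in> borel_measurable borel" for s
    using measurable_vol[OF J, of s] by measurable
  have cross: "(\<integral>\<^sup>+w\<in>{w. x < \<bar>w\<bar>}. ?a s w \<partial>lborel) * (\<integral>\<^sup>+y. ?a t y \<partial>lborel)
      \<le> (\<integral>\<^sup>+w\<in>{w. x < \<bar>w\<bar>}. ?a t w \<partial>lborel) * (\<integral>\<^sup>+y. ?a s y \<partial>lborel)"
  proof (rule nn_integral_cross_le)
    fix w y assume wy: "w \<in> {w. x < \<bar>w\<bar>}" "y \<notin> {w. x < \<bar>w\<bar>}"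
    show "?a s w * ?a t y \<le> ?a t w * ?a s y"
    proof (cases "w \<in> D")
      case True
      then have "y \<in> D" "G y \<le> G w" using D_down[of w y] G_mono[of w y] wy by auto
      moreover have "vol J (s - G w) * vol J (t - G y) \<le> vol J (t - G w) * vol J (s - G y)"
        using st \<open>G y \<le> G w\<close> by (intro vol_four_points J) auto
      ultimately show ?thesis using True by simp
    qed simp
  qed measurable
  have total: "(\<integral>\<^sup>+y. ?a s y \<partial>lborel) = vol (insert i J) s" for s
    unfolding vol_insert[OF J] by (intro nn_integral_cong) (rule mult.commute)
  have tail: "(\<integral>\<^sup>+w\<in>{w. x < \<bar>w\<bar>}. ?a s w \<partial>lborel)
      = (\<integral>\<^sup>+y. ?a s y * indicator {x<..} \<bar>y\<bar> \<partial>lborel)" for s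
    by (intro nn_integral_cong) (auto split: split_indicator)
  note le = cross[unfolded total tail]
  have "vol (insert i J) t \<noteq> 0" using nz vol_mono[OF J' st] by auto
  then show ?thesis
    unfolding emeasure_coord_dist[OF borel_open[OF open_greaterThan]]
    using le nz vol_finite[OF J', of s] vol_finite[OF J', of t]
    by (intro ennreal_divide_le_divideI) auto
qed

text \<open>Given \<open>z\<close>, the length of \<open>{y. c + \<delta> < G y \<le> s + \<delta> - (\<Sum>j\<in>J. G (z j))}\<close> decreases with \<open>\<delta>\<close>.\<close>

lemma coord_dist_level_antimono:
  assumes d: "0 \<le> \<delta>" and c: "0 \<le> c" and nz: "vol (insert i J) s \<noteq> 0"
  shows "emeasure (coord_dist J i (s + \<delta>)) {y\<in>D. c + \<delta> < G y} \<le> emeasure (coord_dist J i s) {y\<in>D. c < G y}"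
proof -
  have J': "finite (insert i J)" using J by simp
  interpret product_sigma_finite "\<lambda>_::'i. lborel :: real measure" ..
  interpret P: sigma_finite_measure "PiM J (\<lambda>_. lborel :: real measure)"
    by (rule sigma_finite) (rule J)
  interpret Q: pair_sigma_finite "lborel :: real measure" "PiM J (\<lambda>_. lborel :: real measure)" ..
  define E where "E = {z \<in> space (PiM J (\<lambda>_. lborel)). \<forall>j\<in>J. z j \<in> D}"
  have [measurable]: "E \<in> sets (PiM J (\<lambda>_. lborel))"
    unfolding E_def using J by (intro sets.sets_Collect_finite_All) measurable
  define u where "u z = (\<Sum>j\<in>J. G (z j))" for z :: "'i \<Rightarrow> real"
  have [measurable]: "u \<in> borel_measurable (PiM J (\<lambda>_. lborel))" unfolding u_def by measurable
  \<comment> \<open>Tonelli with the coordinate i innermost: for fixed z the inner integral is the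
    length of a difference of sublevel sets of \<open>G\<close>, to which
    \<open>sublevel_increment\<close> applies.\<close>
  have eq: "(\<integral>\<^sup>+y. indicator D y * vol J (s - G y) * indicator {y\<in>D. c < G y} \<bar>y\<bar> \<partial>lborel)
     = (\<integral>\<^sup>+z\<in>E. emeasure lborel {y\<in>D. c < G y \<and> G y \<le> s - u z} \<partial>PiM J (\<lambda>_. lborel))" for c s
  proof -
    have "(\<integral>\<^sup>+y. indicator D y * vol J (s - G y) * indicator {y\<in>D. c < G y} \<bar>y\<bar> \<partial>lborel)
       = (\<integral>\<^sup>+y. (\<integral>\<^sup>+z. indicator E z * indicator {y\<in>D. c < G y} y * indicator {x. x \<le> s} (G y + u z)
            \<partial>PiM J (\<lambda>_. lborel)) \<partial>lborel)"
    proof (intro nn_integral_cong)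
      fix y :: real
      have [measurable]: "orlicz_set J (s - G y) \<in> sets (PiM J (\<lambda>_. lborel))"
        by (rule orlicz_set_measurable) (rule J)
      have "indicator D y * vol J (s - G y) * indicator {y\<in>D. c < G y} \<bar>y\<bar>
          = indicator {y\<in>D. c < G y} y * vol J (s - G y)"
        by (auto simp: abs_D G_abs split: split_indicator)
      also have "\<dots> = (\<integral>\<^sup>+z. indicator {y\<in>D. c < G y} y * indicator (orlicz_set J (s - G y)) z \<partial>PiM J (\<lambda>_. lborel))"
        unfolding vol_def by (rule nn_integral_cmult_indicator[symmetric]) measurable
      also have "\<dots> = (\<integral>\<^sup>+z. indicator E z * indicator {y\<in>D. c < G y} y * indicator {x. x \<le> s} (G y + u z)
            \<partial>PiM J (\<lambda>_. lborel))"
        by (intro nn_integral_cong) (auto simp: orlicz_set_def E_def u_def algebra_simps split: split_indicator)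
      finally show "indicator D y * vol J (s - G y) * indicator {y\<in>D. c < G y} \<bar>y\<bar> = \<dots>" .
    qed
    also have "\<dots> = (\<integral>\<^sup>+z. (\<integral>\<^sup>+y. indicator E z * indicator {y\<in>D. c < G y} y * indicator {x. x \<le> s} (G y + u z)
            \<partial>lborel) \<partial>PiM J (\<lambda>_. lborel))"
      by (rule Q.Fubini'[symmetric]) measurable
    also have "\<dots> = (\<integral>\<^sup>+z\<in>E. emeasure lborel {y\<in>D. c < G y \<and> G y \<le> s - u z} \<partial>PiM J (\<lambda>_. lborel))"
    proof (intro nn_integral_cong)
      fix z :: "'i \<Rightarrow> real"
      have "(\<integral>\<^sup>+y. indicator E z * indicator {y\<in>D. c < G y} y * indicator {x. x \<le> s} (G y + u z) \<partial>lborel)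
         = (\<integral>\<^sup>+y. indicator E z * indicator {y\<in>D. c < G y \<and> G y \<le> s - u z} y \<partial>lborel)"
        by (intro nn_integral_cong) (auto simp: algebra_simps split: split_indicator)
      also have "\<dots> = indicator E z * emeasure lborel {y\<in>D. c < G y \<and> G y \<le> s - u z}"
        by (rule nn_integral_cmult_indicator) measurable
      finally show "(\<integral>\<^sup>+y. indicator E z * indicator {y\<in>D. c < G y} y * indicator {x. x \<le> s} (G y + u z) \<partial>lborel)
         = emeasure lborel {y\<in>D. c < G y \<and> G y \<le> s - u z} * indicator E z" by (simp only: mult.commute)
    qed
    finally show ?thesis .
  qed
  have "emeasure lborel {y\<in>D. c + \<delta> < G y \<and> G y \<le> s + \<delta> - u z}
      \<le> emeasure lborel {y\<in>D. c < G y \<and> G y \<le> s - u z}" for z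
    using sublevel_increment[OF c d, of "s - u z"] by (simp add: algebra_simps)
  then have "(\<integral>\<^sup>+z\<in>E. emeasure lborel {y\<in>D. c + \<delta> < G y \<and> G y \<le> s + \<delta> - u z} \<partial>PiM J (\<lambda>_. lborel))
      \<le> (\<integral>\<^sup>+z\<in>E. emeasure lborel {y\<in>D. c < G y \<and> G y \<le> s - u z} \<partial>PiM J (\<lambda>_. lborel))"
    by (intro nn_integral_mono mult_right_mono) auto
  \<comment> \<open>Raising the level also enlarges the normalizing volume, which acts in the same
    direction.\<close>
  moreover have "vol (insert i J) s \<le> vol (insert i J) (s + \<delta>)" using vol_mono[OF J', of s "s + \<delta>"] d by simp
  moreover have "{y\<in>D. c + \<delta> < G y} \<in> sets borel" "{y\<in>D. c < G y} \<in> sets borel" by measurable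
  moreover have "vol (insert i J) (s + \<delta>) \<noteq> 0" using nz calculation(2) by auto
  ultimately show ?thesis
    using nz vol_finite[OF J', of s] vol_finite[OF J', of "s + \<delta>"]
    by (simp only: emeasure_coord_dist eq) (intro ennreal_divide_le_divideI mult_mono; simp)
qed

text \<open>Both laws are realized by their quantile functions on the unit interval.\<close>

lemma coord_dist_coupling:
  assumes st: "s \<le> t" and nz: "vol (insert i J) s \<noteq> 0"
  obtains Q Q' :: "real \<Rightarrow> real" and N :: "real measure" where
    "Q \<in> borel_measurable N" "Q' \<in> borel_measurable N"
    "coord_dist J i s = distr N borel Q" "coord_dist J i t = distr N borel Q'"
    "AE \<omega> in N. 0 \<le> Q \<omega> \<and> Q \<omega> \<in> D \<and> Q' \<omega> \<in> D \<and> Q \<omega> \<le> Q' \<omega> \<and> G (Q' \<omega>) \<le> G (Q \<omega>) + (t - s)"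
proof -
  have J': "finite (insert i J)" using J by simp
  have nz': "vol (insert i J) t \<noteq> 0" using nz vol_mono[OF J' st] by auto
  interpret P: real_distribution "coord_dist J i s" by (rule real_distribution_coord_dist[OF nz])
  interpret P': real_distribution "coord_dist J i t" by (rule real_distribution_coord_dist[OF nz'])
  interpret C: cdf_distribution "coord_dist J i s" ..
  interpret C': cdf_distribution "coord_dist J i t" ..
  define N where "N = restrict_space lborel {0<..<1::real}"
  have [measurable]: "C.I \<in> borel_measurable N" "C'.I \<in> borel_measurable N"
    using C.measurable_CI C'.measurable_CI by (simp_all add: N_def measurable_def space_restrict_space sets_restrict_space cong: measurable_cong_sets)
  have dist: "coord_dist J i s = distr N borel C.I" "coord_dist J i t = distr N borel C'.I"
    using C.distr_I_eq_M C'.distr_I_eq_M by (simp_all add: N_def)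
  have AE_D: "AE y in coord_dist J i r. 0 \<le> y \<and> y \<in> D" if "vol (insert i J) r \<noteq> 0" for r
  proof (rule AE_I')
    show "- {y. 0 \<le> y \<and> y \<in> D} \<in> null_sets (coord_dist J i r)"
    proof
      show "- {y. 0 \<le> y \<and> y \<in> D} \<in> sets (coord_dist J i r)"
        by (auto simp: coord_dist_def)
      have "(\<integral>\<^sup>+y. indicator D y * vol J (r - G y) * indicator (- {y. 0 \<le> y \<and> y \<in> D}) \<bar>y\<bar> \<partial>lborel)
          = (\<integral>\<^sup>+(y::real). 0 \<partial>lborel)"
        by (intro nn_integral_cong) (auto simp: abs_D split: split_indicator)
      moreover have "- {y. 0 \<le> y \<and> y \<in> D} \<in> sets borel" by measurable
      ultimately show "emeasure (coord_dist J i r) (- {y. 0 \<le> y \<and> y \<in> D}) = 0"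
        by (simp add: emeasure_coord_dist)
    qed
  qed auto
  have AE: "AE \<omega> in N. 0 \<le> C.I \<omega> \<and> C.I \<omega> \<in> D" "AE \<omega> in N. 0 \<le> C'.I \<omega> \<and> C'.I \<omega> \<in> D"
  proof -
    have "AE y in distr N borel C.I. 0 \<le> y \<and> y \<in> D" by (subst dist(1)[symmetric]) (rule AE_D[OF nz])
    then show "AE \<omega> in N. 0 \<le> C.I \<omega> \<and> C.I \<omega> \<in> D" by (rule AE_distrD[rotated]) measurable
    have "AE y in distr N borel C'.I. 0 \<le> y \<and> y \<in> D" by (subst dist(2)[symmetric]) (rule AE_D[OF nz'])
    then show "AE \<omega> in N. 0 \<le> C'.I \<omega> \<and> C'.I \<omega> \<in> D" by (rule AE_distrD[rotated]) measurable
  qed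
  have cdf_le: "C'.C x \<le> C.C x" for x
  proof -
    have "measure (coord_dist J i s) (space (coord_dist J i s) - {..x})
        \<le> measure (coord_dist J i t) (space (coord_dist J i t) - {..x})"
      using coord_dist_tail_mono[OF st nz, of x]
      by (simp add: Compl_eq_Diff_UNIV[symmetric] P.emeasure_eq_measure P'.emeasure_eq_measure)
    then show ?thesis
      using P.prob_compl[of "{..x}"] P'.prob_compl[of "{..x}"] by (simp add: cdf_def)
  qed
  have key: "C.I \<omega> \<le> C'.I \<omega> \<and> G (C'.I \<omega>) \<le> G (C.I \<omega>) + (t - s)"
    if w: "\<omega> \<in> {0<..<1}" and y0: "0 \<le> C.I \<omega>" "C.I \<omega> \<in> D" and x0: "0 \<le> C'.I \<omega>" "C'.I \<omega> \<in> D" for \<omega>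
  proof
    define y x where "y = C.I \<omega>" and "x = C'.I \<omega>"
    have inv: "\<omega> \<le> C.C v \<longleftrightarrow> y \<le> v" "\<omega> \<le> C'.C v \<longleftrightarrow> x \<le> v" for v
      using C.pseudoinverse[of \<omega> v] C'.pseudoinverse[of \<omega> v] w by (auto simp: x_def y_def)
    have "\<omega> \<le> C'.C x" by (simp add: inv)
    then have "\<omega> \<le> C.C x" using cdf_le[of x] by simp
    then have "y \<le> x" by (rule inv(1)[THEN iffD1])
    then show "C.I \<omega> \<le> C'.I \<omega>" unfolding x_def y_def .
    \<comment> \<open>If \<open>G x\<close> were too large, continuity of \<open>G\<close> at x
      would keep the whole of \<open>T\<close> below some v < x. The comparison of levels then gives
      \<omega> \<le> \<open>C'.C v\<close>, although x is the smallest point with this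
      property.\<close>
    define T where "T = {v\<in>D. 0 \<le> v \<and> G v \<le> G y + (t - s)}"
    have "G x \<le> G y + (t - s)"
    proof (rule ccontr)
      assume neg: "\<not> G x \<le> G y + (t - s)"
      have xT: "v < x" if "v \<in> T" for v
      proof (rule ccontr)
        assume "\<not> v < x"
        then have "G x \<le> G v" using that x0 by (intro G_mono) (auto simp: T_def x_def)
        then show False using neg that by (simp add: T_def)
      qed
      have "isCont G x"
        using convex_on_continuous[OF open_D G_convex] x0 open_D
        by (simp add: continuous_on_eq_continuous_at x_def)
      then obtain e where e: "e > 0" "\<And>v. \<bar>v - x\<bar> < e \<Longrightarrow> \<bar>G v - G x\<bar> < G x - (G y + (t - s))"
        using neg unfolding isCont_def LIM_eq by (metis (no_types, opaque_lifting) diff_gt_0_iff_gt not_le real_norm_def diff_self abs_zero)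
      define v where "v = x - e / 2"
      have vT: "T \<subseteq> {..v}"
      proof
        fix b assume b: "b \<in> T"
        show "b \<in> {..v}"
        proof (rule ccontr)
          assume "b \<notin> {..v}"
          then have "\<bar>b - x\<bar> < e" using xT[OF b] e(1) by (auto simp: v_def)
          moreover have "G b \<le> G y + (t - s)" using b by (simp add: T_def)
          ultimately show False using e(2)[of b] by linarith
        qed
      qed
      let ?A = "\<lambda>c. {w\<in>D. c < G w}"
      have [measurable]: "?A c \<in> sets borel" for c by measurable
      have "\<omega> \<le> C.C y" by (simp add: inv)
      also have "\<dots> \<le> measure (coord_dist J i s) (space (coord_dist J i s) - ?A (G y))"
        unfolding cdf_def
      proof (rule P.finite_measure_mono_AE)
        show "AE w in coord_dist J i s. w \<in> {..y} \<longrightarrow> w \<in> space (coord_dist J i s) - ?A (G y)"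
          using AE_D[OF nz]
        proof eventually_elim
          case (elim w)
          then show ?case using G_mono[of y w] y0 by (auto simp: y_def not_less)
        qed
      qed simp
      also have "\<dots> = 1 - measure (coord_dist J i s) (?A (G y))" by (rule P.prob_compl) simp
      also have "\<dots> \<le> 1 - measure (coord_dist J i t) (?A (G y + (t - s)))"
        using coord_dist_level_antimono[of "t - s" "G y" s] st nz G_nonneg
        by (simp add: P.emeasure_eq_measure P'.emeasure_eq_measure)
      also have "\<dots> = measure (coord_dist J i t) (space (coord_dist J i t) - ?A (G y + (t - s)))"
        by (rule P'.prob_compl[symmetric]) simp
      also have "\<dots> \<le> C'.C v"
        unfolding cdf_def
      proof (rule P'.finite_measure_mono_AE)
        show "AE w in coord_dist J i t. w \<in> space (coord_dist J i t) - ?A (G y + (t - s)) \<longrightarrow> w \<in> {..v}"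
          using AE_D[OF nz']
        proof eventually_elim
          case (elim w)
          then show ?case using vT by (auto simp: T_def not_less)
        qed
      qed simp
      finally have "x \<le> v" by (simp add: inv)
      then show False using e(1) by (simp add: v_def)
    qed
    then show "G (C'.I \<omega>) \<le> G (C.I \<omega>) + (t - s)" by (simp add: x_def y_def)
  qed
  have "AE \<omega> in N. \<omega> \<in> {0<..<1}" by (intro AE_I2) (simp add: N_def space_restrict_space)
  then have AE_all: "AE \<omega> in N. 0 \<le> C.I \<omega> \<and> C.I \<omega> \<in> D \<and> C'.I \<omega> \<in> D \<and> C.I \<omega> \<le> C'.I \<omega> \<and> G (C'.I \<omega>) \<le> G (C.I \<omega>) + (t - s)"
    using AE
  proof eventually_elim
    case (elim \<omega>)
    then show ?case using key[of \<omega>] by blast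
  qed
  show ?thesis by (rule that[of C.I N C'.I, OF _ _ dist AE_all]) measurable
qed

end

section \<open>Stochastic monotonicity in the level and negative dependence\<close>

lemma mass_mono:
  assumes "\<And>z. z \<in> space (PiM J (\<lambda>_. lborel)) \<Longrightarrow> \<psi> (\<lambda>j\<in>J. \<bar>z j\<bar>) \<le> \<psi>' (\<lambda>j\<in>J. \<bar>z j\<bar>)"
  shows "mass J \<psi> s \<le> mass J \<psi>' s"
  unfolding mass_def using assms by (intro nn_integral_mono mult_right_mono) auto

text \<open>The uniform law on \<open>orlicz_set J s\<close> increases stochastically with \<open>s\<close>. In the induction step the
  coupling of the new coordinate raises it by at most \<open>t - s\<close> in terms of \<open>G\<close>, so that the level left
  for the other coordinates increases as well.\<close>

theorem mass_ratio_mono: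
  fixes \<psi> :: "('i \<Rightarrow> real) \<Rightarrow> ennreal"
  assumes "finite J" "\<psi> \<in> borel_measurable (PiM J (\<lambda>_. lborel))"
    and "\<And>x y. x \<in> PiE J (\<lambda>_. {0..}) \<Longrightarrow> y \<in> PiE J (\<lambda>_. {0..}) \<Longrightarrow> (\<And>j. j \<in> J \<Longrightarrow> x j \<le> y j) \<Longrightarrow> \<psi> x \<le> \<psi> y"
    and "s \<le> t"
  shows "mass J \<psi> s * vol J t \<le> mass J \<psi> t * vol J s"
  using assms
proof (induction J arbitrary: \<psi> s t rule: finite_induct)
  case empty
  interpret product_sigma_finite "\<lambda>_::'i. lborel :: real measure" ..
  have "vol ({} :: 'i set) r = indicator {0..} r" for r
  proof -
    have "(orlicz_set {} r :: ('i \<Rightarrow> real) set) = (if 0 \<le> r then {\<lambda>_. undefined} else {})"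
      by (auto simp: orlicz_set_def space_PiM)
    then show ?thesis by (simp add: vol_def)
  qed
  moreover have "mass {} \<psi> r = \<psi> (\<lambda>_. undefined) * indicator {0..} r" for r
    unfolding mass_def
    by (subst nn_integral_empty) (auto simp: orlicz_set_def space_PiM restrict_def split: split_indicator)
  ultimately show ?case using empty.prems(3) by (auto split: split_indicator)
next
  case (insert i J)
  have J: "finite J" "i \<notin> J" and J': "finite (insert i J)" using insert.hyps by auto
  show ?case
  proof (cases "vol (insert i J) s = 0")
    case True
    then show ?thesis by (simp add: mass_null[OF J'])
  next
    case nz: False
    then have nz': "vol (insert i J) t \<noteq> 0" using vol_mono[OF J' insert.prems(3)] by auto
    \<comment> \<open>The conditional mean of \<psi> at level r, given that the coordinate i has
      absolute value |y|. Where the volume vanishes the mass vanishes as well, and the quotient 0 /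
      0 is 0 in \<open>ennreal\<close>.\<close>
    define h where "h r y = mass J (\<lambda>z. \<psi> (z(i := \<bar>y\<bar>))) (r - G y) / vol J (r - G y)" for r y
    have [measurable]: "h r \<in> borel_measurable borel" for r
      unfolding h_def using measurable_mass[OF J insert.prems(1)] measurable_vol[OF J] by measurable
    have h: "(\<integral>\<^sup>+y. h r y \<partial>coord_dist J i r) = mass (insert i J) \<psi> r / vol (insert i J) r" for r
    proof -
      have "indicator D y * vol J (r - G y) * h r \<bar>y\<bar>
          = mass J (\<lambda>z. \<psi> (z(i := \<bar>y\<bar>))) (r - G y) * indicator D y" for y
      proof (cases "vol J (r - G y) = 0")
        case True then show ?thesis by (simp add: mass_null[OF J(1)])
      next
        case False
        have "vol J (r - G y) * (m / vol J (r - G y)) = m" for m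
          using False vol_finite[OF J(1), of "r - G y"]
          by (simp add: ennreal_times_divide mult.commute[of _ m] ennreal_mult_divide_eq less_top)
        then show ?thesis by (simp add: h_def G_abs mult.assoc mult.commute)
      qed
      then have "(\<integral>\<^sup>+y. indicator D y * vol J (r - G y) * h r \<bar>y\<bar> \<partial>lborel) = mass (insert i J) \<psi> r"
        by (simp only: mass_insert[OF J insert.prems(1)])
      moreover have "(\<integral>\<^sup>+y. h r y \<partial>coord_dist J i r)
          = (\<integral>\<^sup>+y. indicator D y * vol J (r - G y) * h r \<bar>y\<bar> \<partial>lborel) / vol (insert i J) r"
        by (rule nn_integral_coord_dist[OF J]) measurable
      ultimately show ?thesis by (simp only:)
    qed
    obtain Q Q' and N :: "real measure" where
      Q: "Q \<in> borel_measurable N" "Q' \<in> borel_measurable N"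
        "coord_dist J i s = distr N borel Q" "coord_dist J i t = distr N borel Q'"
        "AE \<omega> in N. 0 \<le> Q \<omega> \<and> Q \<omega> \<in> D \<and> Q' \<omega> \<in> D \<and> Q \<omega> \<le> Q' \<omega> \<and> G (Q' \<omega>) \<le> G (Q \<omega>) + (t - s)"
      by (rule coord_dist_coupling[OF J insert.prems(3) nz])
    have h_le: "h s y \<le> h t y'" if y: "0 \<le> y" "y \<le> y'" "G y' \<le> G y + (t - s)" for y y'
    proof -
      let ?r = "s - G y" and ?r' = "t - G y'"
      have le: "?r \<le> ?r'" using y by simp
      have upd: "x(i := v) \<in> PiE (insert i J) (\<lambda>_. {0..})" if "x \<in> PiE J (\<lambda>_. {0..})" "0 \<le> v" for x v
        using that by (auto simp: PiE_fun_upd)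
      \<comment> \<open>Two moves lead from \<open>h s y\<close> to \<open>h t y'\<close>: the fixed
        coordinate is raised inside \<psi>, which is monotone, and then the level of the other
        coordinates is raised by the induction hypothesis.\<close>
      have "mass J (\<lambda>z. \<psi> (z(i := \<bar>y\<bar>))) ?r \<le> mass J (\<lambda>z. \<psi> (z(i := \<bar>y'\<bar>))) ?r"
      proof (rule mass_mono)
        fix z :: "'i \<Rightarrow> real"
        have "(\<lambda>j\<in>J. \<bar>z j\<bar>) \<in> PiE J (\<lambda>_. {0..})" by auto
        then show "\<psi> ((\<lambda>j\<in>J. \<bar>z j\<bar>)(i := \<bar>y\<bar>)) \<le> \<psi> ((\<lambda>j\<in>J. \<bar>z j\<bar>)(i := \<bar>y'\<bar>))"
          using y by (intro insert.prems(2) upd) auto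
      qed
      then have "h s y \<le> mass J (\<lambda>z. \<psi> (z(i := \<bar>y'\<bar>))) ?r / vol J ?r"
        unfolding h_def by (rule divide_right_mono_ennreal)
      also have "\<dots> \<le> h t y'"
      proof (cases "vol J ?r = 0")
        case True then show ?thesis by (simp add: mass_null[OF J(1)])
      next
        case False
        then have "vol J ?r' \<noteq> 0" using vol_mono[OF J(1) le] by auto
        moreover have "mass J (\<lambda>z. \<psi> (z(i := \<bar>y'\<bar>))) ?r * vol J ?r' \<le> mass J (\<lambda>z. \<psi> (z(i := \<bar>y'\<bar>))) ?r' * vol J ?r"
        proof (rule insert.IH)
          show "(\<lambda>z. \<psi> (z(i := \<bar>y'\<bar>))) \<in> borel_measurable (PiM J (\<lambda>_. lborel))"
            by (rule measurable_compose[OF _ insert.prems(1)], rule measurable_fun_upd[where J = J]) auto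
          fix x z :: "'i \<Rightarrow> real"
          assume xz: "x \<in> PiE J (\<lambda>_. {0..})" "z \<in> PiE J (\<lambda>_. {0..})" "\<And>j. j \<in> J \<Longrightarrow> x j \<le> z j"
          show "\<psi> (x(i := \<bar>y'\<bar>)) \<le> \<psi> (z(i := \<bar>y'\<bar>))"
            by (intro insert.prems(2) upd xz(1,2)) (use xz(3) in auto)
        qed (rule le)
        ultimately show ?thesis unfolding h_def
          using False vol_finite[OF J(1)] by (intro ennreal_divide_le_divideI) auto
      qed
      finally show ?thesis .
    qed
    have "AE \<omega> in N. h s (Q \<omega>) \<le> h t (Q' \<omega>)"
      using Q(5)
    proof eventually_elim
      case (elim \<omega>)
      then show ?case using h_le by blast
    qed
    then have "(\<integral>\<^sup>+\<omega>. h s (Q \<omega>) \<partial>N) \<le> (\<integral>\<^sup>+\<omega>. h t (Q' \<omega>) \<partial>N)" by (rule nn_integral_mono_AE)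
    then have "(\<integral>\<^sup>+y. h s y \<partial>coord_dist J i s) \<le> (\<integral>\<^sup>+y. h t y \<partial>coord_dist J i t)"
      unfolding Q(3,4) using Q(1,2) by (simp add: nn_integral_distr)
    then have "mass (insert i J) \<psi> s / vol (insert i J) s \<le> mass (insert i J) \<psi> t / vol (insert i J) t"
      unfolding h .
    then show ?thesis
      using nz nz' vol_finite[OF J'] by (intro ennreal_divide_le_divideD) auto
  qed
qed

text \<open>If |y| \<le> x < |w|, then the slice at y has level \<open>s - G y\<close>, at least as
  high as the slice at w. By \<open>mass_ratio_mono\<close> the mean of \<psi> over the slice at y
  is then at least the mean over the slice at w. Thus \<psi> has a smaller mean on the tail event,
  and \<open>nn_integral_cross_le\<close> integrates this comparison.\<close>

theorem orlicz_negative_dependence: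
  fixes \<psi> :: "('i \<Rightarrow> real) \<Rightarrow> ennreal"
  assumes J: "finite J" "i \<notin> J"
    and \<psi>: "\<psi> \<in> borel_measurable (PiM J (\<lambda>_. lborel))"
    and \<psi>_mono: "\<And>x y. x \<in> PiE J (\<lambda>_. {0..}) \<Longrightarrow> y \<in> PiE J (\<lambda>_. {0..}) \<Longrightarrow> (\<And>j. j \<in> J \<Longrightarrow> x j \<le> y j) \<Longrightarrow> \<psi> x \<le> \<psi> y"
  shows "mass (insert i J) (\<lambda>z. indicator {x<..} (z i) * \<psi> (restrict z J)) s * vol (insert i J) s
     \<le> mass (insert i J) (\<lambda>z. indicator {x<..} (z i)) s * mass (insert i J) (\<lambda>z. \<psi> (restrict z J)) s"
proof -
  have \<psi>': "(\<lambda>z. \<psi> (restrict z J)) \<in> borel_measurable (PiM (insert i J) (\<lambda>_. lborel))"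
    by (rule measurable_compose[OF measurable_restrict_subset \<psi>]) auto
  have ind: "(\<lambda>z. indicator {x<..} (z i) :: ennreal) \<in> borel_measurable (PiM (insert i J) (\<lambda>_. lborel :: real measure))"
    by measurable
  have restr: "restrict ((\<lambda>j\<in>J. \<bar>z j\<bar>)(i := v)) J = (\<lambda>j\<in>J. \<bar>z j\<bar>)" for z :: "'i \<Rightarrow> real" and v
    using J by (auto simp: fun_eq_iff)
  have m: "mass J (\<lambda>z. c * \<psi> (restrict (z(i := \<bar>y\<bar>)) J)) r = c * mass J \<psi> r" for c y r
  proof -
    note [measurable] = \<psi> orlicz_set_measurable[OF J(1), of r]
    have "mass J (\<lambda>z. c * \<psi> (restrict (z(i := \<bar>y\<bar>)) J)) r
        = (\<integral>\<^sup>+z. c * (\<psi> (\<lambda>j\<in>J. \<bar>z j\<bar>) * indicator (orlicz_set J r) z) \<partial>PiM J (\<lambda>_. lborel))"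
      unfolding mass_def restr by (simp only: mult.assoc)
    also have "\<dots> = c * mass J \<psi> r"
      unfolding mass_def by (rule nn_integral_cmult) measurable
    finally show ?thesis .
  qed
  let ?a = "\<lambda>y. mass J \<psi> (s - G y) * indicator D y" and ?b = "\<lambda>y. vol J (s - G y) * indicator D y"
  have [measurable]: "?a \<in> borel_measurable borel" "?b \<in> borel_measurable borel"
    using measurable_mass[OF J \<psi>', of s] m[of 1] measurable_vol[OF J, of s] by simp_all
  have cross: "(\<integral>\<^sup>+w\<in>{w. x < \<bar>w\<bar>}. ?a w \<partial>lborel) * (\<integral>\<^sup>+y. ?b y \<partial>lborel)
      \<le> (\<integral>\<^sup>+w\<in>{w. x < \<bar>w\<bar>}. ?b w \<partial>lborel) * (\<integral>\<^sup>+y. ?a y \<partial>lborel)"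
  proof (rule nn_integral_cross_le)
    fix w y assume wy: "w \<in> {w. x < \<bar>w\<bar>}" "y \<notin> {w. x < \<bar>w\<bar>}"
    show "?a w * ?b y \<le> ?b w * ?a y"
    proof (cases "w \<in> D")
      case True
      then have "y \<in> D" "G y \<le> G w" using D_down[of w y] G_mono[of w y] wy by auto
      moreover have "mass J \<psi> (s - G w) * vol J (s - G y) \<le> mass J \<psi> (s - G y) * vol J (s - G w)"
        using \<open>G y \<le> G w\<close> by (intro mass_ratio_mono J \<psi> \<psi>_mono) auto
      ultimately show ?thesis using True by (simp add: mult.commute)
    qed simp
  qed measurable
  have 1: "mass (insert i J) (\<lambda>z. indicator {x<..} (z i) * \<psi> (restrict z J)) s
      = (\<integral>\<^sup>+w\<in>{w. x < \<bar>w\<bar>}. ?a w \<partial>lborel)"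
    unfolding mass_insert[OF J borel_measurable_times_ennreal[OF ind \<psi>']] fun_upd_same m
    by (intro nn_integral_cong) (auto split: split_indicator)
  have 2: "mass (insert i J) (\<lambda>z. indicator {x<..} (z i)) s = (\<integral>\<^sup>+w\<in>{w. x < \<bar>w\<bar>}. ?b w \<partial>lborel)"
  proof -
    have "mass J (\<lambda>_. c) r = c * vol J r" for c r
      using orlicz_set_measurable[OF J(1), of r] by (simp add: mass_def vol_def nn_integral_cmult_indicator)
    then show ?thesis
      unfolding mass_insert[OF J ind] fun_upd_same
      by (intro nn_integral_cong) (auto split: split_indicator)
  qed
  have 3: "mass (insert i J) (\<lambda>z. \<psi> (restrict z J)) s = (\<integral>\<^sup>+y. ?a y \<partial>lborel)"
    unfolding mass_insert[OF J \<psi>'] using m[of 1] by simp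
  show ?thesis unfolding 1 2 3 vol_insert[OF J] by (rule cross)
qed

end

section \<open>Symmetrized powers\<close>

text \<open>Covers the origin, which the derivative rule for \<open>powr\<close> excludes: as r > 1,
  the difference quotient is bounded by |h|^(r - 1) and tends to 0.\<close>

lemma DERIV_zero_of_powr_bound:
  fixes f :: "real \<Rightarrow> real"
  assumes r: "1 < r" and f: "\<And>h. \<bar>f h\<bar> \<le> \<bar>h\<bar> powr r"
  shows "(f has_real_derivative 0) (at 0)"
proof -
  have f0: "f 0 = 0" using f[of 0] by simp
  have "((\<lambda>h. \<bar>h::real\<bar> powr (r - 1)) \<longlongrightarrow> \<bar>0\<bar> powr (r - 1)) (at 0)"
    using r by (intro tendsto_powr' tendsto_intros) auto
  then have "((\<lambda>h. \<bar>h::real\<bar> powr (r - 1)) \<longlongrightarrow> 0) (at 0)" by simp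
  moreover have "eventually (\<lambda>h. norm (f h / h) \<le> \<bar>h\<bar> powr (r - 1)) (at 0)"
  proof (rule eventually_at_filter[THEN iffD2], rule always_eventually, intro allI impI)
    fix h :: real assume "h \<noteq> 0"
    then have "\<bar>f h\<bar> / \<bar>h\<bar> \<le> \<bar>h\<bar> powr r / \<bar>h\<bar>" using f[of h] by (intro divide_right_mono) auto
    also have "\<dots> = \<bar>h\<bar> powr (r - 1)" using \<open>h \<noteq> 0\<close> by (simp add: powr_diff)
    finally show "norm (f h / h) \<le> \<bar>h\<bar> powr (r - 1)" by simp
  qed
  ultimately have "((\<lambda>h. f h / h) \<longlongrightarrow> 0) (at 0)"
    by (rule Lim_null_comparison[rotated])
  then show ?thesis by (simp add: DERIV_def f0)
qed

definition signed_powr :: "real \<Rightarrow> real \<Rightarrow> real" where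
  "signed_powr r x = sgn x * \<bar>x\<bar> powr r"

lemma signed_powr_measurable [measurable]: "signed_powr r \<in> borel_measurable borel"
  unfolding signed_powr_def by measurable

lemma DERIV_abs_powr:
  assumes "1 < p"
  shows "((\<lambda>x. \<bar>x\<bar> powr p) has_real_derivative p * signed_powr (p - 1) x) (at x)"
proof (cases x "0 :: real" rule: linorder_cases)
  case equal
  have "((\<lambda>x. \<bar>x::real\<bar> powr p) has_real_derivative 0) (at 0)"
    by (rule DERIV_zero_of_powr_bound[OF assms]) simp
  then show ?thesis using equal by (simp add: signed_powr_def)
next
  case greater
  have "((\<lambda>x. x powr p) has_real_derivative p * x powr (p - 1)) (at x)"
    using greater by (rule has_real_derivative_powr)
  moreover have "eventually (\<lambda>x. x powr p = \<bar>x\<bar> powr p) (nhds x)"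
    using eventually_nhds_in_open[of "{0<..}" x] greater by (auto elim!: eventually_mono)
  ultimately show ?thesis using greater
    by (subst (asm) DERIV_cong_ev[OF refl _ refl]) (auto simp: signed_powr_def)
next
  case less
  have "((\<lambda>x. (- x) powr p) has_real_derivative p * (- x) powr (p - 1) * (- 1)) (at x)"
    by (rule DERIV_chain2[OF has_real_derivative_powr]) (use less in \<open>auto intro!: derivative_eq_intros\<close>)
  moreover have "eventually (\<lambda>x. (- x) powr p = \<bar>x\<bar> powr p) (nhds x)"
    using eventually_nhds_in_open[of "{..<0}" x] less by (auto elim!: eventually_mono)
  ultimately show ?thesis using less
    by (subst (asm) DERIV_cong_ev[OF refl _ refl]) (auto simp: signed_powr_def)
qed

lemma DERIV_signed_powr:
  assumes "1 < r"
  shows "(signed_powr r has_real_derivative r * \<bar>x\<bar> powr (r - 1)) (at x)"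
proof (cases x "0 :: real" rule: linorder_cases)
  case equal
  have "(signed_powr r has_real_derivative 0) (at 0)"
    by (rule DERIV_zero_of_powr_bound[OF assms]) (simp add: signed_powr_def abs_mult abs_sgn_eq)
  then show ?thesis using equal by simp
next
  case greater
  have "((\<lambda>x. x powr r) has_real_derivative r * x powr (r - 1)) (at x)"
    using greater by (rule has_real_derivative_powr)
  moreover have "eventually (\<lambda>x. x powr r = signed_powr r x) (nhds x)"
    using eventually_nhds_in_open[of "{0<..}" x] greater by (auto elim!: eventually_mono simp: signed_powr_def)
  ultimately show ?thesis using greater
    by (subst (asm) DERIV_cong_ev[OF refl _ refl]) auto
next
  case less
  have "((\<lambda>x. - ((- x) powr r)) has_real_derivative - (r * (- x) powr (r - 1) * (- 1))) (at x)"
    by (intro DERIV_minus DERIV_chain2[OF has_real_derivative_powr]) (use less in \<open>auto intro!: derivative_eq_intros\<close>)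
  moreover have "eventually (\<lambda>x. - ((- x) powr r) = signed_powr r x) (nhds x)"
    using eventually_nhds_in_open[of "{..<0}" x] less by (auto elim!: eventually_mono simp: signed_powr_def)
  ultimately show ?thesis using less
    by (subst (asm) DERIV_cong_ev[OF refl _ refl]) auto
qed

lemma abs_powr_mult: "\<bar>x * y :: real\<bar> powr p = \<bar>x\<bar> powr p * \<bar>y\<bar> powr p"
  by (simp add: abs_mult powr_mult)

lemma convex_on_abs_powr:
  assumes "1 \<le> q"
  shows "convex_on UNIV (\<lambda>x::real. \<bar>x\<bar> powr q)"
proof (cases "q = 1")
  case True
  have "convex_on UNIV (\<lambda>x::real. \<bar>x\<bar>)"
    by (rule convex_onI) (auto intro!: order_trans[OF abs_triangle_ineq] simp: abs_mult)
  then show ?thesis using True by simp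
next
  case False
  show ?thesis
  proof (rule convex_on_realI)
    fix x y :: real assume "x \<le> y"
    have sp: "signed_powr r x \<le> signed_powr r y" if "0 < r" for r
    proof (cases "0 \<le> x \<or> y \<le> 0")
      case True
      then show ?thesis using \<open>x \<le> y\<close> that
        by (cases "x = 0"; cases "y = 0") (auto simp: signed_powr_def sgn_if intro!: powr_mono2)
    next
      case False
      then have "signed_powr r x \<le> 0" "0 \<le> signed_powr r y" by (auto simp: signed_powr_def sgn_if)
      then show ?thesis by linarith
    qed
    show "q * signed_powr (q - 1) x \<le> q * signed_powr (q - 1) y"
      using assms False by (intro mult_left_mono sp) auto
  qed (use assms False in \<open>auto intro!: DERIV_abs_powr\<close>)
qed

lemma convex_four_points:
  fixes f :: "real \<Rightarrow> real"
  assumes f: "convex_on UNIV f" and ord: "p \<le> u" "p \<le> v" "u + v = p + q"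
  shows "f u + f v \<le> f p + f q"
proof (cases "p = q")
  case True
  then have "u = p" "v = p" using ord by auto
  then show ?thesis using True by simp
next
  case False
  then have pq: "p < q" using ord by linarith
  define t where "t = (u - p) / (q - p)"
  have t: "0 \<le> t" "t \<le> 1" using ord pq by (auto simp: t_def)
  have tm: "t * (q - p) = u - p" using pq by (simp add: t_def)
  have "f u = f ((1 - t) *\<^sub>R p + t *\<^sub>R q)" using tm by (intro arg_cong[where f = f]) (simp add: algebra_simps)
  also have "\<dots> \<le> (1 - t) * f p + t * f q" using t by (intro convex_onD[OF f]) auto
  finally have 1: "f u \<le> (1 - t) * f p + t * f q" .
  have "f v = f ((1 - (1 - t)) *\<^sub>R p + (1 - t) *\<^sub>R q)"
    using tm ord by (intro arg_cong[where f = f]) (simp add: algebra_simps)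
  also have "\<dots> \<le> (1 - (1 - t)) * f p + (1 - t) * f q" using t by (intro convex_onD[OF f]) auto
  finally show ?thesis using 1 by (simp add: algebra_simps)
qed

lemma convex_sum_symmetric_mono:
  fixes k :: "real \<Rightarrow> real"
  assumes "convex_on UNIV k" "0 \<le> u" "u \<le> v"
  shows "k (x + u) + k (x - u) \<le> k (x + v) + k (x - v)"
  using convex_four_points[OF assms(1), of "x - v" "x - u" "x + u" "x + v"] assms(2,3) by simp

text \<open>The mean of |s + \<epsilon> y|^p over a random sign \<epsilon>. An unconditional law
  allows the sign of any one coordinate to be averaged out, so moments are analysed through this
  even function of y; \<open>sym_deriv\<close> is its derivative in y.\<close>

definition sym_mean :: "real \<Rightarrow> real \<Rightarrow> real \<Rightarrow> real" where
  "sym_mean p s y = (\<bar>s + y\<bar> powr p + \<bar>s - y\<bar> powr p) / 2"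

definition sym_deriv :: "real \<Rightarrow> real \<Rightarrow> real \<Rightarrow> real" where
  "sym_deriv p s u = p * (signed_powr (p - 1) (s + u) - signed_powr (p - 1) (s - u)) / 2"

lemma sym_mean_0 [simp]: "sym_mean p s 0 = \<bar>s\<bar> powr p"
  by (simp add: sym_mean_def)

lemma sym_deriv_0 [simp]: "sym_deriv p s 0 = 0"
  by (simp add: sym_deriv_def)

lemma sym_mean_abs: "sym_mean p s \<bar>y\<bar> = sym_mean p s y"
  by (cases "0 \<le> y") (simp_all add: sym_mean_def)

lemma sym_deriv_measurable [measurable]:
  assumes [measurable]: "f \<in> borel_measurable M" "g \<in> borel_measurable M"
  shows "(\<lambda>x. sym_deriv p (f x) (g x)) \<in> borel_measurable M"
  unfolding sym_deriv_def by measurable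

lemma DERIV_sym_mean:
  assumes "1 < p"
  shows "(sym_mean p s has_real_derivative sym_deriv p s y) (at y)"
proof -
  have "((\<lambda>y. (\<bar>s + y\<bar> powr p + \<bar>s - y\<bar> powr p) / 2) has_real_derivative
      (p * signed_powr (p - 1) (s + y) * 1 + p * signed_powr (p - 1) (s - y) * (0 - 1)) / 2) (at y)"
    by (intro DERIV_cdivide DERIV_add DERIV_chain2[OF DERIV_abs_powr[OF assms]])
      (auto intro!: derivative_eq_intros)
  then show ?thesis by (simp add: sym_mean_def[abs_def] sym_deriv_def algebra_simps)
qed

lemma DERIV_sym_deriv:
  assumes "2 < p"
  shows "(sym_deriv p s has_real_derivative p * (p - 1) * sym_mean (p - 2) s u) (at u)"
proof -
  have "((\<lambda>u. p * (signed_powr (p - 1) (s + u) - signed_powr (p - 1) (s - u)) / 2) has_real_derivative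
      p * ((p - 1) * \<bar>s + u\<bar> powr (p - 1 - 1) * 1 - (p - 1) * \<bar>s - u\<bar> powr (p - 1 - 1) * (0 - 1)) / 2) (at u)"
    using assms
    by (intro DERIV_cdivide DERIV_cmult DERIV_diff DERIV_chain2[OF DERIV_signed_powr])
      (auto intro!: derivative_eq_intros)
  then show ?thesis by (simp add: sym_mean_def sym_deriv_def[abs_def] algebra_simps)
qed

lemma DERIV_sym_deriv_left:
  assumes "2 < p"
  shows "((\<lambda>s. sym_deriv p s u) has_real_derivative
     p * (p - 1) * (\<bar>s + u\<bar> powr (p - 2) - \<bar>s - u\<bar> powr (p - 2)) / 2) (at s)"
proof -
  have "((\<lambda>s. p * (signed_powr (p - 1) (s + u) - signed_powr (p - 1) (s - u)) / 2) has_real_derivative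
      p * ((p - 1) * \<bar>s + u\<bar> powr (p - 1 - 1) * 1 - (p - 1) * \<bar>s - u\<bar> powr (p - 1 - 1) * 1) / 2) (at s)"
    using assms
    by (intro DERIV_cdivide DERIV_cmult DERIV_diff DERIV_chain2[OF DERIV_signed_powr])
      (auto intro!: derivative_eq_intros)
  then show ?thesis by (simp add: sym_deriv_def[abs_def] algebra_simps)
qed

text \<open>The derivative in s is a multiple of |s + u|^(p - 2) - |s - u|^(p - 2), which is
  nondecreasing because p - 2 \<ge> 1 makes the power convex. Together with nonnegativity this makes
  \<open>sym_deriv p s u\<close>, as a function of s, an admissible test function for negative
  dependence.\<close>

lemma convex_on_sym_deriv_left:
  assumes p: "3 \<le> p" and u: "0 \<le> u"
  shows "convex_on UNIV (\<lambda>s. sym_deriv p s u)"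
proof (rule convex_on_realI)
  fix s t :: real assume "s \<le> t"
  have "\<bar>s + u\<bar> powr (p - 2) + \<bar>t - u\<bar> powr (p - 2) \<le> \<bar>s - u\<bar> powr (p - 2) + \<bar>t + u\<bar> powr (p - 2)"
    using p u \<open>s \<le> t\<close> convex_four_points[OF convex_on_abs_powr[of "p - 2"], of "s - u" "s + u" "t - u" "t + u"] by simp
  then have "\<bar>s + u\<bar> powr (p - 2) - \<bar>s - u\<bar> powr (p - 2) \<le> \<bar>t + u\<bar> powr (p - 2) - \<bar>t - u\<bar> powr (p - 2)"
    by linarith
  then show "p * (p - 1) * (\<bar>s + u\<bar> powr (p - 2) - \<bar>s - u\<bar> powr (p - 2)) / 2
      \<le> p * (p - 1) * (\<bar>t + u\<bar> powr (p - 2) - \<bar>t - u\<bar> powr (p - 2)) / 2"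
    using p by (intro divide_right_mono mult_left_mono) auto
qed (use p in \<open>auto intro!: DERIV_sym_deriv_left\<close>)

lemma sym_mean_mono:
  assumes "1 \<le> q" "0 \<le> u" "u \<le> v"
  shows "sym_mean q s u \<le> sym_mean q s v"
  using convex_sum_symmetric_mono[OF convex_on_abs_powr[OF assms(1)] assms(2,3), of s]
  by (simp add: sym_mean_def)

lemma sym_deriv_ge:
  assumes p: "3 \<le> p" and u: "0 \<le> u"
  shows "p * (p - 1) * \<bar>s\<bar> powr (p - 2) * u \<le> sym_deriv p s u"
proof -
  let ?c = "p * (p - 1) * \<bar>s\<bar> powr (p - 2)"
  have "sym_deriv p s 0 - ?c * 0 \<le> sym_deriv p s u - ?c * u"
  proof (rule DERIV_nonneg_imp_nondecreasing[OF u])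
    fix x assume x: "0 \<le> x" "x \<le> u"
    have "((\<lambda>x. sym_deriv p s x - ?c * x) has_real_derivative p * (p - 1) * sym_mean (p - 2) s x - ?c) (at x)"
      using p by (auto intro!: derivative_eq_intros DERIV_sym_deriv)
    moreover have "0 \<le> p * (p - 1) * (sym_mean (p - 2) s x - \<bar>s\<bar> powr (p - 2))"
      using p x sym_mean_mono[of "p - 2" 0 x s] by (intro mult_nonneg_nonneg) auto
    ultimately show "\<exists>y. ((\<lambda>x. sym_deriv p s x - ?c * x) has_real_derivative y) (at x) \<and> 0 \<le> y"
      by (auto simp: algebra_simps)
  qed
  then show ?thesis by simp
qed

lemma sym_deriv_nonneg: "3 \<le> p \<Longrightarrow> 0 \<le> u \<Longrightarrow> 0 \<le> sym_deriv p s u"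
  by (rule order_trans[OF _ sym_deriv_ge]) auto

text \<open>As a function of u \<ge> 0 the derivative is convex and vanishes at 0, so its ratio to u
  is nondecreasing. This is the hypothesis under which tails that cross once can be
  compared.\<close>

lemma sym_deriv_ratio_mono:
  assumes p: "3 \<le> p" and uv: "0 \<le> u" "u \<le> v"
  shows "sym_deriv p s u * v \<le> sym_deriv p s v * u"
proof (cases "v = 0")
  case False
  then have v: "v > 0" using uv by simp
  have "convex_on {0..} (sym_deriv p s)"
  proof (rule convex_on_realI)
    fix x y :: real assume "x \<in> {0..}" "x \<le> y"
    then show "p * (p - 1) * sym_mean (p - 2) s x \<le> p * (p - 1) * sym_mean (p - 2) s y"
      using p by (intro mult_left_mono sym_mean_mono) auto
  qed (use p in \<open>auto intro!: DERIV_sym_deriv\<close>)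
  from convex_onD[OF this, of "u / v" 0 v] uv v
  have "sym_deriv p s u \<le> (u / v) * sym_deriv p s v" by simp
  then show ?thesis using v by (simp add: field_simps)
qed (use uv in simp)

lemma sym_mean_eq_nn_integral:
  assumes p: "3 \<le> p" and y: "0 \<le> y"
  shows "ennreal (sym_mean p s y) = ennreal (\<bar>s\<bar> powr p)
     + (\<integral>\<^sup>+u. ennreal (sym_deriv p s u) * indicator {0..y} u \<partial>lborel)"
proof -
  have "(\<integral>\<^sup>+u. ennreal (sym_deriv p s u) * indicator {0..y} u \<partial>lborel) = sym_mean p s y - sym_mean p s 0"
    using p y by (intro nn_integral_FTC_Icc sym_deriv_nonneg DERIV_sym_mean) auto
  moreover have "sym_mean p s 0 \<le> sym_mean p s y" using p y by (intro sym_mean_mono) auto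
  ultimately show ?thesis by (simp add: ennreal_plus[symmetric] del: ennreal_plus)
qed

section \<open>Taylor estimates for the symmetrized power\<close>

lemma le_of_second_derivative_le:
  fixes f g :: "real \<Rightarrow> real"
  assumes y: "0 \<le> y"
    and f: "\<And>x. (f has_real_derivative f' x) (at x)" "\<And>x. (f' has_real_derivative f'' x) (at x)"
    and g: "\<And>x. (g has_real_derivative g' x) (at x)" "\<And>x. (g' has_real_derivative g'' x) (at x)"
    and le: "f 0 \<le> g 0" "f' 0 \<le> g' 0" "\<And>x. 0 \<le> x \<Longrightarrow> f'' x \<le> g'' x"
  shows "f y \<le> g y"
proof -
  have d: "f' x \<le> g' x" if "0 \<le> x" for x
  proof -
    have "g' 0 - f' 0 \<le> g' x - f' x"
    proof (rule DERIV_nonneg_imp_nondecreasing[OF that])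
      fix z :: real assume "0 \<le> z" "z \<le> x"
      then show "\<exists>y. ((\<lambda>x. g' x - f' x) has_real_derivative y) (at z) \<and> 0 \<le> y"
        using DERIV_diff[OF g(2) f(2)] le(3)[of z] by (intro exI[of _ "g'' z - f'' z"]) auto
    qed
    then show ?thesis using le(2) by simp
  qed
  have "g 0 - f 0 \<le> g y - f y"
  proof (rule DERIV_nonneg_imp_nondecreasing[OF y])
    fix z :: real assume "0 \<le> z" "z \<le> y"
    then show "\<exists>w. ((\<lambda>x. g x - f x) has_real_derivative w) (at z) \<and> 0 \<le> w"
      using DERIV_diff[OF g(1) f(1)] d[of z] by (intro exI[of _ "g' z - f' z"]) auto
  qed
  then show ?thesis using le(1) by simp
qed

lemma powr_le_tangent_at_1:
  fixes t \<theta> :: real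
  assumes "0 \<le> t" "0 \<le> \<theta>" "\<theta> \<le> 1"
  shows "t powr \<theta> \<le> 1 + \<theta> * (t - 1)"
proof (cases "\<theta> = 1 \<or> \<theta> = 0")
  case True then show ?thesis using assms by (auto simp: powr_def)
next
  case False
  then show ?thesis
    using Youngs_inequality_0[of \<theta> "1 - \<theta>" t 1] assms by (cases "t = 0") (simp_all add: algebra_simps)
qed

lemma powr_add_le:
  fixes x y \<theta> :: real
  assumes "0 \<le> x" "0 \<le> y" "0 < \<theta>" "\<theta> \<le> 1"
  shows "(x + y) powr \<theta> \<le> x powr \<theta> + y powr \<theta>"
proof (cases "x + y = 0")
  case False
  then have s: "x + y > 0" using assms by simp
  have *: "z / (x + y) \<le> (z / (x + y)) powr \<theta>" if "0 \<le> z" "z \<le> x + y" for z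
  proof (cases "z = 0")
    case False
    have "(z / (x + y)) powr 1 \<le> (z / (x + y)) powr \<theta>"
      using that s assms False by (intro powr_mono') auto
    then show ?thesis using that s by simp
  qed simp
  have "1 = x / (x + y) + y / (x + y)" using s by (simp add: add_divide_distrib[symmetric])
  also have "\<dots> \<le> (x / (x + y)) powr \<theta> + (y / (x + y)) powr \<theta>" using assms by (intro add_mono *) auto
  also have "\<dots> = (x powr \<theta> + y powr \<theta>) / (x + y) powr \<theta>"
    using assms s by (simp add: powr_divide add_divide_distrib)
  finally show ?thesis using s by (simp add: le_divide_eq)
qed (use assms in auto)

text \<open>Concavity and subadditivity of \<open>t \<mapsto> t powr (q / 2)\<close>, applied to \<open>(s \<plusminus> y)\<^sup>2\<close>.\<close>

lemma sym_mean_le_0_2: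
  assumes q: "0 < q" "q \<le> 2"
  shows "sym_mean q s y \<le> \<bar>s\<bar> powr q + \<bar>y\<bar> powr q"
proof -
  define \<theta> where "\<theta> = q / 2"
  have \<theta>: "0 < \<theta>" "\<theta> \<le> 1" using q by (auto simp: \<theta>_def)
  have sq: "\<bar>x\<bar> powr q = (x\<^sup>2) powr \<theta>" for x :: real
  proof -
    have "\<bar>x\<bar> powr q = (\<bar>x\<bar> powr 2) powr \<theta>" by (simp add: powr_powr \<theta>_def del: powr_numeral)
    moreover have "\<bar>x\<bar> powr 2 = x\<^sup>2" by simp
    ultimately show ?thesis by (simp only:)
  qed
  define m where "m = s\<^sup>2 + y\<^sup>2"
  have "sym_mean q s y \<le> m powr \<theta>"
  proof (cases "m = 0")
    case True
    then show ?thesis by (simp add: m_def sum_power2_eq_zero_iff sym_mean_def)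
  next
    case False
    then have m: "m > 0" by (simp add: m_def sum_power2_gt_zero_iff less_le)
    have t: "a powr \<theta> \<le> m powr \<theta> * (1 + \<theta> * (a / m - 1))" if "0 \<le> a" for a
    proof -
      have "a powr \<theta> = m powr \<theta> * (a / m) powr \<theta>" using m that by (simp add: powr_divide)
      also have "\<dots> \<le> m powr \<theta> * (1 + \<theta> * (a / m - 1))"
        using m that \<theta> by (intro mult_left_mono powr_le_tangent_at_1) auto
      finally show ?thesis .
    qed
    have "(s + y)\<^sup>2 + (s - y)\<^sup>2 = 2 * m" by (simp add: m_def power2_eq_square algebra_simps)
    then have e: "(s + y)\<^sup>2 / m + (s - y)\<^sup>2 / m = 2" using m by (simp add: add_divide_distrib[symmetric])
    have "2 * sym_mean q s y \<le> m powr \<theta> * (1 + \<theta> * ((s + y)\<^sup>2 / m - 1)) + m powr \<theta> * (1 + \<theta> * ((s - y)\<^sup>2 / m - 1))"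
    proof -
      have "2 * sym_mean q s y = ((s + y)\<^sup>2) powr \<theta> + ((s - y)\<^sup>2) powr \<theta>"
        by (simp add: sym_mean_def sq)
      also have "\<dots> \<le> m powr \<theta> * (1 + \<theta> * ((s + y)\<^sup>2 / m - 1)) + m powr \<theta> * (1 + \<theta> * ((s - y)\<^sup>2 / m - 1))"
        by (intro add_mono t) auto
      finally show ?thesis .
    qed
    also have "\<dots> = m powr \<theta> * (2 + \<theta> * (((s + y)\<^sup>2 / m + (s - y)\<^sup>2 / m) - 2))"
      by (simp add: algebra_simps)
    also have "\<dots> = 2 * m powr \<theta>" unfolding e by simp
    finally show ?thesis by simp
  qed
  also have "\<dots> \<le> (s\<^sup>2) powr \<theta> + (y\<^sup>2) powr \<theta>" unfolding m_def using \<theta> by (intro powr_add_le) auto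
  finally show ?thesis by (simp add: sq)
qed

text \<open>The second derivative of \<open>sym_mean p s\<close> is p (p - 1)
  \<open>sym_mean (p - 2) s\<close>, so the estimate for the exponent p - 2 in (0, 2] is integrated
  twice. The remainder |y|^p keeps the coefficient 1, since its second derivative carries the same
  factor p (p - 1).\<close>

lemma sym_mean_le_2_4:
  assumes p: "2 < p" "p \<le> 4"
  shows "sym_mean p s y \<le> \<bar>s\<bar> powr p + p * (p - 1) / 2 * y\<^sup>2 * \<bar>s\<bar> powr (p - 2) + \<bar>y\<bar> powr p"
proof -
  have "sym_mean p s \<bar>y\<bar> \<le> \<bar>s\<bar> powr p + p * (p - 1) / 2 * \<bar>y\<bar>\<^sup>2 * \<bar>s\<bar> powr (p - 2) + \<bar>\<bar>y\<bar>\<bar> powr p"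
  proof (rule le_of_second_derivative_le[where y = "\<bar>y\<bar>" and f = "sym_mean p s"
      and g = "\<lambda>y. \<bar>s\<bar> powr p + p * (p - 1) / 2 * y\<^sup>2 * \<bar>s\<bar> powr (p - 2) + \<bar>y\<bar> powr p"
      and g' = "\<lambda>y. p * (p - 1) * y * \<bar>s\<bar> powr (p - 2) + p * signed_powr (p - 1) y"
      and g'' = "\<lambda>y. p * (p - 1) * (\<bar>s\<bar> powr (p - 2) + \<bar>y\<bar> powr (p - 2))"])
    fix x :: real
    show "(sym_mean p s has_real_derivative sym_deriv p s x) (at x)" using p by (intro DERIV_sym_mean) auto
    show "(sym_deriv p s has_real_derivative p * (p - 1) * sym_mean (p - 2) s x) (at x)"
      using p by (intro DERIV_sym_deriv) auto
    show "((\<lambda>y. \<bar>s\<bar> powr p + p * (p - 1) / 2 * y\<^sup>2 * \<bar>s\<bar> powr (p - 2) + \<bar>y\<bar> powr p) has_real_derivative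
        p * (p - 1) * x * \<bar>s\<bar> powr (p - 2) + p * signed_powr (p - 1) x) (at x)"
      using p by (intro DERIV_add[OF _ DERIV_abs_powr]) (auto intro!: derivative_eq_intros)
    show "((\<lambda>y. p * (p - 1) * y * \<bar>s\<bar> powr (p - 2) + p * signed_powr (p - 1) y) has_real_derivative
        p * (p - 1) * (\<bar>s\<bar> powr (p - 2) + \<bar>x\<bar> powr (p - 2))) (at x)"
      using p by (auto intro!: derivative_eq_intros DERIV_signed_powr simp: algebra_simps)
    show "p * (p - 1) * sym_mean (p - 2) s x \<le> p * (p - 1) * (\<bar>s\<bar> powr (p - 2) + \<bar>x\<bar> powr (p - 2))"
      using p by (intro mult_left_mono sym_mean_le_0_2) auto
  qed (simp_all add: signed_powr_def)
  then show ?thesis by (simp add: sym_mean_abs)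
qed

text \<open>The same double integration once more, now from an exponent p - 2 in (2, 4]; it produces
  the fourth-order Taylor term in y.\<close>

lemma sym_mean_le_4_6:
  assumes p: "4 < p" "p \<le> 6"
  shows "sym_mean p s y \<le> \<bar>s\<bar> powr p + p * (p - 1) / 2 * y\<^sup>2 * \<bar>s\<bar> powr (p - 2)
     + p * (p - 1) * (p - 2) * (p - 3) / 24 * y ^ 4 * \<bar>s\<bar> powr (p - 4) + \<bar>y\<bar> powr p"
proof -
  have "sym_mean p s \<bar>y\<bar> \<le> \<bar>s\<bar> powr p + p * (p - 1) / 2 * \<bar>y\<bar>\<^sup>2 * \<bar>s\<bar> powr (p - 2)
     + p * (p - 1) * (p - 2) * (p - 3) / 24 * \<bar>y\<bar> ^ 4 * \<bar>s\<bar> powr (p - 4) + \<bar>\<bar>y\<bar>\<bar> powr p"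
  proof (rule le_of_second_derivative_le[where y = "\<bar>y\<bar>" and f = "sym_mean p s"
      and g = "\<lambda>y. \<bar>s\<bar> powr p + p * (p - 1) / 2 * y\<^sup>2 * \<bar>s\<bar> powr (p - 2)
          + p * (p - 1) * (p - 2) * (p - 3) / 24 * y ^ 4 * \<bar>s\<bar> powr (p - 4) + \<bar>y\<bar> powr p"
      and g' = "\<lambda>y. p * (p - 1) * y * \<bar>s\<bar> powr (p - 2)
          + p * (p - 1) * (p - 2) * (p - 3) / 6 * y ^ 3 * \<bar>s\<bar> powr (p - 4) + p * signed_powr (p - 1) y"
      and g'' = "\<lambda>y. p * (p - 1) * \<bar>s\<bar> powr (p - 2)
          + p * (p - 1) * (p - 2) * (p - 3) / 6 * (3 * y\<^sup>2) * \<bar>s\<bar> powr (p - 4)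
          + p * ((p - 1) * \<bar>y\<bar> powr (p - 1 - 1))"])
    fix x :: real
    show "(sym_mean p s has_real_derivative sym_deriv p s x) (at x)" using p by (intro DERIV_sym_mean) auto
    show "(sym_deriv p s has_real_derivative p * (p - 1) * sym_mean (p - 2) s x) (at x)"
      using p by (intro DERIV_sym_deriv) auto
    show "((\<lambda>y. \<bar>s\<bar> powr p + p * (p - 1) / 2 * y\<^sup>2 * \<bar>s\<bar> powr (p - 2)
          + p * (p - 1) * (p - 2) * (p - 3) / 24 * y ^ 4 * \<bar>s\<bar> powr (p - 4) + \<bar>y\<bar> powr p) has_real_derivative
        p * (p - 1) * x * \<bar>s\<bar> powr (p - 2)
          + p * (p - 1) * (p - 2) * (p - 3) / 6 * x ^ 3 * \<bar>s\<bar> powr (p - 4) + p * signed_powr (p - 1) x) (at x)"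
      using p by (intro DERIV_add[OF _ DERIV_abs_powr]) (auto intro!: derivative_eq_intros)
    show "((\<lambda>y. p * (p - 1) * y * \<bar>s\<bar> powr (p - 2)
          + p * (p - 1) * (p - 2) * (p - 3) / 6 * y ^ 3 * \<bar>s\<bar> powr (p - 4) + p * signed_powr (p - 1) y) has_real_derivative
        p * (p - 1) * \<bar>s\<bar> powr (p - 2)
          + p * (p - 1) * (p - 2) * (p - 3) / 6 * (3 * x\<^sup>2) * \<bar>s\<bar> powr (p - 4)
          + p * ((p - 1) * \<bar>x\<bar> powr (p - 1 - 1))) (at x)"
      using p by (intro DERIV_add[OF _ DERIV_cmult[OF DERIV_signed_powr]]) (auto intro!: derivative_eq_intros)
    have "sym_mean (p - 2) s x \<le> \<bar>s\<bar> powr (p - 2) + (p - 2) * (p - 2 - 1) / 2 * x\<^sup>2 * \<bar>s\<bar> powr (p - 2 - 2) + \<bar>x\<bar> powr (p - 2)"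
      using p by (intro sym_mean_le_2_4) auto
    then have "p * (p - 1) * sym_mean (p - 2) s x \<le> p * (p - 1) * (\<bar>s\<bar> powr (p - 2)
          + (p - 2) * (p - 3) / 2 * x\<^sup>2 * \<bar>s\<bar> powr (p - 4) + \<bar>x\<bar> powr (p - 2))"
      using p by (intro mult_left_mono) auto
    also have "\<dots> = p * (p - 1) * \<bar>s\<bar> powr (p - 2)
          + p * (p - 1) * (p - 2) * (p - 3) / 6 * (3 * x\<^sup>2) * \<bar>s\<bar> powr (p - 4)
          + p * ((p - 1) * \<bar>x\<bar> powr (p - 1 - 1))"
      by (simp add: distrib_left)
    finally show "p * (p - 1) * sym_mean (p - 2) s x \<le> \<dots>" .
  qed (simp_all add: signed_powr_def)
  then show ?thesis by (simp add: sym_mean_abs)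
qed

lemma sym_mean_ge:
  assumes p: "3 \<le> p"
  shows "\<bar>s\<bar> powr p + p * (p - 1) / 2 * y\<^sup>2 * \<bar>s\<bar> powr (p - 2) \<le> sym_mean p s y"
proof -
  have "\<bar>s\<bar> powr p + p * (p - 1) / 2 * \<bar>y\<bar>\<^sup>2 * \<bar>s\<bar> powr (p - 2) \<le> sym_mean p s \<bar>y\<bar>"
  proof (rule le_of_second_derivative_le[where y = "\<bar>y\<bar>" and g = "sym_mean p s"
      and f = "\<lambda>y. \<bar>s\<bar> powr p + p * (p - 1) / 2 * y\<^sup>2 * \<bar>s\<bar> powr (p - 2)"
      and f' = "\<lambda>y. p * (p - 1) * y * \<bar>s\<bar> powr (p - 2)"
      and f'' = "\<lambda>y. p * (p - 1) * \<bar>s\<bar> powr (p - 2)"])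
    fix x :: real
    show "(sym_mean p s has_real_derivative sym_deriv p s x) (at x)" using p by (intro DERIV_sym_mean) auto
    show "(sym_deriv p s has_real_derivative p * (p - 1) * sym_mean (p - 2) s x) (at x)"
      using p by (intro DERIV_sym_deriv) auto
    show "((\<lambda>y. \<bar>s\<bar> powr p + p * (p - 1) / 2 * y\<^sup>2 * \<bar>s\<bar> powr (p - 2)) has_real_derivative
        p * (p - 1) * x * \<bar>s\<bar> powr (p - 2)) (at x)"
      by (auto intro!: derivative_eq_intros)
    show "((\<lambda>y. p * (p - 1) * y * \<bar>s\<bar> powr (p - 2)) has_real_derivative p * (p - 1) * \<bar>s\<bar> powr (p - 2)) (at x)"
      by (auto intro!: derivative_eq_intros)
    show "p * (p - 1) * \<bar>s\<bar> powr (p - 2) \<le> p * (p - 1) * sym_mean (p - 2) s x" if "0 \<le> x"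
      using p that sym_mean_mono[of "p - 2" 0 x s] by (intro mult_left_mono) auto
  qed simp_all
  then show ?thesis by (simp add: sym_mean_abs)
qed

section \<open>Gaussian moments\<close>

lemma nn_integral_even_function:
  fixes f :: "real \<Rightarrow> ennreal"
  assumes [measurable]: "f \<in> borel_measurable borel" and even: "\<And>x. f (- x) = f x"
  shows "(\<integral>\<^sup>+x. f x \<partial>lborel) = 2 * (\<integral>\<^sup>+x\<in>{0..}. f x \<partial>lborel)"
proof -
  have "(\<integral>\<^sup>+x\<in>{..0}. f x \<partial>lborel) = ennreal \<bar>-1\<bar> * (\<integral>\<^sup>+x. f (0 + (-1) * x) * indicator {..0} (0 + (-1) * x) \<partial>lborel)"
    by (intro nn_integral_real_affine) auto
  also have "\<dots> = (\<integral>\<^sup>+x\<in>{0..}. f x \<partial>lborel)"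
    by (auto simp: even intro!: nn_integral_cong split: split_indicator)
  finally have neg: "(\<integral>\<^sup>+x\<in>{..0}. f x \<partial>lborel) = (\<integral>\<^sup>+x\<in>{0..}. f x \<partial>lborel)" .
  have "(\<integral>\<^sup>+x. f x \<partial>lborel) = (\<integral>\<^sup>+x. f x * indicator {..0} x + f x * indicator {0..} x \<partial>lborel)"
  proof (rule nn_integral_cong_AE)
    show "AE x in lborel. f x = f x * indicator {..0} x + f x * indicator {0..} x"
      using AE_lborel_singleton[of "0::real"]
    proof eventually_elim
      case (elim x)
      then show ?case by (cases "0 \<le> x") auto
    qed
  qed
  also have "\<dots> = (\<integral>\<^sup>+x\<in>{..0}. f x \<partial>lborel) + (\<integral>\<^sup>+x\<in>{0..}. f x \<partial>lborel)"
    by (intro nn_integral_add) auto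
  finally show ?thesis unfolding neg mult_2 .
qed

lemma nn_integral_std_normal:
  assumes [measurable]: "h \<in> borel_measurable borel"
  shows "(\<integral>\<^sup>+g. h g \<partial>std_normal_distribution) = (\<integral>\<^sup>+g. ennreal (std_normal_density g) * h g \<partial>lborel)"
  by (simp add: nn_integral_density)

lemma nn_integral_std_normal_scale:
  assumes [measurable]: "h \<in> borel_measurable borel" and \<sigma>: "0 < \<sigma>"
  shows "(\<integral>\<^sup>+g. h (\<sigma> * g) \<partial>std_normal_distribution) = (\<integral>\<^sup>+y. ennreal (normal_density 0 \<sigma> y) * h y \<partial>lborel)"
proof -
  have "(\<integral>\<^sup>+y. ennreal (normal_density 0 \<sigma> y) * h y \<partial>lborel)
      = ennreal \<bar>\<sigma>\<bar> * (\<integral>\<^sup>+g. ennreal (normal_density 0 \<sigma> (0 + \<sigma> * g)) * h (0 + \<sigma> * g) \<partial>lborel)"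
    using \<sigma> by (intro nn_integral_real_affine) auto
  also have "\<dots> = (\<integral>\<^sup>+g. ennreal \<bar>\<sigma>\<bar> * (ennreal (normal_density 0 \<sigma> (0 + \<sigma> * g)) * h (0 + \<sigma> * g)) \<partial>lborel)"
    by (intro nn_integral_cmult[symmetric]) measurable
  also have "\<dots> = (\<integral>\<^sup>+g. ennreal (std_normal_density g) * h (\<sigma> * g) \<partial>lborel)"
  proof (intro nn_integral_cong)
    fix g :: real
    have "\<sigma> * normal_density 0 \<sigma> (\<sigma> * g) = std_normal_density g"
      using \<sigma> by (simp add: normal_density_def real_sqrt_mult power_mult_distrib field_simps)
    then have "ennreal \<bar>\<sigma>\<bar> * ennreal (normal_density 0 \<sigma> (\<sigma> * g)) = ennreal (std_normal_density g)"
      using \<sigma> by (simp add: ennreal_mult[symmetric])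
    then show "ennreal \<bar>\<sigma>\<bar> * (ennreal (normal_density 0 \<sigma> (0 + \<sigma> * g)) * h (0 + \<sigma> * g))
        = ennreal (std_normal_density g) * h (\<sigma> * g)"
      by (simp add: mult.assoc[symmetric])
  qed
  finally show ?thesis by (simp add: nn_integral_std_normal)
qed

lemma nn_integral_std_normal_conv:
  assumes h[measurable]: "h \<in> borel_measurable borel" and st: "0 \<le> \<sigma>" "0 \<le> \<tau>"
  shows "(\<integral>\<^sup>+g. (\<integral>\<^sup>+g'. h (\<sigma> * g + \<tau> * g') \<partial>std_normal_distribution) \<partial>std_normal_distribution)
     = (\<integral>\<^sup>+g. h (sqrt (\<sigma>\<^sup>2 + \<tau>\<^sup>2) * g) \<partial>std_normal_distribution)"
proof -
  interpret N: prob_space std_normal_distribution by (rule prob_space_normal_density) simp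
  show ?thesis
  proof (cases "\<sigma> = 0 \<or> \<tau> = 0")
    case True
    then show ?thesis using st N.emeasure_space_1 by auto
  next
    case False
    then have pos: "0 < \<sigma>" "0 < \<tau>" using st by auto
    then have s: "0 < sqrt (\<sigma>\<^sup>2 + \<tau>\<^sup>2)" by (simp add: sum_power2_gt_zero_iff)
    have "(\<integral>\<^sup>+g. (\<integral>\<^sup>+g'. h (\<sigma> * g + \<tau> * g') \<partial>std_normal_distribution) \<partial>std_normal_distribution)
        = (\<integral>\<^sup>+y. ennreal (normal_density 0 \<sigma> y) * (\<integral>\<^sup>+g'. h (y + \<tau> * g') \<partial>std_normal_distribution) \<partial>lborel)"
      using pos by (intro nn_integral_std_normal_scale[where h = "\<lambda>y. \<integral>\<^sup>+g'. h (y + \<tau> * g') \<partial>std_normal_distribution"]) measurable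
    also have "\<dots> = (\<integral>\<^sup>+y. (\<integral>\<^sup>+z. ennreal (normal_density 0 \<sigma> y * normal_density 0 \<tau> (z - y)) * h z \<partial>lborel) \<partial>lborel)"
    proof (intro nn_integral_cong)
      fix y :: real
      have "(\<integral>\<^sup>+g'. h (y + \<tau> * g') \<partial>std_normal_distribution)
          = (\<integral>\<^sup>+w. ennreal (normal_density 0 \<tau> w) * h (y + w) \<partial>lborel)"
        using pos by (intro nn_integral_std_normal_scale[where h = "\<lambda>w. h (y + w)"]) measurable
      also have "\<dots> = ennreal \<bar>1\<bar> * (\<integral>\<^sup>+z. ennreal (normal_density 0 \<tau> (- y + 1 * z)) * h (y + (- y + 1 * z)) \<partial>lborel)"
        by (intro nn_integral_real_affine) auto
      finally have "(\<integral>\<^sup>+g'. h (y + \<tau> * g') \<partial>std_normal_distribution)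
          = (\<integral>\<^sup>+z. ennreal (normal_density 0 \<tau> (z - y)) * h z \<partial>lborel)" by (simp add: algebra_simps)
      then show "ennreal (normal_density 0 \<sigma> y) * (\<integral>\<^sup>+g'. h (y + \<tau> * g') \<partial>std_normal_distribution)
          = (\<integral>\<^sup>+z. ennreal (normal_density 0 \<sigma> y * normal_density 0 \<tau> (z - y)) * h z \<partial>lborel)"
        by (simp add: nn_integral_cmult[symmetric] ennreal_mult mult.assoc)
    qed
    also have "\<dots> = (\<integral>\<^sup>+z. (\<integral>\<^sup>+y. ennreal (normal_density 0 \<sigma> y * normal_density 0 \<tau> (z - y)) * h z \<partial>lborel) \<partial>lborel)"
      by (rule lborel_pair.Fubini'[symmetric]) measurable
    also have "\<dots> = (\<integral>\<^sup>+z. ennreal (normal_density 0 (sqrt (\<sigma>\<^sup>2 + \<tau>\<^sup>2)) z) * h z \<partial>lborel)"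
    proof (intro nn_integral_cong)
      fix z :: real
      have "(\<integral>\<^sup>+y. ennreal (normal_density 0 \<sigma> y * normal_density 0 \<tau> (z - y)) \<partial>lborel)
          = normal_density 0 (sqrt (\<sigma>\<^sup>2 + \<tau>\<^sup>2)) z"
        using fun_cong[OF conv_normal_density_zero_mean[OF pos(2,1)], of z] by (simp add: mult.commute add.commute)
      then show "(\<integral>\<^sup>+y. ennreal (normal_density 0 \<sigma> y * normal_density 0 \<tau> (z - y)) * h z \<partial>lborel)
          = ennreal (normal_density 0 (sqrt (\<sigma>\<^sup>2 + \<tau>\<^sup>2)) z) * h z"
        by (simp add: nn_integral_multc)
    qed
    also have "\<dots> = (\<integral>\<^sup>+g. h (sqrt (\<sigma>\<^sup>2 + \<tau>\<^sup>2) * g) \<partial>std_normal_distribution)"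
      using s by (intro nn_integral_std_normal_scale[symmetric]) auto
    finally show ?thesis .
  qed
qed

lemma nn_integral_std_normal_uminus:
  assumes [measurable]: "h \<in> borel_measurable borel"
  shows "(\<integral>\<^sup>+g. h (- g) \<partial>std_normal_distribution) = (\<integral>\<^sup>+g. h g \<partial>std_normal_distribution)"
proof -
  have "(\<integral>\<^sup>+g. ennreal (std_normal_density g) * h g \<partial>lborel)
      = ennreal \<bar>-1\<bar> * (\<integral>\<^sup>+g. ennreal (std_normal_density (0 + (-1) * g)) * h (0 + (-1) * g) \<partial>lborel)"
    by (intro nn_integral_real_affine) auto
  also have "\<dots> = (\<integral>\<^sup>+g. ennreal (std_normal_density g) * h (- g) \<partial>lborel)"
    by (simp add: std_normal_density_def)
  finally show ?thesis by (simp add: nn_integral_std_normal)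
qed

lemma integrable_std_normal_abs_powr:
  assumes p: "0 \<le> p"
  shows "integrable std_normal_distribution (\<lambda>g. \<bar>x + t * g\<bar> powr p)"
proof -
  interpret N: prob_space std_normal_distribution by (rule prob_space_normal_density) simp
  define n where "n = nat \<lceil>p\<rceil>"
  have n: "p \<le> real (2 * n)" using p unfolding n_def by linarith
  show ?thesis
  proof (rule Bochner_Integration.integrable_bound)
    show "integrable std_normal_distribution (\<lambda>g. 1 + 2 ^ (2 * n) * (x ^ (2 * n) + t ^ (2 * n) * g ^ (2 * n)))"
      using std_normal_distribution_even_moments(2)[of n] by auto
    show "AE g in std_normal_distribution. norm (\<bar>x + t * g\<bar> powr p)
        \<le> norm (1 + 2 ^ (2 * n) * (x ^ (2 * n) + t ^ (2 * n) * g ^ (2 * n)))"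
    proof (rule AE_I2)
      fix g :: real
      let ?y = "\<bar>x + t * g\<bar>"
      have "?y powr p \<le> 1 + ?y ^ (2 * n)"
      proof (cases "?y \<le> 1")
        case True
        then have "?y powr p \<le> 1" using p by (intro powr_le1) auto
        then show ?thesis by (simp add: add_increasing2)
      next
        case False
        then have "?y powr p \<le> ?y powr real (2 * n)" using n by (intro powr_mono) auto
        also have "\<dots> = ?y ^ (2 * n)" using False by (intro powr_realpow) auto
        finally show ?thesis by simp
      qed
      also have "?y ^ (2 * n) \<le> 2 ^ (2 * n) * (x ^ (2 * n) + t ^ (2 * n) * g ^ (2 * n))"
      proof -
        have "?y ^ (2 * n) \<le> (2 * max \<bar>x\<bar> \<bar>t * g\<bar>) ^ (2 * n)" by (intro power_mono) auto
        also have "\<dots> = 2 ^ (2 * n) * (max \<bar>x\<bar> \<bar>t * g\<bar>) ^ (2 * n)" by (rule power_mult_distrib)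
        also have "(max \<bar>x\<bar> \<bar>t * g\<bar>) ^ (2 * n) \<le> \<bar>x\<bar> ^ (2 * n) + \<bar>t * g\<bar> ^ (2 * n)"
          by (cases "\<bar>x\<bar> \<le> \<bar>t * g\<bar>") (simp_all add: max_def)
        finally show ?thesis by (simp add: power_mult_distrib power_even_abs)
      qed
      finally show "norm (?y powr p) \<le> norm (1 + 2 ^ (2 * n) * (x ^ (2 * n) + t ^ (2 * n) * g ^ (2 * n)))"
        by simp
    qed
  qed measurable
qed

section \<open>Absolute moments of the standard Gaussian\<close>

definition gauss_moment :: "real \<Rightarrow> real" where
  "gauss_moment p = (LINT g|std_normal_distribution. \<bar>g\<bar> powr p)"

lemma gauss_moment_nonneg: "0 \<le> gauss_moment p"
  unfolding gauss_moment_def by (intro integral_nonneg_AE) auto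

lemma nn_integral_gauss_moment:
  assumes "0 \<le> p"
  shows "(\<integral>\<^sup>+g. ennreal (\<bar>t * g\<bar> powr p) \<partial>std_normal_distribution) = ennreal (\<bar>t\<bar> powr p * gauss_moment p)"
proof -
  have "(\<integral>\<^sup>+g. ennreal (\<bar>t * g\<bar> powr p) \<partial>std_normal_distribution)
      = ennreal (LINT g|std_normal_distribution. \<bar>t * g\<bar> powr p)"
    using integrable_std_normal_abs_powr[OF assms, of 0 t] by (intro nn_integral_eq_integral) auto
  then show ?thesis by (simp add: abs_powr_mult gauss_moment_def)
qed

lemma nn_integral_gauss_tail:
  "(\<integral>\<^sup>+t. ennreal (t * std_normal_density t) * indicator {0..} (t - \<bar>x\<bar>) \<partial>lborel) = ennreal (std_normal_density x)"
proof -
  have "(\<integral>\<^sup>+t. ennreal (t * std_normal_density t) * indicator {0..} (t - \<bar>x\<bar>) \<partial>lborel)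
      = (\<integral>\<^sup>+t. ennreal (t * std_normal_density t) * indicator {\<bar>x\<bar>..} t \<partial>lborel)"
    by (intro nn_integral_cong) (auto split: split_indicator)
  also have "(\<integral>\<^sup>+t. ennreal (t * std_normal_density t) * indicator {\<bar>x\<bar>..} t \<partial>lborel)
      = ennreal (0 - (- std_normal_density \<bar>x\<bar>))"
  proof (rule nn_integral_FTC_atLeast)
    fix t assume "\<bar>x\<bar> \<le> t"
    show "((\<lambda>t. - std_normal_density t) has_real_derivative t * std_normal_density t) (at t)"
    proof -
      have "((\<lambda>t. - (c * exp (- t\<^sup>2 / 2))) has_real_derivative t * (c * exp (- t\<^sup>2 / 2))) (at t)" for c :: real
        by (auto intro!: derivative_eq_intros)
      then show ?thesis unfolding std_normal_density_def .
    qed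
    show "0 \<le> t * std_normal_density t" using \<open>\<bar>x\<bar> \<le> t\<close> by (intro mult_nonneg_nonneg) auto
  next
    have "((\<lambda>t::real. exp (- (t\<^sup>2 / 2))) \<longlongrightarrow> 0) at_top"
      by (rule filterlim_compose[OF exp_at_bot])
        (intro filterlim_uminus_at_bot_at_top[THEN filterlim_compose] filterlim_at_top_mono[OF filterlim_ident]
          eventually_at_top_linorderI[of 2]; simp add: power2_eq_square)
    then have "((\<lambda>t::real. - (1 / sqrt (2 * pi) * exp (- (t\<^sup>2 / 2)))) \<longlongrightarrow> - (1 / sqrt (2 * pi) * 0)) at_top"
      by (intro tendsto_intros)
    then show "((\<lambda>t. - std_normal_density t) \<longlongrightarrow> 0) at_top"
      by (simp add: std_normal_density_def)
  qed measurable
  finally show ?thesis by (simp add: std_normal_density_def)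
qed

text \<open>Integration by parts, in the form of Tonelli applied to \<open>\<phi> x = \<integral>\<^bsub>t \<ge> \<bar>x\<bar>\<^esub> t \<phi> t\<close>.\<close>

lemma gauss_moment_rec:
  assumes p: "2 < p"
  shows "gauss_moment p = (p - 1) * gauss_moment (p - 2)"
proof -
  let ?\<phi> = std_normal_density
  have "ennreal ((p - 1) * gauss_moment (p - 2)) = ennreal (p - 1) * (\<integral>\<^sup>+x. ennreal (\<bar>1 * x\<bar> powr (p - 2)) \<partial>std_normal_distribution)"
    using p nn_integral_gauss_moment[of "p - 2" 1] by (simp add: ennreal_mult gauss_moment_nonneg)
  also have "\<dots> = (\<integral>\<^sup>+x. ennreal ((p - 1) * \<bar>x\<bar> powr (p - 2)) * ennreal (?\<phi> x) \<partial>lborel)"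
    using p by (simp add: nn_integral_std_normal nn_integral_cmult[symmetric] ennreal_mult mult_ac)
  also have "\<dots> = (\<integral>\<^sup>+x. (\<integral>\<^sup>+t. ennreal ((p - 1) * \<bar>x\<bar> powr (p - 2)) * (ennreal (t * ?\<phi> t) * indicator {0..} (t - \<bar>x\<bar>)) \<partial>lborel) \<partial>lborel)"
    unfolding nn_integral_gauss_tail[symmetric] by (intro nn_integral_cong nn_integral_cmult[symmetric]) measurable
  also have "\<dots> = (\<integral>\<^sup>+t. (\<integral>\<^sup>+x. ennreal ((p - 1) * \<bar>x\<bar> powr (p - 2)) * (ennreal (t * ?\<phi> t) * indicator {0..} (t - \<bar>x\<bar>)) \<partial>lborel) \<partial>lborel)"
    by (rule lborel_pair.Fubini'[symmetric]) measurable
  also have "\<dots> = (\<integral>\<^sup>+t. 2 * (ennreal (?\<phi> t) * ennreal (\<bar>t\<bar> powr p) * indicator {0..} t) \<partial>lborel)"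
  proof (intro nn_integral_cong)
    fix t :: real
    show "(\<integral>\<^sup>+x. ennreal ((p - 1) * \<bar>x\<bar> powr (p - 2)) * (ennreal (t * ?\<phi> t) * indicator {0..} (t - \<bar>x\<bar>)) \<partial>lborel)
        = 2 * (ennreal (?\<phi> t) * ennreal (\<bar>t\<bar> powr p) * indicator {0..} t)"
    proof (cases "0 \<le> t")
      case True
      have "(\<integral>\<^sup>+x. ennreal ((p - 1) * \<bar>x\<bar> powr (p - 2)) * (ennreal (t * ?\<phi> t) * indicator {0..} (t - \<bar>x\<bar>)) \<partial>lborel)
          = (\<integral>\<^sup>+x. ennreal (t * ?\<phi> t) * (ennreal ((p - 1) * \<bar>x\<bar> powr (p - 1 - 1)) * indicator {-t..t} x) \<partial>lborel)"
        by (intro nn_integral_cong) (auto simp: mult_ac split: split_indicator)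
      also have "\<dots> = ennreal (t * ?\<phi> t) * (\<integral>\<^sup>+x. ennreal ((p - 1) * \<bar>x\<bar> powr (p - 1 - 1)) * indicator {-t..t} x \<partial>lborel)"
        by (intro nn_integral_cmult) measurable
      also have "(\<integral>\<^sup>+x. ennreal ((p - 1) * \<bar>x\<bar> powr (p - 1 - 1)) * indicator {-t..t} x \<partial>lborel)
          = ennreal (signed_powr (p - 1) t - signed_powr (p - 1) (- t))"
        using p True by (intro nn_integral_FTC_Icc DERIV_signed_powr) auto
      also have "signed_powr (p - 1) t - signed_powr (p - 1) (- t) = 2 * t powr (p - 1)"
        using True by (simp add: signed_powr_def sgn_if)
      also have "ennreal (t * ?\<phi> t) * ennreal (2 * t powr (p - 1)) = ennreal (2 * (?\<phi> t * \<bar>t\<bar> powr p))"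
        using True by (cases "t = 0") (auto simp: ennreal_mult[symmetric] powr_diff field_simps)
      finally show ?thesis using True by (simp add: ennreal_mult)
    next
      case False
      then show ?thesis by (auto intro!: nn_integral_0_iff_AE[THEN iffD2] split: split_indicator)
    qed
  qed
  also have "\<dots> = 2 * (\<integral>\<^sup>+t\<in>{0..}. (ennreal (?\<phi> t) * ennreal (\<bar>t\<bar> powr p)) \<partial>lborel)"
    by (intro nn_integral_cmult) measurable
  also have "\<dots> = (\<integral>\<^sup>+t. ennreal (?\<phi> t) * ennreal (\<bar>t\<bar> powr p) \<partial>lborel)"
    by (intro nn_integral_even_function[symmetric]) (auto simp: std_normal_density_def)
  also have "\<dots> = ennreal (gauss_moment p)"
    using p nn_integral_gauss_moment[of p 1] by (simp add: nn_integral_std_normal)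
  finally show ?thesis using p by (simp add: gauss_moment_nonneg)
qed

lemma gauss_moment_3: "gauss_moment 3 = 2 * sqrt (2 / pi)"
  using std_normal_distribution_odd_moments_abs[of 1]
  by (simp add: gauss_moment_def numeral_3_eq_3)

text \<open>Jensen's inequality with E g^2 = 1: |g|^q lies above 1 + (q / 2) (g^2 - 1), the tangent
  at 1 in the variable g^2.\<close>

lemma gauss_moment_ge_1:
  assumes q: "2 \<le> q"
  shows "1 \<le> gauss_moment q"
proof -
  interpret N: prob_space std_normal_distribution by (rule prob_space_normal_density) simp
  have i2: "integrable std_normal_distribution (\<lambda>g::real. g\<^sup>2)" "(LINT g|std_normal_distribution. g\<^sup>2) = 1"
    using std_normal_distribution_even_moments[of 1] by simp_all
  have "1 + q / 2 * (g\<^sup>2 - 1) \<le> \<bar>g\<bar> powr q" for g :: real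
  proof -
    define s where "s = \<bar>g\<bar> powr q"
    have "s powr (2 / q) = \<bar>g\<bar> powr 2" unfolding s_def powr_powr using q by simp
    then have "g\<^sup>2 = s powr (2 / q)" by simp
    also have "\<dots> \<le> 1 + (2 / q) * (s - 1)" using q by (intro powr_le_tangent_at_1) (auto simp: s_def)
    finally have "q / 2 * (g\<^sup>2 - 1) \<le> q / 2 * ((2 / q) * (s - 1))"
      using q by (intro mult_left_mono) auto
    then show ?thesis using q by (simp add: s_def)
  qed
  then have "(LINT g|std_normal_distribution. 1 + q / 2 * (g\<^sup>2 - 1)) \<le> gauss_moment q"
    unfolding gauss_moment_def using i2 integrable_std_normal_abs_powr[of q 0 1] q
    by (intro integral_mono) auto
  moreover have "(LINT g|std_normal_distribution. 1 + q / 2 * (g\<^sup>2 - 1)) = 1"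
    using i2 N.prob_space by simp
  ultimately show ?thesis by simp
qed

lemma gauss_moment_pos: "2 \<le> q \<Longrightarrow> 0 < gauss_moment q"
  using gauss_moment_ge_1[of q] by simp

text \<open>On \<open>[3, 5]\<close> convexity of \<open>q \<mapsto> (\<bar>g\<bar> / 2) powr q\<close> interpolates between the third and fifth moments,
  which have the same normalized value.\<close>

lemma gauss_moment_le_base:
  assumes p: "3 \<le> p" "p \<le> 5"
  shows "gauss_moment p \<le> (p / 2) powr (p / 2)"
proof -
  define u where "u = (5 - p) / 2"
  have u: "0 \<le> u" "0 \<le> 1 - u" "p = u * 3 + (1 - u) * 5" using p by (auto simp: u_def field_simps)
  have pt: "\<bar>g\<bar> powr p \<le> 2 powr p * (u * (\<bar>g\<bar> powr 3 / 8) + (1 - u) * (\<bar>g\<bar> powr 5 / 32))" for g :: real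
  proof (cases "g = 0")
    case False
    let ?a = "\<bar>g\<bar> / 2"
    have "?a powr p = (?a powr 3) powr u * (?a powr 5) powr (1 - u)"
      unfolding powr_powr powr_add[symmetric] using u(3) by (simp add: mult.commute)
    also have "\<dots> \<le> u * ?a powr 3 + (1 - u) * ?a powr 5"
      using u False by (intro Youngs_inequality_0) auto
    also have "\<dots> = u * (\<bar>g\<bar> powr 3 / 8) + (1 - u) * (\<bar>g\<bar> powr 5 / 32)"
      by (simp add: powr_divide)
    finally show ?thesis by (simp add: powr_divide divide_le_eq mult.commute)
  qed (use u in simp)
  have i: "integrable std_normal_distribution (\<lambda>g. \<bar>g\<bar> powr q)" if "0 \<le> q" for q
    using integrable_std_normal_abs_powr[OF that, of 0 1] by simp
  have "gauss_moment p \<le> (LINT g|std_normal_distribution.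
      2 powr p * (u * (\<bar>g\<bar> powr 3 / 8) + (1 - u) * (\<bar>g\<bar> powr 5 / 32)))"
    unfolding gauss_moment_def using p pt
    by (intro integral_mono integrable_mult_right Bochner_Integration.integrable_add integrable_divide i) auto
  also have "\<dots> = 2 powr p * (u * (gauss_moment 3 / 8) + (1 - u) * (gauss_moment 5 / 32))"
    using i[of 3] i[of 5] by (simp add: gauss_moment_def)
  also have "gauss_moment 5 = 4 * gauss_moment 3" using gauss_moment_rec[of 5] by simp
  also have "2 powr p * (u * (gauss_moment 3 / 8) + (1 - u) * (4 * gauss_moment 3 / 32)) = 2 powr (p - 3) * gauss_moment 3"
    by (simp add: powr_diff field_simps)
  finally have 1: "gauss_moment p \<le> 2 powr (p - 3) * gauss_moment 3" .
  \<comment> \<open>The left-hand side equals 8 / pi, so pi > 3 suffices because 8 / 3 \<le> 27 /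
    8.\<close>
  have "gauss_moment 3 powr 2 \<le> (3 / 2) powr 3"
    using pi_gt3 by (simp add: gauss_moment_3 power_mult_distrib field_simps)
  then have "(gauss_moment 3 powr 2) powr (1 / 2) \<le> ((3 / 2) powr 3) powr (1 / 2)"
    by (intro powr_mono2) auto
  then have 2: "gauss_moment 3 \<le> (3 / 2) powr (3 / 2)"
    unfolding powr_powr using gauss_moment_pos[of 3] by simp
  \<comment> \<open>It remains to compare (p - 3) ln 2 + (3 / 2) ln (3 / 2) with (p / 2) ln (p / 2).
    The latter is convex in p and lies above its tangent at p = 3, so a comparison of slopes is
    enough: 2 ln 2 \<le> ln (3 / 2) + 1, that is, 8 / 3 \<le> e.\<close>
  have "ln (3 / p) \<le> 3 / p - 1" using p by (intro ln_le_minus_one) auto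
  then have "ln (3 / 2) - ln (p / 2) \<le> 3 / p - 1" using p by (simp add: ln_div)
  then have "p / 2 * (ln (3 / 2) + 1 - 3 / p) \<le> p / 2 * ln (p / 2)" using p by (intro mult_left_mono) auto
  moreover have "p / 2 * (ln (3 / 2) + 1 - 3 / p) = p / 2 * ln (3 / 2) + (p - 3) / 2" using p by (simp add: field_simps)
  moreover have "2 * ln 2 \<le> ln (3 / 2 :: real) + 1"
  proof -
    have "(8 / 3 :: real) \<le> exp 1"
    proof -
      have "5837465777 / 2147483648 - inverse (2 ^ 32) \<le> (exp 1 :: real)"
        using e_approx_32 by (simp only: abs_le_iff) linarith
      moreover have "(8 / 3 :: real) \<le> 5837465777 / 2147483648 - inverse (2 ^ 32)" by simp
      ultimately show ?thesis by linarith
    qed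
    then have "ln (8 / 3 :: real) \<le> ln (exp 1)" by (subst ln_le_cancel_iff) auto
    then have "ln (8 / 3 :: real) \<le> 1" by simp
    moreover have "ln (8 / 3 :: real) = 2 * ln 2 - ln (3 / 2)"
    proof -
      have "ln (8 / 3 :: real) = ln (2 * 2 / (3 / 2))" by simp
      also have "\<dots> = ln (2 * 2) - ln (3 / 2)" by (rule ln_divide_pos) auto
      also have "ln (2 * 2 :: real) = 2 * ln 2" using ln_mult_pos[of 2 "2 :: real"] by (simp only: mult_2)
      finally show ?thesis .
    qed
    ultimately show ?thesis by simp
  qed
  then have "(p - 3) / 2 * (2 * ln 2) \<le> (p - 3) / 2 * (ln (3 / 2) + 1)" using p by (intro mult_left_mono) auto
  ultimately have "(p - 3) * ln 2 + 3 / 2 * ln (3 / 2) \<le> p / 2 * ln (p / 2)" by (simp add: field_simps)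
  then have "2 powr (p - 3) * (3 / 2) powr (3 / 2) \<le> (p / 2) powr (p / 2)"
    using p by (simp add: powr_def exp_add[symmetric])
  moreover have "2 powr (p - 3) * gauss_moment 3 \<le> 2 powr (p - 3) * (3 / 2) powr (3 / 2)"
    using 2 by (intro mult_left_mono) auto
  ultimately show ?thesis using 1 by linarith
qed

text \<open>After a p-th root this is \<gamma>_p \<le> sqrt (p / 2). In the step from q = p - 2 to p
  the moment grows by the factor q + 1 and the bound by at least q + 2, since (1 + 2 / q)^(q / 2)
  \<ge> 2 by Bernoulli's inequality.\<close>

lemma gauss_moment_le:
  assumes "3 \<le> p"
  shows "gauss_moment p \<le> (p / 2) powr (p / 2)"
proof -
  have "gauss_moment p \<le> (p / 2) powr (p / 2)" if "3 \<le> p" "p \<le> 5 + 2 * real n" for n p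
    using that
  proof (induction n arbitrary: p)
    case 0
    then show ?case using gauss_moment_le_base by simp
  next
    case (Suc n)
    show ?case
    proof (cases "p \<le> 5")
      case True then show ?thesis using gauss_moment_le_base Suc.prems by simp
    next
      case False
      define q where "q = p - 2"
      have q: "3 \<le> q" "p = q + 2" using False by (auto simp: q_def)
      have IH: "gauss_moment q \<le> (q / 2) powr (q / 2)" using Suc.prems False by (intro Suc.IH) (auto simp: q_def)
      have "((q + 2) / q) powr (q / 2) \<ge> 2"
      proof -
        define s where "s = ((q + 2) / q) powr (q / 2)"
        have "s powr (2 / q) = (q + 2) / q" using q unfolding s_def powr_powr by simp
        moreover have "s powr (2 / q) \<le> 1 + (2 / q) * (s - 1)"
          using q by (intro powr_le_tangent_at_1) (auto simp: s_def)
        ultimately have "(q + 2) / q \<le> 1 + (2 / q) * (s - 1)" by simp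
        then have "2 / q \<le> (2 / q) * (s - 1)" using q by (simp add: add_divide_distrib)
        then show ?thesis using q by (simp add: s_def field_simps)
      qed
      then have "2 * (q / 2) powr (q / 2) \<le> ((q + 2) / q) powr (q / 2) * (q / 2) powr (q / 2)"
        by (intro mult_right_mono) auto
      also have "\<dots> = ((q + 2) / 2) powr (q / 2)" using q by (simp add: powr_mult[symmetric])
      finally have "(q + 2) / 2 * (2 * (q / 2) powr (q / 2)) \<le> (q + 2) / 2 * ((q + 2) / 2) powr (q / 2)"
        using q by (intro mult_left_mono) auto
      also have "\<dots> = ((q + 2) / 2) powr (q / 2 + 1)" using q by (simp add: powr_add)
      also have "\<dots> = (p / 2) powr (p / 2)" by (simp add: q(2) add_divide_distrib)
      finally have *: "(q + 2) * (q / 2) powr (q / 2) \<le> (p / 2) powr (p / 2)" by simp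
      have "gauss_moment p = (q + 1) * gauss_moment q" using gauss_moment_rec[of p] q by simp
      also have "\<dots> \<le> (q + 2) * (q / 2) powr (q / 2)"
        using q IH gauss_moment_nonneg by (intro mult_mono) auto
      finally show ?thesis using * by simp
    qed
  qed
  moreover have "p \<le> 5 + 2 * real (nat \<lceil>p\<rceil>)" using assms by linarith
  ultimately show ?thesis using assms by blast
qed

section \<open>Replacing a sign by a Gaussian of the same variance\<close>

definition gauss_shift :: "real \<Rightarrow> real \<Rightarrow> real \<Rightarrow> real" where
  "gauss_shift p t x = (LINT g|std_normal_distribution. \<bar>x + t * g\<bar> powr p)"

lemma nn_integral_gauss_shift:
  "0 \<le> p \<Longrightarrow> (\<integral>\<^sup>+g. ennreal (\<bar>x + t * g\<bar> powr p) \<partial>std_normal_distribution) = ennreal (gauss_shift p t x)"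
  unfolding gauss_shift_def by (intro nn_integral_eq_integral integrable_std_normal_abs_powr) auto

lemma gauss_shift_nonneg: "0 \<le> gauss_shift p t x"
  unfolding gauss_shift_def by (intro integral_nonneg_AE) auto

lemma gauss_shift_0: "gauss_shift p 0 x = \<bar>x\<bar> powr p"
proof -
  interpret N: prob_space std_normal_distribution by (rule prob_space_normal_density) simp
  show ?thesis using N.prob_space by (simp add: gauss_shift_def)
qed

lemma gauss_shift_at_0: "gauss_shift p t 0 = \<bar>t\<bar> powr p * gauss_moment p"
  by (simp add: gauss_shift_def gauss_moment_def abs_powr_mult)

lemma gauss_shift_uminus:
  assumes "0 \<le> p" shows "gauss_shift p (- t) x = gauss_shift p t x"
proof -
  have "ennreal (gauss_shift p (- t) x) = ennreal (gauss_shift p t x)"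
    using nn_integral_std_normal_uminus[of "\<lambda>g. ennreal (\<bar>x + t * g\<bar> powr p)"]
    by (simp add: nn_integral_gauss_shift[OF assms, symmetric])
  then show ?thesis using gauss_shift_nonneg by simp
qed

text \<open>Above 4, three times the fourth-order coefficient in \<open>sym_mean_le_4_6\<close>,
  where 3 is the fourth moment of a standard Gaussian. Up to 4 the estimate has no such
  term.\<close>

definition taylor_const :: "real \<Rightarrow> real" where
  "taylor_const p = (if p \<le> 4 then 0 else p * (p - 1) * (p - 2) * (p - 3) / 8)"

lemma taylor_const_nonneg: "0 \<le> taylor_const p"
  by (simp add: taylor_const_def)

text \<open>The upper Taylor estimate is averaged over the Gaussian and the lower one is used for
  the sign. Equal variances make the terms up to second order agree; what is left is the moment of b
  g and, above p = 4, the fourth-order term.\<close>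

lemma gauss_shift_le_sym_mean:
  assumes p: "3 \<le> p" "p \<le> 5" and b: "0 \<le> b"
  shows "gauss_shift p b x \<le> sym_mean p x b + gauss_moment p * b powr p + taylor_const p * b ^ 4 * \<bar>x\<bar> powr (p - 4)"
proof -
  interpret N: prob_space std_normal_distribution by (rule prob_space_normal_density) simp
  let ?N = std_normal_distribution
  have mom: "integrable ?N (\<lambda>g::real. g\<^sup>2)" "(LINT g|?N. g\<^sup>2) = 1"
    "integrable ?N (\<lambda>g::real. g ^ 4)" "(LINT g|?N. g ^ 4) = 3"
    using std_normal_distribution_even_moments[of 1] std_normal_distribution_even_moments[of 2]
    by (simp_all add: fact_numeral)
  have ip: "integrable ?N (\<lambda>g. \<bar>g\<bar> powr p)"
    using p integrable_std_normal_abs_powr[of p 0 1] by simp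
  have i: "integrable ?N (\<lambda>g. \<bar>x + b * g\<bar> powr p)" "integrable ?N (\<lambda>g. \<bar>x - b * g\<bar> powr p)"
    using p integrable_std_normal_abs_powr[of p x b] integrable_std_normal_abs_powr[of p x "- b"] by simp_all
  have "gauss_shift p b x = (gauss_shift p b x + gauss_shift p (- b) x) / 2"
    using p by (simp add: gauss_shift_uminus)
  also have "\<dots> = (LINT g|?N. sym_mean p x (b * g))"
    using i by (simp add: gauss_shift_def sym_mean_def)
  also have "\<dots> \<le> (LINT g|?N. \<bar>x\<bar> powr p + p * (p - 1) / 2 * b\<^sup>2 * \<bar>x\<bar> powr (p - 2) * g\<^sup>2
      + taylor_const p / 3 * b ^ 4 * \<bar>x\<bar> powr (p - 4) * g ^ 4 + b powr p * \<bar>g\<bar> powr p)"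
  proof (intro integral_mono)
    fix g :: real
    have "sym_mean p x (b * g) \<le> \<bar>x\<bar> powr p + p * (p - 1) / 2 * (b * g)\<^sup>2 * \<bar>x\<bar> powr (p - 2)
      + taylor_const p / 3 * (b * g) ^ 4 * \<bar>x\<bar> powr (p - 4) + \<bar>b * g\<bar> powr p"
      using p sym_mean_le_2_4[of p x "b * g"] sym_mean_le_4_6[of p x "b * g"]
      by (cases "p \<le> 4") (simp_all add: taylor_const_def)
    then show "sym_mean p x (b * g) \<le> \<bar>x\<bar> powr p + p * (p - 1) / 2 * b\<^sup>2 * \<bar>x\<bar> powr (p - 2) * g\<^sup>2
      + taylor_const p / 3 * b ^ 4 * \<bar>x\<bar> powr (p - 4) * g ^ 4 + b powr p * \<bar>g\<bar> powr p"
      using b by (simp add: power_mult_distrib abs_powr_mult mult_ac)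
  qed (use i mom ip in \<open>auto simp: sym_mean_def\<close>)
  also have "\<dots> = \<bar>x\<bar> powr p + p * (p - 1) / 2 * b\<^sup>2 * \<bar>x\<bar> powr (p - 2)
      + taylor_const p * b ^ 4 * \<bar>x\<bar> powr (p - 4) + b powr p * gauss_moment p"
    using mom ip N.prob_space by (simp add: gauss_moment_def)
  also have "\<dots> \<le> sym_mean p x b + taylor_const p * b ^ 4 * \<bar>x\<bar> powr (p - 4) + b powr p * gauss_moment p"
    using sym_mean_ge[OF p(1), of x b] by simp
  finally show ?thesis by (simp add: mult.commute)
qed

text \<open>The previous estimate at x + t g, averaged over g. On the left, the two independent
  Gaussians of variances t^2 and b^2 merge into one.\<close>

lemma lindeberg_step:
  assumes p: "3 \<le> p" "p \<le> 5" and t: "0 \<le> t" and b: "0 \<le> b"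
  shows "gauss_shift p (sqrt (t\<^sup>2 + b\<^sup>2)) x \<le> (gauss_shift p t (x + b) + gauss_shift p t (x - b)) / 2
     + gauss_moment p * b powr p + taylor_const p * b ^ 4 * gauss_shift (p - 4) t x"
proof -
  interpret N: prob_space std_normal_distribution by (rule prob_space_normal_density) simp
  let ?N = std_normal_distribution
  let ?r = "\<lambda>g. sym_mean p (x + t * g) b + gauss_moment p * b powr p + taylor_const p * b ^ 4 * \<bar>x + t * g\<bar> powr (p - 4)"
  have i: "integrable ?N (\<lambda>g. \<bar>x + t * g\<bar> powr (p - 4))" if "4 \<le> p"
    using that by (intro integrable_std_normal_abs_powr) auto
  have i': "integrable ?N (\<lambda>g. taylor_const p * b ^ 4 * \<bar>x + t * g\<bar> powr (p - 4))"
    using i by (cases "p \<le> 4") (auto simp: taylor_const_def)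
  have s: "integrable ?N (\<lambda>g. \<bar>x + t * g + b\<bar> powr p)" "integrable ?N (\<lambda>g. \<bar>x + t * g - b\<bar> powr p)"
    using p integrable_std_normal_abs_powr[of p "x + b" t] integrable_std_normal_abs_powr[of p "x - b" t]
    by (simp_all add: algebra_simps)
  have ir: "integrable ?N ?r" using s i' by (auto simp: sym_mean_def)
  have "ennreal (gauss_shift p (sqrt (t\<^sup>2 + b\<^sup>2)) x)
      = (\<integral>\<^sup>+g. ennreal (\<bar>x + sqrt (t\<^sup>2 + b\<^sup>2) * g\<bar> powr p) \<partial>?N)"
    using p by (simp add: nn_integral_gauss_shift)
  also have "\<dots> = (\<integral>\<^sup>+g. (\<integral>\<^sup>+g'. ennreal (\<bar>x + (t * g + b * g')\<bar> powr p) \<partial>?N) \<partial>?N)"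
    using t b by (intro nn_integral_std_normal_conv[symmetric]) auto
  also have "\<dots> = (\<integral>\<^sup>+g. ennreal (gauss_shift p b (x + t * g)) \<partial>?N)"
    using p by (simp add: nn_integral_gauss_shift[symmetric] add.assoc)
  also have "\<dots> \<le> (\<integral>\<^sup>+g. ennreal (?r g) \<partial>?N)"
    using p b by (intro nn_integral_mono ennreal_leI gauss_shift_le_sym_mean) auto
  also have "\<dots> = ennreal (LINT g|?N. ?r g)"
    using ir p b by (intro nn_integral_eq_integral AE_I2) (auto intro!: add_nonneg_nonneg mult_nonneg_nonneg
        simp: sym_mean_def gauss_moment_nonneg taylor_const_nonneg)
  finally have le: "gauss_shift p (sqrt (t\<^sup>2 + b\<^sup>2)) x \<le> (LINT g|?N. ?r g)"
    using p b by (subst (asm) ennreal_le_iff) (auto intro!: integral_nonneg_AE add_nonneg_nonneg mult_nonneg_nonneg AE_I2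
        simp: sym_mean_def gauss_moment_nonneg taylor_const_nonneg)
  have "(LINT g|?N. ?r g) = (LINT g|?N. sym_mean p (x + t * g) b) + gauss_moment p * b powr p
      + (LINT g|?N. taylor_const p * b ^ 4 * \<bar>x + t * g\<bar> powr (p - 4))"
    using s i' N.prob_space by (subst Bochner_Integration.integral_add, auto simp: sym_mean_def)+
  also have "(LINT g|?N. sym_mean p (x + t * g) b) = (gauss_shift p t (x + b) + gauss_shift p t (x - b)) / 2"
    using s by (simp add: sym_mean_def gauss_shift_def algebra_simps)
  also have "(LINT g|?N. taylor_const p * b ^ 4 * \<bar>x + t * g\<bar> powr (p - 4)) = taylor_const p * b ^ 4 * gauss_shift (p - 4) t x"
    by (simp add: gauss_shift_def)
  finally show ?thesis using le by simp
qed

lemma powr_ge_tangent_at_1: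
  fixes t r :: real
  assumes "0 \<le> t" "1 \<le> r"
  shows "1 + r * (t - 1) \<le> t powr r"
proof -
  have "(t powr r) powr (1 / r) \<le> 1 + (1 / r) * (t powr r - 1)"
    using assms by (intro powr_le_tangent_at_1) auto
  then have "t \<le> 1 + (1 / r) * (t powr r - 1)" using assms by (simp add: powr_powr)
  then have "r * (t - 1) \<le> r * ((1 / r) * (t powr r - 1))" using assms by (intro mult_left_mono) auto
  then show ?thesis using assms by simp
qed

text \<open>The tangent at m of the convex map taking z to (max 0 z)^r. Averaging such an affine
  minorant gives Jensen's inequality in the random and in the discrete case.\<close>

lemma max_powr_ge_tangent:
  fixes z m r :: real
  assumes "0 < m" "1 \<le> r"
  shows "m powr r + r * m powr (r - 1) * (z - m) \<le> (max 0 z) powr r"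
proof -
  have e: "m powr r + r * m powr (r - 1) * (z - m) = m powr r * (1 + r * (z / m - 1))"
    using assms by (simp add: powr_diff field_simps)
  show ?thesis
  proof (cases "0 \<le> z")
    case True
    have "m powr r * (1 + r * (z / m - 1)) \<le> m powr r * (z / m) powr r"
      using assms True by (intro mult_left_mono powr_ge_tangent_at_1) auto
    also have "\<dots> = z powr r" using assms True by (simp add: powr_divide)
    finally show ?thesis using True by (simp add: e max_def)
  next
    case False
    then have "z / m \<le> 0" using assms by (simp add: divide_le_0_iff)
    then have "r * (z / m - 1) \<le> r * (- 1)" using assms by (intro mult_left_mono) auto
    then have "m powr r * (1 + r * (z / m - 1)) \<le> 0" using assms by (intro mult_nonneg_nonpos) auto
    then show ?thesis using False by (simp add: e max_def)
  qed
qed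

section \<open>Moments of Rademacher sums\<close>

text \<open>\<open>rad I b \<phi>\<close> is the expectation of \<open>\<phi> (\<Sum>i\<in>I. b i * \<epsilon> i)\<close> over independent random signs \<open>\<epsilon>\<close>; the set
  \<open>A\<close> collects the indices with a negative sign.\<close>

definition rad :: "'i set \<Rightarrow> ('i \<Rightarrow> real) \<Rightarrow> (real \<Rightarrow> real) \<Rightarrow> real" where
  "rad I b \<phi> = (\<Sum>A\<in>Pow I. \<phi> (\<Sum>i\<in>I. if i \<in> A then - b i else b i)) / 2 ^ card I"

lemma rad_empty [simp]: "rad {} b \<phi> = \<phi> 0"
  by (simp add: rad_def)

lemma rad_insert:
  assumes I: "finite I" "j \<notin> I"
  shows "rad (insert j I) b \<phi> = (rad I b (\<lambda>x. \<phi> (x + b j)) + rad I b (\<lambda>x. \<phi> (x - b j))) / 2"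
proof -
  let ?s = "\<lambda>A i. if i \<in> A then - b i else b i"
  have inj: "inj_on (insert j) (Pow I)" using I by (auto simp: inj_on_def)
  have "(\<Sum>A\<in>Pow (insert j I). \<phi> (\<Sum>i\<in>insert j I. ?s A i))
      = (\<Sum>A\<in>Pow I. \<phi> (\<Sum>i\<in>insert j I. ?s A i)) + (\<Sum>A\<in>insert j ` Pow I. \<phi> (\<Sum>i\<in>insert j I. ?s A i))"
    unfolding Pow_insert using I by (intro sum.union_disjoint) auto
  also have "(\<Sum>A\<in>Pow I. \<phi> (\<Sum>i\<in>insert j I. ?s A i)) = (\<Sum>A\<in>Pow I. \<phi> ((\<Sum>i\<in>I. ?s A i) + b j))"
    using I by (intro sum.cong refl arg_cong[where f = \<phi>]) auto
  also have "(\<Sum>A\<in>insert j ` Pow I. \<phi> (\<Sum>i\<in>insert j I. ?s A i)) = (\<Sum>A\<in>Pow I. \<phi> (\<Sum>i\<in>insert j I. ?s (insert j A) i))"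
    using inj by (simp add: sum.reindex)
  also have "\<dots> = (\<Sum>A\<in>Pow I. \<phi> ((\<Sum>i\<in>I. ?s A i) - b j))"
  proof (intro sum.cong refl arg_cong[where f = \<phi>])
    fix A
    have "(\<Sum>i\<in>I. ?s (insert j A) i) = (\<Sum>i\<in>I. ?s A i)" using I by (intro sum.cong) auto
    then show "(\<Sum>i\<in>insert j I. ?s (insert j A) i) = (\<Sum>i\<in>I. ?s A i) - b j" using I by simp
  qed
  finally show ?thesis using I by (simp add: rad_def add_divide_distrib)
qed

lemma rad_add: "rad I b (\<lambda>x. \<phi> x + \<psi> x) = rad I b \<phi> + rad I b \<psi>"
  by (simp add: rad_def sum.distrib add_divide_distrib)

lemma rad_cmult: "rad I b (\<lambda>x. c * \<phi> x) = c * rad I b \<phi>"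
  by (simp add: rad_def sum_distrib_left[symmetric])

lemma rad_half: "rad I b (\<lambda>x. (\<phi> x + \<psi> x) / 2) = (rad I b \<phi> + rad I b \<psi>) / 2"
  using rad_cmult[of I b "1 / 2" "\<lambda>x. \<phi> x + \<psi> x"] rad_add[of I b \<phi> \<psi>] by simp

lemma rad_insert':
  assumes "finite I" "j \<notin> I"
  shows "rad (insert j I) b \<phi> = rad I b (\<lambda>x. (\<phi> (x + b j) + \<phi> (x - b j)) / 2)"
  unfolding rad_insert[OF assms] rad_half ..

lemma rad_const: "finite I \<Longrightarrow> rad I b (\<lambda>_. c) = c"
  by (simp add: rad_def card_Pow)

lemma rad_mono: "(\<And>x. \<phi> x \<le> \<psi> x) \<Longrightarrow> rad I b \<phi> \<le> rad I b \<psi>"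
  by (auto simp: rad_def intro!: divide_right_mono sum_mono)

lemma rad_nonneg: "(\<And>x. 0 \<le> \<phi> x) \<Longrightarrow> 0 \<le> rad I b \<phi>"
  by (auto simp: rad_def intro!: divide_nonneg_nonneg sum_nonneg)

lemma rad_abs: "finite I \<Longrightarrow> rad I (\<lambda>i. \<bar>b i\<bar>) \<phi> = rad I b \<phi>"
proof (induction I arbitrary: \<phi> rule: finite_induct)
  case (insert j I)
  then show ?case by (cases "0 \<le> b j") (simp_all add: rad_insert add.commute)
qed simp

lemma rad_cong: "(\<And>i. i \<in> I \<Longrightarrow> b i = c i) \<Longrightarrow> rad I b \<phi> = rad I c \<phi>"
  unfolding rad_def by (intro arg_cong2[where f = "(/)"] sum.cong refl arg_cong[where f = \<phi>]) auto

lemma rad_square_shift: "finite I \<Longrightarrow> rad I b (\<lambda>x. (x + c)\<^sup>2) = c\<^sup>2 + (\<Sum>i\<in>I. (b i)\<^sup>2)"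
proof (induction I arbitrary: c rule: finite_induct)
  case (insert j I)
  have "rad (insert j I) b (\<lambda>x. (x + c)\<^sup>2)
      = (rad I b (\<lambda>x. (x + (c + b j))\<^sup>2) + rad I b (\<lambda>x. (x + (c - b j))\<^sup>2)) / 2"
    using insert.hyps by (simp add: rad_insert algebra_simps)
  also have "\<dots> = ((c + b j)\<^sup>2 + (c - b j)\<^sup>2) / 2 + (\<Sum>i\<in>I. (b i)\<^sup>2)"
    unfolding insert.IH by (simp add: add_divide_distrib)
  also have "((c + b j)\<^sup>2 + (c - b j)\<^sup>2) / 2 = c\<^sup>2 + (b j)\<^sup>2" by (simp add: power2_eq_square algebra_simps)
  finally show ?case using insert.hyps by simp
qed simp

lemma rad_square: "finite I \<Longrightarrow> rad I b (\<lambda>x. x\<^sup>2) = (\<Sum>i\<in>I. (b i)\<^sup>2)"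
  using rad_square_shift[of I b 0] by simp

text \<open>Discrete integration by parts: in E (S \<psi> S) each summand b_i \<epsilon>_i is
  treated separately, and averaging over \<epsilon>_i leaves half the difference of \<psi> at the
  two shifts of the sum without i.\<close>

lemma rad_times:
  "finite I \<Longrightarrow> rad I b (\<lambda>x. x * \<psi> x) = (\<Sum>i\<in>I. b i * rad (I - {i}) b (\<lambda>x. (\<psi> (x + b i) - \<psi> (x - b i)) / 2))"
proof (induction I arbitrary: \<psi> rule: finite_induct)
  case (insert j I)
  define \<psi>' where "\<psi>' x = (\<psi> (x + b j) + \<psi> (x - b j)) / 2" for x
  have "rad (insert j I) b (\<lambda>x. x * \<psi> x)
      = rad I b (\<lambda>x. ((x + b j) * \<psi> (x + b j) + (x - b j) * \<psi> (x - b j)) / 2)"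
    by (rule rad_insert'[OF insert.hyps])
  also have "\<dots> = rad I b (\<lambda>x. x * \<psi>' x + b j * ((\<psi> (x + b j) - \<psi> (x - b j)) / 2))"
    by (intro arg_cong[where f = "rad I b"])
      (auto simp: \<psi>'_def fun_eq_iff algebra_simps add_divide_distrib diff_divide_distrib)
  also have "\<dots> = rad I b (\<lambda>x. x * \<psi>' x) + b j * rad I b (\<lambda>x. (\<psi> (x + b j) - \<psi> (x - b j)) / 2)"
    unfolding rad_add rad_cmult ..
  also have "rad I b (\<lambda>x. x * \<psi>' x)
      = (\<Sum>i\<in>I. b i * rad (insert j I - {i}) b (\<lambda>x. (\<psi> (x + b i) - \<psi> (x - b i)) / 2))"
    unfolding insert.IH
  proof (intro sum.cong refl arg_cong[where f = "(*) (b i)" for i])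
    fix i assume i: "i \<in> I"
    have e: "insert j I - {i} = insert j (I - {i})" using i insert.hyps by auto
    have "rad (insert j (I - {i})) b (\<lambda>x. (\<psi> (x + b i) - \<psi> (x - b i)) / 2)
        = rad (I - {i}) b (\<lambda>x. ((\<psi> (x + b j + b i) - \<psi> (x + b j - b i)) / 2 + (\<psi> (x - b j + b i) - \<psi> (x - b j - b i)) / 2) / 2)"
      using insert.hyps by (intro rad_insert') auto
    also have "\<dots> = rad (I - {i}) b (\<lambda>x. (\<psi>' (x + b i) - \<psi>' (x - b i)) / 2)"
      by (intro arg_cong[where f = "rad (I - {i}) b"]) (auto simp: \<psi>'_def fun_eq_iff algebra_simps add_divide_distrib diff_divide_distrib)
    finally show "rad (I - {i}) b (\<lambda>x. (\<psi>' (x + b i) - \<psi>' (x - b i)) / 2)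
        = rad (insert j I - {i}) b (\<lambda>x. (\<psi> (x + b i) - \<psi> (x - b i)) / 2)" unfolding e ..
  qed
  finally show ?case using insert.hyps by (simp add: add.commute)
qed simp

text \<open>Jensen for the concave power q / 2. The sum of signs and Gaussian has second moment at
  most V, and the tangent of the power at V, being affine in the square, is averaged exactly. This
  bounds the fourth-order error terms of the Lindeberg argument.\<close>

lemma rad_gauss_shift_le:
  assumes I: "finite I" and V: "0 < V" "t\<^sup>2 + (\<Sum>i\<in>I. (b i)\<^sup>2) \<le> V" and q: "0 < q" "q \<le> 1"
  shows "rad I b (gauss_shift q t) \<le> V powr (q / 2)"
proof -
  interpret N: prob_space std_normal_distribution by (rule prob_space_normal_density) simp
  let ?N = std_normal_distribution
  have mom: "integrable ?N (\<lambda>g::real. g\<^sup>2)" "(LINT g|?N. g\<^sup>2) = 1"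
    "integrable ?N (\<lambda>g::real. g)" "(LINT g|?N. g) = 0"
    using std_normal_distribution_even_moments[of 1] integrable_std_normal_distribution_moment[of 1]
      integral_std_normal_distribution_moment_odd[of 1] by simp_all
  let ?c = "V powr (q / 2)"
  have "gauss_shift q t x \<le> ?c * (1 + q / 2 * ((x\<^sup>2 + t\<^sup>2) / V - 1))" for x
  proof -
    have "gauss_shift q t x \<le> (LINT g|?N. ?c * (1 + q / 2 * ((x\<^sup>2 + 2 * x * t * g + t\<^sup>2 * g\<^sup>2) / V - 1)))"
      unfolding gauss_shift_def
    proof (rule integral_mono)
      show "integrable ?N (\<lambda>g. \<bar>x + t * g\<bar> powr q)" using q by (intro integrable_std_normal_abs_powr) auto
      show "integrable ?N (\<lambda>g. ?c * (1 + q / 2 * ((x\<^sup>2 + 2 * x * t * g + t\<^sup>2 * g\<^sup>2) / V - 1)))"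
        using mom by auto
      fix g :: real
      have sq: "(x + t * g)\<^sup>2 = x\<^sup>2 + 2 * x * t * g + t\<^sup>2 * g\<^sup>2" by (simp add: power2_eq_square algebra_simps)
      have "\<bar>x + t * g\<bar> powr q = (\<bar>x + t * g\<bar> powr 2) powr (q / 2)" unfolding powr_powr by simp
      also have "\<bar>x + t * g\<bar> powr 2 = (x + t * g)\<^sup>2" by simp
      also have "((x + t * g)\<^sup>2) powr (q / 2) = ?c * ((x + t * g)\<^sup>2 / V) powr (q / 2)"
        using V by (simp add: powr_divide)
      also have "\<dots> \<le> ?c * (1 + q / 2 * ((x + t * g)\<^sup>2 / V - 1))"
        using V q by (intro mult_left_mono powr_le_tangent_at_1) auto
      finally show "\<bar>x + t * g\<bar> powr q \<le> ?c * (1 + q / 2 * ((x\<^sup>2 + 2 * x * t * g + t\<^sup>2 * g\<^sup>2) / V - 1))"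
        unfolding sq .
    qed
    also have "\<dots> = ?c * (1 + q / 2 * ((x\<^sup>2 + t\<^sup>2) / V - 1))"
      using mom N.prob_space by simp
    finally show ?thesis .
  qed
  then have "rad I b (gauss_shift q t) \<le> rad I b (\<lambda>x. ?c * (1 + q / 2 * ((x\<^sup>2 + t\<^sup>2) / V - 1)))"
    by (rule rad_mono)
  also have "(\<lambda>x. ?c * (1 + q / 2 * ((x\<^sup>2 + t\<^sup>2) / V - 1)))
      = (\<lambda>x. ?c * (1 + q / 2 * (t\<^sup>2 / V - 1)) + (?c * (q / 2) / V) * x\<^sup>2)"
    by (auto simp: fun_eq_iff algebra_simps add_divide_distrib)
  also have "rad I b \<dots> = ?c * (1 + q / 2 * (t\<^sup>2 / V - 1)) + (?c * (q / 2) / V) * (\<Sum>i\<in>I. (b i)\<^sup>2)"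
    unfolding rad_add rad_cmult rad_const[OF I] rad_square[OF I] ..
  also have "\<dots> = ?c * (1 + q / 2 * ((t\<^sup>2 + (\<Sum>i\<in>I. (b i)\<^sup>2)) / V - 1))"
    by (simp add: algebra_simps add_divide_distrib)
  also have "\<dots> \<le> ?c * (1 + q / 2 * 0)"
    using V q by (intro mult_left_mono add_left_mono) (auto simp: divide_le_eq)
  finally show ?thesis by simp
qed

text \<open>Lindeberg replacement of the signs by Gaussians, one at a time.\<close>

lemma rad_lindeberg:
  assumes I: "finite I" and p: "3 \<le> p" "p \<le> 5" and V: "0 < V" and b: "\<And>i. 0 \<le> b i"
    and t: "0 \<le> t" "t\<^sup>2 + (\<Sum>i\<in>I. (b i)\<^sup>2) \<le> V"
  shows "gauss_shift p (sqrt (t\<^sup>2 + (\<Sum>i\<in>I. (b i)\<^sup>2))) 0 \<le> rad I b (gauss_shift p t)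
     + (\<Sum>i\<in>I. gauss_moment p * b i powr p + taylor_const p * b i ^ 4 * V powr ((p - 4) / 2))"
  using I t
proof (induction I arbitrary: t rule: finite_induct)
  case empty
  then show ?case by simp
next
  case (insert j I)
  let ?err = "\<lambda>i. gauss_moment p * b i powr p + taylor_const p * b i ^ 4 * V powr ((p - 4) / 2)"
  \<comment> \<open>The standard deviation once the sign with coefficient \<open>b j\<close> has
    been turned into a Gaussian. The total variance does not change, so the bound V
    persists.\<close>
  define t' where "t' = sqrt (t\<^sup>2 + (b j)\<^sup>2)"
  have t': "0 \<le> t'" "t'\<^sup>2 = t\<^sup>2 + (b j)\<^sup>2" by (simp_all add: t'_def)
  have sum: "t\<^sup>2 + (\<Sum>i\<in>insert j I. (b i)\<^sup>2) = t'\<^sup>2 + (\<Sum>i\<in>I. (b i)\<^sup>2)" using insert.hyps by (simp add: t')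
  have le: "t'\<^sup>2 + (\<Sum>i\<in>I. (b i)\<^sup>2) \<le> V" using insert.prems(2) unfolding sum .
  have r: "taylor_const p * b j ^ 4 * rad I b (gauss_shift (p - 4) t) \<le> taylor_const p * b j ^ 4 * V powr ((p - 4) / 2)"
  proof (cases "p \<le> 4")
    case True then show ?thesis by (simp add: taylor_const_def)
  next
    case False
    have "t\<^sup>2 + (\<Sum>i\<in>I. (b i)\<^sup>2) \<le> V" using le t'(2) zero_le_power2[of "b j"] by linarith
    then have "rad I b (gauss_shift (p - 4) t) \<le> V powr ((p - 4) / 2)"
      using False p V insert.hyps by (intro rad_gauss_shift_le) auto
    then show ?thesis by (intro mult_left_mono mult_nonneg_nonneg taylor_const_nonneg) (simp_all add: b)
  qed
  have "gauss_shift p (sqrt (t'\<^sup>2 + (\<Sum>i\<in>I. (b i)\<^sup>2))) 0 \<le> rad I b (gauss_shift p t') + (\<Sum>i\<in>I. ?err i)"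
    by (rule insert.IH[OF t'(1) le])
  also have "rad I b (gauss_shift p t') \<le> rad I b (\<lambda>x. 1 / 2 * (gauss_shift p t (x + b j) + gauss_shift p t (x - b j))
      + (gauss_moment p * b j powr p + taylor_const p * b j ^ 4 * gauss_shift (p - 4) t x))"
    using lindeberg_step[OF p insert.prems(1) b[of j]] unfolding t'_def by (intro rad_mono) (simp add: add.assoc)
  also have "\<dots> = rad (insert j I) b (gauss_shift p t) + (gauss_moment p * b j powr p
      + taylor_const p * b j ^ 4 * rad I b (gauss_shift (p - 4) t))"
    unfolding rad_add rad_cmult using insert.hyps by (simp add: rad_insert rad_const)
  also have "\<dots> \<le> rad (insert j I) b (gauss_shift p t) + ?err j" using r by simp
  finally show ?case unfolding sum using insert.hyps by simp
qed

text \<open>Relative to the main term, the Lindeberg error is governed by v = D / S with D^2 the sum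
  of the b_i^4. For p \<le> 4 it is at most v, as Cauchy-Schwarz bounds the sum of the b_i^3 by sqrt
  S * D. For p > 4 it is at most p v^2 = (sqrt p v)^2. Both are at most sqrt p v in the relevant
  range sqrt p v < 1.\<close>

lemma rademacher_moment_lower_base:
  fixes b :: "'i \<Rightarrow> real"
  assumes I: "finite I" and p: "3 \<le> p" "p \<le> 5" and b: "\<And>i. 0 \<le> b i"
  shows "gauss_moment p * (max 0 ((\<Sum>i\<in>I. (b i)\<^sup>2) - sqrt p * sqrt (\<Sum>i\<in>I. b i ^ 4))) powr (p / 2)
     \<le> rad I b (\<lambda>x. \<bar>x\<bar> powr p)"
proof -
  define S where "S = (\<Sum>i\<in>I. (b i)\<^sup>2)"
  define D where "D = sqrt (\<Sum>i\<in>I. b i ^ 4)"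
  have D: "0 \<le> D" "D\<^sup>2 = (\<Sum>i\<in>I. b i ^ 4)" by (simp_all add: D_def sum_nonneg b)
  have g: "0 < gauss_moment p" using p by (intro gauss_moment_pos) auto
  have "gauss_moment p * (max 0 (S - sqrt p * D)) powr (p / 2) \<le> rad I b (\<lambda>x. \<bar>x\<bar> powr p)"
  proof (cases "S - sqrt p * D \<le> 0")
    case True
    then show ?thesis by (simp add: max_def rad_nonneg)
  next
    case False
    moreover have "0 \<le> sqrt p * D" using p D by simp
    ultimately have S: "0 < S" by linarith
    define v where "v = D / S"
    have v: "0 \<le> v" "sqrt p * v < 1" using S D False by (auto simp: v_def field_simps)
    have bS: "b i \<le> sqrt S" if "i \<in> I" for i
    proof -
      have "(b i)\<^sup>2 \<le> S" unfolding S_def using I that by (intro member_le_sum) auto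
      then show ?thesis by (rule real_le_rsqrt)
    qed
    \<comment> \<open>Each \<open>b i\<close> is at most sqrt S, so surplus powers of it are traded
      for powers of S. It is used with k = 3 and k = 4.\<close>
    have pw: "b i powr p \<le> S powr ((p - real k) / 2) * b i ^ k" if "i \<in> I" "real k \<le> p" "0 < k" for i k
    proof (cases "b i = 0")
      case True
      then show ?thesis using p that by simp
    next
      case False
      then have "b i powr p = b i powr (p - real k) * b i ^ k"
        using b[of i] by (simp add: powr_realpow[symmetric] powr_add[symmetric])
      also have "\<dots> \<le> sqrt S powr (p - real k) * b i ^ k"
        using that b[of i] bS by (intro mult_right_mono powr_mono2) auto
      also have "sqrt S powr (p - real k) = S powr ((p - real k) / 2)"
        using S by (simp add: powr_half_sqrt[symmetric] powr_powr)
      finally show ?thesis .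
    qed
    have "gauss_shift p (sqrt (0\<^sup>2 + (\<Sum>i\<in>I. (b i)\<^sup>2))) 0 \<le> rad I b (gauss_shift p 0)
       + (\<Sum>i\<in>I. gauss_moment p * b i powr p + taylor_const p * b i ^ 4 * S powr ((p - 4) / 2))"
      by (intro rad_lindeberg I p S b) (auto simp: S_def)
    then have "S powr (p / 2) * gauss_moment p \<le> rad I b (\<lambda>x. \<bar>x\<bar> powr p)
       + (\<Sum>i\<in>I. gauss_moment p * b i powr p + taylor_const p * b i ^ 4 * S powr ((p - 4) / 2))"
      using S by (simp add: gauss_shift_at_0 gauss_shift_0[abs_def] S_def[symmetric] powr_half_sqrt[symmetric] powr_powr)
    also have "(\<Sum>i\<in>I. gauss_moment p * b i powr p + taylor_const p * b i ^ 4 * S powr ((p - 4) / 2))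
        \<le> gauss_moment p * S powr (p / 2) * (sqrt p * v)"
    proof (cases "p \<le> 4")
      case True
      have "(\<Sum>i\<in>I. gauss_moment p * b i powr p + taylor_const p * b i ^ 4 * S powr ((p - 4) / 2))
          = gauss_moment p * (\<Sum>i\<in>I. b i powr p)" using True by (simp add: taylor_const_def sum_distrib_left)
      also have "\<dots> \<le> gauss_moment p * (\<Sum>i\<in>I. S powr ((p - real 3) / 2) * b i ^ 3)"
        using g p by (intro mult_left_mono sum_mono pw) auto
      also have "\<dots> = gauss_moment p * S powr ((p - 3) / 2) * (\<Sum>i\<in>I. b i * (b i)\<^sup>2)"
        by (simp add: sum_distrib_left power2_eq_square power3_eq_cube mult.assoc)
      also have "\<dots> \<le> gauss_moment p * S powr ((p - 3) / 2) * (sqrt S * D)"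
      proof (intro mult_left_mono)
        have "(\<Sum>i\<in>I. b i * (b i)\<^sup>2)\<^sup>2 \<le> (\<Sum>i\<in>I. (b i)\<^sup>2) * (\<Sum>i\<in>I. ((b i)\<^sup>2)\<^sup>2)"
          by (rule Cauchy_Schwarz_ineq_sum)
        also have "\<dots> = (sqrt S * D)\<^sup>2" using S D by (simp add: S_def power_mult_distrib flip: power_mult)
        finally show "(\<Sum>i\<in>I. b i * (b i)\<^sup>2) \<le> sqrt S * D"
          by (rule power2_le_imp_le) (use S D(1) in simp)
      qed (use g in auto)
      also have "\<dots> = gauss_moment p * (S powr ((p - 3) / 2) * S powr (1 / 2) * S powr 1) * v"
        using S by (simp add: v_def powr_half_sqrt)
      also have "S powr ((p - 3) / 2) * S powr (1 / 2) * S powr 1 = S powr (p / 2)"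
        unfolding powr_add[symmetric] by (simp add: field_simps)
      also have "gauss_moment p * S powr (p / 2) * v \<le> gauss_moment p * S powr (p / 2) * (sqrt p * v)"
      proof (intro mult_left_mono)
        have "1 * v \<le> sqrt p * v" using p v by (intro mult_right_mono) auto
        then show "v \<le> sqrt p * v" by simp
      qed (use g in auto)
      finally show ?thesis .
    next
      case False
      let ?s = "S powr ((p - 4) / 2)"
      have "(\<Sum>i\<in>I. gauss_moment p * b i powr p + taylor_const p * b i ^ 4 * S powr ((p - 4) / 2))
          \<le> (\<Sum>i\<in>I. (gauss_moment p + taylor_const p) * ?s * b i ^ 4)"
      proof (intro sum_mono)
        fix i assume "i \<in> I"
        then have "gauss_moment p * b i powr p \<le> gauss_moment p * (S powr ((p - real 4) / 2) * b i ^ 4)"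
          using g False by (intro mult_left_mono pw) auto
        then show "gauss_moment p * b i powr p + taylor_const p * b i ^ 4 * ?s \<le> (gauss_moment p + taylor_const p) * ?s * b i ^ 4"
          by (simp add: algebra_simps)
      qed
      also have "\<dots> = (gauss_moment p + taylor_const p) * (?s * D\<^sup>2)" by (simp add: D sum_distrib_left mult.assoc)
      also have "?s * D\<^sup>2 = S powr ((p - 4) / 2) * S powr 2 * v\<^sup>2"
        using S by (simp add: v_def power_divide)
      also have "S powr ((p - 4) / 2) * S powr 2 = S powr (p / 2)"
        unfolding powr_add[symmetric] by (simp add: field_simps)
      also have "(gauss_moment p + taylor_const p) * (S powr (p / 2) * v\<^sup>2) \<le> (gauss_moment p * p) * (S powr (p / 2) * v\<^sup>2)"
      proof (intro mult_right_mono)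
        \<comment> \<open>For p between 4 and 5 this gives p (p - 2) (p - 3) / 8 \<le> 3 p / 4 \<le>
          p - 1. With p - 1 \<le> \<open>gauss_moment p\<close>, the Taylor constant is at most (p -
          1) \<open>gauss_moment p\<close>, which explains the total factor p.\<close>
        have "(p - 2) * (p - 3) \<le> 3 * 2" using p False by (intro mult_mono) auto
        then have "p * ((p - 2) * (p - 3)) \<le> p * 6" using p by (intro mult_left_mono) auto
        then have c: "p * (p - 2) * (p - 3) / 8 \<le> p - 1" using False by (simp only: mult.assoc)
        have "p - 1 \<le> gauss_moment p"
        proof -
          have "(p - 1) * 1 \<le> (p - 1) * gauss_moment (p - 2)"
            using p False by (intro mult_left_mono gauss_moment_ge_1) auto
          then show ?thesis using gauss_moment_rec[of p] p by simp
        qed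
        then have "(p - 1) * (p * (p - 2) * (p - 3) / 8) \<le> gauss_moment p * (p - 1)"
          using c p False by (intro mult_mono) auto
        moreover have "taylor_const p = (p - 1) * (p * (p - 2) * (p - 3) / 8)"
          using False by (simp add: taylor_const_def)
        ultimately have "gauss_moment p + taylor_const p \<le> gauss_moment p + gauss_moment p * (p - 1)" by (simp only: add_left_mono)
        also have "\<dots> = gauss_moment p * p" by (simp add: right_diff_distrib)
        finally show "gauss_moment p + taylor_const p \<le> gauss_moment p * p" .
      qed auto
      also have "\<dots> = gauss_moment p * S powr (p / 2) * ((sqrt p * v) * (sqrt p * v))"
        using p by (simp add: power2_eq_square mult_ac)
      also have "\<dots> \<le> gauss_moment p * S powr (p / 2) * (sqrt p * v)"
      proof (intro mult_left_mono)
        have "(sqrt p * v) * (sqrt p * v) \<le> 1 * (sqrt p * v)" using p v by (intro mult_right_mono) auto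
        then show "(sqrt p * v) * (sqrt p * v) \<le> sqrt p * v" by simp
      qed (use g in auto)
      finally show ?thesis .
    qed
    finally have main: "gauss_moment p * S powr (p / 2) * (1 - sqrt p * v) \<le> rad I b (\<lambda>x. \<bar>x\<bar> powr p)"
      by (simp add: algebra_simps)
    \<comment> \<open>The factor 1 - sqrt p v lies in [0, 1], and the exponent p / 2 \<ge> 1 can
      only decrease it; so the linear factor already obtained suffices.\<close>
    have "max 0 (S - sqrt p * D) = S * (1 - sqrt p * v)" using False S by (simp add: v_def field_simps)
    then have "(max 0 (S - sqrt p * D)) powr (p / 2) = S powr (p / 2) * (1 - sqrt p * v) powr (p / 2)"
      using S v by (simp add: powr_mult)
    also have "\<dots> \<le> S powr (p / 2) * (1 - sqrt p * v) powr 1"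
      using v p by (intro mult_left_mono powr_mono') auto
    finally have "gauss_moment p * (max 0 (S - sqrt p * D)) powr (p / 2) \<le> gauss_moment p * (S powr (p / 2) * (1 - sqrt p * v))"
      using g v by (intro mult_left_mono) auto
    then show ?thesis using main by (simp add: mult.assoc)
  qed
  then show ?thesis by (simp add: S_def D_def)
qed

text \<open>Conditioning on all signs but one gives \<open>E \<bar>S\<bar>\<^sup>p \<ge> (p - 1) \<Sum> b\<^sub>i\<^sup>2 E \<bar>S - b\<^sub>i \<epsilon>\<^sub>i\<bar>\<^sup>p\<^sup>-\<^sup>2\<close>.\<close>

lemma rad_abs_powr_ge:
  assumes I: "finite I" and p: "3 \<le> p" and b: "\<And>i. 0 \<le> b i"
  shows "(p - 1) * (\<Sum>i\<in>I. (b i)\<^sup>2 * rad (I - {i}) b (\<lambda>x. \<bar>x\<bar> powr (p - 2))) \<le> rad I b (\<lambda>x. \<bar>x\<bar> powr p)"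
proof -
  have "\<bar>x\<bar> powr p = x * signed_powr (p - 1) x" for x :: real
    by (cases "x = 0") (auto simp: signed_powr_def powr_diff sgn_if)
  then have "rad I b (\<lambda>x. \<bar>x\<bar> powr p)
      = (\<Sum>i\<in>I. b i * rad (I - {i}) b (\<lambda>x. (signed_powr (p - 1) (x + b i) - signed_powr (p - 1) (x - b i)) / 2))"
    by (simp add: rad_times[OF I])
  moreover have "(p - 1) * ((b i)\<^sup>2 * rad (I - {i}) b (\<lambda>x. \<bar>x\<bar> powr (p - 2)))
     \<le> b i * rad (I - {i}) b (\<lambda>x. (signed_powr (p - 1) (x + b i) - signed_powr (p - 1) (x - b i)) / 2)" for i
  proof -
    have "rad (I - {i}) b (\<lambda>x. (p - 1) * b i * \<bar>x\<bar> powr (p - 2))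
        \<le> rad (I - {i}) b (\<lambda>x. (signed_powr (p - 1) (x + b i) - signed_powr (p - 1) (x - b i)) / 2)"
    proof (rule rad_mono)
      fix x
      have "p * ((p - 1) * b i * \<bar>x\<bar> powr (p - 2)) \<le> p * ((signed_powr (p - 1) (x + b i) - signed_powr (p - 1) (x - b i)) / 2)"
        using sym_deriv_ge[OF p b[of i], of x] by (simp add: sym_deriv_def mult_ac)
      then show "(p - 1) * b i * \<bar>x\<bar> powr (p - 2) \<le> (signed_powr (p - 1) (x + b i) - signed_powr (p - 1) (x - b i)) / 2"
        using p by simp
    qed
    then have "b i * ((p - 1) * b i * rad (I - {i}) b (\<lambda>x. \<bar>x\<bar> powr (p - 2)))
        \<le> b i * rad (I - {i}) b (\<lambda>x. (signed_powr (p - 1) (x + b i) - signed_powr (p - 1) (x - b i)) / 2)"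
      unfolding rad_cmult using b by (intro mult_left_mono) auto
    then show ?thesis by (simp add: power2_eq_square mult_ac)
  qed
  ultimately show ?thesis by (simp add: sum_distrib_left sum_mono)
qed

text \<open>In the step from q = p - 2 to p, \<open>rad_abs_powr_ge\<close> reduces the moment to
  moments of the sums without i, weighted by b_i^2. Leaving out i costs b_i^2 in the variance, which
  averages to D^2 / S. The gain sqrt p - sqrt (p - 2) \<ge> 1 / sqrt p pays for it, as D^2 / S \<le>
  D / sqrt p whenever the bound is not trivial. This is why the loss has the coefficient sqrt
  p.\<close>

theorem rademacher_moment_lower:
  fixes b :: "'i \<Rightarrow> real"
  assumes "finite I" "3 \<le> p" "\<And>i. 0 \<le> b i"
  shows "gauss_moment p * (max 0 ((\<Sum>i\<in>I. (b i)\<^sup>2) - sqrt p * sqrt (\<Sum>i\<in>I. b i ^ 4))) powr (p / 2)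
     \<le> rad I b (\<lambda>x. \<bar>x\<bar> powr p)"
proof -
  have "gauss_moment p * (max 0 ((\<Sum>i\<in>I. (b i)\<^sup>2) - sqrt p * sqrt (\<Sum>i\<in>I. b i ^ 4))) powr (p / 2)
     \<le> rad I b (\<lambda>x. \<bar>x\<bar> powr p)" if "finite I" "3 \<le> p" "p \<le> 5 + 2 * real n" for n p and I :: "'i set"
    using that
  proof (induction n arbitrary: p I)
    case 0
    then show ?case using assms(3) by (intro rademacher_moment_lower_base) auto
  next
    case (Suc n)
    note I = Suc.prems(1) and b = assms(3)
    show ?case
    proof (cases "p \<le> 5")
      case True
      then show ?thesis using Suc.prems assms(3) by (intro rademacher_moment_lower_base) auto
    next
      case False
      define q where "q = p - 2"
      have q: "3 \<le> q" "p = q + 2" using False by (auto simp: q_def)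
      define S where "S = (\<Sum>i\<in>I. (b i)\<^sup>2)"
      define D where "D = sqrt (\<Sum>i\<in>I. b i ^ 4)"
      have D: "0 \<le> D" "D\<^sup>2 = (\<Sum>i\<in>I. b i ^ 4)" by (simp_all add: D_def sum_nonneg b)
      define w where "w = S - sqrt p * D"
      have gq: "0 \<le> gauss_moment q" by (rule gauss_moment_nonneg)
      have "gauss_moment p * (max 0 w) powr (p / 2) \<le> rad I b (\<lambda>x. \<bar>x\<bar> powr p)"
      proof (cases "w \<le> 0")
        case True
        then show ?thesis by (simp add: max_def rad_nonneg)
      next
        case False
        moreover have "0 \<le> sqrt p * D" using q D by simp
        ultimately have S: "0 < S" and w: "0 < w" "w \<le> S" by (auto simp: w_def)
        \<comment> \<open>The mean of S - b_i^2 - sqrt q * D under the weights b_i^2 / S. Placing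
          the tangent there makes the linear terms cancel in the weighted sum, which is Jensen's
          inequality.\<close>
        define m where "m = S - sqrt q * D - D\<^sup>2 / S"
        have wm: "w \<le> m"
        proof -
          have "sqrt q \<le> sqrt p - 1 / sqrt p"
          proof (rule real_le_lsqrt)
            have "1 / sqrt p \<le> sqrt p" using q by (simp add: divide_le_eq)
            then show "0 \<le> sqrt p - 1 / sqrt p" by simp
            have "(sqrt p - 1 / sqrt p)\<^sup>2 = p - 2 + 1 / p" using q by (simp add: power2_diff power_divide)
            then show "q \<le> (sqrt p - 1 / sqrt p)\<^sup>2" using q by simp
          qed
          then have 1: "sqrt q * D \<le> (sqrt p - 1 / sqrt p) * D" using D by (intro mult_right_mono) auto
          have "D * (sqrt p * D) \<le> D * S" using D w by (intro mult_left_mono) (auto simp: w_def)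
          then have "D\<^sup>2 / S \<le> D / sqrt p" using S q by (simp add: field_simps power2_eq_square)
          then show ?thesis using 1 by (simp add: m_def w_def algebra_simps)
        qed
        have m: "0 < m" using wm w by simp
        have step: "m powr (q / 2) + q / 2 * m powr (q / 2 - 1) * (S - (b i)\<^sup>2 - sqrt q * D - m)
            \<le> (max 0 ((\<Sum>k\<in>I - {i}. (b k)\<^sup>2) - sqrt q * sqrt (\<Sum>k\<in>I - {i}. b k ^ 4))) powr (q / 2)"
          if "i \<in> I" for i
        proof -
          have "(\<Sum>k\<in>I - {i}. (b k)\<^sup>2) = S - (b i)\<^sup>2" using I that by (simp add: S_def sum_diff1)
          moreover have "sqrt q * sqrt (\<Sum>k\<in>I - {i}. b k ^ 4) \<le> sqrt q * D"
            unfolding D_def using I that q by (intro mult_left_mono real_sqrt_le_mono sum_mono2) (auto simp: b)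
          ultimately have "max 0 (S - (b i)\<^sup>2 - sqrt q * D) \<le> max 0 ((\<Sum>k\<in>I - {i}. (b k)\<^sup>2) - sqrt q * sqrt (\<Sum>k\<in>I - {i}. b k ^ 4))"
            by auto
          then have "(max 0 (S - (b i)\<^sup>2 - sqrt q * D)) powr (q / 2) \<le> (max 0 ((\<Sum>k\<in>I - {i}. (b k)\<^sup>2) - sqrt q * sqrt (\<Sum>k\<in>I - {i}. b k ^ 4))) powr (q / 2)"
            using q by (intro powr_mono2) auto
          then show ?thesis
            using max_powr_ge_tangent[of m "q / 2" "S - (b i)\<^sup>2 - sqrt q * D"] m q by simp
        qed
        have "w powr (p / 2) \<le> S * m powr (q / 2)"
        proof -
          have "w powr (p / 2) = w * w powr (q / 2)" using w by (simp add: q(2) add_divide_distrib powr_add)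
          also have "\<dots> \<le> S * m powr (q / 2)" using w wm q by (intro mult_mono powr_mono2) auto
          finally show ?thesis .
        qed
        also have "S * m powr (q / 2) = (\<Sum>i\<in>I. (b i)\<^sup>2 * (m powr (q / 2) + q / 2 * m powr (q / 2 - 1) * (S - (b i)\<^sup>2 - sqrt q * D - m)))"
        proof -
          have "(\<Sum>i\<in>I. (b i)\<^sup>2 * (S - (b i)\<^sup>2 - sqrt q * D - m)) = (\<Sum>i\<in>I. (S - sqrt q * D - m) * (b i)\<^sup>2 - b i ^ 4)"
            by (intro sum.cong) (auto simp: algebra_simps power2_eq_square power4_eq_xxxx)
          also have "\<dots> = (S - sqrt q * D - m) * S - D\<^sup>2"
            by (simp add: sum_subtractf sum_distrib_left[symmetric] S_def D)
          also have "\<dots> = 0" using S by (simp add: m_def)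
          finally have z: "(\<Sum>i\<in>I. (b i)\<^sup>2 * (S - (b i)\<^sup>2 - sqrt q * D - m)) = 0" .
          have "(\<Sum>i\<in>I. (b i)\<^sup>2 * (m powr (q / 2) + q / 2 * m powr (q / 2 - 1) * (S - (b i)\<^sup>2 - sqrt q * D - m)))
             = m powr (q / 2) * (\<Sum>i\<in>I. (b i)\<^sup>2) + q / 2 * m powr (q / 2 - 1) * (\<Sum>i\<in>I. (b i)\<^sup>2 * (S - (b i)\<^sup>2 - sqrt q * D - m))"
            by (simp only: distrib_left sum.distrib sum_distrib_left) (simp add: mult_ac)
          then show ?thesis unfolding z S_def[symmetric] by (simp only: mult_zero_right add_0_right mult.commute[of S])
        qed
        also have "\<dots> \<le> (\<Sum>i\<in>I. (b i)\<^sup>2 * (max 0 ((\<Sum>k\<in>I - {i}. (b k)\<^sup>2) - sqrt q * sqrt (\<Sum>k\<in>I - {i}. b k ^ 4))) powr (q / 2))"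
          by (intro sum_mono mult_left_mono step) auto
        finally have "gauss_moment q * w powr (p / 2)
            \<le> gauss_moment q * (\<Sum>i\<in>I. (b i)\<^sup>2 * (max 0 ((\<Sum>k\<in>I - {i}. (b k)\<^sup>2) - sqrt q * sqrt (\<Sum>k\<in>I - {i}. b k ^ 4))) powr (q / 2))"
          using gq by (intro mult_left_mono) auto
        also have "\<dots> = (\<Sum>i\<in>I. (b i)\<^sup>2 * (gauss_moment q * (max 0 ((\<Sum>k\<in>I - {i}. (b k)\<^sup>2) - sqrt q * sqrt (\<Sum>k\<in>I - {i}. b k ^ 4))) powr (q / 2)))"
          by (simp add: sum_distrib_left mult_ac)
        also have "\<dots> \<le> (\<Sum>i\<in>I. (b i)\<^sup>2 * rad (I - {i}) b (\<lambda>x. \<bar>x\<bar> powr q))"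
          using Suc.prems q by (intro sum_mono mult_left_mono Suc.IH) auto
        finally have "(p - 1) * (gauss_moment q * w powr (p / 2)) \<le> (p - 1) * (\<Sum>i\<in>I. (b i)\<^sup>2 * rad (I - {i}) b (\<lambda>x. \<bar>x\<bar> powr q))"
          using q by (intro mult_left_mono) auto
        also have "\<dots> \<le> rad I b (\<lambda>x. \<bar>x\<bar> powr p)"
          unfolding q_def using I q b by (intro rad_abs_powr_ge) auto
        finally have "(p - 1) * gauss_moment q * w powr (p / 2) \<le> rad I b (\<lambda>x. \<bar>x\<bar> powr p)"
          by (simp only: mult.assoc)
        moreover have "gauss_moment p = (p - 1) * gauss_moment q"
          unfolding q_def using Suc.prems(2) by (intro gauss_moment_rec) simp
        moreover have "max 0 w = w" using w by simp
        ultimately show ?thesis by (simp only:)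
      qed
      then show ?thesis by (simp add: w_def S_def D_def)
    qed
  qed
  moreover have "p \<le> 5 + 2 * real (nat \<lceil>p\<rceil>)" using assms by linarith
  ultimately show ?thesis using assms by blast
qed

section \<open>Exponential tails and Gaussian mixtures\<close>

text \<open>Cauchy-Schloemilch: for \<open>g x = x - c / x\<close> the map \<open>x \<mapsto> c / x\<close> leaves the density at \<open>g x\<close>
  unchanged, so twice the integral is that of \<open>g' x\<close> times the density at \<open>g x\<close>.\<close>

lemma nn_integral_normal_density_substitution:
  assumes c: "0 < c"
  shows "(\<integral>\<^sup>+x\<in>{0<..}. ennreal (std_normal_density (x - c / x)) \<partial>lborel) = ennreal (1 / 2)"
proof -
  let ?\<phi> = std_normal_density and ?S = "{0<..} :: real set"
  have univ: "?\<phi> absolutely_integrable_on UNIV \<and> integral UNIV ?\<phi> = 1"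
  proof -
    have i: "integrable lborel ?\<phi>" by simp
    then have "set_integrable lebesgue UNIV ?\<phi>"
      unfolding set_integrable_def by (subst integrable_completion) auto
    moreover have "integral UNIV ?\<phi> = 1"
      using set_borel_integral_eq_integral(2)[of UNIV ?\<phi>] i
      by (simp add: set_integrable_def set_lebesgue_integral_def)
    ultimately show ?thesis by simp
  qed
  define g where "g x = x - c / x" for x :: real
  have dg: "(g has_field_derivative 1 + c / x\<^sup>2) (at x within ?S)" if "x \<in> ?S" for x
    unfolding g_def using that by (auto intro!: derivative_eq_intros simp: power2_eq_square)
  have inj: "inj_on g ?S"
  proof (rule linorder_inj_onI)
    fix x y assume xy: "x < y" "x \<in> ?S" "y \<in> ?S"
    then have "c / y < c / x" using c by (intro divide_strict_left_mono) auto
    then show "g x \<noteq> g y" using xy by (simp add: g_def)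
  qed auto
  have img: "g ` ?S = UNIV"
  proof (intro set_eqI iffI UNIV_I)
    fix y :: real
    define x where "x = (y + sqrt (y\<^sup>2 + 4 * c)) / 2"
    have "\<bar>y\<bar> = sqrt (y\<^sup>2)" by simp
    also have "\<dots> < sqrt (y\<^sup>2 + 4 * c)" using c by (intro real_sqrt_less_mono) auto
    finally have x: "0 < x" by (simp add: x_def)
    have "(sqrt (y\<^sup>2 + 4 * c))\<^sup>2 = y\<^sup>2 + 4 * c" using c by simp
    moreover have "2 * x - y = sqrt (y\<^sup>2 + 4 * c)" by (simp add: x_def field_simps)
    ultimately have "(2 * x - y)\<^sup>2 = y\<^sup>2 + 4 * c" by (simp only:)
    then have "x * x - c = x * y" by (simp add: power2_eq_square algebra_simps)
    then have "g x = y" using x by (simp add: g_def field_simps)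
    then show "y \<in> g ` ?S" using x by auto
  qed
  have 1: "(\<lambda>x. \<bar>1 + c / x\<^sup>2\<bar> * ?\<phi> (g x)) absolutely_integrable_on ?S \<and>
      integral ?S (\<lambda>x. \<bar>1 + c / x\<^sup>2\<bar> * ?\<phi> (g x)) = 1"
    using has_absolute_integral_change_of_variables_1'[OF _ dg inj, of ?\<phi> 1] univ unfolding img by auto
  have [measurable]: "g \<in> borel_measurable borel" unfolding g_def by measurable
  have abs: "(\<lambda>x. ?\<phi> (g x)) absolutely_integrable_on ?S"
  proof (rule set_integrable_bound)
    show "set_integrable lebesgue ?S (\<lambda>x. \<bar>1 + c / x\<^sup>2\<bar> * ?\<phi> (g x))" using 1 by blast
    show "set_borel_measurable lebesgue ?S (\<lambda>x. ?\<phi> (g x))"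
      unfolding set_borel_measurable_def by (rule measurable_completion) measurable
    have "?\<phi> (g x) \<le> \<bar>1 + c / x\<^sup>2\<bar> * ?\<phi> (g x)" for x
    proof -
      have "1 * ?\<phi> (g x) \<le> \<bar>1 + c / x\<^sup>2\<bar> * ?\<phi> (g x)" using c by (intro mult_right_mono) auto
      then show ?thesis by simp
    qed
    then show "AE x in lebesgue. x \<in> ?S \<longrightarrow> norm (?\<phi> (g x)) \<le> norm (\<bar>1 + c / x\<^sup>2\<bar> * ?\<phi> (g x))"
      by (intro AE_I2) (simp add: abs_mult)
  qed
  define b where "b = integral ?S (\<lambda>x. ?\<phi> (g x))"
  have h_img: "(\<lambda>x. c / x) ` ?S = ?S"
  proof (intro set_eqI iffI)
    fix y assume "y \<in> ?S"
    then have "y = c / (c / y)" "c / y \<in> ?S" using c by auto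
    then show "y \<in> (\<lambda>x. c / x) ` ?S" by blast
  qed (use c in auto)
  have 2: "(\<lambda>x. \<bar>- c / x\<^sup>2\<bar> * ?\<phi> (g (c / x))) absolutely_integrable_on ?S \<and>
      integral ?S (\<lambda>x. \<bar>- c / x\<^sup>2\<bar> * ?\<phi> (g (c / x))) = b"
  proof (subst has_absolute_integral_change_of_variables_1'[where g = "\<lambda>x. c / x"])
    show "((\<lambda>x. c / x) has_field_derivative - c / x\<^sup>2) (at x within ?S)" if "x \<in> ?S" for x
      using that by (auto intro!: derivative_eq_intros simp: power2_eq_square)
    show "inj_on (\<lambda>x. c / x) ?S" using c by (auto simp: inj_on_def)
    show "(\<lambda>x. ?\<phi> (g x)) absolutely_integrable_on (\<lambda>x. c / x) ` ?S \<and> integral ((\<lambda>x. c / x) ` ?S) (\<lambda>x. ?\<phi> (g x)) = b"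
      unfolding h_img using abs by (simp add: b_def)
  qed simp
  have "?\<phi> (g (c / x)) = ?\<phi> (g x)" for x
    using c by (simp add: g_def std_normal_density_def power2_commute)
  with 2 have 3: "(\<lambda>x. c / x\<^sup>2 * ?\<phi> (g x)) absolutely_integrable_on ?S \<and>
      integral ?S (\<lambda>x. c / x\<^sup>2 * ?\<phi> (g x)) = b" using c by simp
  have "integral ?S (\<lambda>x. ?\<phi> (g x) + c / x\<^sup>2 * ?\<phi> (g x)) = b + b"
    using abs 3 by (subst integral_add) (auto simp: b_def absolutely_integrable_on_def)
  also have "(\<lambda>x. ?\<phi> (g x) + c / x\<^sup>2 * ?\<phi> (g x)) = (\<lambda>x. \<bar>1 + c / x\<^sup>2\<bar> * ?\<phi> (g x))"
    using c by (auto simp: fun_eq_iff abs_of_nonneg algebra_simps)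
  finally have b: "b = 1 / 2" using 1 by simp
  have i: "set_integrable lborel ?S (\<lambda>x. ?\<phi> (g x))"
    using abs unfolding set_integrable_def by (subst (asm) integrable_completion) auto
  have "(\<integral>\<^sup>+x\<in>?S. ennreal (?\<phi> (g x)) \<partial>lborel) = (\<integral>\<^sup>+x. ennreal (indicator ?S x *\<^sub>R ?\<phi> (g x)) \<partial>lborel)"
    by (intro nn_integral_cong) (auto split: split_indicator)
  also have "\<dots> = ennreal (LINT x|lborel. indicator ?S x *\<^sub>R ?\<phi> (g x))"
    using i unfolding set_integrable_def by (intro nn_integral_eq_integral) auto
  also have "(LINT x|lborel. indicator ?S x *\<^sub>R ?\<phi> (g x)) = b"
    using set_borel_integral_eq_integral(2)[OF i] by (simp add: b_def set_lebesgue_integral_def)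
  finally show ?thesis by (simp add: b g_def)
qed

text \<open>Completing the square: with c = sqrt 2 * w, x^2 / 2 + w^2 / x^2 = (x - c / x)^2 / 2 + c.
  The factor exp (- c) comes out, and the remaining integral over the half-line is 1 / 2.\<close>

lemma nn_integral_gauss_exp_inverse_square:
  assumes w: "0 < w"
  shows "(\<integral>\<^sup>+g. ennreal (exp (- (w\<^sup>2 / g\<^sup>2))) \<partial>std_normal_distribution) = ennreal (exp (- (sqrt 2 * w)))"
proof -
  let ?\<phi> = std_normal_density and ?c = "sqrt 2 * w"
  have eq: "?\<phi> x * exp (- (w\<^sup>2 / x\<^sup>2)) = exp (- ?c) * ?\<phi> (x - ?c / x)" if "0 < x" for x
  proof -
    have "- x\<^sup>2 / 2 + - (w\<^sup>2 / x\<^sup>2) = - ?c + - (x - ?c / x)\<^sup>2 / 2"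
      using that by (simp add: power2_diff power_divide power_mult_distrib power2_eq_square field_simps)
    then show ?thesis by (simp add: std_normal_density_def exp_add[symmetric])
  qed
  have "(\<integral>\<^sup>+g. ennreal (exp (- (w\<^sup>2 / g\<^sup>2))) \<partial>std_normal_distribution)
      = (\<integral>\<^sup>+g. ennreal (?\<phi> g) * ennreal (exp (- (w\<^sup>2 / g\<^sup>2))) \<partial>lborel)"
    by (rule nn_integral_std_normal) measurable
  also have "\<dots> = 2 * (\<integral>\<^sup>+g\<in>{0..}. (ennreal (?\<phi> g) * ennreal (exp (- (w\<^sup>2 / g\<^sup>2)))) \<partial>lborel)"
    by (rule nn_integral_even_function) (auto simp: std_normal_density_def)
  also have "(\<integral>\<^sup>+g\<in>{0..}. (ennreal (?\<phi> g) * ennreal (exp (- (w\<^sup>2 / g\<^sup>2)))) \<partial>lborel)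
      = (\<integral>\<^sup>+x. ennreal (exp (- ?c)) * (ennreal (?\<phi> (x - ?c / x)) * indicator {0<..} x) \<partial>lborel)"
  proof (rule nn_integral_cong_AE)
    show "AE x in lborel. ennreal (?\<phi> x) * ennreal (exp (- (w\<^sup>2 / x\<^sup>2))) * indicator {0..} x
        = ennreal (exp (- ?c)) * (ennreal (?\<phi> (x - ?c / x)) * indicator {0<..} x)"
      using AE_lborel_singleton[of "0::real"]
    proof eventually_elim
      case (elim x)
      show ?case
      proof (cases "0 < x")
        case True
        then show ?thesis using eq[OF True] by (simp add: ennreal_mult[symmetric])
      next
        case False
        then show ?thesis using elim by simp
      qed
    qed
  qed
  also have "\<dots> = ennreal (exp (- ?c)) * ennreal (1 / 2)"
    using w by (subst nn_integral_cmult) (auto simp: nn_integral_normal_density_substitution)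
  also have "2 * (ennreal (exp (- ?c)) * ennreal (1 / 2)) = ennreal (exp (- ?c))"
  proof -
    have "ennreal 2 * ennreal (1 / 2) = 1" by (subst ennreal_mult[symmetric]) auto
    then have "ennreal (exp (- ?c)) * (ennreal 2 * ennreal (1 / 2)) = ennreal (exp (- ?c))" by (simp only: mult_1_right)
    then show ?thesis by (simp only: mult.left_commute ennreal_numeral)
  qed
  finally show ?thesis .
qed

lemma nn_integral_exp_atLeast:
  "(\<integral>\<^sup>+v. ennreal (exp (- v)) * indicator {r..} v \<partial>lborel) = ennreal (exp (- r))"
proof -
  have "(\<integral>\<^sup>+v. ennreal (exp (- v)) * indicator {r..} v \<partial>lborel) = ennreal (0 - (- exp (- r)))"
  proof (rule nn_integral_FTC_atLeast)
    have "((\<lambda>v::real. exp (- v)) \<longlongrightarrow> 0) at_top"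
      by (rule filterlim_compose[OF exp_at_bot filterlim_uminus_at_bot_at_top])
    then show "((\<lambda>v::real. - exp (- v)) \<longlongrightarrow> 0) at_top" using tendsto_minus by fastforce
  qed (auto intro!: derivative_eq_intros)
  then show ?thesis by simp
qed

text \<open>If \<open>V\<close> is exponential with mean 1 and independent of the standard Gaussian \<open>G\<close>, then
  \<open>sqrt V * G\<close> has the two-sided exponential distribution with variance 1.\<close>

lemma laplace_gaussian_mixture_tail:
  assumes w: "0 < w"
  shows "(\<integral>\<^sup>+v\<in>{0..}. (ennreal (exp (- v)) * emeasure std_normal_distribution {g. w < sqrt v * \<bar>g\<bar>}) \<partial>lborel)
     = ennreal (exp (- (sqrt 2 * w)))"
proof -
  interpret N: prob_space std_normal_distribution by (rule prob_space_normal_density) simp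
  interpret P: pair_sigma_finite std_normal_distribution "lborel :: real measure" ..
  have "(\<integral>\<^sup>+v\<in>{0..}. (ennreal (exp (- v)) * emeasure std_normal_distribution {g. w < sqrt v * \<bar>g\<bar>}) \<partial>lborel)
     = (\<integral>\<^sup>+v. (\<integral>\<^sup>+g. ennreal (exp (- v)) * indicator {0..} v * indicator {0<..} (sqrt v * \<bar>g\<bar> - w) \<partial>std_normal_distribution) \<partial>lborel)"
  proof (intro nn_integral_cong)
    fix v :: real
    have "(\<integral>\<^sup>+g. ennreal (exp (- v)) * indicator {0..} v * indicator {0<..} (sqrt v * \<bar>g\<bar> - w) \<partial>std_normal_distribution)
       = (\<integral>\<^sup>+g. ennreal (exp (- v)) * indicator {0..} v * indicator {g. w < sqrt v * \<bar>g\<bar>} g \<partial>std_normal_distribution)"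
      by (intro nn_integral_cong) (auto split: split_indicator)
    also have "\<dots> = ennreal (exp (- v)) * indicator {0..} v * emeasure std_normal_distribution {g. w < sqrt v * \<bar>g\<bar>}"
      by (rule nn_integral_cmult_indicator) measurable
    finally show "ennreal (exp (- v)) * emeasure std_normal_distribution {g. w < sqrt v * \<bar>g\<bar>} * indicator {0..} v
       = (\<integral>\<^sup>+g. ennreal (exp (- v)) * indicator {0..} v * indicator {0<..} (sqrt v * \<bar>g\<bar> - w) \<partial>std_normal_distribution)"
      by (simp only: mult_ac)
  qed
  also have "\<dots> = (\<integral>\<^sup>+g. (\<integral>\<^sup>+v. ennreal (exp (- v)) * indicator {0..} v * indicator {0<..} (sqrt v * \<bar>g\<bar> - w) \<partial>lborel) \<partial>std_normal_distribution)"
    by (rule P.Fubini') measurable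
  \<comment> \<open>For fixed g the event is v > w^2 / g^2, whose probability under the exponential
    law is exp (- (w^2 / g^2)).\<close>
  also have "\<dots> = (\<integral>\<^sup>+g. ennreal (exp (- (w\<^sup>2 / g\<^sup>2))) \<partial>std_normal_distribution)"
  proof (rule nn_integral_cong_AE)
    have "AE g in lborel. g \<noteq> (0::real)" by (rule AE_lborel_singleton)
    then have "AE g in std_normal_distribution. g \<noteq> 0" by (subst AE_density) (auto elim!: eventually_mono)
    then show "AE g in std_normal_distribution.
        (\<integral>\<^sup>+v. ennreal (exp (- v)) * indicator {0..} v * indicator {0<..} (sqrt v * \<bar>g\<bar> - w) \<partial>lborel) = ennreal (exp (- (w\<^sup>2 / g\<^sup>2)))"
    proof eventually_elim
      case (elim g)
      let ?r = "w\<^sup>2 / g\<^sup>2"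
      have r: "0 < ?r" using elim w by simp
      have iff: "w < sqrt v * \<bar>g\<bar> \<longleftrightarrow> ?r < v" if "0 \<le> v" for v
      proof -
        have "w < sqrt v * \<bar>g\<bar> \<longleftrightarrow> w\<^sup>2 < (sqrt v * \<bar>g\<bar>)\<^sup>2"
          using w that by (auto intro!: power_strict_mono dest: power2_less_imp_less)
        also have "(sqrt v * \<bar>g\<bar>)\<^sup>2 = v * g\<^sup>2" using that by (simp add: power_mult_distrib)
        finally show ?thesis using elim by (simp add: divide_less_eq)
      qed
      have "(\<integral>\<^sup>+v. ennreal (exp (- v)) * indicator {0..} v * indicator {0<..} (sqrt v * \<bar>g\<bar> - w) \<partial>lborel)
         = (\<integral>\<^sup>+v. ennreal (exp (- v)) * indicator {?r..} v \<partial>lborel)"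
      proof (rule nn_integral_cong_AE)
        show "AE v in lborel. ennreal (exp (- v)) * indicator {0..} v * indicator {0<..} (sqrt v * \<bar>g\<bar> - w)
            = ennreal (exp (- v)) * indicator {?r..} v"
          using AE_lborel_singleton[of ?r]
        proof eventually_elim
          case (elim v)
          then show ?case using r iff[of v] by (cases "0 \<le> v") (auto split: split_indicator)
        qed
      qed
      then show ?case by (simp add: nn_integral_exp_atLeast)
    qed
  qed
  finally show ?thesis by (simp add: nn_integral_gauss_exp_inverse_square[OF w])
qed

section \<open>Gamma integrals and comparison of tails crossing once\<close>

lemma nn_integral_power_times_exp:
  assumes l: "0 < l"
  shows "(\<integral>\<^sup>+u\<in>{0<..}. ennreal (u ^ k * exp (- (l * u))) \<partial>lborel) = ennreal (fact k / l ^ Suc k)"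
proof -
  have "ennreal (fact k) = (\<integral>\<^sup>+x. ennreal (x ^ k * exp (- x)) * indicator {0..} x \<partial>lborel)"
    by (simp add: nn_intergal_power_times_exp_Ici)
  also have "\<dots> = ennreal \<bar>l\<bar> * (\<integral>\<^sup>+u. ennreal ((0 + l * u) ^ k * exp (- (0 + l * u))) * indicator {0..} (0 + l * u) \<partial>lborel)"
    using l by (intro nn_integral_real_affine) auto
  also have "(\<integral>\<^sup>+u. ennreal ((0 + l * u) ^ k * exp (- (0 + l * u))) * indicator {0..} (0 + l * u) \<partial>lborel)
      = (\<integral>\<^sup>+u. ennreal (l ^ k) * (ennreal (u ^ k * exp (- (l * u))) * indicator {0<..} u) \<partial>lborel)"
  proof (rule nn_integral_cong_AE)
    show "AE u in lborel. ennreal ((0 + l * u) ^ k * exp (- (0 + l * u))) * indicator {0..} (0 + l * u)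
        = ennreal (l ^ k) * (ennreal (u ^ k * exp (- (l * u))) * indicator {0<..} u)"
      using AE_lborel_singleton[of "0::real"]
    proof eventually_elim
      case (elim u)
      then show ?case using l
        by (auto simp: ennreal_mult[symmetric] power_mult_distrib zero_le_mult_iff mult.assoc split: split_indicator)
    qed
  qed
  also have "\<dots> = ennreal (l ^ k) * (\<integral>\<^sup>+u\<in>{0<..}. ennreal (u ^ k * exp (- (l * u))) \<partial>lborel)"
    by (rule nn_integral_cmult) measurable
  finally have e: "ennreal (fact k) = ennreal (l ^ Suc k) * (\<integral>\<^sup>+u\<in>{0<..}. ennreal (u ^ k * exp (- (l * u))) \<partial>lborel)"
    using l by (simp add: ennreal_mult mult.assoc)
  have "ennreal (fact k / l ^ Suc k) = ennreal (1 / l ^ Suc k) * ennreal (fact k)"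
    using l by (simp add: ennreal_mult[symmetric])
  also have "\<dots> = (ennreal (1 / l ^ Suc k) * ennreal (l ^ Suc k)) * (\<integral>\<^sup>+u\<in>{0<..}. ennreal (u ^ k * exp (- (l * u))) \<partial>lborel)"
    unfolding e by (simp only: mult.assoc)
  also have "ennreal (1 / l ^ Suc k) * ennreal (l ^ Suc k) = 1"
    using l by (subst ennreal_mult[symmetric]) auto
  finally show ?thesis by simp
qed

text \<open>The ratio \<open>k u / u\<close> is nondecreasing, so replacing it by its value at the crossing point of \<open>N\<close> and
  \<open>E\<close> can only increase \<open>(N - E) * k\<close>.\<close>

lemma nn_integral_single_crossing:
  fixes N E k :: "real \<Rightarrow> real"
  assumes [measurable]: "N \<in> borel_measurable borel" "E \<in> borel_measurable borel" "k \<in> borel_measurable borel"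
    and nonneg: "\<And>u. 0 \<le> N u" "\<And>u. 0 \<le> E u" "\<And>u. 0 < u \<Longrightarrow> 0 \<le> k u"
    and cross: "\<And>s t. 0 < s \<Longrightarrow> s < t \<Longrightarrow> N s \<le> E s \<Longrightarrow> N t \<le> E t"
    and ratio: "\<And>u v. 0 < u \<Longrightarrow> u \<le> v \<Longrightarrow> k u * v \<le> k v * u"
    and eq: "(\<integral>\<^sup>+u\<in>{0<..}. ennreal (u * N u) \<partial>lborel) = (\<integral>\<^sup>+u\<in>{0<..}. ennreal (u * E u) \<partial>lborel)"
    and fin: "(\<integral>\<^sup>+u\<in>{0<..}. ennreal (u * E u) \<partial>lborel) < \<infinity>"
  shows "(\<integral>\<^sup>+u\<in>{0<..}. ennreal (k u * N u) \<partial>lborel) \<le> (\<integral>\<^sup>+u\<in>{0<..}. ennreal (k u * E u) \<partial>lborel)"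
proof -
  define S where "S = {u. 0 < u \<and> E u < N u}"
  have "\<exists>\<kappa>\<ge>0. \<forall>u>0. (u \<in> S \<longrightarrow> k u \<le> \<kappa> * u) \<and> (u \<notin> S \<longrightarrow> \<kappa> * u \<le> k u)" if ex: "\<exists>u1>0. u1 \<notin> S"
  proof (cases "S = {}")
    case True
    then show ?thesis using nonneg(3) by (intro exI[of _ 0]) auto
  next
    case False
    obtain u1 where u1: "0 < u1" "u1 \<notin> S" using ex by blast
    have less: "s < t" if "s \<in> S" "t \<notin> S" "0 < t" for s t
      using cross[of t s] that by (cases s t rule: linorder_cases) (auto simp: S_def not_less)
    have rat: "k u / u \<le> k v / v" if "0 < u" "u \<le> v" for u v
      using ratio[OF that] that by (simp add: field_simps)
    \<comment> \<open>By \<open>cross\<close>, the set \<open>S\<close> lies to the left of all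
      positive points outside it. The supremum of the ratios over \<open>S\<close> serves as the
      ratio at the crossing, and no such point has to be exhibited.\<close>
    define \<kappa> where "\<kappa> = Sup ((\<lambda>u. k u / u) ` S)"
    have ub: "k s / s \<le> k t / t" if "s \<in> S" "t \<notin> S" "0 < t" for s t
      using less[OF that] that by (intro rat) (auto simp: S_def)
    then have bdd: "bdd_above ((\<lambda>u. k u / u) ` S)" using u1 by (intro bdd_aboveI2) auto
    have "k u \<le> \<kappa> * u" if "u \<in> S" for u
    proof -
      have "k u / u \<le> \<kappa>" unfolding \<kappa>_def using that by (intro cSUP_upper bdd)
      then show ?thesis using that by (simp add: S_def field_simps)
    qed
    moreover have "\<kappa> * u \<le> k u" if "u \<notin> S" "0 < u" for u
    proof -
      have "\<kappa> \<le> k u / u" unfolding \<kappa>_def using False ub that by (intro cSUP_least) auto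
      then show ?thesis using that by (simp add: field_simps)
    qed
    moreover have "0 \<le> \<kappa>"
    proof -
      obtain s where s: "s \<in> S" using False by blast
      have "0 \<le> k s / s" using s nonneg(3) by (auto simp: S_def)
      also have "\<dots> \<le> \<kappa>" unfolding \<kappa>_def using s by (intro cSUP_upper bdd)
      finally show ?thesis .
    qed
    ultimately show ?thesis by blast
  qed
  then consider (all) "\<forall>u>0. u \<in> S" | (cut) \<kappa> where "0 \<le> \<kappa>" "\<And>u. 0 < u \<Longrightarrow> u \<in> S \<Longrightarrow> k u \<le> \<kappa> * u"
      "\<And>u. 0 < u \<Longrightarrow> u \<notin> S \<Longrightarrow> \<kappa> * u \<le> k u" by blast
  then show ?thesis
  proof cases
    \<comment> \<open>Without a crossing E < N on the whole half-line. The equal and finite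
      integrals of u N u and u E u then force almost every u to be nonpositive, so that both sides
      of the claim coincide.\<close>
    case all
    have le: "ennreal (u * E u) * indicator {0<..} u \<le> ennreal (u * N u) * indicator {0<..} u" for u
      using all by (auto simp: S_def less_imp_le intro!: ennreal_leI mult_left_mono split: split_indicator)
    have "(\<integral>\<^sup>+u. ennreal (u * N u) * indicator {0<..} u - ennreal (u * E u) * indicator {0<..} u \<partial>lborel) = 0"
      using fin eq by (subst nn_integral_diff) (auto simp: le less_top intro!: AE_I2)
    then have "AE u in lborel. ennreal (u * N u) * indicator {0<..} u - ennreal (u * E u) * indicator {0<..} u = 0"
      by (subst (asm) nn_integral_0_iff_AE) auto
    then have "AE u in lborel. u \<le> (0::real)"
    proof eventually_elim
      case (elim u)
      show ?case
      proof (rule ccontr)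
        assume "\<not> u \<le> 0"
        then have u: "0 < u" by simp
        then have "u * E u < u * N u" using all by (simp add: S_def)
        then have "ennreal (u * E u) < ennreal (u * N u)"
            using u nonneg(2)[of u] by (intro ennreal_lessI) (auto intro: le_less_trans[of 0 "u * E u" "u * N u"])
        then show False using elim u by (auto simp: diff_eq_0_iff_ennreal)
      qed
    qed
    then have "(\<integral>\<^sup>+u\<in>{0<..}. ennreal (k u * N u) \<partial>lborel) = (\<integral>\<^sup>+u\<in>{0<..}. ennreal (k u * E u) \<partial>lborel)"
      by (intro nn_integral_cong_AE) (auto elim!: eventually_mono split: split_indicator)
    then show ?thesis by simp
  next
    case cut
    let ?i = "indicator {0<..} :: real \<Rightarrow> ennreal"
    have pt: "ennreal (k u * N u) * ?i u + ennreal \<kappa> * (ennreal (u * E u) * ?i u)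
        \<le> ennreal (k u * E u) * ?i u + ennreal \<kappa> * (ennreal (u * N u) * ?i u)" for u
    proof (cases "0 < u")
      case True
      have "(k u - \<kappa> * u) * (N u - E u) \<le> 0"
      proof (cases "u \<in> S")
        case u: True
        then show ?thesis using cut(2)[OF True] by (intro mult_nonpos_nonneg) (auto simp: S_def)
      next
        case u: False
        then show ?thesis using cut(3)[OF True] True by (intro mult_nonneg_nonpos) (auto simp: S_def)
      qed
      then have "k u * N u + \<kappa> * (u * E u) \<le> k u * E u + \<kappa> * (u * N u)" by (simp add: algebra_simps)
      then have "ennreal (k u * N u + \<kappa> * (u * E u)) \<le> ennreal (k u * E u + \<kappa> * (u * N u))" by (rule ennreal_leI)
      then show ?thesis using True nonneg cut(1) by (simp add: ennreal_plus ennreal_mult)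
    qed simp
    have "(\<integral>\<^sup>+u\<in>{0<..}. ennreal (k u * N u) \<partial>lborel) + ennreal \<kappa> * (\<integral>\<^sup>+u\<in>{0<..}. ennreal (u * E u) \<partial>lborel)
        = (\<integral>\<^sup>+u. ennreal (k u * N u) * ?i u + ennreal \<kappa> * (ennreal (u * E u) * ?i u) \<partial>lborel)"
      by (simp add: nn_integral_add nn_integral_cmult)
    also have "\<dots> \<le> (\<integral>\<^sup>+u. ennreal (k u * E u) * ?i u + ennreal \<kappa> * (ennreal (u * N u) * ?i u) \<partial>lborel)"
      by (intro nn_integral_mono pt)
    also have "\<dots> = (\<integral>\<^sup>+u\<in>{0<..}. ennreal (k u * E u) \<partial>lborel) + ennreal \<kappa> * (\<integral>\<^sup>+u\<in>{0<..}. ennreal (u * E u) \<partial>lborel)"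
      by (simp add: nn_integral_add nn_integral_cmult eq)
    finally have "ennreal \<kappa> * (\<integral>\<^sup>+u\<in>{0<..}. ennreal (u * E u) \<partial>lborel) + (\<integral>\<^sup>+u\<in>{0<..}. ennreal (k u * N u) \<partial>lborel)
        \<le> ennreal \<kappa> * (\<integral>\<^sup>+u\<in>{0<..}. ennreal (u * E u) \<partial>lborel) + (\<integral>\<^sup>+u\<in>{0<..}. ennreal (k u * E u) \<partial>lborel)"
      by (simp only: add.commute)
    then show ?thesis using fin
      by (subst (asm) ennreal_add_left_cancel_le) (auto simp: ennreal_mult_eq_top_iff)
  qed
qed

text \<open>The function - ln N is convex and vanishes at 0, so once it has reached the line of
  slope l it remains above it. Hence a log-concave tail crosses an exponential tail at most
  once.\<close>

lemma log_concave_tail_crossing: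
  fixes N :: "real \<Rightarrow> real"
  assumes N: "\<And>s t. 0 \<le> s \<Longrightarrow> s \<le> t \<Longrightarrow> N t \<le> N s" "\<And>t. 0 \<le> N t" "N 0 = 1"
    and mid: "\<And>s t. 0 \<le> s \<Longrightarrow> 0 \<le> t \<Longrightarrow> N s * N t \<le> (N ((s + t) / 2))\<^sup>2"
    and st: "0 < s" "s < t" "N s \<le> exp (- (l * s))"
  shows "N t \<le> exp (- (l * t))"
proof -
  \<comment> \<open>The time is reversed because the interpolation lemma is formulated for
    nondecreasing functions.\<close>
  define \<phi> where "\<phi> \<theta> = N ((1 - \<theta>) * t)" for \<theta>
  have "\<phi> 0 powr (1 - (1 - s / t)) * \<phi> 1 powr (1 - s / t) \<le> \<phi> (1 - s / t)"
  proof (rule midpoint_log_concave_imp_log_concave)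
    show "mono_on {0..1} \<phi>"
      unfolding \<phi>_def using st by (intro mono_onI N) (auto intro!: mult_right_mono)
    show "0 \<le> \<phi> \<theta>" for \<theta> by (simp add: \<phi>_def N)
    show "\<phi> a * \<phi> b \<le> (\<phi> ((a + b) / 2))\<^sup>2" if "a \<in> {0..1}" "b \<in> {0..1}" for a b
    proof -
      have "N ((1 - a) * t) * N ((1 - b) * t) \<le> (N (((1 - a) * t + (1 - b) * t) / 2))\<^sup>2"
        using that st by (intro mid) auto
      also have "((1 - a) * t + (1 - b) * t) / 2 = (1 - (a + b) / 2) * t" by (simp add: field_simps)
      finally show ?thesis by (simp add: \<phi>_def)
    qed
    show "1 - s / t \<in> {0..1}" using st by simp
  qed
  then have "N t powr (s / t) \<le> N s" using st by (simp add: \<phi>_def N(3))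
  also note st(3)
  finally have "N t powr (s / t) \<le> exp (- (l * s))" .
  then have "(N t powr (s / t)) powr (t / s) \<le> exp (- (l * s)) powr (t / s)"
    using st by (intro powr_mono2) auto
  then show ?thesis using st N(2)[of t] by (simp add: powr_powr powr_def[of "exp _"] mult.commute)
qed

text \<open>A layer cake formula in |Y|. The variable Y survives only through the events u < |Y|,
  each multiplied by a convex function of Z; this is the shape on which negative dependence
  acts.\<close>

lemma nn_integral_sym_mean:
  assumes M: "prob_space M" and p: "3 \<le> p" and [measurable]: "Y \<in> borel_measurable M" "Z \<in> borel_measurable M"
  shows "(\<integral>\<^sup>+\<omega>. ennreal (sym_mean p (Z \<omega>) (Y \<omega>)) \<partial>M) = (\<integral>\<^sup>+\<omega>. ennreal (\<bar>Z \<omega>\<bar> powr p) \<partial>M)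
     + (\<integral>\<^sup>+u\<in>{0<..}. (\<integral>\<^sup>+\<omega>. indicator {u<..} \<bar>Y \<omega>\<bar> * ennreal (sym_deriv p (Z \<omega>) u) \<partial>M) \<partial>lborel)"
proof -
  interpret prob_space M by fact
  interpret P: pair_sigma_finite M "lborel :: real measure" ..
  have "(\<integral>\<^sup>+\<omega>. ennreal (sym_mean p (Z \<omega>) (Y \<omega>)) \<partial>M)
     = (\<integral>\<^sup>+\<omega>. ennreal (\<bar>Z \<omega>\<bar> powr p) + (\<integral>\<^sup>+u. indicator {0<..} u * (indicator {0<..} (\<bar>Y \<omega>\<bar> - u) * ennreal (sym_deriv p (Z \<omega>) u)) \<partial>lborel) \<partial>M)"
  proof (intro nn_integral_cong)
    fix \<omega>
    have "ennreal (sym_mean p (Z \<omega>) (Y \<omega>)) = ennreal (\<bar>Z \<omega>\<bar> powr p) + (\<integral>\<^sup>+u. ennreal (sym_deriv p (Z \<omega>) u) * indicator {0..\<bar>Y \<omega>\<bar>} u \<partial>lborel)"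
      using sym_mean_eq_nn_integral[OF p, of "\<bar>Y \<omega>\<bar>" "Z \<omega>"] by (simp add: sym_mean_abs)
    also have "(\<integral>\<^sup>+u. ennreal (sym_deriv p (Z \<omega>) u) * indicator {0..\<bar>Y \<omega>\<bar>} u \<partial>lborel)
       = (\<integral>\<^sup>+u. indicator {0<..} u * (indicator {0<..} (\<bar>Y \<omega>\<bar> - u) * ennreal (sym_deriv p (Z \<omega>) u)) \<partial>lborel)"
    proof (rule nn_integral_cong_AE)
      show "AE u in lborel. ennreal (sym_deriv p (Z \<omega>) u) * indicator {0..\<bar>Y \<omega>\<bar>} u
          = indicator {0<..} u * (indicator {0<..} (\<bar>Y \<omega>\<bar> - u) * ennreal (sym_deriv p (Z \<omega>) u))"
        using AE_lborel_singleton[of "0::real"] AE_lborel_singleton[of "\<bar>Y \<omega>\<bar>"]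
        by eventually_elim (auto split: split_indicator)
    qed
    finally show "ennreal (sym_mean p (Z \<omega>) (Y \<omega>)) = ennreal (\<bar>Z \<omega>\<bar> powr p)
       + (\<integral>\<^sup>+u. indicator {0<..} u * (indicator {0<..} (\<bar>Y \<omega>\<bar> - u) * ennreal (sym_deriv p (Z \<omega>) u)) \<partial>lborel)" .
  qed
  also have "\<dots> = (\<integral>\<^sup>+\<omega>. ennreal (\<bar>Z \<omega>\<bar> powr p) \<partial>M)
     + (\<integral>\<^sup>+\<omega>. (\<integral>\<^sup>+u. indicator {0<..} u * (indicator {0<..} (\<bar>Y \<omega>\<bar> - u) * ennreal (sym_deriv p (Z \<omega>) u)) \<partial>lborel) \<partial>M)"
    by (intro nn_integral_add) measurable
  also have "(\<integral>\<^sup>+\<omega>. (\<integral>\<^sup>+u. indicator {0<..} u * (indicator {0<..} (\<bar>Y \<omega>\<bar> - u) * ennreal (sym_deriv p (Z \<omega>) u)) \<partial>lborel) \<partial>M)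
     = (\<integral>\<^sup>+u. (\<integral>\<^sup>+\<omega>. indicator {0<..} u * (indicator {0<..} (\<bar>Y \<omega>\<bar> - u) * ennreal (sym_deriv p (Z \<omega>) u)) \<partial>M) \<partial>lborel)"
    by (rule P.Fubini'[symmetric]) measurable
  also have "\<dots> = (\<integral>\<^sup>+u\<in>{0<..}. (\<integral>\<^sup>+\<omega>. indicator {u<..} \<bar>Y \<omega>\<bar> * ennreal (sym_deriv p (Z \<omega>) u) \<partial>M) \<partial>lborel)"
  proof (intro nn_integral_cong)
    fix u :: real
    have "(\<integral>\<^sup>+\<omega>. indicator {0<..} u * (indicator {0<..} (\<bar>Y \<omega>\<bar> - u) * ennreal (sym_deriv p (Z \<omega>) u)) \<partial>M)
       = indicator {0<..} u * (\<integral>\<^sup>+\<omega>. indicator {0<..} (\<bar>Y \<omega>\<bar> - u) * ennreal (sym_deriv p (Z \<omega>) u) \<partial>M)"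
      by (intro nn_integral_cmult) measurable
    also have "(\<integral>\<^sup>+\<omega>. indicator {0<..} (\<bar>Y \<omega>\<bar> - u) * ennreal (sym_deriv p (Z \<omega>) u) \<partial>M)
       = (\<integral>\<^sup>+\<omega>. indicator {u<..} \<bar>Y \<omega>\<bar> * ennreal (sym_deriv p (Z \<omega>) u) \<partial>M)"
      by (intro nn_integral_cong) (auto split: split_indicator)
    finally show "(\<integral>\<^sup>+\<omega>. indicator {0<..} u * (indicator {0<..} (\<bar>Y \<omega>\<bar> - u) * ennreal (sym_deriv p (Z \<omega>) u)) \<partial>M)
       = (\<integral>\<^sup>+\<omega>. indicator {u<..} \<bar>Y \<omega>\<bar> * ennreal (sym_deriv p (Z \<omega>) u) \<partial>M) * indicator {0<..} u"
      by (simp only: mult.commute)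
  qed
  finally show ?thesis .
qed

text \<open>The layer cake formula for Y = c sqrt V G with V exponential. By
  \<open>laplace_gaussian_mixture_tail\<close> its tail is exp (- (sqrt 2 / c * u)). Read from right
  to left, it turns an exponential tail back into a Gaussian mixture.\<close>

lemma laplace_smoothing:
  assumes p: "3 \<le> p" and c: "0 < c"
  shows "(\<integral>\<^sup>+v\<in>{0..}. (ennreal (exp (- v)) * (\<integral>\<^sup>+g. ennreal (\<bar>s + c * sqrt v * g\<bar> powr p) \<partial>std_normal_distribution)) \<partial>lborel)
     = ennreal (\<bar>s\<bar> powr p) + (\<integral>\<^sup>+u\<in>{0<..}. ennreal (sym_deriv p s u * exp (- (sqrt 2 / c * u))) \<partial>lborel)"
proof -
  interpret N: prob_space std_normal_distribution by (rule prob_space_normal_density) simp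
  let ?N = std_normal_distribution
  let ?D = "\<lambda>u. ennreal (sym_deriv p s u)"
  have inner: "(\<integral>\<^sup>+g. ennreal (\<bar>s + c * sqrt v * g\<bar> powr p) \<partial>?N)
      = ennreal (\<bar>s\<bar> powr p) + (\<integral>\<^sup>+u\<in>{0<..}. (?D u * emeasure ?N {g. u / c < sqrt v * \<bar>g\<bar>}) \<partial>lborel)" if v: "0 \<le> v" for v
  proof -
    let ?t = "c * sqrt v"
    have t: "0 \<le> ?t" using c v by simp
    have "(\<integral>\<^sup>+g. ennreal (sym_mean p s (?t * g)) \<partial>?N)
        = (\<integral>\<^sup>+g. (ennreal (\<bar>s + ?t * g\<bar> powr p) + ennreal (\<bar>s - ?t * g\<bar> powr p)) / 2 \<partial>?N)"
      by (intro nn_integral_cong) (simp add: sym_mean_def ennreal_plus[symmetric] divide_ennreal[symmetric] del: ennreal_plus)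
    also have "\<dots> = ((\<integral>\<^sup>+g. ennreal (\<bar>s + ?t * g\<bar> powr p) \<partial>?N) + (\<integral>\<^sup>+g. ennreal (\<bar>s + ?t * - g\<bar> powr p) \<partial>?N)) / 2"
      by (simp add: nn_integral_divide nn_integral_add)
    also have "(\<integral>\<^sup>+g. ennreal (\<bar>s + ?t * - g\<bar> powr p) \<partial>?N) = (\<integral>\<^sup>+g. ennreal (\<bar>s + ?t * g\<bar> powr p) \<partial>?N)"
      by (rule nn_integral_std_normal_uminus) measurable
    also have "((\<integral>\<^sup>+g. ennreal (\<bar>s + ?t * g\<bar> powr p) \<partial>?N) + (\<integral>\<^sup>+g. ennreal (\<bar>s + ?t * g\<bar> powr p) \<partial>?N)) / 2
        = (\<integral>\<^sup>+g. ennreal (\<bar>s + ?t * g\<bar> powr p) \<partial>?N)"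
      by (simp add: mult_2[symmetric] mult.commute[of 2] ennreal_mult_divide_eq)
    finally have "(\<integral>\<^sup>+g. ennreal (\<bar>s + ?t * g\<bar> powr p) \<partial>?N) = (\<integral>\<^sup>+g. ennreal (sym_mean p s (?t * g)) \<partial>?N)" ..
    also have "\<dots> = (\<integral>\<^sup>+g. ennreal (\<bar>s\<bar> powr p) \<partial>?N)
        + (\<integral>\<^sup>+u\<in>{0<..}. (\<integral>\<^sup>+g. indicator {u<..} \<bar>?t * g\<bar> * ?D u \<partial>?N) \<partial>lborel)"
      by (rule nn_integral_sym_mean[OF N.prob_space_axioms p, of "\<lambda>g. ?t * g" "\<lambda>_. s"]) measurable
    also have "(\<integral>\<^sup>+g. ennreal (\<bar>s\<bar> powr p) \<partial>?N) = ennreal (\<bar>s\<bar> powr p)" using N.emeasure_space_1 by simp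
    also have "(\<integral>\<^sup>+u\<in>{0<..}. (\<integral>\<^sup>+g. indicator {u<..} \<bar>?t * g\<bar> * ?D u \<partial>?N) \<partial>lborel)
        = (\<integral>\<^sup>+u\<in>{0<..}. (?D u * emeasure ?N {g. u / c < sqrt v * \<bar>g\<bar>}) \<partial>lborel)"
    proof (intro nn_integral_cong)
      fix u :: real
      have "(\<integral>\<^sup>+g. indicator {u<..} \<bar>?t * g\<bar> * ?D u \<partial>?N) = (\<integral>\<^sup>+g. ?D u * indicator {g. u / c < sqrt v * \<bar>g\<bar>} g \<partial>?N)"
        using c v by (intro nn_integral_cong) (auto simp: abs_mult field_simps split: split_indicator)
      also have "\<dots> = ?D u * emeasure ?N {g. u / c < sqrt v * \<bar>g\<bar>}"
        by (rule nn_integral_cmult_indicator) measurable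
      finally show "(\<integral>\<^sup>+g. indicator {u<..} \<bar>?t * g\<bar> * ?D u \<partial>?N) * indicator {0<..} u
          = ?D u * emeasure ?N {g. u / c < sqrt v * \<bar>g\<bar>} * indicator {0<..} u" by simp
    qed
    finally show ?thesis .
  qed
  define E where "E u v = emeasure ?N {g. u / c < sqrt v * \<bar>g\<bar>}" for u v
  have E_meas [measurable]: "(\<lambda>p. E (fst p) (snd p)) \<in> borel_measurable (borel \<Otimes>\<^sub>M borel)"
  proof -
    have "(\<lambda>p. \<integral>\<^sup>+g. indicator {0<..} (sqrt (snd p) * \<bar>g\<bar> - fst p / c) \<partial>?N) \<in> borel_measurable (borel \<Otimes>\<^sub>M borel)"
      by measurable
    moreover have "(\<integral>\<^sup>+g. indicator {0<..} (sqrt v * \<bar>g\<bar> - u / c) \<partial>?N) = E u v" for u v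
    proof -
      have "(\<integral>\<^sup>+g. indicator {0<..} (sqrt v * \<bar>g\<bar> - u / c) \<partial>?N) = (\<integral>\<^sup>+g. indicator {g. u / c < sqrt v * \<bar>g\<bar>} g \<partial>?N)"
        by (intro nn_integral_cong) (auto split: split_indicator)
      also have "\<dots> = E u v" unfolding E_def by (rule nn_integral_indicator) measurable
      finally show ?thesis .
    qed
    ultimately show ?thesis by simp
  qed
  have H: "(\<lambda>p. ennreal (exp (- fst p)) * indicator {0..} (fst p) * (?D (snd p) * E (snd p) (fst p) * indicator {0<..} (snd p)))
      \<in> borel_measurable (lborel \<Otimes>\<^sub>M lborel)"
  proof -
    have [measurable]: "(\<lambda>p. E (snd p) (fst p)) \<in> borel_measurable (borel \<Otimes>\<^sub>M borel)"
      using measurable_compose[OF measurable_Pair[OF measurable_snd measurable_fst] E_meas] by simp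
    show ?thesis by measurable
  qed
  have H1: "(\<lambda>v. \<integral>\<^sup>+u. ennreal (exp (- v)) * indicator {0..} v * (?D u * E u v * indicator {0<..} u) \<partial>lborel) \<in> borel_measurable lborel"
    using lborel.borel_measurable_nn_integral[of "\<lambda>v u. ennreal (exp (- v)) * indicator {0..} v * (?D u * E u v * indicator {0<..} u)" lborel] H
    by (simp only: split_beta')
  have E1 [measurable]: "(\<lambda>v. E u v) \<in> borel_measurable borel" for u
    using measurable_compose[OF _ E_meas, of "\<lambda>v. (u, v)" borel] by simp
  have E2 [measurable]: "(\<lambda>u. E u v) \<in> borel_measurable borel" for v
    using measurable_compose[OF _ E_meas, of "\<lambda>u. (u, v)" borel] by simp
  have "(\<integral>\<^sup>+v\<in>{0..}. (ennreal (exp (- v)) * (\<integral>\<^sup>+g. ennreal (\<bar>s + c * sqrt v * g\<bar> powr p) \<partial>?N)) \<partial>lborel)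
      = (\<integral>\<^sup>+v. ennreal (exp (- v)) * indicator {0..} v * ennreal (\<bar>s\<bar> powr p)
        + (\<integral>\<^sup>+u. ennreal (exp (- v)) * indicator {0..} v * (?D u * E u v * indicator {0<..} u) \<partial>lborel) \<partial>lborel)"
  proof (intro nn_integral_cong)
    fix v :: real
    have "(\<integral>\<^sup>+u. ennreal (exp (- v)) * indicator {0..} v * (?D u * E u v * indicator {0<..} u) \<partial>lborel)
        = ennreal (exp (- v)) * indicator {0..} v * (\<integral>\<^sup>+u\<in>{0<..}. (?D u * E u v) \<partial>lborel)"
      by (intro nn_integral_cmult) measurable
    then show "ennreal (exp (- v)) * (\<integral>\<^sup>+g. ennreal (\<bar>s + c * sqrt v * g\<bar> powr p) \<partial>?N) * indicator {0..} v
      = ennreal (exp (- v)) * indicator {0..} v * ennreal (\<bar>s\<bar> powr p)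
        + (\<integral>\<^sup>+u. ennreal (exp (- v)) * indicator {0..} v * (?D u * E u v * indicator {0<..} u) \<partial>lborel)"
      using inner[of v] by (cases "0 \<le> v") (simp_all add: E_def distrib_left)
  qed
  also have "\<dots> = (\<integral>\<^sup>+v. ennreal (exp (- v)) * indicator {0..} v * ennreal (\<bar>s\<bar> powr p) \<partial>lborel)
      + (\<integral>\<^sup>+v. (\<integral>\<^sup>+u. ennreal (exp (- v)) * indicator {0..} v * (?D u * E u v * indicator {0<..} u) \<partial>lborel) \<partial>lborel)"
    by (rule nn_integral_add[OF _ H1]) measurable
  also have "(\<integral>\<^sup>+v. ennreal (exp (- v)) * indicator {0..} v * ennreal (\<bar>s\<bar> powr p) \<partial>lborel) = ennreal (\<bar>s\<bar> powr p)"
    by (subst nn_integral_multc) (auto simp: nn_integral_exp_atLeast)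
  also have "(\<integral>\<^sup>+v. (\<integral>\<^sup>+u. ennreal (exp (- v)) * indicator {0..} v * (?D u * E u v * indicator {0<..} u) \<partial>lborel) \<partial>lborel)
      = (\<integral>\<^sup>+u. (\<integral>\<^sup>+v. ennreal (exp (- v)) * indicator {0..} v * (?D u * E u v * indicator {0<..} u) \<partial>lborel) \<partial>lborel)"
    using H by (intro lborel_pair.Fubini'[symmetric]) (simp only: split_beta')
  also have "\<dots> = (\<integral>\<^sup>+u\<in>{0<..}. ennreal (sym_deriv p s u * exp (- (sqrt 2 / c * u))) \<partial>lborel)"
  proof (intro nn_integral_cong)
    fix u :: real
    have "(\<integral>\<^sup>+v. ennreal (exp (- v)) * indicator {0..} v * (?D u * E u v * indicator {0<..} u) \<partial>lborel)
        = (\<integral>\<^sup>+v. (?D u * indicator {0<..} u) * (ennreal (exp (- v)) * E u v * indicator {0..} v) \<partial>lborel)"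
      by (intro nn_integral_cong) (simp only: mult_ac)
    also have "\<dots> = (?D u * indicator {0<..} u) * (\<integral>\<^sup>+v\<in>{0..}. (ennreal (exp (- v)) * E u v) \<partial>lborel)"
      by (intro nn_integral_cmult) measurable
    also have "\<dots> = ennreal (sym_deriv p s u * exp (- (sqrt 2 / c * u))) * indicator {0<..} u"
    proof (cases "0 < u")
      case True
      then have "(\<integral>\<^sup>+v\<in>{0..}. (ennreal (exp (- v)) * E u v) \<partial>lborel) = ennreal (exp (- (sqrt 2 * (u / c))))"
        unfolding E_def using c by (intro laplace_gaussian_mixture_tail) simp
      moreover have "0 \<le> sym_deriv p s u" using True p by (intro sym_deriv_nonneg) auto
      ultimately show ?thesis using True by (simp add: ennreal_mult)
    qed simp
    finally show "(\<integral>\<^sup>+v. ennreal (exp (- v)) * indicator {0..} v * (?D u * E u v * indicator {0<..} u) \<partial>lborel) = \<dots>" .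
  qed
  finally show ?thesis .
qed

section \<open>Unconditional vectors\<close>

lemma borel_measurable_vec_nth [measurable]:
  fixes f :: "'a \<Rightarrow> real ^ 'n"
  assumes "f \<in> borel_measurable M"
  shows "(\<lambda>\<omega>. f \<omega> $ i) \<in> borel_measurable M"
  using assms by (simp add: cart_eq_inner_axis)

lemma borel_measurable_vec_lambda:
  fixes f :: "'n::finite \<Rightarrow> 'a \<Rightarrow> real"
  assumes "\<And>i. f i \<in> borel_measurable M"
  shows "(\<lambda>\<omega>. \<chi> i. f i \<omega>) \<in> borel_measurable M"
  using assms by (subst borel_measurable_euclidean_space) (auto simp: Basis_vec_def inner_axis)

text \<open>What is kept of log-concavity is one-dimensional: the tails of the |X_i| are midpoint
  log-concave and start at 1. Isotropy is kept as the normalization of the second moments.\<close>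

locale unconditional_vector = prob_space M for M :: "'a measure" +
  fixes X :: "'a \<Rightarrow> real ^ 'n"
  assumes X_measurable [measurable]: "X \<in> borel_measurable M"
    and unconditional: "unconditional M X"
    and second_moment: "\<And>i. (\<integral>\<^sup>+\<omega>. ennreal ((X \<omega> $ i)\<^sup>2) \<partial>M) = 1"
    and tail_0: "\<And>i. prob {\<omega> \<in> space M. 0 < \<bar>X \<omega> $ i\<bar>} = 1"
    and tail_midpoint: "\<And>i s t. 0 \<le> s \<Longrightarrow> 0 \<le> t \<Longrightarrow>
      prob {\<omega> \<in> space M. s < \<bar>X \<omega> $ i\<bar>} * prob {\<omega> \<in> space M. t < \<bar>X \<omega> $ i\<bar>}
        \<le> (prob {\<omega> \<in> space M. (s + t) / 2 < \<bar>X \<omega> $ i\<bar>})\<^sup>2"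
begin

definition lin :: "('n \<Rightarrow> real) \<Rightarrow> 'n set \<Rightarrow> 'a \<Rightarrow> real" where
  "lin a I \<omega> = (\<Sum>i\<in>I. a i * X \<omega> $ i)"

lemma lin_measurable [measurable]: "lin a I \<in> borel_measurable M"
  unfolding lin_def by measurable

lemma nn_integral_sign_change:
  assumes "\<And>i. \<eta> i \<in> {-1, 1}" and [measurable]: "h \<in> borel_measurable borel"
  shows "(\<integral>\<^sup>+\<omega>. h (X \<omega>) \<partial>M) = (\<integral>\<^sup>+\<omega>. h (\<chi> i. \<eta> i * X \<omega> $ i) \<partial>M)"
proof -
  have [measurable]: "(\<lambda>\<omega>. \<chi> i. \<eta> i * X \<omega> $ i) \<in> borel_measurable M"
    by (intro borel_measurable_vec_lambda) measurable
  have "(\<integral>\<^sup>+\<omega>. h (X \<omega>) \<partial>M) = (\<integral>\<^sup>+x. h x \<partial>distr M borel X)" by (simp add: nn_integral_distr)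
  also have "\<dots> = (\<integral>\<^sup>+x. h x \<partial>distr M borel (\<lambda>\<omega>. \<chi> i. \<eta> i * X \<omega> $ i))"
    using unconditional assms(1) by (simp add: unconditional_def)
  also have "\<dots> = (\<integral>\<^sup>+\<omega>. h (\<chi> i. \<eta> i * X \<omega> $ i) \<partial>M)" by (simp add: nn_integral_distr)
  finally show ?thesis .
qed

lemma lin_insert: "j \<notin> I \<Longrightarrow> lin a (insert j I) \<omega> = lin a I \<omega> + a j * X \<omega> $ j"
  by (simp add: lin_def)

lemma nn_integral_flip_coordinate:
  assumes p: "3 \<le> p" and j: "j \<notin> I"
  shows "(\<integral>\<^sup>+\<omega>. ennreal (\<bar>lin a (insert j I) \<omega> + z\<bar> powr p) \<partial>M)
     = (\<integral>\<^sup>+\<omega>. ennreal (sym_mean p (lin a I \<omega> + z) (a j * X \<omega> $ j)) \<partial>M)"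
proof -
  let ?h = "\<lambda>x :: real ^ 'n. ennreal (\<bar>(\<Sum>i\<in>insert j I. a i * x $ i) + z\<bar> powr p)"
  let ?\<eta> = "\<lambda>i. if i = j then -1 else 1 :: real"
  have "(\<integral>\<^sup>+\<omega>. ?h (X \<omega>) \<partial>M) = (\<integral>\<^sup>+\<omega>. ?h (\<chi> i. ?\<eta> i * X \<omega> $ i) \<partial>M)"
    by (rule nn_integral_sign_change) auto
  moreover have "?h (\<chi> i. ?\<eta> i * X \<omega> $ i) = ennreal (\<bar>lin a I \<omega> + z - a j * X \<omega> $ j\<bar> powr p)" for \<omega>
  proof -
    have "(\<Sum>i\<in>I. a i * (?\<eta> i * X \<omega> $ i)) = lin a I \<omega>"
      unfolding lin_def using j by (intro sum.cong) auto
    then show ?thesis using j by (simp add: algebra_simps)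
  qed
  moreover have "?h (X \<omega>) = ennreal (\<bar>lin a I \<omega> + z + a j * X \<omega> $ j\<bar> powr p)" for \<omega>
    using j by (simp add: lin_def algebra_simps)
  ultimately have flip: "(\<integral>\<^sup>+\<omega>. ennreal (\<bar>lin a I \<omega> + z + a j * X \<omega> $ j\<bar> powr p) \<partial>M)
      = (\<integral>\<^sup>+\<omega>. ennreal (\<bar>lin a I \<omega> + z - a j * X \<omega> $ j\<bar> powr p) \<partial>M)" by (simp only:)
  have "(\<integral>\<^sup>+\<omega>. ennreal (sym_mean p (lin a I \<omega> + z) (a j * X \<omega> $ j)) \<partial>M)
      = (\<integral>\<^sup>+\<omega>. (ennreal (\<bar>lin a I \<omega> + z + a j * X \<omega> $ j\<bar> powr p) + ennreal (\<bar>lin a I \<omega> + z - a j * X \<omega> $ j\<bar> powr p)) / 2 \<partial>M)"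
    by (intro nn_integral_cong) (simp add: sym_mean_def ennreal_plus[symmetric] divide_ennreal[symmetric] del: ennreal_plus)
  also have "\<dots> = ((\<integral>\<^sup>+\<omega>. ennreal (\<bar>lin a I \<omega> + z + a j * X \<omega> $ j\<bar> powr p) \<partial>M)
      + (\<integral>\<^sup>+\<omega>. ennreal (\<bar>lin a I \<omega> + z - a j * X \<omega> $ j\<bar> powr p) \<partial>M)) / 2"
    by (simp add: nn_integral_divide nn_integral_add)
  also have "\<dots> = (\<integral>\<^sup>+\<omega>. ennreal (\<bar>lin a I \<omega> + z + a j * X \<omega> $ j\<bar> powr p) \<partial>M)"
    unfolding flip[symmetric] by (simp add: mult_2[symmetric] mult.commute[of 2] ennreal_mult_divide_eq)
  finally show ?thesis using j by (simp add: lin_insert algebra_simps)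
qed

section \<open>Tails and moments of the marginals\<close>

definition tail :: "'n \<Rightarrow> real \<Rightarrow> real" where
  "tail i u = prob {\<omega> \<in> space M. u < \<bar>X \<omega> $ i\<bar>}"

lemma tail_antimono: "s \<le> t \<Longrightarrow> tail i t \<le> tail i s"
  unfolding tail_def by (intro finite_measure_mono) auto

lemma tail_measurable [measurable]: "tail i \<in> borel_measurable borel"
proof -
  have "mono (\<lambda>u. - tail i u)" using tail_antimono by (auto intro!: monoI)
  then have "(\<lambda>u. - tail i u) \<in> borel_measurable borel" by (rule borel_measurable_mono)
  then have "(\<lambda>u. - (- tail i u)) \<in> borel_measurable borel" by (rule borel_measurable_uminus)
  then show ?thesis by simp
qed

lemma tail_nonneg: "0 \<le> tail i u"
  by (simp add: tail_def)

lemma nn_integral_tail: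
  assumes [measurable]: "k \<in> borel_measurable borel" and k: "\<And>u. 0 < u \<Longrightarrow> 0 \<le> k u"
  shows "(\<integral>\<^sup>+\<omega>. (\<integral>\<^sup>+u\<in>{0<..}. (ennreal (k u) * indicator {u<..} \<bar>X \<omega> $ i\<bar>) \<partial>lborel) \<partial>M)
     = (\<integral>\<^sup>+u\<in>{0<..}. ennreal (k u * tail i u) \<partial>lborel)"
proof -
  interpret P: pair_sigma_finite M "lborel :: real measure" ..
  have "(\<integral>\<^sup>+\<omega>. (\<integral>\<^sup>+u\<in>{0<..}. (ennreal (k u) * indicator {u<..} \<bar>X \<omega> $ i\<bar>) \<partial>lborel) \<partial>M)
      = (\<integral>\<^sup>+\<omega>. (\<integral>\<^sup>+u. ennreal (k u) * indicator {0<..} u * indicator {0<..} (\<bar>X \<omega> $ i\<bar> - u) \<partial>lborel) \<partial>M)"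
    by (intro nn_integral_cong) (auto split: split_indicator)
  also have "\<dots> = (\<integral>\<^sup>+u. (\<integral>\<^sup>+\<omega>. ennreal (k u) * indicator {0<..} u * indicator {0<..} (\<bar>X \<omega> $ i\<bar> - u) \<partial>M) \<partial>lborel)"
    by (rule P.Fubini'[symmetric]) measurable
  also have "\<dots> = (\<integral>\<^sup>+u\<in>{0<..}. ennreal (k u * tail i u) \<partial>lborel)"
  proof (intro nn_integral_cong)
    fix u :: real
    have "(\<integral>\<^sup>+\<omega>. ennreal (k u) * indicator {0<..} u * indicator {0<..} (\<bar>X \<omega> $ i\<bar> - u) \<partial>M)
        = (\<integral>\<^sup>+\<omega>. ennreal (k u) * indicator {0<..} u * indicator {\<omega> \<in> space M. u < \<bar>X \<omega> $ i\<bar>} \<omega> \<partial>M)"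
      by (intro nn_integral_cong) (auto split: split_indicator)
    also have "\<dots> = ennreal (k u) * indicator {0<..} u * emeasure M {\<omega> \<in> space M. u < \<bar>X \<omega> $ i\<bar>}"
      by (rule nn_integral_cmult_indicator) measurable
    also have "\<dots> = ennreal (k u * tail i u) * indicator {0<..} u"
      using k[of u] by (cases "0 < u") (simp_all add: tail_def emeasure_eq_measure ennreal_mult)
    finally show "(\<integral>\<^sup>+\<omega>. ennreal (k u) * indicator {0<..} u * indicator {0<..} (\<bar>X \<omega> $ i\<bar> - u) \<partial>M) = \<dots>" .
  qed
  finally show ?thesis .
qed

lemma nn_integral_power_tail:
  "(\<integral>\<^sup>+\<omega>. ennreal (\<bar>X \<omega> $ i\<bar> ^ Suc k) \<partial>M) = (\<integral>\<^sup>+u\<in>{0<..}. ennreal (real (Suc k) * u ^ k * tail i u) \<partial>lborel)"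
proof -
  have "(\<integral>\<^sup>+u\<in>{0<..}. (ennreal (real (Suc k) * u ^ k) * indicator {u<..} y) \<partial>lborel) = ennreal (y ^ Suc k)"
    if y: "0 \<le> y" for y :: real
  proof -
    have "(\<integral>\<^sup>+u\<in>{0<..}. (ennreal (real (Suc k) * u ^ k) * indicator {u<..} y) \<partial>lborel)
        = (\<integral>\<^sup>+u. ennreal (real (Suc k) * u ^ k) * indicator {0..y} u \<partial>lborel)"
    proof (rule nn_integral_cong_AE)
      show "AE u in lborel. ennreal (real (Suc k) * u ^ k) * indicator {u<..} y * indicator {0<..} u
          = ennreal (real (Suc k) * u ^ k) * indicator {0..y} u"
        using AE_lborel_singleton[of "0::real"] AE_lborel_singleton[of y]
        by eventually_elim (auto split: split_indicator)
    qed
    also have "\<dots> = ennreal (y ^ Suc k - 0 ^ Suc k)"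
      using y by (intro nn_integral_FTC_Icc) (auto intro!: derivative_eq_intros simp del: power_Suc)
    finally show ?thesis by simp
  qed
  then have "(\<integral>\<^sup>+\<omega>. ennreal (\<bar>X \<omega> $ i\<bar> ^ Suc k) \<partial>M)
      = (\<integral>\<^sup>+\<omega>. (\<integral>\<^sup>+u\<in>{0<..}. (ennreal (real (Suc k) * u ^ k) * indicator {u<..} \<bar>X \<omega> $ i\<bar>) \<partial>lborel) \<partial>M)"
    by simp
  also have "\<dots> = (\<integral>\<^sup>+u\<in>{0<..}. ennreal (real (Suc k) * u ^ k * tail i u) \<partial>lborel)"
    by (rule nn_integral_tail) auto
  finally show ?thesis .
qed

text \<open>The rate sqrt 2 / c is the one for which the exponential tail has the same second moment
  as c |X_i|: both integrals against u equal c^2 / 2. A log-concave tail crosses it at most once,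
  from above, so every k with nondecreasing k u / u favours the exponential tail.\<close>

lemma tail_crossing:
  assumes k_measurable[measurable]: "k \<in> borel_measurable borel" and k: "\<And>u. 0 < u \<Longrightarrow> 0 \<le> k u"
    and ratio: "\<And>u v. 0 < u \<Longrightarrow> u \<le> v \<Longrightarrow> k u * v \<le> k v * u" and c: "0 < c"
  shows "(\<integral>\<^sup>+u\<in>{0<..}. ennreal (k u * tail i (u / c)) \<partial>lborel) \<le> (\<integral>\<^sup>+u\<in>{0<..}. ennreal (k u * exp (- (sqrt 2 / c * u))) \<partial>lborel)"
proof (rule nn_integral_single_crossing)
  have scale: "(\<integral>\<^sup>+u\<in>{0<..}. ennreal (u * tail i (u / c)) \<partial>lborel) = ennreal (c\<^sup>2) * (\<integral>\<^sup>+u\<in>{0<..}. ennreal (u * tail i u) \<partial>lborel)"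
  proof -
    have "(\<integral>\<^sup>+u. ennreal (u * tail i (u / c)) * indicator {0<..} u \<partial>lborel)
        = ennreal \<bar>c\<bar> * (\<integral>\<^sup>+u. ennreal ((0 + c * u) * tail i ((0 + c * u) / c)) * indicator {0<..} (0 + c * u) \<partial>lborel)"
      using c by (intro nn_integral_real_affine) auto
    also have "(\<integral>\<^sup>+u. ennreal ((0 + c * u) * tail i ((0 + c * u) / c)) * indicator {0<..} (0 + c * u) \<partial>lborel)
        = (\<integral>\<^sup>+u. ennreal c * (ennreal (u * tail i u) * indicator {0<..} u) \<partial>lborel)"
      using c by (intro nn_integral_cong)
        (auto simp: ennreal_mult[symmetric] tail_nonneg zero_less_mult_iff mult.assoc split: split_indicator)
    also have "\<dots> = ennreal c * (\<integral>\<^sup>+u\<in>{0<..}. ennreal (u * tail i u) \<partial>lborel)"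
      by (intro nn_integral_cmult) measurable
    finally show ?thesis using c by (simp add: ennreal_mult power2_eq_square mult.assoc)
  qed
  have half: "(\<integral>\<^sup>+u\<in>{0<..}. ennreal (u * tail i u) \<partial>lborel) = ennreal (1 / 2)"
  proof -
    have "1 = (\<integral>\<^sup>+\<omega>. ennreal (\<bar>X \<omega> $ i\<bar> ^ Suc 1) \<partial>M)"
      using second_moment[of i] by (simp add: power2_eq_square)
    also have "\<dots> = (\<integral>\<^sup>+u\<in>{0<..}. ennreal (2 * (u * tail i u)) \<partial>lborel)"
      unfolding nn_integral_power_tail by (intro nn_integral_cong) (simp add: mult.assoc)
    also have "\<dots> = (\<integral>\<^sup>+u. ennreal 2 * (ennreal (u * tail i u) * indicator {0<..} u) \<partial>lborel)"
      by (intro nn_integral_cong) (auto simp: ennreal_mult tail_nonneg split: split_indicator)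
    also have "\<dots> = ennreal 2 * (\<integral>\<^sup>+u\<in>{0<..}. ennreal (u * tail i u) \<partial>lborel)"
      by (intro nn_integral_cmult) measurable
    finally have e: "ennreal 2 * (\<integral>\<^sup>+u\<in>{0<..}. ennreal (u * tail i u) \<partial>lborel) = 1" ..
    have "(\<integral>\<^sup>+u\<in>{0<..}. ennreal (u * tail i u) \<partial>lborel)
        = ennreal (1 / 2) * ennreal 2 * (\<integral>\<^sup>+u\<in>{0<..}. ennreal (u * tail i u) \<partial>lborel)"
      by (subst ennreal_mult[symmetric]) auto
    also have "\<dots> = ennreal (1 / 2)" unfolding mult.assoc e by simp
    finally show ?thesis .
  qed
  have expi: "(\<integral>\<^sup>+u\<in>{0<..}. ennreal (u * exp (- (sqrt 2 / c * u))) \<partial>lborel) = ennreal (c\<^sup>2 / 2)"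
    using nn_integral_power_times_exp[of "sqrt 2 / c" 1] c by (simp add: power_divide power2_eq_square)
  show "(\<integral>\<^sup>+u\<in>{0<..}. ennreal (u * tail i (u / c)) \<partial>lborel) = (\<integral>\<^sup>+u\<in>{0<..}. ennreal (u * exp (- (sqrt 2 / c * u))) \<partial>lborel)"
    unfolding scale half expi by (subst ennreal_mult[symmetric]) auto
  show "(\<integral>\<^sup>+u\<in>{0<..}. ennreal (u * exp (- (sqrt 2 / c * u))) \<partial>lborel) < \<infinity>" unfolding expi by simp
  show "tail i (t / c) \<le> exp (- (sqrt 2 / c * t))"
    if "0 < s" "s < t" "tail i (s / c) \<le> exp (- (sqrt 2 / c * s))" for s t
  proof -
    have "tail i (t / c) \<le> exp (- (sqrt 2 * (t / c)))"
    proof (rule log_concave_tail_crossing[where s = "s / c"])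
      show "tail i 0 = 1" using tail_0 by (simp add: tail_def)
      show "tail i s * tail i t \<le> (tail i ((s + t) / 2))\<^sup>2" if "0 \<le> s" "0 \<le> t" for s t
        using tail_midpoint[OF that] by (simp add: tail_def)
    qed (use that c in \<open>auto simp: tail_antimono tail_nonneg divide_strict_right_mono\<close>)
    then show ?thesis by simp
  qed
qed (use k ratio in \<open>auto simp: tail_nonneg\<close>)

text \<open>Comparison with the exponential tail of equal second moment for k u = 4 u^3; the
  extremal value is 4 * 3! / (sqrt 2)^4 = 6.\<close>

lemma fourth_moment: "(\<integral>\<^sup>+\<omega>. ennreal ((X \<omega> $ i) ^ 4) \<partial>M) \<le> 6"
proof -
  have "(\<integral>\<^sup>+\<omega>. ennreal ((X \<omega> $ i) ^ 4) \<partial>M) = (\<integral>\<^sup>+\<omega>. ennreal (\<bar>X \<omega> $ i\<bar> ^ Suc 3) \<partial>M)"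
    by (simp add: power_even_abs)
  also have "\<dots> = (\<integral>\<^sup>+u\<in>{0<..}. ennreal (4 * u ^ 3 * tail i (u / 1)) \<partial>lborel)"
    unfolding nn_integral_power_tail by simp
  also have "\<dots> \<le> (\<integral>\<^sup>+u\<in>{0<..}. ennreal (4 * u ^ 3 * exp (- (sqrt 2 / 1 * u))) \<partial>lborel)"
  proof (rule tail_crossing)
    fix u v :: real assume uv: "0 < u" "u \<le> v"
    have "(4 * u * v) * u\<^sup>2 \<le> (4 * u * v) * v\<^sup>2" using uv by (intro mult_left_mono power_mono) auto
    then show "4 * u ^ 3 * v \<le> 4 * v ^ 3 * u" by (simp add: power2_eq_square power3_eq_cube mult_ac)
  qed auto
  also have "\<dots> = (\<integral>\<^sup>+u. ennreal 4 * (ennreal (u ^ 3 * exp (- (sqrt 2 * u))) * indicator {0<..} u) \<partial>lborel)"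
    by (intro nn_integral_cong) (auto simp: ennreal_mult mult.assoc split: split_indicator)
  also have "\<dots> = ennreal 4 * (\<integral>\<^sup>+u\<in>{0<..}. ennreal (u ^ 3 * exp (- (sqrt 2 * u))) \<partial>lborel)"
    by (intro nn_integral_cmult) measurable
  also have "\<dots> = ennreal 4 * ennreal (6 / 4)"
  proof -
    have "sqrt 2 ^ Suc 3 = ((sqrt 2)\<^sup>2)\<^sup>2" by (simp only: power_mult[symmetric]) simp
    then have "sqrt 2 ^ Suc 3 = (4 :: real)" by simp
    then show ?thesis using nn_integral_power_times_exp[of "sqrt 2" 3] by (simp add: fact_numeral)
  qed
  also have "\<dots> = 6" by (subst ennreal_mult[symmetric]) auto
  finally show ?thesis .
qed

text \<open>Invariance is applied to every sign pattern on I and the results are averaged. In this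
  way one conditions on the absolute values without conditional expectations. The factor c |X_j|
  does not see the signs and later becomes the indicator of a tail event.\<close>

lemma nn_integral_rad:
  assumes [measurable]: "c \<in> borel_measurable borel" "K \<in> borel_measurable borel" and K: "\<And>x. 0 \<le> K x"
  shows "(\<integral>\<^sup>+\<omega>. c \<bar>X \<omega> $ j\<bar> * ennreal (K (lin a I \<omega>)) \<partial>M)
     = (\<integral>\<^sup>+\<omega>. c \<bar>X \<omega> $ j\<bar> * ennreal (rad I (\<lambda>i. \<bar>a i * X \<omega> $ i\<bar>) K) \<partial>M)"
proof -
  let ?s = "\<lambda>A \<omega>. \<Sum>i\<in>I. if i \<in> A then - (a i * X \<omega> $ i) else a i * X \<omega> $ i"
  have I: "finite I" by simp
  have flip: "(\<integral>\<^sup>+\<omega>. c \<bar>X \<omega> $ j\<bar> * ennreal (K (?s A \<omega>)) \<partial>M) = (\<integral>\<^sup>+\<omega>. c \<bar>X \<omega> $ j\<bar> * ennreal (K (lin a I \<omega>)) \<partial>M)" for A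
  proof -
    let ?\<eta> = "\<lambda>i. if i \<in> A then -1 else 1 :: real"
    have "(\<integral>\<^sup>+\<omega>. c \<bar>X \<omega> $ j\<bar> * ennreal (K (\<Sum>i\<in>I. a i * X \<omega> $ i)) \<partial>M)
        = (\<integral>\<^sup>+\<omega>. c \<bar>(\<chi> i. ?\<eta> i * X \<omega> $ i) $ j\<bar> * ennreal (K (\<Sum>i\<in>I. a i * (\<chi> i. ?\<eta> i * X \<omega> $ i) $ i)) \<partial>M)"
      by (rule nn_integral_sign_change[where h = "\<lambda>x. c \<bar>x $ j\<bar> * ennreal (K (\<Sum>i\<in>I. a i * x $ i))"]) auto
    also have "\<dots> = (\<integral>\<^sup>+\<omega>. c \<bar>X \<omega> $ j\<bar> * ennreal (K (?s A \<omega>)) \<partial>M)"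
    proof (intro nn_integral_cong)
      fix \<omega>
      have "(\<Sum>i\<in>I. a i * (?\<eta> i * X \<omega> $ i)) = ?s A \<omega>" by (intro sum.cong) auto
      moreover have "\<bar>?\<eta> j * X \<omega> $ j\<bar> = \<bar>X \<omega> $ j\<bar>" by simp
      ultimately show "c \<bar>(\<chi> i. ?\<eta> i * X \<omega> $ i) $ j\<bar> * ennreal (K (\<Sum>i\<in>I. a i * (\<chi> i. ?\<eta> i * X \<omega> $ i) $ i))
          = c \<bar>X \<omega> $ j\<bar> * ennreal (K (?s A \<omega>))" by (simp only: vec_lambda_beta)
    qed
    finally show ?thesis unfolding lin_def ..
  qed
  have "(\<integral>\<^sup>+\<omega>. c \<bar>X \<omega> $ j\<bar> * ennreal (rad I (\<lambda>i. \<bar>a i * X \<omega> $ i\<bar>) K) \<partial>M)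
      = (\<integral>\<^sup>+\<omega>. (\<Sum>A\<in>Pow I. c \<bar>X \<omega> $ j\<bar> * ennreal (K (?s A \<omega>))) / 2 ^ card I \<partial>M)"
  proof (intro nn_integral_cong)
    fix \<omega>
    have "ennreal (rad I (\<lambda>i. \<bar>a i * X \<omega> $ i\<bar>) K) = (\<Sum>A\<in>Pow I. ennreal (K (?s A \<omega>))) / 2 ^ card I"
      unfolding rad_abs[OF I] unfolding rad_def using K
      by (simp add: divide_ennreal[symmetric] sum_nonneg ennreal_power[symmetric])
    then show "c \<bar>X \<omega> $ j\<bar> * ennreal (rad I (\<lambda>i. \<bar>a i * X \<omega> $ i\<bar>) K)
        = (\<Sum>A\<in>Pow I. c \<bar>X \<omega> $ j\<bar> * ennreal (K (?s A \<omega>))) / 2 ^ card I"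
      by (simp only: sum_distrib_left ennreal_times_divide)
  qed
  also have "\<dots> = (\<Sum>A\<in>Pow I. \<integral>\<^sup>+\<omega>. c \<bar>X \<omega> $ j\<bar> * ennreal (K (?s A \<omega>)) \<partial>M) / 2 ^ card I"
    by (simp add: nn_integral_divide nn_integral_sum)
  also have "\<dots> = (2 ^ card I * (\<integral>\<^sup>+\<omega>. c \<bar>X \<omega> $ j\<bar> * ennreal (K (lin a I \<omega>)) \<partial>M)) / 2 ^ card I"
    unfolding flip by (simp add: card_Pow)
  also have "\<dots> = (\<integral>\<^sup>+\<omega>. c \<bar>X \<omega> $ j\<bar> * ennreal (K (lin a I \<omega>)) \<partial>M)"
    by (subst mult.commute, subst ennreal_mult_divide_eq) (simp_all add: power_eq_top_ennreal)
  finally show ?thesis ..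
qed

lemma second_moment_integrable:
  "integrable M (\<lambda>\<omega>. (X \<omega> $ i)\<^sup>2)" "expectation (\<lambda>\<omega>. (X \<omega> $ i)\<^sup>2) = 1"
proof -
  show "integrable M (\<lambda>\<omega>. (X \<omega> $ i)\<^sup>2)"
    using second_moment[of i] by (intro integrableI_nonneg) auto
  show "expectation (\<lambda>\<omega>. (X \<omega> $ i)\<^sup>2) = 1"
    using second_moment[of i] by (subst integral_eq_nn_integral) auto
qed

lemma fourth_moment_integrable:
  "integrable M (\<lambda>\<omega>. (X \<omega> $ i) ^ 4)" "expectation (\<lambda>\<omega>. (X \<omega> $ i) ^ 4) \<le> 6"
proof -
  have fin: "(\<integral>\<^sup>+\<omega>. ennreal ((X \<omega> $ i) ^ 4) \<partial>M) < \<infinity>"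
    using fourth_moment[of i] by (rule le_less_trans) simp
  then show "integrable M (\<lambda>\<omega>. (X \<omega> $ i) ^ 4)" by (intro integrableI_nonneg) auto
  have "enn2real (\<integral>\<^sup>+\<omega>. ennreal ((X \<omega> $ i) ^ 4) \<partial>M) \<le> enn2real 6"
    using fourth_moment[of i] by (intro enn2real_mono) auto
  then show "expectation (\<lambda>\<omega>. (X \<omega> $ i) ^ 4) \<le> 6"
    by (subst integral_eq_nn_integral) auto
qed

text \<open>Given the absolute values, the Rademacher bound applies with random B and Q in place of
  the sums of squares and of fourth powers. Here E B = S, and E Q \<le> 6 m^2 S because E X_i^4
  \<le> 6 and a_i^4 \<le> m^2 a_i^2. Jensen then moves the expectation inside the power.\<close>

lemma moment_lower:
  assumes p: "3 \<le> p" and m: "\<And>i. \<bar>a i\<bar> \<le> m" "0 < m"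
    and S: "S = (\<Sum>i\<in>UNIV. (a i)\<^sup>2)" "0 < S"
  shows "ennreal (gauss_moment p * (max 0 (S - sqrt (6 * p) * m * sqrt S)) powr (p / 2))
     \<le> (\<integral>\<^sup>+\<omega>. ennreal (\<bar>lin a UNIV \<omega>\<bar> powr p) \<partial>M)"
proof (cases "S - sqrt (6 * p) * m * sqrt S \<le> 0")
  case True
  then show ?thesis by (simp add: max_def)
next
  case False
  define \<mu> where "\<mu> = S - sqrt (6 * p) * m * sqrt S"
  have \<mu>: "0 < \<mu>" using False by (simp add: \<mu>_def)
  define B where "B \<omega> = (\<Sum>i\<in>UNIV. \<bar>a i * X \<omega> $ i\<bar>\<^sup>2)" for \<omega>
  define Q where "Q \<omega> = (\<Sum>i\<in>UNIV. \<bar>a i * X \<omega> $ i\<bar> ^ 4)" for \<omega>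
  have Beq: "B = (\<lambda>\<omega>. \<Sum>i\<in>UNIV. (a i)\<^sup>2 * (X \<omega> $ i)\<^sup>2)" by (simp add: B_def fun_eq_iff power_mult_distrib)
  have Qeq: "Q = (\<lambda>\<omega>. \<Sum>i\<in>UNIV. (a i) ^ 4 * (X \<omega> $ i) ^ 4)"
    by (simp add: Q_def fun_eq_iff power_even_abs power_mult_distrib)
  have [measurable]: "B \<in> borel_measurable M" "Q \<in> borel_measurable M" unfolding B_def Q_def by measurable
  have Q0: "0 \<le> Q \<omega>" for \<omega> by (simp add: Q_def sum_nonneg)
  have B: "integrable M B" "expectation B = S"
    unfolding Beq S using second_moment_integrable by simp_all
  have Q: "integrable M Q" "expectation Q \<le> 6 * m\<^sup>2 * S"
  proof -
    show "integrable M Q" unfolding Qeq using fourth_moment_integrable by simp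
    have "expectation Q = (\<Sum>i\<in>UNIV. (a i) ^ 4 * expectation (\<lambda>\<omega>. (X \<omega> $ i) ^ 4))"
      unfolding Qeq using fourth_moment_integrable by simp
    also have "\<dots> \<le> (\<Sum>i\<in>UNIV. (m\<^sup>2 * (a i)\<^sup>2) * 6)"
    proof (intro sum_mono mult_mono)
      fix i
      have "(a i) ^ 4 = (a i)\<^sup>2 * (a i)\<^sup>2" by (simp add: power2_eq_square power4_eq_xxxx)
      also have "(a i)\<^sup>2 \<le> m\<^sup>2" using m(1)[of i] by (rule abs_le_square_iff[THEN iffD1, OF order_trans]) (use m in auto)
      then have "(a i)\<^sup>2 * (a i)\<^sup>2 \<le> m\<^sup>2 * (a i)\<^sup>2" by (intro mult_right_mono) auto
      finally show "(a i) ^ 4 \<le> m\<^sup>2 * (a i)\<^sup>2" .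
    qed (auto simp: fourth_moment_integrable intro!: integral_nonneg_AE)
    also have "\<dots> = 6 * m\<^sup>2 * S" by (simp add: S sum_distrib_left mult_ac)
    finally show "expectation Q \<le> 6 * m\<^sup>2 * S" .
  qed
  \<comment> \<open>An upper bound for sqrt (E Q). The inequality sqrt Q \<le> (Q / \<kappa> +
    \<kappa>) / 2 yields both the integrability of sqrt Q and E sqrt Q \<le> \<kappa>.\<close>
  define \<kappa> where "\<kappa> = sqrt 6 * m * sqrt S"
  have \<kappa>: "0 < \<kappa>" "\<kappa>\<^sup>2 = 6 * m\<^sup>2 * S" using m S by (simp_all add: \<kappa>_def power_mult_distrib)
  have sQ_le: "sqrt (Q \<omega>) \<le> (Q \<omega> / \<kappa> + \<kappa>) / 2" for \<omega>
  proof -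
    have "0 \<le> (sqrt (Q \<omega>) - \<kappa>)\<^sup>2" by simp
    then have "2 * sqrt (Q \<omega>) * \<kappa> \<le> Q \<omega> + \<kappa>\<^sup>2" using Q0[of \<omega>] by (simp add: power2_diff)
    then show ?thesis using \<kappa>(1) by (simp add: field_simps power2_eq_square)
  qed
  have sQ: "integrable M (\<lambda>\<omega>. sqrt (Q \<omega>))"
    by (rule Bochner_Integration.integrable_bound[of M "\<lambda>\<omega>. (Q \<omega> / \<kappa> + \<kappa>) / 2"])
      (use Q sQ_le Q0 \<kappa> in \<open>auto intro!: AE_I2 simp: abs_of_nonneg\<close>)
  have EsQ: "expectation (\<lambda>\<omega>. sqrt (Q \<omega>)) \<le> \<kappa>"
  proof -
    have "expectation (\<lambda>\<omega>. sqrt (Q \<omega>)) \<le> expectation (\<lambda>\<omega>. (Q \<omega> / \<kappa> + \<kappa>) / 2)"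
      using sQ Q sQ_le by (intro integral_mono) auto
    also have "\<dots> = (expectation Q / \<kappa> + \<kappa>) / 2" using Q prob_space by simp
    also have "\<dots> \<le> (\<kappa>\<^sup>2 / \<kappa> + \<kappa>) / 2" unfolding \<kappa>(2) using Q(2) \<kappa>(1) by (intro divide_right_mono add_right_mono) auto
    finally show ?thesis using \<kappa>(1) by (simp add: power2_eq_square)
  qed
  define Y where "Y \<omega> = B \<omega> - sqrt p * sqrt (Q \<omega>)" for \<omega>
  have Y: "integrable M Y" "\<mu> \<le> expectation Y"
  proof -
    show "integrable M Y" unfolding Y_def using B sQ by simp
    have "expectation Y = S - sqrt p * expectation (\<lambda>\<omega>. sqrt (Q \<omega>))" unfolding Y_def using B sQ by simp
    moreover have "sqrt p * expectation (\<lambda>\<omega>. sqrt (Q \<omega>)) \<le> sqrt p * \<kappa>" using p EsQ by (intro mult_left_mono) auto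
    ultimately show "\<mu> \<le> expectation Y" by (simp add: \<mu>_def \<kappa>_def real_sqrt_mult mult_ac)
  qed
  define r where "r = p / 2"
  \<comment> \<open>The tangent at \<mu> of the map taking z to (max 0 z)^r, evaluated at
    \<open>Y\<close>. Its mean is at least \<mu>^r because E Y \<ge> \<mu>, and integrability of the
    power of \<open>Y\<close> is not presupposed.\<close>
  define T where "T \<omega> = \<mu> powr r + r * \<mu> powr (r - 1) * (Y \<omega> - \<mu>)" for \<omega>
  have T: "integrable M T" unfolding T_def using Y by simp
  have "\<mu> powr r \<le> expectation T"
    unfolding T_def using Y prob_space p by (simp add: r_def)
  also have "\<dots> \<le> expectation (\<lambda>\<omega>. max 0 (T \<omega>))" using T by (intro integral_mono integrable_max) auto
  finally have "ennreal (\<mu> powr r) \<le> ennreal (expectation (\<lambda>\<omega>. max 0 (T \<omega>)))" by (rule ennreal_leI)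
  also have "\<dots> = (\<integral>\<^sup>+\<omega>. ennreal (max 0 (T \<omega>)) \<partial>M)"
    using T by (intro nn_integral_eq_integral[symmetric] integrable_max) auto
  also have "\<dots> \<le> (\<integral>\<^sup>+\<omega>. ennreal ((max 0 (Y \<omega>)) powr r) \<partial>M)"
    using max_powr_ge_tangent[OF \<mu>, of r] p by (intro nn_integral_mono ennreal_leI) (auto simp: T_def r_def)
  finally have 1: "ennreal (gauss_moment p) * ennreal (\<mu> powr r) \<le> ennreal (gauss_moment p) * (\<integral>\<^sup>+\<omega>. ennreal ((max 0 (Y \<omega>)) powr r) \<partial>M)"
    by (rule mult_left_mono) simp
  have [measurable]: "Y \<in> borel_measurable M" unfolding Y_def by measurable
  have "ennreal (gauss_moment p) * (\<integral>\<^sup>+\<omega>. ennreal ((max 0 (Y \<omega>)) powr r) \<partial>M)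
      = (\<integral>\<^sup>+\<omega>. ennreal (gauss_moment p * (max 0 (Y \<omega>)) powr r) \<partial>M)"
    by (simp add: nn_integral_cmult[symmetric] ennreal_mult gauss_moment_nonneg)
  also have "\<dots> \<le> (\<integral>\<^sup>+\<omega>. ennreal (rad UNIV (\<lambda>i. \<bar>a i * X \<omega> $ i\<bar>) (\<lambda>x. \<bar>x\<bar> powr p)) \<partial>M)"
    unfolding Y_def B_def Q_def r_def using p
    by (intro nn_integral_mono ennreal_leI rademacher_moment_lower) auto
  also have "\<dots> = (\<integral>\<^sup>+\<omega>. ennreal (\<bar>lin a UNIV \<omega>\<bar> powr p) \<partial>M)"
    using nn_integral_rad[of "\<lambda>_. 1" "\<lambda>x. \<bar>x\<bar> powr p" undefined a UNIV] by simp
  finally have "ennreal (gauss_moment p) * ennreal (\<mu> powr r) \<le> (\<integral>\<^sup>+\<omega>. ennreal (\<bar>lin a UNIV \<omega>\<bar> powr p) \<partial>M)"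
    using 1 by (rule order_trans[rotated])
  moreover have "max 0 (S - sqrt (6 * p) * m * sqrt S) = \<mu>" using \<mu> by (simp add: \<mu>_def)
  ultimately show ?thesis by (simp add: ennreal_mult gauss_moment_nonneg r_def)
qed

end

text \<open>A tail event of one coordinate is set against a convex function of a signed sum of the
  others, because these are the two factors that the layer cake formula for \<open>sym_mean\<close>
  produces. Both alternatives of the final theorem are brought to this form.\<close>

locale negatively_dependent_vector = unconditional_vector M X
  for M :: "'a measure" and X :: "'a \<Rightarrow> real ^ 'n" +
  assumes negative_dependence: "\<And>a I j t K. j \<notin> I \<Longrightarrow> 0 \<le> t \<Longrightarrow> convex_on UNIV K \<Longrightarrow> (\<And>x. 0 \<le> K x) \<Longrightarrow>
     K \<in> borel_measurable borel \<Longrightarrow>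
     (\<integral>\<^sup>+\<omega>. indicator {t<..} \<bar>X \<omega> $ j\<bar> * ennreal (K (lin a I \<omega>)) \<partial>M)
       \<le> ennreal (tail j t) * (\<integral>\<^sup>+\<omega>. ennreal (K (lin a I \<omega>)) \<partial>M)"
begin

text \<open>After averaging over the sign of X_j, the layer cake formula separates the tail event of
  X_j from \<open>sym_deriv\<close> at the rest, and negative dependence bounds their product by a
  product of means. The tail is then replaced by an exponential one, and
  \<open>laplace_smoothing\<close> reads the result as a Gaussian mixture. The shift z leaves room
  for the Gaussian part that stems from coordinates already replaced.\<close>

lemma replace_coordinate:
  assumes p: "3 \<le> p" and j: "j \<notin> I"
  shows "(\<integral>\<^sup>+\<omega>. ennreal (\<bar>lin a (insert j I) \<omega> + z\<bar> powr p) \<partial>M)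
     \<le> (\<integral>\<^sup>+v\<in>{0..}. (ennreal (exp (- v)) * (\<integral>\<^sup>+\<omega>. (\<integral>\<^sup>+g. ennreal (\<bar>lin a I \<omega> + z + \<bar>a j\<bar> * sqrt v * g\<bar> powr p)
          \<partial>std_normal_distribution) \<partial>M)) \<partial>lborel)"
proof -
  interpret N: prob_space std_normal_distribution by (rule prob_space_normal_density) simp
  interpret P: pair_sigma_finite M "lborel :: real measure" ..
  let ?N = std_normal_distribution
  define c where "c = \<bar>a j\<bar>"
  define R where "R \<omega> = lin a I \<omega> + z" for \<omega>
  have [measurable]: "R \<in> borel_measurable M" unfolding R_def by measurable
  have "(\<integral>\<^sup>+\<omega>. ennreal (\<bar>lin a (insert j I) \<omega> + z\<bar> powr p) \<partial>M)
      \<le> (\<integral>\<^sup>+\<omega>. (\<integral>\<^sup>+v. ennreal (exp (- v)) * indicator {0..} v * (\<integral>\<^sup>+g. ennreal (\<bar>R \<omega> + c * sqrt v * g\<bar> powr p) \<partial>?N) \<partial>lborel) \<partial>M)"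
  \<comment> \<open>A vanishing coefficient is treated apart because the tails are rescaled by 1 /
    c; then nothing is replaced, and the exponential density integrates to 1.\<close>
  proof (cases "c = 0")
    case True
    then have "lin a (insert j I) \<omega> + z = R \<omega>" for \<omega> using j by (simp add: lin_insert R_def c_def)
    moreover have "(\<integral>\<^sup>+v. ennreal (exp (- v)) * indicator {0..} v * C \<partial>lborel) = C" for C
      by (subst nn_integral_multc) (auto simp: nn_integral_exp_atLeast)
    ultimately show ?thesis using True N.emeasure_space_1 by simp
  next
    case False
    then have c: "0 < c" by (simp add: c_def)
    have D0: "0 \<le> sym_deriv p s u" if "0 < u" for s u using that p by (intro sym_deriv_nonneg) auto
    have "(\<integral>\<^sup>+\<omega>. ennreal (\<bar>lin a (insert j I) \<omega> + z\<bar> powr p) \<partial>M) = (\<integral>\<^sup>+\<omega>. ennreal (\<bar>R \<omega>\<bar> powr p) \<partial>M)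
        + (\<integral>\<^sup>+u\<in>{0<..}. (\<integral>\<^sup>+\<omega>. indicator {u<..} \<bar>a j * X \<omega> $ j\<bar> * ennreal (sym_deriv p (R \<omega>) u) \<partial>M) \<partial>lborel)"
      unfolding nn_integral_flip_coordinate[OF p j] R_def[symmetric]
      by (rule nn_integral_sym_mean[OF prob_space_axioms p]) measurable
    also have "(\<integral>\<^sup>+u\<in>{0<..}. (\<integral>\<^sup>+\<omega>. indicator {u<..} \<bar>a j * X \<omega> $ j\<bar> * ennreal (sym_deriv p (R \<omega>) u) \<partial>M) \<partial>lborel)
        \<le> (\<integral>\<^sup>+u. (\<integral>\<^sup>+\<omega>. indicator {0<..} u * ennreal (tail j (u / c)) * ennreal (sym_deriv p (R \<omega>) u) \<partial>M) \<partial>lborel)"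
    proof (rule nn_integral_mono)
      fix u :: real
      show "(\<integral>\<^sup>+\<omega>. indicator {u<..} \<bar>a j * X \<omega> $ j\<bar> * ennreal (sym_deriv p (R \<omega>) u) \<partial>M) * indicator {0<..} u
          \<le> (\<integral>\<^sup>+\<omega>. indicator {0<..} u * ennreal (tail j (u / c)) * ennreal (sym_deriv p (R \<omega>) u) \<partial>M)"
      proof (cases "0 < u")
        case u: True
        have "(\<integral>\<^sup>+\<omega>. indicator {u<..} \<bar>a j * X \<omega> $ j\<bar> * ennreal (sym_deriv p (R \<omega>) u) \<partial>M)
            = (\<integral>\<^sup>+\<omega>. indicator {u / c<..} \<bar>X \<omega> $ j\<bar> * ennreal (sym_deriv p (lin a I \<omega> + z) u) \<partial>M)"
          unfolding R_def using c
          by (intro nn_integral_cong) (auto simp: abs_mult c_def[symmetric] field_simps split: split_indicator)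
        also have "\<dots> \<le> ennreal (tail j (u / c)) * (\<integral>\<^sup>+\<omega>. ennreal (sym_deriv p (lin a I \<omega> + z) u) \<partial>M)"
        proof (rule negative_dependence[OF j, where K = "\<lambda>s. sym_deriv p (s + z) u"])
          show "convex_on UNIV (\<lambda>s. sym_deriv p (s + z) u)"
          proof (rule convex_onI)
            fix t x y :: real assume t: "0 < t" "t < 1"
            have "sym_deriv p ((1 - t) *\<^sub>R (x + z) + t *\<^sub>R (y + z)) u \<le> (1 - t) * sym_deriv p (x + z) u + t * sym_deriv p (y + z) u"
              using t p u by (intro convex_onD[OF convex_on_sym_deriv_left]) auto
            moreover have "(1 - t) *\<^sub>R (x + z) + t *\<^sub>R (y + z) = (1 - t) *\<^sub>R x + t *\<^sub>R y + z" by (simp add: algebra_simps)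
            ultimately show "sym_deriv p ((1 - t) *\<^sub>R x + t *\<^sub>R y + z) u \<le> (1 - t) * sym_deriv p (x + z) u + t * sym_deriv p (y + z) u"
              by simp
          qed simp
        qed (use u c D0 in auto)
        also have "\<dots> = (\<integral>\<^sup>+\<omega>. indicator {0<..} u * ennreal (tail j (u / c)) * ennreal (sym_deriv p (R \<omega>) u) \<partial>M)"
          using u by (simp add: R_def nn_integral_cmult)
        finally show ?thesis using u by simp
      qed simp
    qed
    also have "(\<integral>\<^sup>+u. (\<integral>\<^sup>+\<omega>. indicator {0<..} u * ennreal (tail j (u / c)) * ennreal (sym_deriv p (R \<omega>) u) \<partial>M) \<partial>lborel)
        = (\<integral>\<^sup>+\<omega>. (\<integral>\<^sup>+u. indicator {0<..} u * ennreal (tail j (u / c)) * ennreal (sym_deriv p (R \<omega>) u) \<partial>lborel) \<partial>M)"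
      by (rule P.Fubini') measurable
    also have "\<dots> \<le> (\<integral>\<^sup>+\<omega>. (\<integral>\<^sup>+u\<in>{0<..}. ennreal (sym_deriv p (R \<omega>) u * exp (- (sqrt 2 / c * u))) \<partial>lborel) \<partial>M)"
    proof (rule nn_integral_mono)
      fix \<omega>
      have "(\<integral>\<^sup>+u. indicator {0<..} u * ennreal (tail j (u / c)) * ennreal (sym_deriv p (R \<omega>) u) \<partial>lborel)
          = (\<integral>\<^sup>+u\<in>{0<..}. ennreal (sym_deriv p (R \<omega>) u * tail j (u / c)) \<partial>lborel)"
        using D0 tail_nonneg by (intro nn_integral_cong) (auto simp: ennreal_mult mult.commute split: split_indicator)
      also have "\<dots> \<le> (\<integral>\<^sup>+u\<in>{0<..}. ennreal (sym_deriv p (R \<omega>) u * exp (- (sqrt 2 / c * u))) \<partial>lborel)"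
        using p c D0 by (intro tail_crossing sym_deriv_ratio_mono) auto
      finally show "(\<integral>\<^sup>+u. indicator {0<..} u * ennreal (tail j (u / c)) * ennreal (sym_deriv p (R \<omega>) u) \<partial>lborel) \<le> \<dots>" .
    qed
    also have "(\<integral>\<^sup>+\<omega>. ennreal (\<bar>R \<omega>\<bar> powr p) \<partial>M) + (\<integral>\<^sup>+\<omega>. (\<integral>\<^sup>+u\<in>{0<..}. ennreal (sym_deriv p (R \<omega>) u * exp (- (sqrt 2 / c * u))) \<partial>lborel) \<partial>M)
        = (\<integral>\<^sup>+\<omega>. ennreal (\<bar>R \<omega>\<bar> powr p) + (\<integral>\<^sup>+u\<in>{0<..}. ennreal (sym_deriv p (R \<omega>) u * exp (- (sqrt 2 / c * u))) \<partial>lborel) \<partial>M)"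
      by (rule nn_integral_add[symmetric]) measurable
    also have "\<dots> = (\<integral>\<^sup>+\<omega>. (\<integral>\<^sup>+v. ennreal (exp (- v)) * indicator {0..} v * (\<integral>\<^sup>+g. ennreal (\<bar>R \<omega> + c * sqrt v * g\<bar> powr p) \<partial>?N) \<partial>lborel) \<partial>M)"
      unfolding laplace_smoothing[OF p c, symmetric] by (intro nn_integral_cong) (simp only: mult_ac)
    finally show ?thesis by (simp add: add_left_mono)
  qed
  also have "\<dots> = (\<integral>\<^sup>+v. (\<integral>\<^sup>+\<omega>. ennreal (exp (- v)) * indicator {0..} v * (\<integral>\<^sup>+g. ennreal (\<bar>R \<omega> + c * sqrt v * g\<bar> powr p) \<partial>?N) \<partial>M) \<partial>lborel)"
    by (rule P.Fubini'[symmetric]) measurable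
  also have "\<dots> = (\<integral>\<^sup>+v\<in>{0..}. (ennreal (exp (- v)) * (\<integral>\<^sup>+\<omega>. (\<integral>\<^sup>+g. ennreal (\<bar>R \<omega> + c * sqrt v * g\<bar> powr p) \<partial>?N) \<partial>M)) \<partial>lborel)"
    by (intro nn_integral_cong, subst nn_integral_cmult) (measurable, simp only: mult_ac)
  finally show ?thesis by (simp only: R_def c_def)
qed

text \<open>For fixed v, the new Gaussian of variance (a j)^2 v merges with the one of variance q
  that represents the coordinates replaced before. A single number therefore records the past of the
  replacement procedure.\<close>

lemma smooth_replace_coordinate:
  assumes p: "3 \<le> p" and j: "j \<notin> I" and q: "0 \<le> q"
  shows "(\<integral>\<^sup>+\<omega>. (\<integral>\<^sup>+g. ennreal (\<bar>lin a (insert j I) \<omega> + sqrt q * g\<bar> powr p) \<partial>std_normal_distribution) \<partial>M)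
     \<le> (\<integral>\<^sup>+v\<in>{0..}. (ennreal (exp (- v)) * (\<integral>\<^sup>+\<omega>. (\<integral>\<^sup>+g. ennreal (\<bar>lin a I \<omega> + sqrt (q + (a j)\<^sup>2 * v) * g\<bar> powr p)
          \<partial>std_normal_distribution) \<partial>M)) \<partial>lborel)"
proof -
  interpret N: prob_space std_normal_distribution by (rule prob_space_normal_density) simp
  interpret P: pair_sigma_finite M std_normal_distribution ..
  interpret R: pair_sigma_finite "lborel :: real measure" std_normal_distribution ..
  let ?N = std_normal_distribution
  let ?h = "\<lambda>\<omega> v g g'. ennreal (\<bar>lin a I \<omega> + sqrt q * g + \<bar>a j\<bar> * sqrt v * g'\<bar> powr p)"
  have "(\<integral>\<^sup>+\<omega>. (\<integral>\<^sup>+g. ennreal (\<bar>lin a (insert j I) \<omega> + sqrt q * g\<bar> powr p) \<partial>?N) \<partial>M)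
      = (\<integral>\<^sup>+g. (\<integral>\<^sup>+\<omega>. ennreal (\<bar>lin a (insert j I) \<omega> + sqrt q * g\<bar> powr p) \<partial>M) \<partial>?N)"
    by (rule P.Fubini'[symmetric]) measurable
  also have "\<dots> \<le> (\<integral>\<^sup>+g. (\<integral>\<^sup>+v. ennreal (exp (- v)) * indicator {0..} v * (\<integral>\<^sup>+\<omega>. (\<integral>\<^sup>+g'. ?h \<omega> v g g' \<partial>?N) \<partial>M) \<partial>lborel) \<partial>?N)"
  proof (rule nn_integral_mono)
    fix g
    show "(\<integral>\<^sup>+\<omega>. ennreal (\<bar>lin a (insert j I) \<omega> + sqrt q * g\<bar> powr p) \<partial>M)
        \<le> (\<integral>\<^sup>+v. ennreal (exp (- v)) * indicator {0..} v * (\<integral>\<^sup>+\<omega>. (\<integral>\<^sup>+g'. ?h \<omega> v g g' \<partial>?N) \<partial>M) \<partial>lborel)"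
      using replace_coordinate[OF p j, of a "sqrt q * g"] by (simp only: mult_ac)
  qed
  also have "\<dots> = (\<integral>\<^sup>+v. (\<integral>\<^sup>+g. ennreal (exp (- v)) * indicator {0..} v * (\<integral>\<^sup>+\<omega>. (\<integral>\<^sup>+g'. ?h \<omega> v g g' \<partial>?N) \<partial>M) \<partial>?N) \<partial>lborel)"
    by (rule R.Fubini') measurable
  also have "\<dots> = (\<integral>\<^sup>+v\<in>{0..}. (ennreal (exp (- v)) * (\<integral>\<^sup>+\<omega>. (\<integral>\<^sup>+g. ennreal (\<bar>lin a I \<omega> + sqrt (q + (a j)\<^sup>2 * v) * g\<bar> powr p) \<partial>?N) \<partial>M)) \<partial>lborel)"
  proof (rule nn_integral_cong)
    fix v :: real
    show "(\<integral>\<^sup>+g. ennreal (exp (- v)) * indicator {0..} v * (\<integral>\<^sup>+\<omega>. (\<integral>\<^sup>+g'. ?h \<omega> v g g' \<partial>?N) \<partial>M) \<partial>?N)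
        = ennreal (exp (- v)) * (\<integral>\<^sup>+\<omega>. (\<integral>\<^sup>+g. ennreal (\<bar>lin a I \<omega> + sqrt (q + (a j)\<^sup>2 * v) * g\<bar> powr p) \<partial>?N) \<partial>M) * indicator {0..} v"
    proof (cases "0 \<le> v")
      case True
      have "(\<integral>\<^sup>+g. (\<integral>\<^sup>+\<omega>. (\<integral>\<^sup>+g'. ?h \<omega> v g g' \<partial>?N) \<partial>M) \<partial>?N) = (\<integral>\<^sup>+\<omega>. (\<integral>\<^sup>+g. (\<integral>\<^sup>+g'. ?h \<omega> v g g' \<partial>?N) \<partial>?N) \<partial>M)"
        by (rule P.Fubini') measurable
      also have "\<dots> = (\<integral>\<^sup>+\<omega>. (\<integral>\<^sup>+g. ennreal (\<bar>lin a I \<omega> + sqrt (q + (a j)\<^sup>2 * v) * g\<bar> powr p) \<partial>?N) \<partial>M)"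
      proof (rule nn_integral_cong)
        fix \<omega>
        have "(\<integral>\<^sup>+g. (\<integral>\<^sup>+g'. ennreal (\<bar>lin a I \<omega> + (sqrt q * g + (\<bar>a j\<bar> * sqrt v) * g')\<bar> powr p) \<partial>?N) \<partial>?N)
            = (\<integral>\<^sup>+g. ennreal (\<bar>lin a I \<omega> + sqrt ((sqrt q)\<^sup>2 + (\<bar>a j\<bar> * sqrt v)\<^sup>2) * g\<bar> powr p) \<partial>?N)"
          using q True by (intro nn_integral_std_normal_conv) auto
        moreover have "(sqrt q)\<^sup>2 + (\<bar>a j\<bar> * sqrt v)\<^sup>2 = q + (a j)\<^sup>2 * v" using q True by (simp add: power_mult_distrib)
        ultimately show "(\<integral>\<^sup>+g. (\<integral>\<^sup>+g'. ?h \<omega> v g g' \<partial>?N) \<partial>?N)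
            = (\<integral>\<^sup>+g. ennreal (\<bar>lin a I \<omega> + sqrt (q + (a j)\<^sup>2 * v) * g\<bar> powr p) \<partial>?N)"
          by (simp only: add.assoc)
      qed
      finally have eq: "(\<integral>\<^sup>+g. (\<integral>\<^sup>+\<omega>. (\<integral>\<^sup>+g'. ?h \<omega> v g g' \<partial>?N) \<partial>M) \<partial>?N)
          = (\<integral>\<^sup>+\<omega>. (\<integral>\<^sup>+g. ennreal (\<bar>lin a I \<omega> + sqrt (q + (a j)\<^sup>2 * v) * g\<bar> powr p) \<partial>?N) \<partial>M)" .
      have "(\<integral>\<^sup>+g. ennreal (exp (- v)) * indicator {0..} v * (\<integral>\<^sup>+\<omega>. (\<integral>\<^sup>+g'. ?h \<omega> v g g' \<partial>?N) \<partial>M) \<partial>?N)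
          = ennreal (exp (- v)) * indicator {0..} v * (\<integral>\<^sup>+g. (\<integral>\<^sup>+\<omega>. (\<integral>\<^sup>+g'. ?h \<omega> v g g' \<partial>?N) \<partial>M) \<partial>?N)"
        by (rule nn_integral_cmult) measurable
      then show ?thesis unfolding eq by (simp only: mult_ac)
    qed simp
  qed
  finally show ?thesis .
qed

text \<open>Since \<open>x powr (p / 2) \<le> (p / (2 * exp 1 * l)) powr (p / 2) * exp (l * x)\<close>, the exponential mixing
  variables enter only through their Laplace transforms.\<close>

lemma smooth_moment_upper:
  assumes p: "3 \<le> p" and l: "0 < l" and I: "\<And>i. i \<in> I \<Longrightarrow> l * (a i)\<^sup>2 < 1" and q: "0 \<le> q"
  shows "(\<integral>\<^sup>+\<omega>. (\<integral>\<^sup>+g. ennreal (\<bar>lin a I \<omega> + sqrt q * g\<bar> powr p) \<partial>std_normal_distribution) \<partial>M)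
     \<le> ennreal (gauss_moment p * (p / 2 / (exp 1 * l)) powr (p / 2) * exp (l * q) * (\<Prod>i\<in>I. 1 / (1 - l * (a i)\<^sup>2)))"
  using finite[of I] I q
proof (induction I arbitrary: q rule: finite_induct)
  case empty
  define r where "r = p / 2"
  have r: "0 < r" using p by (simp add: r_def)
  have "(\<integral>\<^sup>+\<omega>. (\<integral>\<^sup>+g. ennreal (\<bar>lin a {} \<omega> + sqrt q * g\<bar> powr p) \<partial>std_normal_distribution) \<partial>M)
      = ennreal (\<bar>sqrt q\<bar> powr p * gauss_moment p)"
    using p nn_integral_gauss_moment[of p "sqrt q"] emeasure_space_1 by (simp add: lin_def)
  also have "\<bar>sqrt q\<bar> powr p = q powr r"
    using empty.prems by (simp add: powr_half_sqrt[symmetric] powr_powr r_def)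
  also have "ennreal (q powr r * gauss_moment p) \<le> ennreal (gauss_moment p * (r / (exp 1 * l)) powr r * exp (l * q))"
  proof (intro ennreal_leI)
    have "l * q / r \<le> exp (l * q / r - 1)" using exp_ge_add_one_self[of "l * q / r - 1"] by simp
    then have "(l * q / r) powr r \<le> exp (l * q / r - 1) powr r"
      using r l empty.prems by (intro powr_mono2) auto
    also have "\<dots> = exp (l * q) / exp r" using r by (simp add: powr_def exp_diff[symmetric] algebra_simps)
    finally have "(r / l) powr r * (l * q / r) powr r \<le> (r / l) powr r * (exp (l * q) / exp r)"
      by (intro mult_left_mono) auto
    moreover have "(r / l) powr r * (l * q / r) powr r = q powr r"
      using r l empty.prems by (simp add: powr_mult[symmetric])
    moreover have "(r / l) powr r * (exp (l * q) / exp r) = (r / (exp 1 * l)) powr r * exp (l * q)"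
    proof -
      have "(r / (exp 1 * l)) powr r = (r / l) powr r / exp 1 powr r"
        using r l by (subst powr_divide[symmetric]) (auto simp: field_simps)
      also have "exp 1 powr r = exp r" by (simp add: powr_def)
      finally show ?thesis by simp
    qed
    ultimately have "q powr r \<le> (r / (exp 1 * l)) powr r * exp (l * q)" by simp
    then have "gauss_moment p * q powr r \<le> gauss_moment p * ((r / (exp 1 * l)) powr r * exp (l * q))"
      by (intro mult_left_mono gauss_moment_nonneg)
    then show "q powr r * gauss_moment p \<le> gauss_moment p * (r / (exp 1 * l)) powr r * exp (l * q)"
      by (simp add: mult_ac)
  qed
  finally show ?case by (simp add: r_def)
next
  case (insert j I)
  let ?C = "gauss_moment p * (p / 2 / (exp 1 * l)) powr (p / 2)" and ?P = "\<Prod>i\<in>I. 1 / (1 - l * (a i)\<^sup>2)"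
  have c: "0 < 1 - l * (a j)\<^sup>2" using insert.prems(1)[of j] by simp
  have P0: "0 \<le> ?P" using insert.prems(1) by (intro prod_nonneg) (auto intro: less_imp_le)
  have "(\<integral>\<^sup>+\<omega>. (\<integral>\<^sup>+g. ennreal (\<bar>lin a (insert j I) \<omega> + sqrt q * g\<bar> powr p) \<partial>std_normal_distribution) \<partial>M)
     \<le> (\<integral>\<^sup>+v\<in>{0..}. (ennreal (exp (- v)) * (\<integral>\<^sup>+\<omega>. (\<integral>\<^sup>+g. ennreal (\<bar>lin a I \<omega> + sqrt (q + (a j)\<^sup>2 * v) * g\<bar> powr p)
          \<partial>std_normal_distribution) \<partial>M)) \<partial>lborel)"
    by (rule smooth_replace_coordinate[OF p insert.hyps(2) insert.prems(2)])
  also have "\<dots> \<le> (\<integral>\<^sup>+v\<in>{0..}. (ennreal (exp (- v)) * ennreal (?C * exp (l * (q + (a j)\<^sup>2 * v)) * ?P)) \<partial>lborel)"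
  proof (rule nn_integral_mono)
    fix v :: real
    show "ennreal (exp (- v)) * (\<integral>\<^sup>+\<omega>. (\<integral>\<^sup>+g. ennreal (\<bar>lin a I \<omega> + sqrt (q + (a j)\<^sup>2 * v) * g\<bar> powr p)
          \<partial>std_normal_distribution) \<partial>M) * indicator {0..} v
       \<le> ennreal (exp (- v)) * ennreal (?C * exp (l * (q + (a j)\<^sup>2 * v)) * ?P) * indicator {0..} v"
    proof (cases "0 \<le> v")
      case True
      then have "(\<integral>\<^sup>+\<omega>. (\<integral>\<^sup>+g. ennreal (\<bar>lin a I \<omega> + sqrt (q + (a j)\<^sup>2 * v) * g\<bar> powr p) \<partial>std_normal_distribution) \<partial>M)
          \<le> ennreal (?C * exp (l * (q + (a j)\<^sup>2 * v)) * ?P)"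
        using insert.prems(2) by (intro insert.IH insert.prems(1)) auto
      then show ?thesis by (intro mult_right_mono mult_left_mono) auto
    qed simp
  qed
  also have "\<dots> = (\<integral>\<^sup>+v. ennreal (?C * exp (l * q) * ?P) * (ennreal (v ^ 0 * exp (- ((1 - l * (a j)\<^sup>2) * v))) * indicator {0<..} v) \<partial>lborel)"
  proof (rule nn_integral_cong_AE)
    show "AE v in lborel. ennreal (exp (- v)) * ennreal (?C * exp (l * (q + (a j)\<^sup>2 * v)) * ?P) * indicator {0..} v
        = ennreal (?C * exp (l * q) * ?P) * (ennreal (v ^ 0 * exp (- ((1 - l * (a j)\<^sup>2) * v))) * indicator {0<..} v)"
      using AE_lborel_singleton[of "0::real"]
    proof eventually_elim
      case (elim v)
      have "exp (- v) * (?C * exp (l * (q + (a j)\<^sup>2 * v)) * ?P) = ?C * exp (l * q) * ?P * exp (- ((1 - l * (a j)\<^sup>2) * v))"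
      proof -
        have eq: "exp (- v) * exp (l * (q + (a j)\<^sup>2 * v)) = exp (l * q) * exp (- ((1 - l * (a j)\<^sup>2) * v))"
          by (simp add: exp_add[symmetric] algebra_simps)
        have "exp (- v) * (?C * exp (l * (q + (a j)\<^sup>2 * v)) * ?P) = ?C * ?P * (exp (- v) * exp (l * (q + (a j)\<^sup>2 * v)))"
          by (simp only: mult_ac)
        also have "\<dots> = ?C * exp (l * q) * ?P * exp (- ((1 - l * (a j)\<^sup>2) * v))"
          unfolding eq by (simp only: mult_ac)
        finally show ?thesis .
      qed
      moreover have "0 \<le> ?C * exp (l * q) * ?P" using P0 gauss_moment_nonneg by simp
      ultimately show ?case using elim by (cases "0 \<le> v") (simp_all add: ennreal_mult[symmetric] P0 gauss_moment_nonneg)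
    qed
  qed
  also have "\<dots> = ennreal (?C * exp (l * q) * ?P) * ennreal (1 / (1 - l * (a j)\<^sup>2))"
    using nn_integral_power_times_exp[OF c, of 0] by (subst nn_integral_cmult) auto
  also have "\<dots> = ennreal (?C * exp (l * q) * (\<Prod>i\<in>insert j I. 1 / (1 - l * (a i)\<^sup>2)))"
    using insert.hyps c P0 gauss_moment_nonneg by (simp add: ennreal_mult[symmetric] mult_ac)
  finally show ?case .
qed

text \<open>\<open>smooth_moment_upper\<close> with q = 0, r = p / 2 and l = r / (S + r m^2). Since
  1 / (1 - x) \<le> exp (x / (1 - x)), the product is at most exp (l S / (1 - l m^2)). This l makes
  the exponent equal to r, so it cancels the exp (- r) hidden in the other factor.\<close>

lemma moment_upper:
  assumes p: "3 \<le> p" and m: "\<And>i. \<bar>a i\<bar> \<le> m" "0 < m"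
    and S: "S = (\<Sum>i\<in>UNIV. (a i)\<^sup>2)" "0 < S"
  shows "(\<integral>\<^sup>+\<omega>. ennreal (\<bar>lin a UNIV \<omega>\<bar> powr p) \<partial>M) \<le> ennreal (gauss_moment p * (S + p / 2 * m\<^sup>2) powr (p / 2))"
proof -
  interpret N: prob_space std_normal_distribution by (rule prob_space_normal_density) simp
  define r where "r = p / 2"
  define y where "y = S + r * m\<^sup>2"
  define l where "l = r / y"
  have r: "0 < r" using p by (simp add: r_def)
  have y: "0 < y" "r * m\<^sup>2 < y" using S r m by (auto simp: y_def intro!: add_pos_nonneg)
  have l: "0 < l" "l * m\<^sup>2 < 1" using r y by (auto simp: l_def)
  have sq: "(a i)\<^sup>2 \<le> m\<^sup>2" for i using m(1)[of i] by (rule abs_le_square_iff[THEN iffD1, OF order_trans]) (use m in auto)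
  have la: "l * (a i)\<^sup>2 \<le> l * m\<^sup>2" for i using sq l by (intro mult_left_mono) auto
  have lt: "l * (a i)\<^sup>2 < 1" for i using la[of i] l(2) by linarith
  have "(\<integral>\<^sup>+\<omega>. ennreal (\<bar>lin a UNIV \<omega>\<bar> powr p) \<partial>M)
      = (\<integral>\<^sup>+\<omega>. (\<integral>\<^sup>+g. ennreal (\<bar>lin a UNIV \<omega> + sqrt 0 * g\<bar> powr p) \<partial>std_normal_distribution) \<partial>M)"
    using N.emeasure_space_1 by simp
  also have "\<dots> \<le> ennreal (gauss_moment p * (p / 2 / (exp 1 * l)) powr (p / 2) * exp (l * 0) * (\<Prod>i\<in>UNIV. 1 / (1 - l * (a i)\<^sup>2)))"
    using p l lt by (intro smooth_moment_upper) auto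
  also have "\<dots> \<le> ennreal (gauss_moment p * y powr r)"
  proof (intro ennreal_leI)
    have "(\<Prod>i\<in>UNIV. 1 / (1 - l * (a i)\<^sup>2)) \<le> (\<Prod>i\<in>UNIV. exp (l * (a i)\<^sup>2 / (1 - l * m\<^sup>2)))"
    proof (intro prod_mono conjI)
      fix i
      show "0 \<le> 1 / (1 - l * (a i)\<^sup>2)" using lt[of i] by simp
      have "1 / (1 - l * (a i)\<^sup>2) = 1 + l * (a i)\<^sup>2 / (1 - l * (a i)\<^sup>2)" using lt[of i] by (simp add: field_simps)
      also have "\<dots> \<le> exp (l * (a i)\<^sup>2 / (1 - l * (a i)\<^sup>2))" by (rule exp_ge_add_one_self)
      also have "\<dots> \<le> exp (l * (a i)\<^sup>2 / (1 - l * m\<^sup>2))"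
        using la[of i] l lt[of i] by (intro exp_mono divide_left_mono) auto
      finally show "1 / (1 - l * (a i)\<^sup>2) \<le> exp (l * (a i)\<^sup>2 / (1 - l * m\<^sup>2))" .
    qed
    also have "\<dots> = exp (l * S / (1 - l * m\<^sup>2))"
      by (simp add: exp_sum[symmetric] S sum_divide_distrib sum_distrib_left)
    also have "l * S / (1 - l * m\<^sup>2) = r"
    proof -
      have "1 - l * m\<^sup>2 = S / y" using y by (simp add: l_def y_def field_simps)
      then show ?thesis using S(2) y by (simp add: l_def)
    qed
    finally have prod: "(\<Prod>i\<in>UNIV. 1 / (1 - l * (a i)\<^sup>2)) \<le> exp r" .
    have "(r / (exp 1 * l)) powr r = y powr r / exp r"
    proof -
      have "r / (exp 1 * l) = y / exp 1" using r y by (simp add: l_def)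
      then have "(r / (exp 1 * l)) powr r = y powr r / exp 1 powr r" using y by (simp add: powr_divide)
      then show ?thesis by (simp add: powr_def)
    qed
    then have "gauss_moment p * (r / (exp 1 * l)) powr r * (\<Prod>i\<in>UNIV. 1 / (1 - l * (a i)\<^sup>2))
        \<le> gauss_moment p * (y powr r / exp r) * exp r"
      using prod gauss_moment_nonneg by (simp only:) (intro mult_left_mono mult_nonneg_nonneg, auto)
    then show "gauss_moment p * (p / 2 / (exp 1 * l)) powr (p / 2) * exp (l * 0) * (\<Prod>i\<in>UNIV. 1 / (1 - l * (a i)\<^sup>2))
        \<le> gauss_moment p * y powr r" by (simp add: r_def)
  qed
  finally show ?thesis by (simp add: y_def r_def)
qed

text \<open>The p-th roots of the two moment bounds. The upper one also provides the finite moment,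
  which lets the Bochner integral in \<open>Lp_norm\<close> be identified with the nonnegative
  integral. The zero vector is separate because both bounds want positive m and S.\<close>

theorem norm_bounds:
  fixes a :: "real ^ 'n"
  assumes p: "3 \<le> p"
  shows "finite_moment M p (\<lambda>\<omega>. \<Sum>i\<in>UNIV. a $ i * X \<omega> $ i) \<and>
    - sqrt 3 * p * infnorm a \<le> Lp_norm M p (\<lambda>\<omega>. \<Sum>i\<in>UNIV. a $ i * X \<omega> $ i) - gauss_norm p * norm a \<and>
    Lp_norm M p (\<lambda>\<omega>. \<Sum>i\<in>UNIV. a $ i * X \<omega> $ i) - gauss_norm p * norm a \<le> p * infnorm a"
proof (cases "a = 0")
  case True
  then show ?thesis by (simp add: finite_moment_def Lp_norm_def infnorm_0)
next
  case False
  define A m where "A = norm a" and "m = infnorm a"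
  define \<gamma> where "\<gamma> = gauss_moment p powr (1 / p)"
  define r where "r = p / 2"
  have A: "0 < A" using False by (simp add: A_def)
  have m: "0 < m" using False by (simp add: m_def infnorm_pos_lt)
  have am: "\<bar>a $ i\<bar> \<le> m" for i unfolding m_def by (rule component_le_infnorm_cart)
  have A2: "A\<^sup>2 = (\<Sum>i\<in>UNIV. (a $ i)\<^sup>2)"
    unfolding A_def norm_vec_def L2_set_def by (simp add: sum_nonneg)
  have r: "0 < r" using p by (simp add: r_def)
  have \<gamma>: "0 \<le> \<gamma>" "\<gamma> \<le> sqrt r" "gauss_norm p = \<gamma>"
  proof -
    show "gauss_norm p = \<gamma>" by (simp add: gauss_norm_def Lp_norm_def \<gamma>_def gauss_moment_def)
    have "gauss_moment p powr (1 / p) \<le> ((p / 2) powr (p / 2)) powr (1 / p)"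
      using p by (intro powr_mono2 gauss_moment_le gauss_moment_nonneg) auto
    also have "\<dots> = (p / 2) powr (1 / 2)" using p by (simp add: powr_powr)
    finally show "\<gamma> \<le> sqrt r" using p by (simp add: \<gamma>_def r_def powr_half_sqrt)
  qed (simp add: \<gamma>_def)
  have S: "(\<lambda>\<omega>. \<Sum>i\<in>UNIV. a $ i * X \<omega> $ i) = lin (($) a) UNIV" by (simp add: lin_def fun_eq_iff)
  define T where "T = (LINT \<omega>|M. \<bar>lin (($) a) UNIV \<omega>\<bar> powr p)"
  have up: "(\<integral>\<^sup>+\<omega>. ennreal (\<bar>lin (($) a) UNIV \<omega>\<bar> powr p) \<partial>M) \<le> ennreal (gauss_moment p * (A\<^sup>2 + r * m\<^sup>2) powr r)"
    unfolding r_def by (intro moment_upper am m A2 p) (use A in simp)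
  have lo: "ennreal (gauss_moment p * (max 0 (A\<^sup>2 - sqrt (6 * p) * m * sqrt (A\<^sup>2))) powr r)
      \<le> (\<integral>\<^sup>+\<omega>. ennreal (\<bar>lin (($) a) UNIV \<omega>\<bar> powr p) \<partial>M)"
    unfolding r_def by (intro moment_lower am m A2 p) (use A in simp)
  have int: "integrable M (\<lambda>\<omega>. \<bar>lin (($) a) UNIV \<omega>\<bar> powr p)"
    using up by (intro integrableI_nonneg) (auto intro: le_less_trans)
  then have nn: "(\<integral>\<^sup>+\<omega>. ennreal (\<bar>lin (($) a) UNIV \<omega>\<bar> powr p) \<partial>M) = ennreal T"
    unfolding T_def by (intro nn_integral_eq_integral) auto
  have T0: "0 \<le> T" unfolding T_def by (intro integral_nonneg_AE) auto
  have Tup: "T \<le> gauss_moment p * (A\<^sup>2 + r * m\<^sup>2) powr r"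
    using up unfolding nn by (subst (asm) ennreal_le_iff) (auto simp: gauss_moment_nonneg)
  have Tlo: "gauss_moment p * (max 0 (A\<^sup>2 - sqrt (6 * p) * m * A)) powr r \<le> T"
    using lo T0 A unfolding nn by (simp add: gauss_moment_nonneg)
  have root: "(gauss_moment p * z powr r) powr (1 / p) = \<gamma> * sqrt z" if "0 \<le> z" for z
    using that p gauss_moment_nonneg by (simp add: powr_mult powr_powr \<gamma>_def r_def powr_half_sqrt)
  have norm: "Lp_norm M p (\<lambda>\<omega>. \<Sum>i\<in>UNIV. a $ i * X \<omega> $ i) = T powr (1 / p)"
    unfolding S by (simp add: Lp_norm_def T_def)
  have sqrtr: "sqrt r * sqrt r = r" using r by simp
  have "T powr (1 / p) \<le> (gauss_moment p * (A\<^sup>2 + r * m\<^sup>2) powr r) powr (1 / p)"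
    using T0 Tup p by (intro powr_mono2) auto
  also have "\<dots> = \<gamma> * sqrt (A\<^sup>2 + r * m\<^sup>2)" using r by (intro root) auto
  also have "\<dots> \<le> \<gamma> * (A + sqrt r * m)"
  proof (intro mult_left_mono \<gamma>)
    have "A\<^sup>2 + r * m\<^sup>2 \<le> (A + sqrt r * m)\<^sup>2" using A r m by (simp add: power2_sum power_mult_distrib)
    then show "sqrt (A\<^sup>2 + r * m\<^sup>2) \<le> A + sqrt r * m" using A r m by (intro real_le_lsqrt) auto
  qed
  also have "\<dots> \<le> \<gamma> * A + p * m"
  proof -
    have "\<gamma> * (sqrt r * m) \<le> sqrt r * (sqrt r * m)" using \<gamma> r m by (intro mult_right_mono) auto
    also have "\<dots> = r * m" unfolding mult.assoc[symmetric] sqrtr ..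
    \<comment> \<open>There is slack here: the estimate has reached r = p / 2 in place of p.\<close>
    also have "\<dots> \<le> p * m" using p m by (intro mult_right_mono) (auto simp: r_def)
    finally show ?thesis by (simp add: distrib_left)
  qed
  finally have upper: "T powr (1 / p) \<le> \<gamma> * A + p * m" .
  have "\<gamma> * (A - sqrt (6 * p) * m) \<le> \<gamma> * sqrt (max 0 (A\<^sup>2 - sqrt (6 * p) * m * A))"
  proof (intro mult_left_mono \<gamma>)
    show "A - sqrt (6 * p) * m \<le> sqrt (max 0 (A\<^sup>2 - sqrt (6 * p) * m * A))"
    proof (cases "A - sqrt (6 * p) * m \<le> 0")
      case True
      then show ?thesis by (rule order_trans) simp
    next
      case False
      let ?k = "sqrt (6 * p) * m"
      have k: "0 \<le> ?k" using p m by simp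
      have "(A - ?k)\<^sup>2 = (A - ?k) * (A - ?k)" by (simp add: power2_eq_square)
      also have "\<dots> \<le> A * (A - ?k)" using False k by (intro mult_right_mono) auto
      also have "\<dots> = A\<^sup>2 - ?k * A" by (simp add: power2_eq_square algebra_simps)
      also have "\<dots> \<le> max 0 (A\<^sup>2 - ?k * A)" by simp
      finally show ?thesis by (rule real_le_rsqrt)
    qed
  qed
  also have "\<dots> = (gauss_moment p * (max 0 (A\<^sup>2 - sqrt (6 * p) * m * A)) powr r) powr (1 / p)" by (rule root[symmetric]) simp
  also have "\<dots> \<le> T powr (1 / p)" using Tlo p gauss_moment_nonneg by (intro powr_mono2) auto
  finally have "\<gamma> * A - \<gamma> * (sqrt (6 * p) * m) \<le> T powr (1 / p)" by (simp add: right_diff_distrib)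
  moreover have "\<gamma> * (sqrt (6 * p) * m) \<le> sqrt 3 * p * m"
  proof -
    have "\<gamma> * (sqrt (6 * p) * m) \<le> sqrt r * (sqrt (6 * p) * m)" using \<gamma> p m by (intro mult_right_mono) auto
    also have "\<dots> = sqrt (3 * (p * p)) * m" by (simp add: r_def real_sqrt_mult[symmetric] mult.assoc[symmetric] del: real_sqrt_mult)
    also have "sqrt (3 * (p * p)) = sqrt 3 * p" using p by (simp add: real_sqrt_mult)
    finally show ?thesis .
  qed
  ultimately have lower: "\<gamma> * A - sqrt 3 * p * m \<le> T powr (1 / p)" by linarith
  have "finite_moment M p (\<lambda>\<omega>. \<Sum>i\<in>UNIV. a $ i * X \<omega> $ i)"
    unfolding finite_moment_def S using int .
  then show ?thesis using upper lower unfolding norm \<gamma>(3) A_def m_def by simp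
qed

end

section \<open>Negatively associated vectors and Orlicz balls\<close>

text \<open>Moving two symmetric points outwards increases the average of a convex function at them,
  and this is done one coordinate at a time. So the mean over the signs is nondecreasing in the
  absolute values, which connects convex functions of sums with negative association.\<close>

lemma rad_mono_coordinates:
  assumes K: "convex_on UNIV K" and I: "finite I"
    and bc: "\<And>i. i \<in> I \<Longrightarrow> 0 \<le> b i" "\<And>i. i \<in> I \<Longrightarrow> b i \<le> c i"
  shows "rad I b K \<le> rad I c K"
proof -
  have "rad I b (\<lambda>x. K (x + z)) \<le> rad I c (\<lambda>x. K (x + z))" for z
    using I bc
  proof (induction I arbitrary: z rule: finite_induct)
    case (insert j I)
    have "rad (insert j I) b (\<lambda>x. K (x + z)) = (rad I b (\<lambda>x. K (x + (b j + z))) + rad I b (\<lambda>x. K (x + (z - b j)))) / 2"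
      using insert.hyps by (simp add: rad_insert algebra_simps)
    also have "\<dots> \<le> (rad I c (\<lambda>x. K (x + (b j + z))) + rad I c (\<lambda>x. K (x + (z - b j)))) / 2"
      using insert.prems by (intro divide_right_mono add_mono insert.IH) auto
    also have "\<dots> = rad I c (\<lambda>x. (K (x + z + b j) + K (x + z - b j)) / 2)"
      by (simp add: rad_half algebra_simps)
    also have "\<dots> \<le> rad I c (\<lambda>x. (K (x + z + c j) + K (x + z - c j)) / 2)"
      using insert.prems by (intro rad_mono divide_right_mono convex_sum_symmetric_mono[OF K]) auto
    also have "\<dots> = rad (insert j I) c (\<lambda>x. K (x + z))"
      using insert.hyps by (simp add: rad_insert' algebra_simps)
    finally show ?case .
  qed simp
  from this[of 0] show ?thesis by simp
qed

section \<open>Lebesgue measure on vectors and the passage to marginal tails\<close>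

lemma lborel_vec_eq_PiM:
  "(lborel :: (real ^ 'n) measure) = distr (PiM UNIV (\<lambda>_. lborel)) borel (\<lambda>f. \<chi> i. f i)"
proof (rule lborel_eqI)
  interpret product_sigma_finite "\<lambda>_::'n. lborel :: real measure" ..
  have [measurable]: "(\<lambda>f. \<chi> i. f i) \<in> borel_measurable (PiM (UNIV :: 'n set) (\<lambda>_. lborel :: real measure))"
    by (intro borel_measurable_vec_lambda) measurable
  fix l u :: "real ^ 'n" assume le: "\<And>b. b \<in> Basis \<Longrightarrow> l \<bullet> b \<le> u \<bullet> b"
  have lu: "l $ i \<le> u $ i" for i using le[of "axis i 1"] by (simp add: inner_axis)
  have box: "box l u = {x. \<forall>i. l $ i < x $ i \<and> x $ i < u $ i}" by (auto simp: mem_box_cart)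
  have "emeasure (distr (PiM UNIV (\<lambda>_. lborel)) borel (\<lambda>f. \<chi> i. f i)) (box l u)
      = emeasure (PiM UNIV (\<lambda>_. lborel)) (PiE UNIV (\<lambda>i. {l $ i <..< u $ i}))"
    by (subst emeasure_distr) (auto simp: box space_PiM intro!: arg_cong[where f = "emeasure _"])
  also have "\<dots> = (\<Prod>i\<in>UNIV. ennreal (u $ i - l $ i))"
    using lu by (subst emeasure_PiM) auto
  also have "\<dots> = ennreal (\<Prod>i\<in>UNIV. u $ i - l $ i)"
    using lu by (simp add: prod_ennreal)
  also have "(\<Prod>i\<in>UNIV. u $ i - l $ i) = (\<Prod>b\<in>Basis. (u - l) \<bullet> b)"
  proof -
    have B: "(Basis :: (real ^ 'n) set) = (\<lambda>i. axis i 1) ` UNIV" by (auto simp: Basis_vec_def)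
    have "inj (\<lambda>i::'n. axis i (1::real))" by (auto simp: inj_def axis_eq_axis)
    then show ?thesis unfolding B by (subst prod.reindex) (auto simp: inner_axis)
  qed
  finally show "emeasure (distr (PiM UNIV (\<lambda>_. lborel)) borel (\<lambda>f. \<chi> i. f i)) (box l u) = ennreal (\<Prod>b\<in>Basis. (u - l) \<bullet> b)" .
qed simp

lemma nn_integral_lborel_vec:
  assumes [measurable]: "h \<in> borel_measurable borel"
  shows "(\<integral>\<^sup>+x. h x \<partial>(lborel :: (real ^ 'n) measure)) = (\<integral>\<^sup>+f. h (\<chi> i. f i) \<partial>PiM UNIV (\<lambda>_. lborel))"
proof -
  have [measurable]: "(\<lambda>f. \<chi> i. f i) \<in> borel_measurable (PiM (UNIV :: 'n set) (\<lambda>_. lborel :: real measure))"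
    by (intro borel_measurable_vec_lambda) measurable
  show ?thesis unfolding lborel_vec_eq_PiM by (subst nn_integral_distr) auto
qed

lemma lborel_vec_sign_change:
  assumes \<eta>: "\<And>i. \<eta> i \<in> {-1, 1 :: real}"
  shows "distr lborel borel (\<lambda>x :: real ^ 'n. \<chi> i. \<eta> i * x $ i) = lborel"
proof -
  define c where "c b = (\<Sum>i\<in>UNIV. if b = axis i 1 then \<eta> i else 0)" for b :: "real ^ 'n"
  have c: "c (axis i 1) = \<eta> i" for i by (simp add: c_def axis_eq_axis)
  have B: "(Basis :: (real ^ 'n) set) = (\<lambda>i. axis i 1) ` UNIV" by (auto simp: Basis_vec_def)
  have inj: "inj (\<lambda>i::'n. axis i (1::real))" by (auto simp: inj_def axis_eq_axis)
  have abs: "\<bar>\<eta> i\<bar> = 1" "\<eta> i \<noteq> 0" for i using \<eta>[of i] by auto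
  have T: "0 + (\<Sum>b\<in>Basis. (c b * (x \<bullet> b)) *\<^sub>R b) = (\<chi> i. \<eta> i * x $ i)" for x :: "real ^ 'n"
  proof -
    have "(\<Sum>b\<in>Basis. (c b * (x \<bullet> b)) *\<^sub>R b) = (\<Sum>i\<in>UNIV. (\<eta> i * x $ i) *\<^sub>R axis i 1)"
      unfolding B by (subst sum.reindex[OF inj]) (simp add: c inner_axis)
    also have "\<dots> = (\<chi> i. \<eta> i * x $ i)"
      by (simp add: vec_eq_iff axis_def if_distrib cong: if_cong)
    finally show ?thesis by simp
  qed
  have "lborel = density (distr lborel borel (\<lambda>x :: real ^ 'n. 0 + (\<Sum>b\<in>Basis. (c b * (x \<bullet> b)) *\<^sub>R b))) (\<lambda>_. ennreal (\<Prod>b\<in>Basis. \<bar>c b\<bar>))"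
    by (rule lborel_affine_euclidean) (use abs c in \<open>auto simp: B\<close>)
  moreover have "(\<Prod>b\<in>Basis. \<bar>c b\<bar>) = 1" unfolding B by (intro prod.neutral) (auto simp: c abs)
  ultimately show ?thesis unfolding T by (simp add: density_1)
qed

lemma hyperplane_null: "{x :: real ^ 'n. x $ i = c} \<in> null_sets lborel"
proof -
  have "negligible {x :: real ^ 'n. x \<bullet> axis i 1 = c}"
    by (rule negligible_standard_hyperplane) (auto simp: Basis_vec_def)
  moreover have "{x :: real ^ 'n. x $ i = c} \<in> sets borel" by measurable
  ultimately show ?thesis
    by (simp add: negligible_iff_null_sets null_sets_completion_iff inner_axis)
qed

text \<open>The midpoint condition on the density passes to the tails of the marginals by the
  Prekopa-Leindler inequality.\<close>

lemma unconditional_vectorI: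
  fixes X :: "'a \<Rightarrow> real ^ 'n"
  assumes M: "prob_space M" and X [measurable]: "X \<in> borel_measurable M" and iso: "isotropic M X"
    and unc: "unconditional M X"
    and d [measurable]: "d \<in> borel_measurable borel" and dens: "distr M lborel X = density lborel d"
    and mid: "\<And>x y. d x * d y \<le> (d ((1 / 2) *\<^sub>R (x + y)))\<^sup>2"
  shows "unconditional_vector M X"
proof -
  interpret prob_space M by fact
  have emb: "(\<integral>\<^sup>+\<omega>. h (X \<omega>) \<partial>M) = (\<integral>\<^sup>+x. d x * h x \<partial>lborel)" if [measurable]: "h \<in> borel_measurable borel" for h
  proof -
    have "(\<integral>\<^sup>+\<omega>. h (X \<omega>) \<partial>M) = (\<integral>\<^sup>+x. h x \<partial>distr M lborel X)" by (subst nn_integral_distr) auto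
    also have "\<dots> = (\<integral>\<^sup>+x. d x * h x \<partial>lborel)" unfolding dens by (subst nn_integral_density) auto
    finally show ?thesis .
  qed
  have pr: "emeasure M {\<omega> \<in> space M. P (X \<omega>)} = (\<integral>\<^sup>+x. d x * indicator {x. P x} x \<partial>lborel)"
    if [measurable]: "Measurable.pred borel P" for P
  proof -
    have "emeasure M {\<omega> \<in> space M. P (X \<omega>)} = (\<integral>\<^sup>+\<omega>. indicator {\<omega> \<in> space M. P (X \<omega>)} \<omega> \<partial>M)"
      by (rule nn_integral_indicator[symmetric]) measurable
    also have "\<dots> = (\<integral>\<^sup>+\<omega>. indicator {x. P x} (X \<omega>) \<partial>M)"
      by (intro nn_integral_cong) (auto split: split_indicator)
    also have "\<dots> = (\<integral>\<^sup>+x. d x * indicator {x. P x} x \<partial>lborel)" by (rule emb) measurable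
    finally show ?thesis .
  qed
  have neg_distr: "distr M borel (\<lambda>\<omega>. \<chi> k. - X \<omega> $ k) = distr M borel X"
    using unc unfolding unconditional_def by (elim allE[of _ "\<lambda>_. -1"]) simp
  have [measurable]: "(\<lambda>\<omega>. \<chi> k. - X \<omega> $ k) \<in> borel_measurable M"
    by (intro borel_measurable_vec_lambda) measurable
  have mean: "expectation (\<lambda>\<omega>. X \<omega> $ i) = 0" for i
  proof -
    have "expectation (\<lambda>\<omega>. X \<omega> $ i) = (LINT x|distr M borel X. x $ i)" by (subst integral_distr) auto
    also have "\<dots> = (LINT x|distr M borel (\<lambda>\<omega>. \<chi> k. - X \<omega> $ k). x $ i)" unfolding neg_distr ..
    also have "\<dots> = - expectation (\<lambda>\<omega>. X \<omega> $ i)" by (subst integral_distr) auto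
    finally show ?thesis by simp
  qed
  show ?thesis
  proof unfold_locales
    show "X \<in> borel_measurable M" "unconditional M X" by fact+
    fix i
    have cov: "(LINT \<omega>|M. (X \<omega> $ i)\<^sup>2) = 1"
    proof -
      have "covariance_matrix M X $ i $ i = 1" using iso by (simp add: isotropic_def mat_def)
      then show ?thesis by (simp add: covariance_matrix_def covariance_def mean power2_eq_square)
    qed
    \<comment> \<open>A non-integrable function would have Bochner integral 0, so the value 1
      implies integrability.\<close>
    then have "integrable M (\<lambda>\<omega>. (X \<omega> $ i)\<^sup>2)" using not_integrable_integral_eq by fastforce
    then have "(\<integral>\<^sup>+\<omega>. ennreal ((X \<omega> $ i)\<^sup>2) \<partial>M) = ennreal (LINT \<omega>|M. (X \<omega> $ i)\<^sup>2)"
      by (rule nn_integral_eq_integral) simp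
    then show "(\<integral>\<^sup>+\<omega>. ennreal ((X \<omega> $ i)\<^sup>2) \<partial>M) = 1" by (simp add: cov)
    have "emeasure M {\<omega> \<in> space M. X \<omega> $ i = 0} = (\<integral>\<^sup>+x. d x * indicator {x. x $ i = 0} x \<partial>lborel)"
      by (rule pr) measurable
    also have "\<dots> = (\<integral>\<^sup>+(x :: real ^ 'n). 0 \<partial>lborel)"
      using AE_not_in[OF hyperplane_null[of i 0]]
      by (intro nn_integral_cong_AE) (auto elim!: eventually_mono split: split_indicator)
    finally have "prob {\<omega> \<in> space M. X \<omega> $ i = 0} = 0" by (simp add: measure_def)
    moreover have "{\<omega> \<in> space M. 0 < \<bar>X \<omega> $ i\<bar>} = space M - {\<omega> \<in> space M. X \<omega> $ i = 0}" by auto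
    ultimately show "prob {\<omega> \<in> space M. 0 < \<bar>X \<omega> $ i\<bar>} = 1" by (simp only:) (subst prob_compl; simp)
    fix s t :: real assume st: "0 \<le> s" "0 \<le> t"
    let ?p = "\<lambda>u. prob {\<omega> \<in> space M. u < X \<omega> $ i}"
    \<comment> \<open>Prekopa-Leindler needs a convex event: the half-space u < x_i is convex while
      u < |x_i| is not. By symmetry the two-sided tail is twice the one-sided one.\<close>
    have two: "prob {\<omega> \<in> space M. u < \<bar>X \<omega> $ i\<bar>} = 2 * ?p u" if "0 \<le> u" for u
    proof -
      have "prob {\<omega> \<in> space M. u < - X \<omega> $ i} = measure (distr M borel (\<lambda>\<omega>. \<chi> k. - X \<omega> $ k)) {x. u < x $ i}"
        by (subst measure_distr) (auto intro!: arg_cong[where f = prob])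
      also have "\<dots> = ?p u" unfolding neg_distr by (subst measure_distr) (auto intro!: arg_cong[where f = prob])
      finally have "prob {\<omega> \<in> space M. u < - X \<omega> $ i} = ?p u" .
      moreover have "{\<omega> \<in> space M. u < \<bar>X \<omega> $ i\<bar>} = {\<omega> \<in> space M. u < X \<omega> $ i} \<union> {\<omega> \<in> space M. u < - X \<omega> $ i}"
        by auto
      moreover have "prob ({\<omega> \<in> space M. u < X \<omega> $ i} \<union> {\<omega> \<in> space M. u < - X \<omega> $ i})
          = ?p u + prob {\<omega> \<in> space M. u < - X \<omega> $ i}"
        using that by (intro finite_measure_Union) auto
      ultimately show ?thesis by simp
    qed
    let ?F = "\<lambda>u f. d (\<chi> i. f i) * indicator {u<..} (f i)"
    have e: "ennreal (?p u) = (\<integral>\<^sup>+f. ?F u f \<partial>PiM UNIV (\<lambda>_. lborel))" for u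
    proof -
      have "ennreal (?p u) = (\<integral>\<^sup>+x. d x * indicator {x. u < x $ i} x \<partial>lborel)"
        unfolding emeasure_eq_measure[symmetric] by (rule pr) measurable
      also have "\<dots> = (\<integral>\<^sup>+f. d (\<chi> i. f i) * indicator {x. u < x $ i} (\<chi> i. f i) \<partial>PiM UNIV (\<lambda>_. lborel))"
        by (rule nn_integral_lborel_vec) measurable
      also have "\<dots> = (\<integral>\<^sup>+f. ?F u f \<partial>PiM UNIV (\<lambda>_. lborel))"
        by (intro nn_integral_cong) (auto split: split_indicator)
      finally show ?thesis .
    qed
    have [measurable]: "(\<lambda>f. \<chi> i. f i) \<in> borel_measurable (PiM (UNIV :: 'n set) (\<lambda>_. lborel :: real measure))"
      by (intro borel_measurable_vec_lambda) measurable
    have "ennreal (?p s) * ennreal (?p t) \<le> (ennreal (?p ((s + t) / 2)))\<^sup>2"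
      unfolding e
    proof (rule prekopa_leindler_midpoint[OF finite])
      fix x y :: "'n \<Rightarrow> real"
      have v: "(\<chi> k. (\<lambda>k\<in>UNIV. (x k + y k) / 2) k) = (1 / 2) *\<^sub>R ((\<chi> k. x k) + (\<chi> k. y k))"
        by (simp add: vec_eq_iff field_simps)
      show "?F s x * ?F t y \<le> (?F ((s + t) / 2) (\<lambda>k\<in>UNIV. (x k + y k) / 2))\<^sup>2"
        unfolding v using mid[of "\<chi> k. x k" "\<chi> k. y k"] by (auto split: split_indicator)
    qed measurable
    then have "?p s * ?p t \<le> (?p ((s + t) / 2))\<^sup>2"
      by (simp add: ennreal_mult[symmetric] ennreal_power)
    then show "prob {\<omega> \<in> space M. s < \<bar>X \<omega> $ i\<bar>} * prob {\<omega> \<in> space M. t < \<bar>X \<omega> $ i\<bar>}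
        \<le> (prob {\<omega> \<in> space M. (s + t) / 2 < \<bar>X \<omega> $ i\<bar>})\<^sup>2"
      using st unfolding two[OF st(1)] two[OF st(2)] by (subst two) (simp_all add: power_mult_distrib)
  qed
qed

lemma exp_minus_midpoint:
  fixes h :: "'b::real_vector \<Rightarrow> ereal"
  assumes h: "\<And>x. h x \<noteq> -\<infinity>" "ereal_convex_on UNIV h"
  shows "exp_minus (h x) * exp_minus (h y) \<le> (exp_minus (h ((1 / 2) *\<^sub>R (x + y))))\<^sup>2"
proof (cases "h x = \<infinity> \<or> h y = \<infinity>")
  case True
  then show ?thesis by (auto simp: exp_minus_def)
next
  case False
  then obtain a b where ab: "h x = ereal a" "h y = ereal b" using h(1)[of x] h(1)[of y] by (cases "h x"; cases "h y") auto
  have "h ((1 / 2) *\<^sub>R x + (1 / 2) *\<^sub>R y) \<le> ereal (1 / 2) * h x + ereal (1 / 2) * h y"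
    using h(2) unfolding ereal_convex_on_def by (elim conjE ballE[of _ _ x] ballE[of _ _ y] allE[of _ "1/2"]) auto
  then have le: "h ((1 / 2) *\<^sub>R (x + y)) \<le> ereal ((a + b) / 2)" by (simp add: ab scaleR_add_right add_divide_distrib)
  then obtain c where c: "h ((1 / 2) *\<^sub>R (x + y)) = ereal c" using h(1) by (cases "h ((1 / 2) *\<^sub>R (x + y))") auto
  have "exp (- a) * exp (- b) \<le> (exp (- c))\<^sup>2" using le by (simp add: c exp_add[symmetric] exp_double[symmetric])
  then show ?thesis by (simp add: exp_minus_def ab c ennreal_mult[symmetric] ennreal_power)
qed

text \<open>The mean over the signs is a nondecreasing function of the absolute values of the
  coordinates in I. It is truncated at k to become a bounded test function, set against the
  indicator of the tail event, and recovered by monotone convergence.\<close>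

lemma (in unconditional_vector) negatively_dependentI:
  assumes NA: "negatively_associated M (\<lambda>i \<omega>. \<bar>X \<omega> $ i\<bar>)"
  shows "negatively_dependent_vector M X"
proof unfold_locales
  fix a :: "'n \<Rightarrow> real" and I :: "'n set" and j :: 'n and t :: real and K :: "real \<Rightarrow> real"
  assume j: "j \<notin> I" and t: "0 \<le> t" and K: "convex_on UNIV K" "\<And>x. 0 \<le> K x"
    and [measurable]: "K \<in> borel_measurable borel"
  \<comment> \<open>Test functions must be monotone on all of R^I, while the sign average is
    monotone only for nonnegative entries; taking positive parts repairs this and changes nothing at
    the |X_i|.\<close>
  define \<psi> where "\<psi> x = rad I (\<lambda>i. \<bar>a i\<bar> * max 0 (x i)) K" for x :: "'n \<Rightarrow> real"
  define f1 where "f1 x = (indicator {t<..} (x j) :: real)" for x :: "'n \<Rightarrow> real"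
  define f2 where "f2 k x = min (real k) (\<psi> x)" for k x
  have \<psi>_measurable [measurable]: "\<psi> \<in> borel_measurable (PiM I (\<lambda>_. borel))"
    unfolding \<psi>_def rad_def by measurable
  have \<psi>0: "0 \<le> \<psi> x" for x unfolding \<psi>_def by (intro rad_nonneg K)
  have test1: "monotone_test_function {j} f1"
    unfolding monotone_test_function_def
  proof (intro conjI ballI)
    show "f1 \<in> borel_measurable (PiM {j} (\<lambda>_. borel))" unfolding f1_def by measurable
    show "bounded (f1 ` ({j} \<rightarrow>\<^sub>E UNIV))"
      by (rule boundedI[of _ 1]) (auto simp: f1_def indicator_def)
    show "mono (\<lambda>t. f1 (x(i := t)))" if "i \<in> {j}" for x i
      using that by (auto intro!: monoI simp: f1_def indicator_def)
  qed
  have test2: "monotone_test_function I (f2 k)" for k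
    unfolding monotone_test_function_def
  proof (intro conjI ballI)
    show "f2 k \<in> borel_measurable (PiM I (\<lambda>_. borel))" unfolding f2_def by measurable
    show "bounded (f2 k ` (I \<rightarrow>\<^sub>E UNIV))"
      by (rule boundedI[of _ "real k"]) (auto simp: f2_def \<psi>0 abs_of_nonneg)
    fix x i assume "i \<in> I"
    show "mono (\<lambda>t. f2 k (x(i := t)))"
    proof (rule monoI)
      fix s t :: real assume "s \<le> t"
      have "\<psi> (x(i := s)) \<le> \<psi> (x(i := t))"
        unfolding \<psi>_def using \<open>s \<le> t\<close>
        by (intro rad_mono_coordinates K) (auto intro!: mult_left_mono)
      then show "f2 k (x(i := s)) \<le> f2 k (x(i := t))" by (auto simp: f2_def)
    qed
  qed
  define U where "U \<omega> = (indicator {t<..} \<bar>X \<omega> $ j\<bar> :: real)" for \<omega>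
  define W where "W \<omega> = rad I (\<lambda>i. \<bar>a i * X \<omega> $ i\<bar>) K" for \<omega>
  have [measurable]: "U \<in> borel_measurable M" "W \<in> borel_measurable M" unfolding U_def W_def rad_def by measurable
  have W0: "0 \<le> W \<omega>" for \<omega> unfolding W_def by (intro rad_nonneg K)
  have U: "0 \<le> U \<omega>" "U \<omega> \<le> 1" for \<omega> by (auto simp: U_def indicator_def)
  have f1X: "f1 (\<lambda>i\<in>{j}. \<bar>X \<omega> $ i\<bar>) = U \<omega>" for \<omega> by (simp add: f1_def U_def)
  have f2X: "f2 k (\<lambda>i\<in>I. \<bar>X \<omega> $ i\<bar>) = min (real k) (W \<omega>)" for k \<omega>
    unfolding f2_def \<psi>_def W_def
    by (intro arg_cong2[where f = min] refl rad_cong) (simp add: abs_mult)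
  have intU: "integrable M U" using U by (intro integrable_const_bound[of _ 1]) auto
  have intW: "integrable M (\<lambda>\<omega>. min (real k) (W \<omega>))" for k
    using W0 by (intro integrable_const_bound[of _ "real k"]) (auto simp: abs_of_nonneg)
  have intUW: "integrable M (\<lambda>\<omega>. U \<omega> * min (real k) (W \<omega>))" for k
  proof (rule integrable_const_bound[of _ "real k"])
    have "U \<omega> * min (real k) (W \<omega>) \<le> 1 * real k" for \<omega>
      using U W0 by (intro mult_mono) auto
    then show "AE \<omega> in M. norm (U \<omega> * min (real k) (W \<omega>)) \<le> real k"
      using U W0 by (intro AE_I2) (simp add: abs_of_nonneg)
  qed measurable
  have EU: "expectation U = tail j t"
  proof -
    have "expectation U = (LINT \<omega>|M. indicator {\<omega> \<in> space M. t < \<bar>X \<omega> $ j\<bar>} \<omega>)"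
      by (intro Bochner_Integration.integral_cong) (auto simp: U_def split: split_indicator)
    also have "\<dots> = tail j t" by (subst Bochner_Integration.integral_indicator) (auto simp: tail_def intro!: arg_cong[where f = prob])
    finally show ?thesis .
  qed
  have trunc: "expectation (\<lambda>\<omega>. U \<omega> * min (real k) (W \<omega>)) \<le> tail j t * expectation (\<lambda>\<omega>. min (real k) (W \<omega>))" for k
  proof -
    have "{j} \<inter> I = {}" using j by auto
    then have cov: "covariance M U (\<lambda>\<omega>. min (real k) (W \<omega>)) \<le> 0"
      using NA test1 test2[of k] unfolding negatively_associated_def f1X[symmetric] f2X[symmetric] by blast
    define e1 e2 where "e1 = expectation U" and "e2 = expectation (\<lambda>\<omega>. min (real k) (W \<omega>))"
    have "covariance M U (\<lambda>\<omega>. min (real k) (W \<omega>))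
        = expectation (\<lambda>\<omega>. U \<omega> * min (real k) (W \<omega>) - e2 * U \<omega> - e1 * min (real k) (W \<omega>) + e1 * e2)"
      unfolding covariance_def e1_def[symmetric] e2_def[symmetric]
      by (intro Bochner_Integration.integral_cong) (auto simp: algebra_simps)
    also have "\<dots> = expectation (\<lambda>\<omega>. U \<omega> * min (real k) (W \<omega>)) - e2 * e1 - e1 * e2 + e1 * e2"
      using intU intW[of k] intUW[of k] prob_space by (simp add: e1_def[symmetric] e2_def[symmetric])
    finally show ?thesis using cov by (simp add: EU[symmetric] e1_def e2_def)
  qed
  have nn: "(\<integral>\<^sup>+\<omega>. ennreal (U \<omega>) * ennreal (min (real k) (W \<omega>)) \<partial>M) \<le> ennreal (tail j t) * (\<integral>\<^sup>+\<omega>. ennreal (W \<omega>) \<partial>M)" for k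
  proof -
    have "(\<integral>\<^sup>+\<omega>. ennreal (U \<omega>) * ennreal (min (real k) (W \<omega>)) \<partial>M) = (\<integral>\<^sup>+\<omega>. ennreal (U \<omega> * min (real k) (W \<omega>)) \<partial>M)"
      using U W0 by (intro nn_integral_cong) (simp add: ennreal_mult)
    also have "\<dots> = ennreal (expectation (\<lambda>\<omega>. U \<omega> * min (real k) (W \<omega>)))"
      using U W0 by (intro nn_integral_eq_integral intUW) auto
    also have "\<dots> \<le> ennreal (tail j t * expectation (\<lambda>\<omega>. min (real k) (W \<omega>)))" by (intro ennreal_leI trunc)
    also have "\<dots> = ennreal (tail j t) * ennreal (expectation (\<lambda>\<omega>. min (real k) (W \<omega>)))"
      using W0 by (intro ennreal_mult tail_nonneg integral_nonneg_AE) auto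
    also have "ennreal (expectation (\<lambda>\<omega>. min (real k) (W \<omega>))) = (\<integral>\<^sup>+\<omega>. ennreal (min (real k) (W \<omega>)) \<partial>M)"
      using W0 by (intro nn_integral_eq_integral[symmetric] intW) auto
    also have "ennreal (tail j t) * \<dots> \<le> ennreal (tail j t) * (\<integral>\<^sup>+\<omega>. ennreal (W \<omega>) \<partial>M)"
      by (intro mult_left_mono nn_integral_mono ennreal_leI) auto
    finally show ?thesis .
  qed
  have "(\<integral>\<^sup>+\<omega>. indicator {t<..} \<bar>X \<omega> $ j\<bar> * ennreal (K (lin a I \<omega>)) \<partial>M)
      = (\<integral>\<^sup>+\<omega>. indicator {t<..} \<bar>X \<omega> $ j\<bar> * ennreal (W \<omega>) \<partial>M)"
    unfolding W_def by (rule nn_integral_rad) (auto simp: K)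
  also have "\<dots> = (\<integral>\<^sup>+\<omega>. (SUP k::nat. ennreal (U \<omega>) * ennreal (min (real k) (W \<omega>))) \<partial>M)"
  proof (intro nn_integral_cong)
    fix \<omega>
    have "(SUP k::nat. ennreal (min (real k) (W \<omega>))) = ennreal (W \<omega>)"
    proof (rule antisym)
      show "(SUP k::nat. ennreal (min (real k) (W \<omega>))) \<le> ennreal (W \<omega>)"
        by (intro SUP_least ennreal_leI) auto
      have "ennreal (W \<omega>) = ennreal (min (real (nat \<lceil>W \<omega>\<rceil>)) (W \<omega>))" using real_nat_ceiling_ge[of "W \<omega>"] by (simp add: min_def)
      also have "\<dots> \<le> (SUP k::nat. ennreal (min (real k) (W \<omega>)))" by (rule SUP_upper) simp
      finally show "ennreal (W \<omega>) \<le> (SUP k::nat. ennreal (min (real k) (W \<omega>)))" .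
    qed
    then show "indicator {t<..} \<bar>X \<omega> $ j\<bar> * ennreal (W \<omega>) = (SUP k::nat. ennreal (U \<omega>) * ennreal (min (real k) (W \<omega>)))"
      by (simp add: SUP_mult_left_ennreal[symmetric] U_def ennreal_indicator)
  qed
  also have "\<dots> = (SUP k::nat. \<integral>\<^sup>+\<omega>. ennreal (U \<omega>) * ennreal (min (real k) (W \<omega>)) \<partial>M)"
    by (intro nn_integral_monotone_convergence_SUP)
      (auto simp: incseq_def le_fun_def intro!: mult_left_mono ennreal_leI)
  also have "\<dots> \<le> ennreal (tail j t) * (\<integral>\<^sup>+\<omega>. ennreal (W \<omega>) \<partial>M)" by (intro SUP_least nn)
  also have "(\<integral>\<^sup>+\<omega>. ennreal (W \<omega>) \<partial>M) = (\<integral>\<^sup>+\<omega>. ennreal (K (lin a I \<omega>)) \<partial>M)"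
    using nn_integral_rad[of "\<lambda>_. 1" K j a I] K by (simp add: W_def)
  finally show "(\<integral>\<^sup>+\<omega>. indicator {t<..} \<bar>X \<omega> $ j\<bar> * ennreal (K (lin a I \<omega>)) \<partial>M)
      \<le> ennreal (tail j t) * (\<integral>\<^sup>+\<omega>. ennreal (K (lin a I \<omega>)) \<partial>M)" .
qed

context orlicz_profile
begin

definition orlicz_body :: "(real ^ 'n) set" where
  "orlicz_body = {x. (\<forall>i. x $ i \<in> D) \<and> (\<Sum>i\<in>UNIV. G (x $ i)) \<le> 1}"

lemma orlicz_body_measurable [measurable]: "orlicz_body \<in> sets borel"
proof -
  have "{x \<in> space borel. (\<forall>i\<in>UNIV. (x :: real ^ 'n) $ i \<in> D)} \<in> sets borel"
    by (intro sets.sets_Collect_finite_All) measurable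
  moreover have "{x \<in> space borel. (\<Sum>i\<in>UNIV. G ((x :: real ^ 'n) $ i)) \<le> 1} \<in> sets borel" by measurable
  ultimately have "{x \<in> space borel. (\<forall>i\<in>UNIV. (x :: real ^ 'n) $ i \<in> D)} \<inter> {x \<in> space borel. (\<Sum>i\<in>UNIV. G (x $ i)) \<le> 1} \<in> sets borel"
    by (rule sets.Int)
  then show ?thesis by (simp add: orlicz_body_def Collect_conj_eq[symmetric] Int_def)
qed

lemma orlicz_body_midpoint:
  assumes "x \<in> orlicz_body" "y \<in> orlicz_body" shows "(1 / 2) *\<^sub>R (x + y) \<in> orlicz_body"
proof -
  have D: "(x $ i + y $ i) / 2 \<in> D" for i
    using convexD[OF convex_D, of "x $ i" "y $ i" "1/2" "1/2"] assms
    by (simp add: orlicz_body_def field_simps)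
  have G: "G ((x $ i + y $ i) / 2) \<le> (G (x $ i) + G (y $ i)) / 2" for i
    using convex_onD[OF G_convex, of "1/2" "x $ i" "y $ i"] assms
    by (simp add: orlicz_body_def field_simps)
  have "(\<Sum>i\<in>UNIV. G ((x $ i + y $ i) / 2)) \<le> (\<Sum>i\<in>UNIV. (G (x $ i) + G (y $ i)) / 2)"
    by (intro sum_mono G)
  also have "\<dots> = ((\<Sum>i\<in>UNIV. G (x $ i)) + (\<Sum>i\<in>UNIV. G (y $ i))) / 2"
    by (simp add: sum.distrib sum_divide_distrib[symmetric])
  also have "\<dots> \<le> 1" using assms by (simp add: orlicz_body_def)
  finally show ?thesis using D by (simp add: orlicz_body_def)
qed

lemma orlicz_body_flip:
  assumes "\<And>i. \<eta> i \<in> {-1, 1 :: real}"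
  shows "(\<chi> i. \<eta> i * x $ i) \<in> orlicz_body \<longleftrightarrow> x \<in> orlicz_body"
proof -
  have "\<bar>\<eta> i * x $ i\<bar> = \<bar>x $ i\<bar>" for i using assms[of i] by (auto simp: abs_mult)
  then have "\<eta> i * x $ i \<in> D \<longleftrightarrow> x $ i \<in> D" "G (\<eta> i * x $ i) = G (x $ i)" for i
    using abs_D[of "\<eta> i * x $ i"] abs_D[of "x $ i"] G_abs[of "\<eta> i * x $ i"] G_abs[of "x $ i"] by auto
  then show ?thesis by (simp add: orlicz_body_def)
qed

lemma emeasure_orlicz_body: "emeasure lborel (orlicz_body :: (real ^ 'n) set) = vol (UNIV :: 'n set) 1"
proof -
  have "emeasure lborel (orlicz_body :: (real ^ 'n) set) = (\<integral>\<^sup>+x. indicator orlicz_body (x :: real ^ 'n) \<partial>lborel)" by simp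
  also have "\<dots> = (\<integral>\<^sup>+f. indicator orlicz_body (\<chi> i. f i :: real ^ 'n) \<partial>PiM UNIV (\<lambda>_. lborel))"
    by (rule nn_integral_lborel_vec) measurable
  also have "\<dots> = (\<integral>\<^sup>+f. indicator (orlicz_set (UNIV :: 'n set) 1) f \<partial>PiM UNIV (\<lambda>_. lborel))"
    by (intro nn_integral_cong) (auto simp: orlicz_body_def orlicz_set_def split: split_indicator)
  also have "\<dots> = vol (UNIV :: 'n set) 1"
    unfolding vol_def by (rule nn_integral_indicator) (rule orlicz_set_measurable, simp)
  finally show ?thesis .
qed

text \<open>The density is constant on a convex set that is invariant under sign changes, which
  gives unconditionality and, by Prekopa-Leindler, the marginal tails. The dependence property is
  \<open>orlicz_negative_dependence\<close> for the sign average of K, divided twice by the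
  volume.\<close>

lemma negatively_dependent_orlicz:
  fixes X :: "'a \<Rightarrow> real ^ 'n"
  assumes M: "prob_space M" and X [measurable]: "X \<in> borel_measurable M" and iso: "isotropic M X"
    and dist: "distr M lborel X = uniform_measure lborel orlicz_body"
  shows "negatively_dependent_vector M X"
proof -
  interpret prob_space M by fact
  define \<kappa> where "\<kappa> = vol (UNIV :: 'n set) 1"
  have \<kappa>_fin: "\<kappa> < \<infinity>" unfolding \<kappa>_def by (rule vol_finite) simp
  have "prob_space (distr M lborel X)" by (rule prob_space_distr) simp
  \<comment> \<open>A uniform measure on a null set has total mass 0, so the law of X being a
    probability forces the body to have positive volume.\<close>
  then have "emeasure (uniform_measure lborel (orlicz_body :: (real ^ 'n) set)) UNIV = 1"
    unfolding dist using prob_space.emeasure_space_1 by fastforce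
  then have \<kappa>0: "\<kappa> \<noteq> 0" by (auto simp: \<kappa>_def emeasure_orlicz_body[symmetric])
  let ?d = "\<lambda>x :: real ^ 'n. indicator orlicz_body x / \<kappa>"
  have dens: "distr M lborel X = density lborel ?d"
    unfolding dist uniform_measure_def \<kappa>_def emeasure_orlicz_body ..
  have emb: "(\<integral>\<^sup>+\<omega>. h (X \<omega>) \<partial>M) = (\<integral>\<^sup>+x. ?d x * h x \<partial>lborel)" if [measurable]: "h \<in> borel_measurable borel" for h
  proof -
    have "(\<integral>\<^sup>+\<omega>. h (X \<omega>) \<partial>M) = (\<integral>\<^sup>+x. h x \<partial>distr M lborel X)" by (subst nn_integral_distr) auto
    also have "\<dots> = (\<integral>\<^sup>+x. ?d x * h x \<partial>lborel)" unfolding dens by (subst nn_integral_density) auto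
    finally show ?thesis .
  qed
  have abs_emb: "(\<integral>\<^sup>+\<omega>. h (\<lambda>i. \<bar>X \<omega> $ i\<bar>) \<partial>M) = mass UNIV h 1 / \<kappa>"
    if [measurable]: "h \<in> borel_measurable (PiM UNIV (\<lambda>_. lborel))" for h :: "('n \<Rightarrow> real) \<Rightarrow> ennreal"
  proof -
    have [measurable]: "(\<lambda>x :: real ^ 'n. (\<lambda>i. \<bar>x $ i\<bar>)) \<in> measurable borel (PiM UNIV (\<lambda>_. lborel))"
    proof -
      have "(\<lambda>x :: real ^ 'n. (\<lambda>i\<in>UNIV. \<bar>x $ i\<bar>)) \<in> measurable borel (PiM UNIV (\<lambda>_. lborel))"
        by (intro measurable_restrict) measurable
      then show ?thesis by (simp only: restrict_UNIV)
    qed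
    have "(\<integral>\<^sup>+\<omega>. h (\<lambda>i. \<bar>X \<omega> $ i\<bar>) \<partial>M) = (\<integral>\<^sup>+x. ?d x * h (\<lambda>i. \<bar>x $ i\<bar>) \<partial>lborel)"
      by (rule emb) measurable
    also have "\<dots> = (\<integral>\<^sup>+f. ?d (\<chi> i. f i) * h (\<lambda>i. \<bar>(\<chi> i. f i) $ i\<bar>) \<partial>PiM UNIV (\<lambda>_. lborel))"
      by (rule nn_integral_lborel_vec) measurable
    also have "\<dots> = (\<integral>\<^sup>+f. h (\<lambda>j\<in>UNIV. \<bar>f j\<bar>) * indicator (orlicz_set (UNIV :: 'n set) 1) f / \<kappa> \<partial>PiM UNIV (\<lambda>_. lborel))"
      by (intro nn_integral_cong) (auto simp: orlicz_body_def orlicz_set_def divide_ennreal_def mult_ac restrict_UNIV split: split_indicator)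
    also have "\<dots> = mass UNIV h 1 / \<kappa>"
      unfolding mass_def using orlicz_set_measurable[of "UNIV :: 'n set" 1] by (intro nn_integral_divide) measurable
    finally show ?thesis .
  qed
  have unc: "unconditional M X"
    unfolding unconditional_def
  proof (intro allI impI)
    fix \<eta> :: "'n \<Rightarrow> real" assume \<eta>: "\<forall>i. \<eta> i \<in> {-1, 1}"
    define T where "T x = (\<chi> i. \<eta> i * x $ i)" for x :: "real ^ 'n"
    have [measurable]: "T \<in> borel_measurable borel" unfolding T_def by (intro borel_measurable_vec_lambda) measurable
    show "distr M borel (\<lambda>\<omega>. \<chi> i. \<eta> i * X \<omega> $ i) = distr M borel X"
    proof (rule measure_eqI)
      fix S assume "S \<in> sets (distr M borel (\<lambda>\<omega>. \<chi> i. \<eta> i * X \<omega> $ i))"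
      then have [measurable]: "S \<in> sets borel" by simp
      have [measurable]: "(\<lambda>\<omega>. \<chi> i. \<eta> i * X \<omega> $ i) \<in> borel_measurable M" by (intro borel_measurable_vec_lambda) measurable
      have flip: "?d (T x) = ?d x" for x
        using orlicz_body_flip[of \<eta> x] \<eta> by (auto simp: T_def split: split_indicator)
      have "emeasure (distr M borel X) S = (\<integral>\<^sup>+x. indicator S x \<partial>distr M borel X)" by simp
      also have "\<dots> = (\<integral>\<^sup>+\<omega>. indicator S (X \<omega>) \<partial>M)" by (subst nn_integral_distr) auto
      also have "\<dots> = (\<integral>\<^sup>+x. ?d x * indicator S x \<partial>lborel)" by (rule emb) measurable
      also have "\<dots> = (\<integral>\<^sup>+x. ?d x * indicator S x \<partial>distr lborel borel T)"
        using lborel_vec_sign_change[of \<eta>] \<eta> by (simp add: T_def[abs_def])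
      also have "\<dots> = (\<integral>\<^sup>+x. ?d (T x) * indicator S (T x) \<partial>lborel)" by (subst nn_integral_distr) auto
      also have "\<dots> = (\<integral>\<^sup>+x. ?d x * indicator S (T x) \<partial>lborel)" unfolding flip ..
      also have "\<dots> = (\<integral>\<^sup>+\<omega>. indicator S (T (X \<omega>)) \<partial>M)" by (rule emb[symmetric]) measurable
      also have "\<dots> = (\<integral>\<^sup>+x. indicator S x \<partial>distr M borel (\<lambda>\<omega>. \<chi> i. \<eta> i * X \<omega> $ i))"
        unfolding T_def by (subst nn_integral_distr) auto
      finally show "emeasure (distr M borel (\<lambda>\<omega>. \<chi> i. \<eta> i * X \<omega> $ i)) S = emeasure (distr M borel X) S" by simp
    qed simp
  qed
  interpret unconditional_vector M X
  proof (rule unconditional_vectorI[OF M X iso unc _ dens])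
    show "?d \<in> borel_measurable borel" by measurable
    show "?d x * ?d y \<le> (?d ((1 / 2) *\<^sub>R (x + y)))\<^sup>2" for x y
      using orlicz_body_midpoint[of x y] by (auto simp: power2_eq_square split: split_indicator)
  qed
  show ?thesis
  proof unfold_locales
    fix a :: "'n \<Rightarrow> real" and I :: "'n set" and j :: 'n and t :: real and K :: "real \<Rightarrow> real"
    assume j: "j \<notin> I" and t: "0 \<le> t" and K: "convex_on UNIV K" "\<And>x. 0 \<le> K x"
      and [measurable]: "K \<in> borel_measurable borel"
    \<comment> \<open>All coordinates except j must be integrated out, although K sees only those in
      I; \<psi> is therefore regarded as a function on the larger index set
      \<open>J\<close>.\<close>
    define J where "J = UNIV - {j}"
    have J: "finite J" "j \<notin> J" "insert j J = UNIV" "I \<subseteq> J" using j by (auto simp: J_def)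
    define \<psi> where "\<psi> z = ennreal (rad I (\<lambda>i. \<bar>a i\<bar> * z i) K)" for z :: "'n \<Rightarrow> real"
    have \<psi>_meas: "\<psi> \<in> borel_measurable (PiM A (\<lambda>_. lborel))" if "I \<subseteq> A" for A
    proof -
      have "(\<lambda>z. z i) \<in> borel_measurable (PiM A (\<lambda>_. lborel))" if "i \<in> I" for i
        using \<open>i \<in> I\<close> \<open>I \<subseteq> A\<close> measurable_component_singleton[of i A "\<lambda>_. lborel :: real measure"] by auto
      then show ?thesis unfolding \<psi>_def rad_def by measurable
    qed
    have restr: "\<psi> (restrict z J) = \<psi> z" for z
      unfolding \<psi>_def using J(4) by (intro arg_cong[where f = ennreal] rad_cong) auto
    have \<psi>_mono: "\<psi> x \<le> \<psi> y" if "x \<in> PiE J (\<lambda>_. {0..})" "y \<in> PiE J (\<lambda>_. {0..})" "\<And>j. j \<in> J \<Longrightarrow> x j \<le> y j" for x y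
      unfolding \<psi>_def using that J(4)
      by (intro ennreal_leI rad_mono_coordinates K) (auto intro!: mult_left_mono mult_nonneg_nonneg simp: PiE_iff subset_iff)
    have W: "ennreal (rad I (\<lambda>i. \<bar>a i * X \<omega> $ i\<bar>) K) = \<psi> (\<lambda>i. \<bar>X \<omega> $ i\<bar>)" for \<omega>
      by (simp add: \<psi>_def abs_mult)
    have key: "mass UNIV (\<lambda>z. indicator {t<..} (z j) * \<psi> z) 1 * \<kappa> \<le> mass UNIV (\<lambda>z. indicator {t<..} (z j)) 1 * mass UNIV \<psi> 1"
    proof -
      have "mass (insert j J) (\<lambda>z. indicator {t<..} (z j) * \<psi> (restrict z J)) 1 * vol (insert j J) 1
        \<le> mass (insert j J) (\<lambda>z. indicator {t<..} (z j)) 1 * mass (insert j J) (\<lambda>z. \<psi> (restrict z J)) 1"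
        by (rule orlicz_negative_dependence[OF J(1,2) \<psi>_meas[OF J(4)]]) (rule \<psi>_mono)
      then show ?thesis by (simp only: J(3) restr \<kappa>_def)
    qed
    have ind: "(\<lambda>z. indicator {t<..} (z j) :: ennreal) \<in> borel_measurable (PiM UNIV (\<lambda>_. lborel :: real measure))"
      by measurable
    have "(\<integral>\<^sup>+\<omega>. indicator {t<..} \<bar>X \<omega> $ j\<bar> * ennreal (K (lin a I \<omega>)) \<partial>M)
        = (\<integral>\<^sup>+\<omega>. indicator {t<..} \<bar>X \<omega> $ j\<bar> * \<psi> (\<lambda>i. \<bar>X \<omega> $ i\<bar>) \<partial>M)"
      unfolding W[symmetric] by (rule nn_integral_rad) (auto simp: K)
    also have "\<dots> = mass UNIV (\<lambda>z. indicator {t<..} (z j) * \<psi> z) 1 / \<kappa>"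
      by (rule abs_emb[OF borel_measurable_times_ennreal[OF ind \<psi>_meas]]) simp
    also have "\<dots> \<le> (mass UNIV (\<lambda>z. indicator {t<..} (z j)) 1 / \<kappa>) * (mass UNIV \<psi> 1 / \<kappa>)"
    proof -
      have "mass UNIV (\<lambda>z. indicator {t<..} (z j) * \<psi> z) 1 / \<kappa>
          = mass UNIV (\<lambda>z. indicator {t<..} (z j) * \<psi> z) 1 * \<kappa> / \<kappa> / \<kappa>"
        using \<kappa>0 \<kappa>_fin by (simp add: ennreal_mult_divide_eq)
      also have "\<dots> \<le> mass UNIV (\<lambda>z. indicator {t<..} (z j)) 1 * mass UNIV \<psi> 1 / \<kappa> / \<kappa>"
        by (intro divide_right_mono_ennreal key)
      also have "\<dots> = (mass UNIV (\<lambda>z. indicator {t<..} (z j)) 1 / \<kappa>) * (mass UNIV \<psi> 1 / \<kappa>)"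
        by (simp add: divide_ennreal_def mult_ac)
      finally show ?thesis .
    qed
    also have "mass UNIV (\<lambda>z. indicator {t<..} (z j)) 1 / \<kappa> = ennreal (tail j t)"
    proof -
      have "mass UNIV (\<lambda>z. indicator {t<..} (z j)) 1 / \<kappa> = (\<integral>\<^sup>+\<omega>. indicator {t<..} \<bar>X \<omega> $ j\<bar> \<partial>M)"
        by (rule abs_emb[OF ind, symmetric])
      also have "\<dots> = (\<integral>\<^sup>+\<omega>. indicator {\<omega> \<in> space M. t < \<bar>X \<omega> $ j\<bar>} \<omega> \<partial>M)"
        by (intro nn_integral_cong) (auto split: split_indicator)
      also have "\<dots> = ennreal (tail j t)" by (simp add: tail_def emeasure_eq_measure)
      finally show ?thesis .
    qed
    also have "mass UNIV \<psi> 1 / \<kappa> = (\<integral>\<^sup>+\<omega>. ennreal (K (lin a I \<omega>)) \<partial>M)"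
      using nn_integral_rad[of "\<lambda>_. 1" K j a I] K abs_emb[OF \<psi>_meas[OF subset_UNIV]] by (simp add: W)
    finally show "(\<integral>\<^sup>+\<omega>. indicator {t<..} \<bar>X \<omega> $ j\<bar> * ennreal (K (lin a I \<omega>)) \<partial>M)
        \<le> ennreal (tail j t) * (\<integral>\<^sup>+\<omega>. ennreal (K (lin a I \<omega>)) \<partial>M)" .
  qed
qed

end

section \<open>From Young functions to profiles\<close>

lemma young_function_mono:
  assumes f: "young_function f" and xy: "0 \<le> x" "x \<le> y"
  shows "f x \<le> f y"
proof (cases "y = 0")
  case False
  then have y: "0 < y" using xy by simp
  define u where "u = x / y"
  have u: "0 \<le> u" "u \<le> 1" "u *\<^sub>R y + (1 - u) *\<^sub>R 0 = x" using xy y by (auto simp: u_def)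
  have fy: "0 \<le> f y" and f0: "f 0 = 0" using f y by (auto simp: young_function_def)
  have conv: "ereal_convex_on {0..} f" using f by (simp add: young_function_def)
  have "f (u *\<^sub>R y + (1 - u) *\<^sub>R 0) \<le> ereal u * f y + ereal (1 - u) * f 0"
    using conv[unfolded ereal_convex_on_def, THEN conjunct2, rule_format, of y 0 u "1 - u"] u y by simp
  then have "f x \<le> ereal u * f y" unfolding u(3) f0 by simp
  also have "\<dots> \<le> 1 * f y" using u fy by (intro ereal_mult_right_mono) auto
  finally show ?thesis by simp
qed (use xy in simp)

locale rescaled_young_function =
  fixes f :: "real \<Rightarrow> ereal" and r :: real
  assumes f: "young_function f" and r: "0 < r"
begin

text \<open>The scaling by r is absorbed here, so that the rescaled ball consists of the x for which
  the sum of \<open>F (x $ i)\<close> is at most 1.\<close>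

definition F :: "real \<Rightarrow> ereal" where "F y = f (\<bar>y\<bar> / r)"

text \<open>The strict inequality makes this the interior of the set where \<open>F\<close> is
  finite, hence open; the end points of that set are left out even if \<open>F\<close> is finite
  there.\<close>

definition D :: "real set" where "D = {y. \<exists>z>\<bar>y\<bar>. F z < \<infinity>}"

definition G :: "real \<Rightarrow> real" where "G y = (if y \<in> D then real_of_ereal (F y) else 0)"

lemma F_nonneg: "0 \<le> F y" and F_0: "F 0 = 0" and F_abs: "F \<bar>y\<bar> = F y"
  using f r by (simp_all add: F_def young_function_def)

lemma F_mono: "\<bar>x\<bar> \<le> \<bar>y\<bar> \<Longrightarrow> F x \<le> F y"
  unfolding F_def using r by (intro young_function_mono[OF f]) (auto simp: divide_right_mono)

lemma F_convex:
  assumes u: "0 \<le> u" "0 \<le> v" "u + v = 1"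
  shows "F (u * x + v * y) \<le> ereal u * F x + ereal v * F y"
proof -
  have conv: "ereal_convex_on {0..} f" using f by (simp add: young_function_def)
  have "\<bar>u * x + v * y\<bar> / r \<le> u * (\<bar>x\<bar> / r) + v * (\<bar>y\<bar> / r)"
  proof -
    have "\<bar>u * x + v * y\<bar> \<le> u * \<bar>x\<bar> + v * \<bar>y\<bar>"
      using u abs_triangle_ineq[of "u * x" "v * y"] by (simp add: abs_mult)
    then show ?thesis using r by (simp add: add_divide_distrib[symmetric] divide_right_mono)
  qed
  then have "F (u * x + v * y) \<le> f (u *\<^sub>R (\<bar>x\<bar> / r) + v *\<^sub>R (\<bar>y\<bar> / r))"
    unfolding F_def using r by (intro young_function_mono[OF f]) auto
  also have "\<dots> \<le> ereal u * F x + ereal v * F y"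
    using conv[unfolded ereal_convex_on_def, THEN conjunct2, rule_format, of "\<bar>x\<bar> / r" "\<bar>y\<bar> / r" u v] u r
    by (simp add: F_def)
  finally show ?thesis .
qed

lemma F_measurable [measurable]: "F \<in> borel_measurable borel"
proof (rule borel_measurableI_le)
  fix c
  have "is_interval {y. F y \<le> c}"
    unfolding is_interval_1
  proof (intro ballI allI impI)
    fix a b x assume ab: "a \<in> {y. F y \<le> c}" "b \<in> {y. F y \<le> c}" and x: "a \<le> x \<and> x \<le> b"
    then have "\<bar>x\<bar> \<le> \<bar>a\<bar> \<or> \<bar>x\<bar> \<le> \<bar>b\<bar>" by linarith
    then have "F x \<le> F a \<or> F x \<le> F b" using F_mono by blast
    then show "x \<in> {y. F y \<le> c}" using ab by auto
  qed
  then show "{x \<in> space borel. F x \<le> c} \<in> sets borel" using real_interval_borel_measurable by simp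
qed

lemma D_iff_abs: "\<bar>y\<bar> \<in> D \<longleftrightarrow> y \<in> D" by (simp add: D_def)

lemma D_down: "y \<in> D \<Longrightarrow> \<bar>x\<bar> \<le> \<bar>y\<bar> \<Longrightarrow> x \<in> D"
  unfolding D_def using order.strict_trans1 by blast

lemma F_eq_G: assumes "y \<in> D" shows "F y = ereal (G y)"
proof -
  obtain z where z: "\<bar>y\<bar> < z" "F z < \<infinity>" using assms by (auto simp: D_def)
  have "F y \<le> F z" using z by (intro F_mono) auto
  then have "F y \<noteq> \<infinity>" using z(2) by auto
  then show ?thesis using F_nonneg[of y] assms by (cases "F y") (auto simp: G_def)
qed

lemma open_D: "open D"
proof -
  have "D = (\<Union>z\<in>{z. F z < \<infinity>}. {-z<..<z})" by (auto simp: D_def abs_less_iff)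
  then show ?thesis by (simp only:) (intro open_UN ballI open_greaterThanLessThan)
qed

lemma G_measurable: "G \<in> borel_measurable borel"
proof -
  have [measurable]: "D \<in> sets borel" using open_D by simp
  show ?thesis unfolding G_def by measurable
qed

text \<open>Choose w > 0 with \<open>F w\<close> nonzero. By convexity and \<open>F 0 = 0\<close>, a
  point y of \<open>D\<close> beyond w satisfies G y \<ge> |y| * G w / w, so \<open>G\<close> grows
  at least linearly. If w itself is outside \<open>D\<close>, then \<open>D\<close> is bounded by
  w.\<close>

lemma bounded_sublevel_G: "bounded {y\<in>D. G y \<le> c}"
proof -
  obtain x0 where "0 \<le> x0" "f x0 \<noteq> 0" using f by (auto simp: young_function_def)
  then have "0 < x0" using f by (cases "x0 = 0") (auto simp: young_function_def)
  define w where "w = r * x0"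
  have w: "0 < w" "F w \<noteq> 0" using \<open>0 < x0\<close> \<open>f x0 \<noteq> 0\<close> r by (auto simp: w_def F_def)
  have "\<bar>y\<bar> \<le> max w (w * c / real_of_ereal (F w))" if y: "y \<in> D" "G y \<le> c" for y
  proof (cases "\<bar>y\<bar> \<le> w")
    case False
    then have "w \<in> D" using w by (intro D_down[OF y(1)]) auto
    then have Fw: "F w = ereal (G w)" by (rule F_eq_G)
    have Gw: "0 < G w" using w(2) F_nonneg[of w] Fw by (auto simp: less_le)
    define u where "u = w / \<bar>y\<bar>"
    have u: "0 \<le> u" "u \<le> 1" "u * \<bar>y\<bar> + (1 - u) * 0 = w" using False w by (auto simp: u_def)
    have "F (u * \<bar>y\<bar> + (1 - u) * 0) \<le> ereal u * F \<bar>y\<bar> + ereal (1 - u) * F 0"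
      using u by (intro F_convex) auto
    then have "ereal (G w) \<le> ereal (u * G y)" unfolding u(3) Fw F_abs F_0 F_eq_G[OF y(1)] by simp
    then have "G w \<le> w / \<bar>y\<bar> * G y" by (simp add: u_def)
    also have "\<dots> \<le> w / \<bar>y\<bar> * c" using y w by (intro mult_left_mono) auto
    finally have "G w * \<bar>y\<bar> \<le> w * c" using False w by (simp add: field_simps)
    then have "\<bar>y\<bar> \<le> w * c / G w" using Gw by (simp add: field_simps)
    then show ?thesis by (simp add: Fw)
  qed simp
  then show ?thesis by (intro boundedI[where B = "max w (w * c / real_of_ereal (F w))"]) auto
qed

sublocale orlicz_profile D G
proof
  show "open D" by (rule open_D)
  show "0 \<in> D"
  proof -
    obtain x where "0 < x" "f x < \<infinity>" using f by (auto simp: young_function_def)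
    then show ?thesis using r by (auto simp: D_def F_def intro!: exI[of _ "r * x"])
  qed
  then show "G 0 = 0" by (simp add: G_def F_0)
  show "\<bar>y\<bar> \<in> D \<longleftrightarrow> y \<in> D" for y by (rule D_iff_abs)
  show "G \<bar>y\<bar> = G y" for y by (simp add: G_def D_iff_abs F_abs)
  show "0 \<le> G y" for y by (simp add: G_def real_of_ereal_pos F_nonneg)
  show "G \<in> borel_measurable borel" by (rule G_measurable)
  show "bounded {y\<in>D. G y \<le> c}" for c by (rule bounded_sublevel_G)
  have comb: "u * x + v * y \<in> D" if u: "0 \<le> u" "0 \<le> v" "u + v = 1" and xy: "x \<in> D" "y \<in> D" for u v x y
  proof -
    have "\<bar>u * x + v * y\<bar> \<le> u * \<bar>x\<bar> + v * \<bar>y\<bar>"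
      using u abs_triangle_ineq[of "u * x" "v * y"] by (simp add: abs_mult)
    also have "\<dots> \<le> max \<bar>x\<bar> \<bar>y\<bar>" using u by (intro convex_bound_le) auto
    finally have "\<bar>u * x + v * y\<bar> \<le> \<bar>x\<bar> \<or> \<bar>u * x + v * y\<bar> \<le> \<bar>y\<bar>" by auto
    then show ?thesis using D_down xy by blast
  qed
  show "convex_on D G"
  proof (rule convex_onI)
    show "convex D" unfolding convex_def using comb by simp
    fix t x y :: real assume t: "0 < t" "t < 1" and xy: "x \<in> D" "y \<in> D"
    have "F ((1 - t) * x + t * y) \<le> ereal (1 - t) * F x + ereal t * F y"
      using t by (intro F_convex) auto
    then have "ereal (G ((1 - t) * x + t * y)) \<le> ereal ((1 - t) * G x + t * G y)"
      using t xy by (simp add: F_eq_G comb)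
    then show "G ((1 - t) *\<^sub>R x + t *\<^sub>R y) \<le> (1 - t) * G x + t * G y" by simp
  qed
qed

text \<open>\<^term>\<open>F\<close> may be finite at the two end points of \<^term>\<open>D\<close>; this changes the ball only within
  finitely many hyperplanes.\<close>

lemma AE_orlicz_ball_iff:
  "AE x in lborel. (x :: real ^ 'n) \<in> (\<lambda>x. r *\<^sub>R x) ` orlicz_ball f \<longleftrightarrow> x \<in> orlicz_body"
  and orlicz_ball_measurable: "(\<lambda>x :: real ^ 'n. r *\<^sub>R x) ` orlicz_ball f \<in> sets borel"
proof -
  have ball: "(\<lambda>x :: real ^ 'n. r *\<^sub>R x) ` orlicz_ball f = {x. (\<Sum>i\<in>UNIV. F (x $ i)) \<le> 1}"
  proof (intro equalityI subsetI)
    fix x :: "real ^ 'n" assume "x \<in> {x. (\<Sum>i\<in>UNIV. F (x $ i)) \<le> 1}"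
    then have "(1 / r) *\<^sub>R x \<in> orlicz_ball f" using r by (simp add: orlicz_ball_def F_def abs_mult)
    then have "r *\<^sub>R (1 / r) *\<^sub>R x \<in> (\<lambda>x. r *\<^sub>R x) ` orlicz_ball f" by (rule imageI)
    then show "x \<in> (\<lambda>x. r *\<^sub>R x) ` orlicz_ball f" using r by simp
  qed (use r in \<open>auto simp: orlicz_ball_def F_def abs_mult\<close>)
  have "{x \<in> space borel. (\<Sum>i\<in>UNIV. F ((x :: real ^ 'n) $ i)) \<le> 1} \<in> sets borel" by measurable
  then show "(\<lambda>x :: real ^ 'n. r *\<^sub>R x) ` orlicz_ball f \<in> sets borel" by (simp add: ball)
  \<comment> \<open>If \<open>F y\<close> is finite, every point of smaller absolute value belongs
    to \<open>D\<close>. Hence two points outside \<open>D\<close> with finite values have the same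
    absolute value.\<close>
  have "\<exists>\<rho>. \<forall>y. F y < \<infinity> \<and> y \<notin> D \<longrightarrow> \<bar>y\<bar> = \<rho>"
  proof -
    have "\<bar>x\<bar> = \<bar>y\<bar>" if "F x < \<infinity>" "x \<notin> D" "F y < \<infinity>" "y \<notin> D" for x y
      using that F_abs unfolding D_def by (metis (mono_tags, lifting) linorder_neqE_linordered_idom mem_Collect_eq)
    then show ?thesis by blast
  qed
  then obtain \<rho> where \<rho>: "\<And>y. F y < \<infinity> \<Longrightarrow> y \<notin> D \<Longrightarrow> \<bar>y\<bar> = \<rho>" by blast
  have "AE x in lborel. \<forall>i\<in>UNIV. (x :: real ^ 'n) $ i \<noteq> \<rho> \<and> x $ i \<noteq> - \<rho>"
  proof (rule AE_finite_allI)
    show "AE x in lborel. (x :: real ^ 'n) $ i \<noteq> \<rho> \<and> x $ i \<noteq> - \<rho>" for i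
      using AE_not_in[OF hyperplane_null[of i \<rho>]] AE_not_in[OF hyperplane_null[of i "- \<rho>"]]
      by (auto elim: eventually_elim2)
  qed simp
  then show "AE x in lborel. (x :: real ^ 'n) \<in> (\<lambda>x. r *\<^sub>R x) ` orlicz_ball f \<longleftrightarrow> x \<in> orlicz_body"
  proof eventually_elim
    case (elim x)
    have "(\<Sum>i\<in>UNIV. F (x $ i)) = ereal (\<Sum>i\<in>UNIV. G (x $ i))" if "\<And>i. x $ i \<in> D"
      using that by (simp add: F_eq_G)
    moreover have "x $ i \<in> D" if le: "(\<Sum>i\<in>UNIV. F (x $ i)) \<le> 1" for i
    proof (rule ccontr)
      assume "x $ i \<notin> D"
      have "F (x $ i) \<le> (\<Sum>i\<in>UNIV. F (x $ i))"
        using sum_mono2[of UNIV "{i}" "\<lambda>i. F (x $ i)"] by (simp add: F_nonneg)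
      also note le
      finally have "F (x $ i) < \<infinity>" by (metis ereal_infty_less(1) ereal_times(1) neq_iff not_less)
      then have "\<bar>x $ i\<bar> = \<rho>" using \<rho> \<open>x $ i \<notin> D\<close> by blast
      then show False using elim by (auto simp: abs_if split: if_splits)
    qed
    ultimately show ?case by (auto simp: ball orlicz_body_def)
  qed
qed

lemma uniform_measure_orlicz_ball:
  "uniform_measure lborel ((\<lambda>x :: real ^ 'n. r *\<^sub>R x) ` orlicz_ball f) = uniform_measure lborel orlicz_body"
proof -
  note [measurable] = orlicz_ball_measurable
  have e: "emeasure lborel ((\<lambda>x :: real ^ 'n. r *\<^sub>R x) ` orlicz_ball f) = emeasure lborel (orlicz_body :: (real ^ 'n) set)"
    by (intro emeasure_eq_AE AE_orlicz_ball_iff) auto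
  show ?thesis
    unfolding uniform_measure_def e using AE_orlicz_ball_iff
    by (intro density_cong) (auto elim!: eventually_mono split: split_indicator)
qed

end

theorem corollary11:
  fixes M :: "'a measure" and X :: "'a \<Rightarrow> real ^ 'n"
  assumes "prob_space M" and "X \<in> borel_measurable M" and "isotropic M X"
    and "(unconditional M X \<and> log_concave_vector M X \<and>
            negatively_associated M (\<lambda>i \<omega>. \<bar>X \<omega> $ i\<bar>))
         \<or> (\<exists>f r. young_function f \<and> r > 0 \<and>
              uniformly_distributed M X ((\<lambda>x. r *\<^sub>R x) ` orlicz_ball f))"
  shows "\<forall>(a :: real ^ 'n) p. p \<ge> 3 \<longrightarrow>
           finite_moment M p (\<lambda>\<omega>. \<Sum>i\<in>UNIV. a $ i * X \<omega> $ i) \<and>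
           - sqrt 3 * p * infnorm a
             \<le> Lp_norm M p (\<lambda>\<omega>. \<Sum>i\<in>UNIV. a $ i * X \<omega> $ i) - gauss_norm p * norm a \<and>
           Lp_norm M p (\<lambda>\<omega>. \<Sum>i\<in>UNIV. a $ i * X \<omega> $ i) - gauss_norm p * norm a
             \<le> p * infnorm a"
proof -
  have "negatively_dependent_vector M X"
    using assms(4)
  proof
    assume *: "unconditional M X \<and> log_concave_vector M X \<and> negatively_associated M (\<lambda>i \<omega>. \<bar>X \<omega> $ i\<bar>)"
    then obtain h where h: "\<And>x. h x \<noteq> -\<infinity>" "ereal_convex_on UNIV h"
      and d: "distributed M lborel X (\<lambda>x. exp_minus (h x))"
      by (auto simp: log_concave_vector_def)
    have "distr M lborel X = density lborel (\<lambda>x. exp_minus (h x))"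
      using d by (rule distributed_distr_eq_density)
    moreover have "(\<lambda>x. exp_minus (h x)) \<in> borel_measurable borel"
      using distributed_borel_measurable[OF d] by simp
    ultimately interpret unconditional_vector M X
      using * exp_minus_midpoint[OF h] by (intro unconditional_vectorI[OF assms(1-3)]) auto
    show ?thesis using * by (intro negatively_dependentI) simp
  next
    assume "\<exists>f r. young_function f \<and> r > 0 \<and> uniformly_distributed M X ((\<lambda>x. r *\<^sub>R x) ` orlicz_ball f)"
    then obtain f r where f: "young_function f" "0 < r"
      and X: "uniformly_distributed M X ((\<lambda>x. r *\<^sub>R x) ` orlicz_ball f)" by auto
    interpret rescaled_young_function f r using f by unfold_locales
    show ?thesis
      using X by (intro negatively_dependent_orlicz assms)
        (simp add: uniformly_distributed_def uniform_measure_orlicz_ball)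
  qed
  then show ?thesis using negatively_dependent_vector.norm_bounds by blast
qed

end
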